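(* Let $\gamma_1,\delta_1>0$, $\gamma=\frac{7}{48}$ and $\gamma_2,\delta_2\in\mathbb{R}$. Let $\sigma>0$ and let $\eta_0\in H^{\sigma,2}(\mathbb{R})$ be real-valued. Suppose that $\eta\in C([0,T];H^{\sigma,2}(\mathbb{R}))$ is the local-in-time solution of the Cauchy problem $$\partial_t\eta+\partial_x\eta-\gamma_1\partial_t\partial_x^2\eta+\gamma_2\partial_x^3\eta+\delta_1\partial_t\partial_x^4\eta+\delta_2\partial_x^5\eta=-\tfrac34\partial_x(\eta^2)-\gamma\partial_x^3(\eta^2)+\tfrac{7}{48}\partial_x(\eta_x^2)+\tfrac18\partial_x(\eta^3),\qquad \eta(x,0)=\eta_0(x),$$ where $T=c\,(1+\|\eta_0\|_{H^{\sigma,2}(\mathbb{R})})^{-2}$ is the local existence time described in the context. Let $v_\sigma=\cosh(\sigma|D|)\eta$ and $$E_\sigma(t)=\frac12\int_{\mathbb{R}} v_\sigma^2+\gamma_1(\partial_xv_\sigma)^2+\delta_1(\partial_x^2v_\sigma)^2\,dx .$$ Then $$\sup_{0\le t\le T}E_\sigma(t)=E_\sigma(0)+\sigma^2T\cdot\mathcal{O}\!\left(\left[1+(E_\sigma(0))^{1/2}\right](E_\sigma(0))^{3/2}\right),$$ that is, there is a constant $C>0$, independent of $\sigma$ and $\eta_0$, such that $$\Big|\sup_{0\le t\le T}E_\sigma(t)-E_\sigma(0)\Big|\le C\,\sigma^2\,T\left[1+(E_\sigma(0))^{1/2}\right](E_\sigma(0))^{3/2}.$$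
   Context: The unknown $\eta=\eta(x,t)$ is real-valued, $x\in\mathbb{R}$, and $D=-i\partial_x$; $\cosh(\sigma|D|)$ is the Fourier multiplier with symbol $\cosh(\sigma|\xi|)$. Modified Gevrey space: for $\sigma\ge0$ and $s\in\mathbb{R}$, $H^{\sigma,s}(\mathbb{R})$ is the space of $f$ with finite norm $$\|f\|_{H^{\sigma,s}(\mathbb{R})}=\big\|\cosh(\sigma|\xi|)\,\langle\xi\rangle^s\,\widehat f(\xi)\big\|_{L^2_\xi(\mathbb{R})},\qquad \langle\xi\rangle=\sqrt{1+\xi^2},$$ where $\widehat f(\xi)=\int_{\mathbb R} e^{-ix\xi}f(x)\,dx$. Notion of solution: with $\varphi(\xi)=1+\gamma_1\xi^2+\delta_1\xi^4$, $$\phi(\xi)=\frac{\xi(1-\gamma_2\xi^2+\delta_2\xi^4)}{\varphi(\xi)},\quad \tau(\xi)=\frac{\xi(3-4\gamma\xi^2)}{4\varphi(\xi)},\quad \psi(\xi)=\frac{\xi}{\varphi(\xi)},$$ and $\phi(D),\tau(D),\psi(D)$ the corresponding Fourier multipliers, a solution of the Cauchy problem on $[0,T]$ is a function satisfying, for $0\le t\le T$, $$\eta(t)=e^{-it\phi(D)}\eta_0-i\int_0^t e^{-i(t-s)\phi(D)}F(\eta)(s)\,ds,\qquad F(\eta)=\tau(D)\eta^2-\tfrac{7}{48}\psi(D)\eta_x^2-\tfrac18\psi(D)\eta^3 .$$ Local existence time: by the paper's local well-posedness theorem (a contraction argument in a ball of $C([0,T];H^{\sigma,2}(\mathbb{R}))$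 with radius comparable to $\|\eta_0\|_{H^{\sigma,2}(\mathbb{R})}$), there is a sufficiently small constant $c>0$ depending only on the coefficients $\gamma,\gamma_1,\gamma_2,\delta_1,\delta_2$ (not on $\sigma$ or $\eta_0$) such that for every $\eta_0\in H^{\sigma,2}(\mathbb{R})$ there is a unique solution $\eta\in C([0,T];H^{\sigma,2}(\mathbb{R}))$ with $T=c(1+\|\eta_0\|_{H^{\sigma,2}(\mathbb{R})})^{-2}$; $T$ and $\eta$ in the statement are these. *)

theory Defs
  imports "HOL-Analysis.Analysis"
begin

section \<open>The space of square-integrable functions on the real line\<close>

definition square_integrable :: "(real \<Rightarrow> complex) \<Rightarrow> bool" where
  "square_integrable f \<longleftrightarrow>
     f \<in> borel_measurable lborel \<and> integrable lborel (\<lambda>x. (cmod (f x))\<^sup>2)"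

lemma square_integrable_zero: "square_integrable (\<lambda>x. 0)"
  by (simp add: square_integrable_def)

lemma square_integrable_scaleR:
  assumes "square_integrable f"
  shows "square_integrable (\<lambda>x. c *\<^sub>R f x)"
  using assms by (auto simp: square_integrable_def power_mult_distrib)

lemma square_integrable_uminus:
  assumes "square_integrable f"
  shows "square_integrable (\<lambda>x. - f x)"
  using assms by (auto simp: square_integrable_def)

lemma square_integrable_add:
  assumes "square_integrable f" "square_integrable g"
  shows "square_integrable (\<lambda>x. f x + g x)"
proof -
  have meas: "f \<in> borel_measurable lborel" "g \<in> borel_measurable lborel"
    using assms by (auto simp: square_integrable_def)
  have "integrable lborel (\<lambda>x. 2 * (cmod (f x))\<^sup>2 + 2 * (cmod (g x))\<^sup>2)"
    using assms by (auto simp: square_integrable_def)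
  moreover have "(\<lambda>x. (cmod (f x + g x))\<^sup>2) \<in> borel_measurable lborel"
    using meas by measurable
  moreover have "(cmod (f x + g x))\<^sup>2 \<le> 2 * (cmod (f x))\<^sup>2 + 2 * (cmod (g x))\<^sup>2" for x
  proof -
    have "(cmod (f x + g x))\<^sup>2 \<le> (cmod (f x) + cmod (g x))\<^sup>2"
      by (intro power_mono norm_triangle_ineq) simp
    also have "\<dots> \<le> 2 * (cmod (f x))\<^sup>2 + 2 * (cmod (g x))\<^sup>2"
      using sum_squares_bound[of "cmod (f x)" "cmod (g x)"] by (simp add: power2_sum)
    finally show ?thesis .
  qed
  ultimately have "integrable lborel (\<lambda>x. (cmod (f x + g x))\<^sup>2)"
    by (elim Bochner_Integration.integrable_bound) auto
  then show ?thesis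
    using meas by (simp add: square_integrable_def)
qed

lemma square_integrable_diff:
  assumes "square_integrable f" "square_integrable g"
  shows "square_integrable (\<lambda>x. f x - g x)"
  using square_integrable_add[OF assms(1) square_integrable_uminus[OF assms(2)]] by simp

lemma square_integrable_inner:
  assumes "square_integrable f" "square_integrable g"
  shows "integrable lborel (\<lambda>x. f x \<bullet> g x)"
proof -
  have meas: "f \<in> borel_measurable lborel" "g \<in> borel_measurable lborel"
    using assms by (auto simp: square_integrable_def)
  have "integrable lborel (\<lambda>x. (cmod (f x))\<^sup>2 + (cmod (g x))\<^sup>2)"
    using assms by (auto simp: square_integrable_def)
  moreover have "(\<lambda>x. f x \<bullet> g x) \<in> borel_measurable lborel"
    using meas by measurable
  moreover have "\<bar>f x \<bullet> g x\<bar> \<le> (cmod (f x))\<^sup>2 + (cmod (g x))\<^sup>2" for x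
  proof -
    have "\<bar>f x \<bullet> g x\<bar> \<le> cmod (f x) * cmod (g x)"
      by (rule Cauchy_Schwarz_ineq2)
    also have "\<dots> \<le> (cmod (f x))\<^sup>2 + (cmod (g x))\<^sup>2"
      using sum_squares_bound[of "cmod (f x)" "cmod (g x)"]
        mult_nonneg_nonneg[OF norm_ge_zero[of "f x"] norm_ge_zero[of "g x"]] unfolding mult.assoc by linarith
    finally show ?thesis .
  qed
  ultimately show ?thesis
    by (elim Bochner_Integration.integrable_bound) auto
qed

definition l2_eq :: "(real \<Rightarrow> complex) \<Rightarrow> (real \<Rightarrow> complex) \<Rightarrow> bool" where
  "l2_eq f g \<longleftrightarrow> square_integrable f \<and> square_integrable g \<and> (AE x in lborel. f x = g x)"

quotient_type l2 = "real \<Rightarrow> complex" / partial: l2_eq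
proof (rule part_equivpI)
  show "\<exists>f. l2_eq f f"
    using square_integrable_zero by (auto simp: l2_eq_def)
  show "symp l2_eq"
    by (auto simp: symp_def l2_eq_def elim: AE_mp)
  show "transp l2_eq"
  proof (rule transpI)
    fix f g h assume "l2_eq f g" "l2_eq g h"
    then show "l2_eq f h"
      unfolding l2_eq_def by (auto elim: eventually_elim2)
  qed
qed

instantiation l2 :: real_inner
begin

lift_definition zero_l2 :: l2 is "\<lambda>x. 0"
  by (simp add: l2_eq_def square_integrable_zero)

lift_definition plus_l2 :: "l2 \<Rightarrow> l2 \<Rightarrow> l2" is "\<lambda>f g x. f x + g x"
  unfolding l2_eq_def by (auto intro: square_integrable_add elim: eventually_elim2)

lift_definition uminus_l2 :: "l2 \<Rightarrow> l2" is "\<lambda>f x. - f x"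
  unfolding l2_eq_def by (auto intro: square_integrable_uminus elim: eventually_mono)

lift_definition minus_l2 :: "l2 \<Rightarrow> l2 \<Rightarrow> l2" is "\<lambda>f g x. f x - g x"
  unfolding l2_eq_def by (auto intro: square_integrable_diff elim: eventually_elim2)

lift_definition scaleR_l2 :: "real \<Rightarrow> l2 \<Rightarrow> l2" is "\<lambda>c f x. c *\<^sub>R f x"
  unfolding l2_eq_def by (auto intro: square_integrable_scaleR elim: eventually_mono)

lift_definition inner_l2 :: "l2 \<Rightarrow> l2 \<Rightarrow> real" is "\<lambda>f g. \<integral>x. f x \<bullet> g x \<partial>lborel"
proof -
  fix f f' g g' assume *: "l2_eq f f'" "l2_eq g g'"
  then have "AE x in lborel. f x \<bullet> g x = f' x \<bullet> g' x"
    unfolding l2_eq_def by (auto elim: eventually_elim2)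
  then show "(\<integral>x. f x \<bullet> g x \<partial>lborel) = (\<integral>x. f' x \<bullet> g' x \<partial>lborel)"
    using * by (intro integral_cong_AE) (auto simp: l2_eq_def square_integrable_def)
qed

definition norm_l2 :: "l2 \<Rightarrow> real" where
  "norm_l2 f = sqrt (f \<bullet> f)"

definition sgn_l2 :: "l2 \<Rightarrow> l2" where
  "sgn_l2 f = scaleR (inverse (norm f)) f"

definition dist_l2 :: "l2 \<Rightarrow> l2 \<Rightarrow> real" where
  "dist_l2 f g = norm (f - g)"

definition uniformity_l2 :: "(l2 \<times> l2) filter" where
  "uniformity_l2 = (INF e\<in>{0<..}. principal {(f, g). dist f g < e})"

definition open_l2 :: "l2 set \<Rightarrow> bool" where
  "open_l2 U \<longleftrightarrow> (\<forall>f\<in>U. eventually (\<lambda>(f', g). f' = f \<longrightarrow> g \<in> U) uniformity)"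

instance
proof
  fix f g h :: l2 and a b :: real
  show "f + g + h = f + (g + h)"
    by transfer (auto simp: l2_eq_def add.assoc intro!: square_integrable_add)
  show "f + g = g + f"
    by transfer (auto simp: l2_eq_def add.commute intro!: square_integrable_add)
  show "0 + f = f"
    by transfer (auto simp: l2_eq_def)
  show "- f + f = 0"
    by transfer (auto simp: l2_eq_def square_integrable_zero)
  show "f - g = f + - g"
    by transfer (auto simp: l2_eq_def intro!: square_integrable_diff)
  show "a *\<^sub>R (f + g) = a *\<^sub>R f + a *\<^sub>R g"
    by transfer (auto simp: l2_eq_def scaleR_add_right
        intro!: square_integrable_add square_integrable_scaleR)
  show "(a + b) *\<^sub>R f = a *\<^sub>R f + b *\<^sub>R f"
    by transfer (auto simp: l2_eq_def scaleR_add_left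
        intro!: square_integrable_add square_integrable_scaleR)
  show "a *\<^sub>R b *\<^sub>R f = (a * b) *\<^sub>R f"
    by transfer (auto simp: l2_eq_def intro!: square_integrable_scaleR)
  show "1 *\<^sub>R f = f"
    by transfer (auto simp: l2_eq_def)
  show "dist f g = norm (f - g)"
    by (rule dist_l2_def)
  show "sgn f = scaleR (inverse (norm f)) f"
    by (rule sgn_l2_def)
  show "uniformity = (INF e\<in>{0<..}. principal {(f::l2, g). dist f g < e})"
    by (rule uniformity_l2_def)
  show "open U \<longleftrightarrow> (\<forall>f\<in>U. eventually (\<lambda>(f', g). f' = f \<longrightarrow> g \<in> U) uniformity)" for U :: "l2 set"
    by (rule open_l2_def)
  show "f \<bullet> g = g \<bullet> f"
    by transfer (simp add: inner_commute)
  show "(f + g) \<bullet> h = f \<bullet> h + g \<bullet> h"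
    by transfer (simp add: l2_eq_def inner_add_left square_integrable_inner)
  show "(a *\<^sub>R f) \<bullet> g = a * (f \<bullet> g)"
    by transfer simp
  show "0 \<le> f \<bullet> f"
    by transfer simp
  show "f \<bullet> f = 0 \<longleftrightarrow> f = 0"
  proof (transfer)
    fix f :: "real \<Rightarrow> complex" assume "l2_eq f f"
    then have f: "square_integrable f"
      by (simp add: l2_eq_def)
    have "(\<integral>x. f x \<bullet> f x \<partial>lborel) = 0 \<longleftrightarrow> (AE x in lborel. f x \<bullet> f x = 0)"
      by (intro integral_nonneg_eq_0_iff_AE square_integrable_inner f) simp
    then show "(\<integral>x. f x \<bullet> f x \<partial>lborel) = 0 \<longleftrightarrow> l2_eq f (\<lambda>x. 0)"
      using f by (simp add: l2_eq_def square_integrable_zero)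
  qed
  show "norm f = sqrt (f \<bullet> f)"
    by (rule norm_l2_def)
qed

end

text \<open>The junk value 0 is never reached for the functions in the main theorem: the arguments below
  are square integrable whenever the solution takes values in the modified Gevrey space.\<close>

definition to_l2 :: "(real \<Rightarrow> complex) \<Rightarrow> l2" where
  "to_l2 f = (if square_integrable f then abs_l2 f else 0)"

definition real_valued :: "l2 \<Rightarrow> bool" where
  "real_valued f \<longleftrightarrow> (AE x in lborel. rep_l2 f x \<in> \<real>)"


section \<open>Fourier transform and Fourier multipliers\<close>

definition truncated_fourier :: "real \<Rightarrow> l2 \<Rightarrow> real \<Rightarrow> complex" where
  "truncated_fourier R f \<xi> =
     (LINT x:{-R..R}|lborel. exp (- (\<i> * complex_of_real (x * \<xi>))) * rep_l2 f x)"

text \<open>An element of \<open>L\<^sup>2\<close> need not be integrable, so \<open>\<integral> e\<^sup>-\<^sup>i\<^sup>x\<^sup>\<xi> f(x) dx\<close> is the limit in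
  \<open>L\<^sup>2\<close> of the integrals over \<open>[-R, R]\<close> (Plancherel).\<close>

definition fourier :: "l2 \<Rightarrow> l2" where
  "fourier f = Lim at_top (\<lambda>R. to_l2 (truncated_fourier R f))"

definition multiply :: "(real \<Rightarrow> complex) \<Rightarrow> l2 \<Rightarrow> l2" where
  "multiply m g = to_l2 (\<lambda>\<xi>. m \<xi> * rep_l2 g \<xi>)"

definition fourier_multiplier :: "(real \<Rightarrow> complex) \<Rightarrow> l2 \<Rightarrow> l2" where
  "fourier_multiplier m f = inv fourier (multiply m (fourier f))"

definition deriv_x :: "l2 \<Rightarrow> l2" where
  "deriv_x = fourier_multiplier (\<lambda>\<xi>. \<i> * complex_of_real \<xi>)"

definition cosh_D :: "real \<Rightarrow> l2 \<Rightarrow> l2" where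
  "cosh_D \<sigma> = fourier_multiplier (\<lambda>\<xi>. complex_of_real (cosh (\<sigma> * \<bar>\<xi>\<bar>)))"


section \<open>Modified Gevrey spaces\<close>

text \<open>Elements are taken in \<open>L\<^sup>2\<close>, which is no restriction for \<open>s \<ge> 0\<close>; only \<open>s = 2\<close> is used.\<close>

definition gevrey_transform :: "real \<Rightarrow> real \<Rightarrow> l2 \<Rightarrow> real \<Rightarrow> complex" where
  "gevrey_transform \<sigma> s f \<xi> =
     complex_of_real (cosh (\<sigma> * \<bar>\<xi>\<bar>) * sqrt (1 + \<xi>\<^sup>2) powr s) * rep_l2 (fourier f) \<xi>"

definition gevrey_space :: "real \<Rightarrow> real \<Rightarrow> l2 set" where
  "gevrey_space \<sigma> s = {f. square_integrable (gevrey_transform \<sigma> s f)}"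

definition gevrey_norm :: "real \<Rightarrow> real \<Rightarrow> l2 \<Rightarrow> real" where
  "gevrey_norm \<sigma> s f = norm (to_l2 (gevrey_transform \<sigma> s f))"

text \<open>The space \<open>C([0,T]; H\<^sup>\<sigma>\<^sup>,\<^sup>s)\<close>.\<close>

definition gevrey_curve :: "real \<Rightarrow> real \<Rightarrow> real \<Rightarrow> (real \<Rightarrow> l2) \<Rightarrow> bool" where
  "gevrey_curve \<sigma> s T \<eta> \<longleftrightarrow>
     (\<forall>t\<in>{0..T}. \<eta> t \<in> gevrey_space \<sigma> s \<and>
        ((\<lambda>t'. gevrey_norm \<sigma> s (\<eta> t' - \<eta> t)) \<longlongrightarrow> 0) (at t within {0..T}))"


section \<open>The Cauchy problem\<close>

definition sym_den :: "real \<Rightarrow> real \<Rightarrow> real \<Rightarrow> real" where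
  "sym_den \<gamma>1 \<delta>1 \<xi> = 1 + \<gamma>1 * \<xi>^2 + \<delta>1 * \<xi>^4"

definition sym_phi :: "real \<Rightarrow> real \<Rightarrow> real \<Rightarrow> real \<Rightarrow> real \<Rightarrow> real" where
  "sym_phi \<gamma>1 \<gamma>2 \<delta>1 \<delta>2 \<xi> = \<xi> * (1 - \<gamma>2 * \<xi>^2 + \<delta>2 * \<xi>^4) / sym_den \<gamma>1 \<delta>1 \<xi>"

definition sym_tau :: "real \<Rightarrow> real \<Rightarrow> real \<Rightarrow> real \<Rightarrow> real" where
  "sym_tau \<gamma> \<gamma>1 \<delta>1 \<xi> = \<xi> * (3 - 4 * \<gamma> * \<xi>^2) / (4 * sym_den \<gamma>1 \<delta>1 \<xi>)"

definition sym_psi :: "real \<Rightarrow> real \<Rightarrow> real \<Rightarrow> real" where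
  "sym_psi \<gamma>1 \<delta>1 \<xi> = \<xi> / sym_den \<gamma>1 \<delta>1 \<xi>"

definition propagator :: "real \<Rightarrow> real \<Rightarrow> real \<Rightarrow> real \<Rightarrow> real \<Rightarrow> l2 \<Rightarrow> l2" where
  "propagator \<gamma>1 \<gamma>2 \<delta>1 \<delta>2 t =
     fourier_multiplier (\<lambda>\<xi>. exp (- (\<i> * complex_of_real (t * sym_phi \<gamma>1 \<gamma>2 \<delta>1 \<delta>2 \<xi>))))"

definition nonlinearity :: "real \<Rightarrow> real \<Rightarrow> real \<Rightarrow> l2 \<Rightarrow> l2" where
  "nonlinearity \<gamma> \<gamma>1 \<delta>1 \<eta> =
     fourier_multiplier (\<lambda>\<xi>. complex_of_real (sym_tau \<gamma> \<gamma>1 \<delta>1 \<xi>)) (to_l2 (\<lambda>x. (rep_l2 \<eta> x)^2))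
     - (7/48) *\<^sub>R fourier_multiplier (\<lambda>\<xi>. complex_of_real (sym_psi \<gamma>1 \<delta>1 \<xi>))
                   (to_l2 (\<lambda>x. (rep_l2 (deriv_x \<eta>) x)^2))
     - (1/8) *\<^sub>R fourier_multiplier (\<lambda>\<xi>. complex_of_real (sym_psi \<gamma>1 \<delta>1 \<xi>))
                   (to_l2 (\<lambda>x. (rep_l2 \<eta> x)^3))"

definition duhamel :: "real \<Rightarrow> real \<Rightarrow> real \<Rightarrow> real \<Rightarrow> real \<Rightarrow> l2 \<Rightarrow> (real \<Rightarrow> l2) \<Rightarrow> real \<Rightarrow> bool" where
  "duhamel \<gamma> \<gamma>1 \<gamma>2 \<delta>1 \<delta>2 \<eta>0 \<eta> t \<longleftrightarrow>
     (\<exists>J. ((\<lambda>s. propagator \<gamma>1 \<gamma>2 \<delta>1 \<delta>2 (t - s) (nonlinearity \<gamma> \<gamma>1 \<delta>1 (\<eta> s))) has_integral J) {0..t} \<and>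
          \<eta> t = propagator \<gamma>1 \<gamma>2 \<delta>1 \<delta>2 t \<eta>0 - multiply (\<lambda>x. \<i>) J)"

definition solution ::
  "real \<Rightarrow> real \<Rightarrow> real \<Rightarrow> real \<Rightarrow> real \<Rightarrow> real \<Rightarrow> real \<Rightarrow> l2 \<Rightarrow> (real \<Rightarrow> l2) \<Rightarrow> bool" where
  "solution \<gamma> \<gamma>1 \<gamma>2 \<delta>1 \<delta>2 \<sigma> T \<eta>0 \<eta> \<longleftrightarrow>
     gevrey_curve \<sigma> 2 T \<eta> \<and>
     (\<forall>t\<in>{0..T}. real_valued (\<eta> t) \<and> duhamel \<gamma> \<gamma>1 \<gamma>2 \<delta>1 \<delta>2 \<eta>0 \<eta> t)"

text \<open>Uniqueness can only concern the values on \<open>[0,T]\<close>, since curves are total functions here.\<close>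

definition uniquely_solvable ::
  "real \<Rightarrow> real \<Rightarrow> real \<Rightarrow> real \<Rightarrow> real \<Rightarrow> real \<Rightarrow> real \<Rightarrow> l2 \<Rightarrow> bool" where
  "uniquely_solvable \<gamma> \<gamma>1 \<gamma>2 \<delta>1 \<delta>2 \<sigma> T \<eta>0 \<longleftrightarrow>
     (\<exists>\<eta>. solution \<gamma> \<gamma>1 \<gamma>2 \<delta>1 \<delta>2 \<sigma> T \<eta>0 \<eta> \<and>
          (\<forall>\<eta>'. solution \<gamma> \<gamma>1 \<gamma>2 \<delta>1 \<delta>2 \<sigma> T \<eta>0 \<eta>' \<longrightarrow> (\<forall>t\<in>{0..T}. \<eta>' t = \<eta> t)))"

definition local_time :: "real \<Rightarrow> real \<Rightarrow> l2 \<Rightarrow> real" where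
  "local_time c \<sigma> \<eta>0 = c / (1 + gevrey_norm \<sigma> 2 \<eta>0)^2"

text \<open>For real-valued \<open>f\<close> the function \<open>v = cosh(\<sigma>|D|) f\<close> and its derivatives are real-valued (the
  symbol is even), so the squared moduli below are the squares.\<close>

definition energy :: "real \<Rightarrow> real \<Rightarrow> real \<Rightarrow> l2 \<Rightarrow> real" where
  "energy \<gamma>1 \<delta>1 \<sigma> f =
     (let v = cosh_D \<sigma> f in
      1/2 * (\<integral>x. (cmod (rep_l2 v x))\<^sup>2 + \<gamma>1 * (cmod (rep_l2 (deriv_x v) x))\<^sup>2
                 + \<delta>1 * (cmod (rep_l2 (deriv_x (deriv_x v)) x))\<^sup>2 \<partial>lborel))"

end

(* On the Fourier side, with u = cosh(sigma xi) <xi>^2 F(eta), the equation becomes an ordinary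
   differential equation in L^2 for w(t) = e^{it phi} u(t), whose right-hand side is a polynomial in w
   built from bounded bilinear convolution operators; Picard iteration gives local well-posedness with
   constants independent of sigma.

   For V = cosh(sigma xi) F(eta) and W = sinh(sigma xi) F(eta) the addition theorem gives
   cosh(sigma xi) F(eta^2) = (V*V + W*W)/(2 pi). In the time derivative of the energy the terms that only
   involve V cancel: after cyclic symmetrisation over xi1 + xi2 + xi3 = 0 the symbol vanishes, precisely
   because gamma = 7/48. Each remaining term has two factors of sinh type, and |sinh a| <= |a| cosh a
   yields the factor sigma^2.

   Plancherel's theorem comes from the boundedness of the Fourier integral (through Gaussian weights)
   and from testing against indicator functions of intervals. *)

theory Submission
  imports Defs "HOL-Probability.Probability"
begin

section \<open>The Hilbert space L2\<close>

text \<open>The weight turns all the Gevrey spaces into the one space L^2, so a single Picard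
  argument with one Lipschitz constant serves every \<sigma>. The interaction picture is needed
  because the dispersion symbol may be unbounded: u itself need not be differentiable in L^2,
  whereas w is, and the unitary factor commutes with the energy weight and leaves the energy
  derivative. The obstacle in the energy estimate is the loss of derivatives: after division by the
  weights each remainder symbol must still decay in at least one of the three interacting
  frequencies, since one square integrable factor 1/<x> is what makes a trilinear integral of L^2
  functions converge. Reality is kept as conjugate symmetry of w; it turns the pairing with the
  energy weight into an integral over three frequencies of sum 0 that may be permuted. The cubic
  term of the energy derivative uses the cyclic permutations; in the quartic one the part in V alone
  is, up to a factor, the integral of v^2 (v^2)_x. The ball of radius 2 ||u_0|| of the contraction
  bounds the solution by its data, whose norm is controlled by E(0)^(1/2).\<close>

lemma square_integrable_rep_l2: "square_integrable (rep_l2 f)"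
  using Quotient3_rep_reflp[OF Quotient3_l2] by (auto simp: l2_eq_def)

lemma rep_l2_measurable [measurable]: "rep_l2 f \<in> borel_measurable borel"
  using square_integrable_rep_l2[of f] by (simp add: square_integrable_def)

lemma to_l2_rep_l2 [simp]: "to_l2 (rep_l2 f) = f"
  using Quotient3_abs_rep[OF Quotient3_l2] by (simp add: to_l2_def square_integrable_rep_l2)

lemma l2_eq_refl: "square_integrable f \<Longrightarrow> l2_eq f f"
  by (simp add: l2_eq_def)

lemma rep_l2_to_l2: "square_integrable f \<Longrightarrow> AE x in lborel. rep_l2 (to_l2 f) x = f x"
  using rep_abs_rsp_left[OF Quotient3_l2 l2_eq_refl] by (auto simp: to_l2_def l2_eq_def)

lemma to_l2_cong:
  assumes "square_integrable f" "square_integrable g" "AE x in lborel. f x = g x"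
  shows "to_l2 f = to_l2 g"
  using assms Quotient3_rel_abs[OF Quotient3_l2] by (simp add: to_l2_def l2_eq_def)

lemma square_integrable_cong_AE:
  assumes "square_integrable f" "g \<in> borel_measurable borel" "AE x in lborel. f x = g x"
  shows "square_integrable g"
  using assms unfolding square_integrable_def
  by (auto intro: integrable_cong_AE_imp[where g="\<lambda>x. (cmod (f x))\<^sup>2"] elim!: eventually_mono)

lemma l2_eqI:
  assumes "AE x in lborel. rep_l2 f x = rep_l2 g x"
  shows "f = g"
  using to_l2_cong[OF square_integrable_rep_l2 square_integrable_rep_l2 assms] by simp

lemma to_l2_eqI:
  assumes "square_integrable f" "AE x in lborel. f x = rep_l2 g x"
  shows "to_l2 f = g"
  using to_l2_cong[OF assms(1) square_integrable_rep_l2 assms(2)] by simp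

lemma to_l2_add:
  assumes "square_integrable f" "square_integrable g"
  shows "to_l2 (\<lambda>x. f x + g x) = to_l2 f + to_l2 g"
  using assms plus_l2.abs_eq[OF l2_eq_refl l2_eq_refl] by (simp add: to_l2_def square_integrable_add)

lemma to_l2_diff:
  assumes "square_integrable f" "square_integrable g"
  shows "to_l2 (\<lambda>x. f x - g x) = to_l2 f - to_l2 g"
  using assms minus_l2.abs_eq[OF l2_eq_refl l2_eq_refl] by (simp add: to_l2_def square_integrable_diff)

lemma to_l2_scaleR:
  assumes "square_integrable f"
  shows "to_l2 (\<lambda>x. c *\<^sub>R f x) = c *\<^sub>R to_l2 f"
  using assms scaleR_l2.abs_eq[OF l2_eq_refl] by (simp add: to_l2_def square_integrable_scaleR)

lemma to_l2_zero [simp]: "to_l2 (\<lambda>x. 0) = 0"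
  by (simp add: to_l2_def zero_l2_def)

lemma rep_l2_add: "AE x in lborel. rep_l2 (f + g) x = rep_l2 f x + rep_l2 g x"
  using rep_l2_to_l2[OF square_integrable_add[OF square_integrable_rep_l2 square_integrable_rep_l2], of f g]
  by (simp add: to_l2_add square_integrable_rep_l2)

lemma rep_l2_scaleR: "AE x in lborel. rep_l2 (c *\<^sub>R f) x = c *\<^sub>R rep_l2 f x"
  using rep_l2_to_l2[OF square_integrable_scaleR[OF square_integrable_rep_l2], of c f]
  by (simp add: to_l2_scaleR square_integrable_rep_l2)

lemma rep_l2_zero: "AE x in lborel. rep_l2 0 x = 0"
  using rep_l2_to_l2[OF square_integrable_zero] by simp

lemma inner_to_l2:
  assumes "square_integrable f" "square_integrable g"
  shows "to_l2 f \<bullet> to_l2 g = (\<integral>x. f x \<bullet> g x \<partial>lborel)"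
  using assms inner_l2.abs_eq[OF l2_eq_refl l2_eq_refl] by (simp add: to_l2_def)

lemma inner_l2: "f \<bullet> g = (\<integral>x. rep_l2 f x \<bullet> rep_l2 g x \<partial>lborel)"
  using inner_to_l2[OF square_integrable_rep_l2 square_integrable_rep_l2] by simp

lemma norm_to_l2:
  assumes "square_integrable f"
  shows "(norm (to_l2 f))\<^sup>2 = (\<integral>x. (cmod (f x))\<^sup>2 \<partial>lborel)"
  using inner_to_l2[OF assms assms] by (simp add: power2_norm_eq_inner)

lemma square_integrable_iff_nn:
  "square_integrable f \<longleftrightarrow> f \<in> borel_measurable borel \<and> (\<integral>\<^sup>+x. ennreal ((cmod (f x))\<^sup>2) \<partial>lborel) < \<infinity>"
  by (auto simp: square_integrable_def integrable_iff_bounded)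

lemma nn_norm_to_l2:
  assumes "square_integrable f"
  shows "(\<integral>\<^sup>+x. ennreal ((cmod (f x))\<^sup>2) \<partial>lborel) = ennreal ((norm (to_l2 f))\<^sup>2)"
  unfolding norm_to_l2[OF assms]
  by (rule nn_integral_eq_integral) (use assms in \<open>auto simp: square_integrable_def\<close>)

lemma norm_l2_sq: "(norm f)\<^sup>2 = (\<integral>x. (cmod (rep_l2 f x))\<^sup>2 \<partial>lborel)"
  using norm_to_l2[OF square_integrable_rep_l2] by simp

text \<open>A bound on the extended nonnegative integral yields membership and the norm estimate at
  once, so integrability need not be shown in advance.\<close>

lemma norm_to_l2_le_nn:
  assumes "f \<in> borel_measurable borel" "(\<integral>\<^sup>+x. ennreal ((cmod (f x))\<^sup>2) \<partial>lborel) \<le> ennreal (B\<^sup>2)" "0 \<le> B"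
  shows "square_integrable f" "norm (to_l2 f) \<le> B"
proof -
  show *: "square_integrable f"
    using assms by (auto simp: square_integrable_iff_nn intro: le_less_trans)
  have "(norm (to_l2 f))\<^sup>2 \<le> B\<^sup>2"
    using assms(2) unfolding nn_norm_to_l2[OF *] by simp
  then show "norm (to_l2 f) \<le> B"
    using assms(3) by (rule power2_le_imp_le)
qed

lemma square_integrable_bound:
  assumes "square_integrable f" "g \<in> borel_measurable borel" "\<And>x. cmod (g x) \<le> K * cmod (f x)"
  shows "square_integrable g"
proof -
  have "integrable lborel (\<lambda>x. K\<^sup>2 * (cmod (f x))\<^sup>2)"
    using assms(1) by (auto simp: square_integrable_def)
  then have "integrable lborel (\<lambda>x. (cmod (g x))\<^sup>2)"
    using assms(2) by (elim Bochner_Integration.integrable_bound)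
      (auto simp: power_mult_distrib[symmetric] intro!: AE_I2 power_mono assms(3))
  then show ?thesis using assms(2) by (simp add: square_integrable_def)
qed

lemma norm_to_l2_bound:
  assumes "square_integrable f" "square_integrable g" "AE x in lborel. cmod (g x) \<le> K * cmod (f x)" "0 \<le> K"
  shows "norm (to_l2 g) \<le> K * norm (to_l2 f)"
proof (rule power2_le_imp_le)
  have "(norm (to_l2 g))\<^sup>2 \<le> (\<integral>x. K\<^sup>2 * (cmod (f x))\<^sup>2 \<partial>lborel)"
    unfolding norm_to_l2[OF assms(2)]
  proof (rule integral_mono_AE)
    show "AE x in lborel. (cmod (g x))\<^sup>2 \<le> K\<^sup>2 * (cmod (f x))\<^sup>2"
      using assms(3) by eventually_elim (auto simp: power_mult_distrib[symmetric] intro!: power_mono)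
  qed (use assms in \<open>auto simp: square_integrable_def\<close>)
  then show "(norm (to_l2 g))\<^sup>2 \<le> (K * norm (to_l2 f))\<^sup>2"
    using norm_to_l2[OF assms(1)] by (simp add: power_mult_distrib)
qed (use assms in auto)

lemma square_integrable_mult_integrable:
  assumes "square_integrable f" "square_integrable g"
  shows "integrable lborel (\<lambda>x. f x * g x)"
proof -
  have [measurable]: "f \<in> borel_measurable borel" "g \<in> borel_measurable borel"
    using assms by (auto simp: square_integrable_def)
  have "integrable lborel (\<lambda>x. (cmod (f x))\<^sup>2 + (cmod (g x))\<^sup>2)"
    using assms by (auto simp: square_integrable_def)
  then show ?thesis
  proof (rule Bochner_Integration.integrable_bound)
    have "cmod (f x * g x) \<le> (cmod (f x))\<^sup>2 + (cmod (g x))\<^sup>2" for x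
      using sum_squares_bound[of "cmod (f x)" "cmod (g x)"]
        mult_nonneg_nonneg[OF norm_ge_zero[of "f x"] norm_ge_zero[of "g x"]]
      unfolding norm_mult mult.assoc by linarith
    then show "AE x in lborel. norm (f x * g x) \<le> norm ((cmod (f x))\<^sup>2 + (cmod (g x))\<^sup>2)"
      by (auto intro!: AE_I2)
  qed simp
qed

text \<open>Riesz--Fischer. A subsequence with summable increments converges almost everywhere, because the
  increments are summable in \<open>L\<^sup>1\<close> of every bounded interval; Fatou's lemma gives convergence in \<open>L\<^sup>2\<close>.\<close>

lemma ennreal_power2_le_imp_le: "(a::ennreal)\<^sup>2 \<le> b\<^sup>2 \<Longrightarrow> a \<le> b"
proof (rule ccontr)
  assume *: "a\<^sup>2 \<le> b\<^sup>2" "\<not> a \<le> b"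
  then have "b < a" by simp
  then obtain r where r: "b = ennreal r" "0 \<le> r" by (cases b) auto
  show False
  proof (cases a)
    case (real s)
    then have "s\<^sup>2 \<le> r\<^sup>2" using *(1) r by (simp add: ennreal_power)
    then have "s \<le> r" using r(2) by (rule power2_le_imp_le)
    then show False using real r \<open>b < a\<close> by (simp add: ennreal_less_iff)
  next
    case top then show False using *(1) r by (simp add: ennreal_power top_unique)
  qed
qed

lemma liminf_le_const:
  fixes f :: "nat \<Rightarrow> ennreal"
  assumes "\<And>m. n \<le> m \<Longrightarrow> f m \<le> C"
  shows "liminf f \<le> C"
proof -
  have "liminf f \<le> limsup f" by (rule Liminf_le_Limsup) simp
  also have "\<dots> \<le> C" by (rule Limsup_bounded) (use assms in \<open>auto simp: eventually_sequentially\<close>)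
  finally show ?thesis .
qed

text \<open>Cauchy-Schwarz against the indicator of the interval, whose squared L^2 norm is its
  length \<open>2 * N\<close>.\<close>

lemma nn_integral_interval_le_norm:
  assumes "square_integrable f" "0 \<le> N"
  shows "(\<integral>\<^sup>+x. ennreal (cmod (f x)) * indicator {-N..N} x \<partial>lborel) \<le> ennreal (sqrt (2 * N) * norm (to_l2 f))"
proof -
  have [measurable]: "f \<in> borel_measurable borel" using assms by (auto simp: square_integrable_def)
  let ?I = "\<integral>\<^sup>+x. ennreal (cmod (f x)) * indicator {-N..N} x \<partial>lborel"
  have "?I\<^sup>2 \<le> (\<integral>\<^sup>+x. (ennreal (cmod (f x)))\<^sup>2 \<partial>lborel) * (\<integral>\<^sup>+x. (indicator {-N..N} x)\<^sup>2 \<partial>lborel)"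
    by (rule Cauchy_Schwarz_nn_integral) auto
  also have "(\<integral>\<^sup>+x. (ennreal (cmod (f x)))\<^sup>2 \<partial>lborel) = ennreal ((norm (to_l2 f))\<^sup>2)"
    using nn_norm_to_l2[OF assms(1)] by (simp add: ennreal_power)
  also have "(\<integral>\<^sup>+x. (indicator {-N..N} x)\<^sup>2 \<partial>lborel) = (\<integral>\<^sup>+x. indicator {-N..N} x \<partial>lborel)"
    by (intro nn_integral_cong) (auto simp: indicator_def)
  also have "\<dots> = ennreal (2 * N)"
    using assms by simp
  also have "ennreal ((norm (to_l2 f))\<^sup>2) * ennreal (2 * N) = (ennreal (sqrt (2 * N) * norm (to_l2 f)))\<^sup>2"
    using assms by (simp add: ennreal_power power_mult_distrib ennreal_mult[symmetric] mult.commute)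
  finally show ?thesis
    by (rule ennreal_power2_le_imp_le)
qed

instance l2 :: banach
proof
  fix X :: "nat \<Rightarrow> l2" assume X: "Cauchy X"
  have "\<exists>r::nat\<Rightarrow>nat. strict_mono r \<and> (\<forall>n. \<forall>i\<ge>r n. \<forall>j\<ge>r n. dist (X i) (X j) < (1/2)^n)"
  proof -
    have "\<forall>n. \<exists>M. \<forall>i\<ge>M. \<forall>j\<ge>M. dist (X i) (X j) < (1/2)^n"
      using X unfolding Cauchy_def by (metis zero_less_power zero_less_divide_1_iff zero_less_numeral)
    then obtain M where M: "\<And>n i j. i \<ge> M n \<Longrightarrow> j \<ge> M n \<Longrightarrow> dist (X i) (X j) < (1/2)^n"
      by metis
    \<comment> \<open>\<open>Suc a\<close> makes the indices strictly increasing, and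
      \<open>M (Suc n)\<close> keeps each of them beyond the Cauchy threshold of its power of
      1/2.\<close>
    define r where "r = rec_nat (M 0) (\<lambda>n a. max (Suc a) (M (Suc n)))"
    have r: "r 0 = M 0" "r (Suc n) = max (Suc (r n)) (M (Suc n))" for n by (auto simp: r_def)
    have "r n \<ge> M n" for n by (cases n) (auto simp: r)
    moreover have "strict_mono r" by (auto simp: strict_mono_Suc_iff r)
    ultimately show ?thesis using M by (meson order_trans)
  qed
  then obtain r :: "nat \<Rightarrow> nat" where r: "strict_mono r"
    and rX: "\<And>n i j. i \<ge> r n \<Longrightarrow> j \<ge> r n \<Longrightarrow> dist (X i) (X j) < (1/2)^n" by blast
  define Y where "Y n = X (r n)" for n
  have Yd: "norm (Y (Suc n) - Y n) \<le> (1/2)^n" for n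
    using rX[of n "r (Suc n)" "r n"] r by (simp add: Y_def dist_norm strict_mono_less_eq less_imp_le)
  define d where "d n x = rep_l2 (Y (Suc n)) x - rep_l2 (Y n) x" for n x
  have [measurable]: "d n \<in> borel_measurable borel" for n unfolding d_def by measurable
  have sd: "square_integrable (d n)" for n
    unfolding d_def by (intro square_integrable_diff square_integrable_rep_l2)
  have nd: "norm (to_l2 (d n)) \<le> (1/2)^n" for n
  proof -
    have "d n = (\<lambda>x. rep_l2 (Y (Suc n)) x - rep_l2 (Y n) x)" by (simp add: d_def fun_eq_iff)
    then show ?thesis using Yd[of n] by (simp add: to_l2_diff square_integrable_rep_l2)
  qed
  have "AE x in lborel. \<forall>N::nat. (\<Sum>n. ennreal (cmod (d n x))) * indicator {-real N..real N} x \<noteq> \<infinity>"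
    unfolding AE_all_countable
  proof
    fix N :: nat
    have "(\<integral>\<^sup>+x. (\<Sum>n. ennreal (cmod (d n x))) * indicator {-real N..real N} x \<partial>lborel)
      = (\<integral>\<^sup>+x. (\<Sum>n. ennreal (cmod (d n x)) * indicator {-real N..real N} x) \<partial>lborel)"
      by simp
    also have "\<dots> = (\<Sum>n. \<integral>\<^sup>+x. ennreal (cmod (d n x)) * indicator {-real N..real N} x \<partial>lborel)"
      by (rule nn_integral_suminf) measurable
    also have "\<dots> \<le> (\<Sum>n. ennreal (sqrt (2 * real N) * (1/2)^n))"
    proof (intro suminf_le allI)
      fix n
      have "(\<integral>\<^sup>+x. ennreal (cmod (d n x)) * indicator {-real N..real N} x \<partial>lborel)
        \<le> ennreal (sqrt (2 * real N) * norm (to_l2 (d n)))"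
        by (rule nn_integral_interval_le_norm[OF sd]) simp
      also have "\<dots> \<le> ennreal (sqrt (2 * real N) * (1/2)^n)"
        by (intro ennreal_leI mult_left_mono nd) simp
      finally show "(\<integral>\<^sup>+x. ennreal (cmod (d n x)) * indicator {-real N..real N} x \<partial>lborel) \<le> \<dots>" .
    qed auto
    also have "\<dots> < \<infinity>"
      by (subst suminf_ennreal_eq[where x="sqrt (2 * real N) * 2"])
         (use sums_mult[OF geometric_sums[of "1/2::real"], of "sqrt (2 * real N)"] in \<open>auto\<close>)
    finally show "AE x in lborel. (\<Sum>n. ennreal (cmod (d n x))) * indicator {-real N..real N} x \<noteq> \<infinity>"
      by (intro nn_integral_PInf_AE) auto
  qed
  then have conv: "AE x in lborel. convergent (\<lambda>n. rep_l2 (Y n) x)"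
  proof eventually_elim
    fix x assume *: "\<forall>N::nat. (\<Sum>n. ennreal (cmod (d n x))) * indicator {-real N..real N} x \<noteq> \<infinity>"
    obtain N :: nat where "\<bar>x\<bar> \<le> real N" using real_arch_simple by blast
    then have "x \<in> {-real N..real N}" by auto
    with spec[OF *, of N] have "(\<Sum>n. ennreal (cmod (d n x))) \<noteq> \<infinity>" by simp
    then have "summable (\<lambda>n. cmod (d n x))" by (intro summable_suminf_not_top) (auto simp: top_ennreal_def)
    then have "summable (\<lambda>n. d n x)" by (rule summable_norm_cancel)
    then have "convergent (\<lambda>n. \<Sum>i<n. d i x)" by (simp add: summable_iff_convergent)
    then have "convergent (\<lambda>n. (\<Sum>i<n. d i x) + rep_l2 (Y 0) x)"
      by (intro convergent_add convergent_const)
    moreover have "(\<Sum>i<n. d i x) + rep_l2 (Y 0) x = rep_l2 (Y n) x" for n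
      using sum_lessThan_telescope[of "\<lambda>i. rep_l2 (Y i) x" n] by (simp add: d_def)
    ultimately show "convergent (\<lambda>n. rep_l2 (Y n) x)" by simp
  qed
  define f where "f x = lim (\<lambda>n. rep_l2 (Y n) x)" for x
  have [measurable]: "f \<in> borel_measurable borel" unfolding f_def by measurable
  have lim: "AE x in lborel. (\<lambda>n. rep_l2 (Y n) x) \<longlonglongrightarrow> f x"
    using conv by eventually_elim (auto simp: f_def convergent_LIMSEQ_iff)
  \<comment> \<open>Fatou in \<open>m\<close> with \<open>n\<close> fixed: all later terms of the
    subsequence stay within \<open>(1/2)^n\<close> of \<open>Y n\<close>, and this bound passes to
    the limit. It also shows that \<open>f\<close> is square integrable.\<close>
  have fat: "(\<integral>\<^sup>+x. ennreal ((cmod (f x - rep_l2 (Y n) x))\<^sup>2) \<partial>lborel) \<le> ennreal (((1/2)^n)\<^sup>2)" for n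
  proof -
    have "(\<integral>\<^sup>+x. ennreal ((cmod (f x - rep_l2 (Y n) x))\<^sup>2) \<partial>lborel)
      = (\<integral>\<^sup>+x. liminf (\<lambda>m. ennreal ((cmod (rep_l2 (Y m) x - rep_l2 (Y n) x))\<^sup>2)) \<partial>lborel)"
      using lim
    proof (intro nn_integral_cong_AE, eventually_elim)
      fix x assume "(\<lambda>n. rep_l2 (Y n) x) \<longlonglongrightarrow> f x"
      then have "(\<lambda>m. ennreal ((cmod (rep_l2 (Y m) x - rep_l2 (Y n) x))\<^sup>2))
        \<longlonglongrightarrow> ennreal ((cmod (f x - rep_l2 (Y n) x))\<^sup>2)"
        by (intro tendsto_intros)
      from lim_imp_Liminf[OF _ this]
      show "ennreal ((cmod (f x - rep_l2 (Y n) x))\<^sup>2)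
        = liminf (\<lambda>m. ennreal ((cmod (rep_l2 (Y m) x - rep_l2 (Y n) x))\<^sup>2))" by simp
    qed
    also have "\<dots> \<le> liminf (\<lambda>m. \<integral>\<^sup>+x. ennreal ((cmod (rep_l2 (Y m) x - rep_l2 (Y n) x))\<^sup>2) \<partial>lborel)"
      by (rule nn_integral_liminf) measurable
    also have "\<dots> \<le> ennreal (((1/2)^n)\<^sup>2)"
    proof (rule liminf_le_const)
      fix m assume "n \<le> m"
      then have "norm (Y m - Y n) \<le> (1/2)^n"
        using rX[of n "r m" "r n"] r by (simp add: Y_def dist_norm strict_mono_less_eq less_imp_le)
      then have "(norm (Y m - Y n))\<^sup>2 \<le> ((1/2)^n)\<^sup>2" by (intro power_mono) auto
      then show "(\<integral>\<^sup>+x. ennreal ((cmod (rep_l2 (Y m) x - rep_l2 (Y n) x))\<^sup>2) \<partial>lborel) \<le> ennreal (((1/2)^n)\<^sup>2)"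
        by (subst nn_norm_to_l2)
          (auto simp: square_integrable_diff square_integrable_rep_l2 to_l2_diff intro!: ennreal_leI)
    qed
    finally show ?thesis .
  qed
  have sfd: "square_integrable (\<lambda>x. f x - rep_l2 (Y n) x)"
    and nfd: "norm (to_l2 (\<lambda>x. f x - rep_l2 (Y n) x)) \<le> (1/2)^n" for n
    using norm_to_l2_le_nn[OF _ fat, of n] by auto
  have sf: "square_integrable f"
    using square_integrable_add[OF sfd[of 0] square_integrable_rep_l2, of "Y 0"] by simp
  have "(\<lambda>n. norm (to_l2 f - Y n)) \<longlonglongrightarrow> 0"
  proof (rule tendsto_sandwich[where f="\<lambda>_. 0" and h="\<lambda>n. (1/2)^n"])
    show "\<forall>\<^sub>F n in sequentially. norm (to_l2 f - Y n) \<le> (1/2)^n"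
      using nfd by (simp add: to_l2_diff sf square_integrable_rep_l2)
  qed (auto intro: LIMSEQ_power_zero)
  then have "Y \<longlonglongrightarrow> to_l2 f"
    by (subst tendsto_dist_iff) (simp add: dist_norm norm_minus_commute)
  moreover have "Y = X \<circ> r" by (auto simp: Y_def)
  ultimately have "(X \<circ> r) \<longlonglongrightarrow> to_l2 f" by simp
  then show "convergent X" using X r
    by (meson Cauchy_converges_subseq LIMSEQ_subseq_LIMSEQ convergent_def)
qed

section \<open>Domination on the plane and Cauchy-Schwarz for extended nonnegative integrals\<close>

lemma integrable_pair_bound:
  fixes F :: "real \<times> real \<Rightarrow> 'a::{banach, second_countable_topology}"
    and f :: "real \<Rightarrow> 'b::{banach, second_countable_topology}"
    and g :: "real \<Rightarrow> 'c::{banach, second_countable_topology}"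
  assumes "integrable lborel f" "integrable lborel g" "F \<in> borel_measurable (lborel \<Otimes>\<^sub>M lborel)"
    and "\<And>x y. norm (F (x, y)) \<le> norm (f x) * norm (g y)"
  shows "integrable (lborel \<Otimes>\<^sub>M lborel) F"
proof -
  have [measurable]: "f \<in> borel_measurable lborel" "g \<in> borel_measurable lborel"
    using assms by auto
  have "(\<integral>\<^sup>+p. ennreal (norm (F p)) \<partial>(lborel \<Otimes>\<^sub>M lborel)) = (\<integral>\<^sup>+x. \<integral>\<^sup>+y. ennreal (norm (F (x, y))) \<partial>lborel \<partial>lborel)"
    using assms(3) by (subst lborel.nn_integral_fst[symmetric]) auto
  also have "\<dots> \<le> (\<integral>\<^sup>+x. \<integral>\<^sup>+y. ennreal (norm (f x)) * ennreal (norm (g y)) \<partial>lborel \<partial>lborel)"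
    using assms(4) by (intro nn_integral_mono) (simp add: ennreal_mult[symmetric])
  also have "\<dots> = (\<integral>\<^sup>+x. ennreal (norm (f x)) \<partial>lborel) * (\<integral>\<^sup>+y. ennreal (norm (g y)) \<partial>lborel)"
    by (simp add: nn_integral_cmult nn_integral_multc)
  also have "\<dots> < \<infinity>"
    using assms(1,2) by (simp add: integrable_iff_bounded ennreal_mult_less_top)
  finally show ?thesis
    using assms(3) by (simp add: integrable_iff_bounded)
qed

text \<open>If \<open>f\<close> is not integrable, its Bochner integral is 0 by convention, so the
  estimate can be used before integrability is known.\<close>

lemma norm_integral_le_nn_integral:
  fixes f :: "'a \<Rightarrow> 'b::{banach, second_countable_topology}"
  shows "ennreal (norm (\<integral>x. f x \<partial>M)) \<le> (\<integral>\<^sup>+x. ennreal (norm (f x)) \<partial>M)"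
  by (cases "integrable M f") (simp_all add: integral_norm_bound_ennreal not_integrable_integral_eq)

lemma borel_measurable_cnj [measurable (raw)]:
  assumes [measurable]: "f \<in> borel_measurable M"
  shows "(\<lambda>x. cnj (f x)) \<in> borel_measurable M"
  by (rule measurable_compose[OF assms borel_measurable_continuous_onI]) (intro continuous_intros)

lemma nn_integral_mult_le_norm:
  assumes "square_integrable f" "square_integrable g"
  shows "(\<integral>\<^sup>+x. ennreal (cmod (f x)) * ennreal (cmod (g x)) \<partial>lborel) \<le> ennreal (norm (to_l2 f) * norm (to_l2 g))"
proof -
  have [measurable]: "f \<in> borel_measurable borel" "g \<in> borel_measurable borel"
    using assms by (auto simp: square_integrable_def)
  have "(\<integral>\<^sup>+x. ennreal (cmod (f x)) * ennreal (cmod (g x)) \<partial>lborel)\<^sup>2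
    \<le> (\<integral>\<^sup>+x. (ennreal (cmod (f x)))\<^sup>2 \<partial>lborel) * (\<integral>\<^sup>+x. (ennreal (cmod (g x)))\<^sup>2 \<partial>lborel)"
    by (rule Cauchy_Schwarz_nn_integral) auto
  also have "\<dots> = (ennreal (norm (to_l2 f) * norm (to_l2 g)))\<^sup>2"
    using nn_norm_to_l2[OF assms(1)] nn_norm_to_l2[OF assms(2)]
    by (simp add: ennreal_power ennreal_mult[symmetric] power_mult_distrib)
  finally show ?thesis by (rule ennreal_power2_le_imp_le)
qed

section \<open>The Fourier integral of functions in the intersection of L1 and L2\<close>

text \<open>No normalising factor, in accordance with \<open>truncated_fourier\<close>; hence the
  factor 2 pi in Parseval's identity and in the inversion formula.\<close>

definition fourier_integral :: "(real \<Rightarrow> complex) \<Rightarrow> real \<Rightarrow> complex" where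
  "fourier_integral f \<xi> = (\<integral>x. exp (- (\<i> * complex_of_real (x * \<xi>))) * f x \<partial>lborel)"

lemma cmod_exp_neg_i [simp]: "cmod (exp (- (\<i> * complex_of_real a))) = 1"
  using norm_exp_i_times[of "-a"] by simp

lemma fourier_integral_measurable [measurable]:
  assumes [measurable]: "f \<in> borel_measurable borel"
  shows "fourier_integral f \<in> borel_measurable borel"
  unfolding fourier_integral_def by measurable

lemma fourier_integral_bound: "cmod (fourier_integral f \<xi>) \<le> (\<integral>x. cmod (f x) \<partial>lborel)"
  unfolding fourier_integral_def by (rule order_trans[OF integral_norm_bound]) (simp add: norm_mult)

lemma integrable_exp_mult:
  fixes f :: "real \<Rightarrow> complex"
  assumes "integrable lborel f"
  shows "integrable lborel (\<lambda>x. exp (- (\<i> * complex_of_real (x * \<xi>))) * f x)"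
proof -
  have [measurable]: "f \<in> borel_measurable borel" using assms by auto
  show ?thesis using assms
    by (rule Bochner_Integration.integrable_bound) (auto simp: norm_mult)
qed

lemma fourier_integral_add:
  assumes "integrable lborel f" "integrable lborel g"
  shows "fourier_integral (\<lambda>x. f x + g x) \<xi> = fourier_integral f \<xi> + fourier_integral g \<xi>"
  unfolding fourier_integral_def distrib_left
  by (rule Bochner_Integration.integral_add) (intro integrable_exp_mult assms)+

lemma fourier_integral_diff:
  assumes "integrable lborel f" "integrable lborel g"
  shows "fourier_integral (\<lambda>x. f x - g x) \<xi> = fourier_integral f \<xi> - fourier_integral g \<xi>"
  unfolding fourier_integral_def right_diff_distrib
  by (rule Bochner_Integration.integral_diff) (intro integrable_exp_mult assms)+

lemma fourier_integral_cmult: "fourier_integral (\<lambda>x. c * f x) \<xi> = c * fourier_integral f \<xi>"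
proof -
  have "fourier_integral (\<lambda>x. c * f x) \<xi> = (\<integral>x. c * (exp (- (\<i> * complex_of_real (x * \<xi>))) * f x) \<partial>lborel)"
    unfolding fourier_integral_def by (intro Bochner_Integration.integral_cong) (auto simp: algebra_simps)
  also have "\<dots> = c * fourier_integral f \<xi>" by (simp add: fourier_integral_def)
  finally show ?thesis .
qed

lemma fourier_integral_cnj: "fourier_integral (\<lambda>x. cnj (f x)) \<xi> = cnj (fourier_integral f (- \<xi>))"
  unfolding fourier_integral_def
  by (simp add: Bochner_Integration.integral_cnj[symmetric] exp_cnj)

lemma fourier_integral_reflect: "fourier_integral (\<lambda>x. f (- x)) \<xi> = fourier_integral f (- \<xi>)"
  unfolding fourier_integral_def
  by (subst lborel_integral_real_affine[where c="-1" and t=0]) simp_all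

section \<open>Gaussian regularisation and boundedness of the Fourier integral\<close>

definition gauss :: "real \<Rightarrow> real \<Rightarrow> real" where
  "gauss \<epsilon> \<xi> = exp (- (\<epsilon> * \<xi>)\<^sup>2 / 2)"

lemma gauss_measurable [measurable]: "gauss \<epsilon> \<in> borel_measurable borel"
  unfolding gauss_def by measurable

lemma gauss_le_1: "gauss \<epsilon> \<xi> \<le> 1" and gauss_nonneg: "0 \<le> gauss \<epsilon> \<xi>"
  by (auto simp: gauss_def)

lemma gauss_eq_density: "gauss \<epsilon> \<xi> = sqrt (2 * pi) * std_normal_density (0 + \<epsilon> * \<xi>)"
  by (simp add: gauss_def std_normal_density_def)

lemma integrable_gauss:
  assumes "\<epsilon> > 0" shows "integrable lborel (gauss \<epsilon>)"
proof -
  have "integrable lborel (\<lambda>\<xi>. std_normal_density (0 + \<epsilon> * \<xi>))"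
    using assms by (intro lborel_integrable_real_affine) auto
  then show ?thesis unfolding gauss_eq_density[abs_def] by simp
qed

text \<open>The characteristic function of the standard normal law, evaluated at
  \<open>x / \<epsilon>\<close>, is again a Gaussian; the substitution z = \<epsilon> \<xi> turns it
  into this integral.\<close>

lemma fourier_integral_gauss:
  assumes "\<epsilon> > 0"
  shows "(\<integral>\<xi>. exp (\<i> * complex_of_real (x * \<xi>)) * complex_of_real (gauss \<epsilon> \<xi>) \<partial>lborel)
    = complex_of_real (2 * pi / \<epsilon> * std_normal_density (x / \<epsilon>))"
proof -
  let ?F = "\<lambda>z. std_normal_density z *\<^sub>R iexp (x / \<epsilon> * z)"
  have "complex_of_real (exp (- ((x / \<epsilon>)^2) / 2)) = (\<integral>z. ?F z \<partial>lborel)"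
    using fun_cong[OF char_std_normal_distribution, of "x / \<epsilon>"] unfolding char_def
    by (simp add: integral_density normal_density_nonneg)
  also have "\<dots> = \<bar>\<epsilon>\<bar> *\<^sub>R (\<integral>\<xi>. ?F (0 + \<epsilon> * \<xi>) \<partial>lborel)"
    using assms by (intro lborel_integral_real_affine) auto
  also have "(\<lambda>\<xi>. ?F (0 + \<epsilon> * \<xi>)) = (\<lambda>\<xi>. complex_of_real (1 / sqrt (2 * pi)) * (exp (\<i> * complex_of_real (x * \<xi>)) * complex_of_real (gauss \<epsilon> \<xi>)))"
    using assms by (auto simp: gauss_eq_density scaleR_conv_of_real fun_eq_iff)
  finally have *: "complex_of_real (exp (- ((x / \<epsilon>)^2) / 2)) = \<epsilon> / sqrt (2 * pi) *
      (\<integral>\<xi>. exp (\<i> * complex_of_real (x * \<xi>)) * complex_of_real (gauss \<epsilon> \<xi>) \<partial>lborel)"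
    using assms by (simp add: scaleR_conv_of_real)
  have "2 * pi / \<epsilon> * std_normal_density (x / \<epsilon>) = sqrt (2 * pi) / \<epsilon> * exp (- ((x / \<epsilon>)^2) / 2)"
  proof -
    have "2 * pi / sqrt (2 * pi) = sqrt (2 * pi)" by (simp add: real_div_sqrt)
    then show ?thesis unfolding std_normal_density_def by (simp add: divide_simps mult_ac)
  qed
  then have "complex_of_real (2 * pi / \<epsilon> * std_normal_density (x / \<epsilon>))
    = complex_of_real (sqrt (2 * pi) / \<epsilon>) * complex_of_real (exp (- ((x / \<epsilon>)^2) / 2))"
    by (simp only: of_real_mult[symmetric])
  then show ?thesis unfolding * using assms by simp
qed

text \<open>Convolution with the Gaussian density of standard deviation \<epsilon>, written after a
  substitution that leaves \<epsilon> only in the argument of \<open>f\<close>; the limit \<epsilon>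
  -> 0 is then a matter of dominated convergence.\<close>

definition gauss_smooth :: "real \<Rightarrow> (real \<Rightarrow> complex) \<Rightarrow> real \<Rightarrow> complex" where
  "gauss_smooth \<epsilon> f y = (\<integral>z. std_normal_density z *\<^sub>R f (y - \<epsilon> * z) \<partial>lborel)"

lemma gauss_smooth_measurable [measurable]:
  assumes [measurable]: "f \<in> borel_measurable borel"
  shows "gauss_smooth \<epsilon> f \<in> borel_measurable borel"
  unfolding gauss_smooth_def by measurable

text \<open>The Gaussian weight makes the double integral absolutely convergent, so Fubini applies;
  the inner integral over \<xi> is the transform of the Gaussian, and the rest is the substitution
  built into \<open>gauss_smooth\<close>.\<close>

lemma inverse_fourier_integral_gauss:
  assumes f: "integrable lborel f" and \<epsilon>: "\<epsilon> > 0"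
  shows "(\<integral>\<xi>. exp (\<i> * complex_of_real (y * \<xi>)) * (complex_of_real (gauss \<epsilon> \<xi>) * fourier_integral f \<xi>) \<partial>lborel)
    = 2 * pi * gauss_smooth \<epsilon> f y"
proof -
  have [measurable]: "f \<in> borel_measurable borel" using f by auto
  let ?F = "\<lambda>\<xi> x. exp (\<i> * complex_of_real ((y - x) * \<xi>)) * complex_of_real (gauss \<epsilon> \<xi>) * f x"
  have "(\<integral>\<xi>. exp (\<i> * complex_of_real (y * \<xi>)) * (complex_of_real (gauss \<epsilon> \<xi>) * fourier_integral f \<xi>) \<partial>lborel)
    = (\<integral>\<xi>. \<integral>x. ?F \<xi> x \<partial>lborel \<partial>lborel)"
  proof (intro Bochner_Integration.integral_cong refl)
    fix \<xi>
    have "exp (\<i> * complex_of_real ((y - x) * \<xi>)) = exp (\<i> * complex_of_real (y * \<xi>)) * exp (- (\<i> * complex_of_real (x * \<xi>)))" for x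
      unfolding exp_add[symmetric] by (simp add: algebra_simps)
    then have "?F \<xi> x = (exp (\<i> * complex_of_real (y * \<xi>)) * complex_of_real (gauss \<epsilon> \<xi>)) * (exp (- (\<i> * complex_of_real (x * \<xi>))) * f x)" for x
      by (simp only: mult.assoc mult.left_commute)
    then show "exp (\<i> * complex_of_real (y * \<xi>)) * (complex_of_real (gauss \<epsilon> \<xi>) * fourier_integral f \<xi>) = (\<integral>x. ?F \<xi> x \<partial>lborel)"
      unfolding fourier_integral_def by (simp only: integral_mult_right_zero mult.assoc)
  qed
  also have "\<dots> = (\<integral>x. \<integral>\<xi>. ?F \<xi> x \<partial>lborel \<partial>lborel)"
  proof (rule lborel_pair.Fubini_integral[symmetric])
    show "integrable (lborel \<Otimes>\<^sub>M lborel) (\<lambda>(\<xi>, x). ?F \<xi> x)"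
      by (rule integrable_pair_bound[OF integrable_gauss[OF \<epsilon>] f]) (auto simp: norm_mult gauss_nonneg)
  qed
  also have "\<dots> = (\<integral>x. complex_of_real (2 * pi / \<epsilon> * std_normal_density ((y - x) / \<epsilon>)) * f x \<partial>lborel)"
    by (simp only: integral_mult_left_zero fourier_integral_gauss[OF \<epsilon>])
  also have "\<dots> = \<bar>-\<epsilon>\<bar> *\<^sub>R (\<integral>z. complex_of_real (2 * pi / \<epsilon> * std_normal_density ((y - (y + -\<epsilon> * z)) / \<epsilon>)) * f (y + -\<epsilon> * z) \<partial>lborel)"
    using \<epsilon> by (intro lborel_integral_real_affine) auto
  also have "\<dots> = \<bar>-\<epsilon>\<bar> *\<^sub>R (\<integral>z. complex_of_real (2 * pi / \<epsilon>) * (std_normal_density z *\<^sub>R f (y - \<epsilon> * z)) \<partial>lborel)"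
  proof -
    have "complex_of_real (2 * pi / \<epsilon> * std_normal_density ((y - (y + -\<epsilon> * z)) / \<epsilon>)) * f (y + -\<epsilon> * z)
      = complex_of_real (2 * pi / \<epsilon>) * (std_normal_density z *\<^sub>R f (y - \<epsilon> * z))" for z
      using \<epsilon> by (simp add: scaleR_conv_of_real)
    then show ?thesis by (simp only:)
  qed
  also have "(\<integral>z. complex_of_real (2 * pi / \<epsilon>) * (std_normal_density z *\<^sub>R f (y - \<epsilon> * z)) \<partial>lborel)
    = complex_of_real (2 * pi / \<epsilon>) * gauss_smooth \<epsilon> f y"
    unfolding gauss_smooth_def by (rule integral_mult_right_zero)
  also have "\<bar>-\<epsilon>\<bar> *\<^sub>R (complex_of_real (2 * pi / \<epsilon>) * gauss_smooth \<epsilon> f y) = 2 * pi * gauss_smooth \<epsilon> f y"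
    using \<epsilon> by (simp add: scaleR_conv_of_real)
  finally show ?thesis .
qed

text \<open>A regularised Parseval identity. \<open>fourier_integral f\<close> is bounded by the L^1
  norm of \<open>f\<close>, so the Gaussian in \<xi> and \<open>g\<close> in y dominate the double
  integral, and Fubini reduces the claim to the weighted inversion formula.\<close>

lemma fourier_integral_gauss_pairing:
  assumes f: "integrable lborel f" and g: "integrable lborel g" and \<epsilon>: "\<epsilon> > 0"
  shows "(\<integral>\<xi>. complex_of_real (gauss \<epsilon> \<xi>) * fourier_integral f \<xi> * cnj (fourier_integral g \<xi>) \<partial>lborel)
    = 2 * pi * (\<integral>y. gauss_smooth \<epsilon> f y * cnj (g y) \<partial>lborel)"
proof -
  have [measurable]: "f \<in> borel_measurable borel" "g \<in> borel_measurable borel" using f g by auto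
  let ?F = "\<lambda>\<xi> y. exp (\<i> * complex_of_real (y * \<xi>)) * (complex_of_real (gauss \<epsilon> \<xi>) * fourier_integral f \<xi>) * cnj (g y)"
  have "complex_of_real (gauss \<epsilon> \<xi>) * fourier_integral f \<xi> * cnj (fourier_integral g \<xi>) = (\<integral>y. ?F \<xi> y \<partial>lborel)" for \<xi>
  proof -
    have "cnj (fourier_integral g \<xi>) = (\<integral>y. exp (\<i> * complex_of_real (y * \<xi>)) * cnj (g y) \<partial>lborel)"
      using fourier_integral_cnj[of g "-\<xi>"] by (simp add: fourier_integral_def)
    then have "complex_of_real (gauss \<epsilon> \<xi>) * fourier_integral f \<xi> * cnj (fourier_integral g \<xi>)
      = (\<integral>y. complex_of_real (gauss \<epsilon> \<xi>) * fourier_integral f \<xi> * (exp (\<i> * complex_of_real (y * \<xi>)) * cnj (g y)) \<partial>lborel)"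
      by simp
    also have "\<dots> = (\<integral>y. ?F \<xi> y \<partial>lborel)"
      by (intro Bochner_Integration.integral_cong) (auto simp: algebra_simps)
    finally show ?thesis .
  qed
  then have "(\<integral>\<xi>. complex_of_real (gauss \<epsilon> \<xi>) * fourier_integral f \<xi> * cnj (fourier_integral g \<xi>) \<partial>lborel)
    = (\<integral>\<xi>. \<integral>y. ?F \<xi> y \<partial>lborel \<partial>lborel)" by simp
  also have "\<dots> = (\<integral>y. \<integral>\<xi>. ?F \<xi> y \<partial>lborel \<partial>lborel)"
  proof (rule lborel_pair.Fubini_integral[symmetric])
    have *: "integrable lborel (\<lambda>\<xi>. (\<integral>x. cmod (f x) \<partial>lborel) * gauss \<epsilon> \<xi>)"
      using integrable_gauss[OF \<epsilon>] by simp
    show "integrable (lborel \<Otimes>\<^sub>M lborel) (\<lambda>(\<xi>, y). ?F \<xi> y)"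
    proof (rule integrable_pair_bound[OF * g])
      show "(\<lambda>(\<xi>, y). ?F \<xi> y) \<in> borel_measurable (lborel \<Otimes>\<^sub>M lborel)" by measurable
      show "cmod (case (\<xi>, y) of (\<xi>, y) \<Rightarrow> ?F \<xi> y) \<le> norm ((\<integral>x. cmod (f x) \<partial>lborel) * gauss \<epsilon> \<xi>) * cmod (g y)" for \<xi> y
        using fourier_integral_bound[of f \<xi>] gauss_nonneg[of \<epsilon> \<xi>]
        by (simp add: norm_mult mult.commute[of "gauss _ _"] mult_right_mono abs_mult)
    qed
  qed
  also have "\<dots> = (\<integral>y. 2 * pi * gauss_smooth \<epsilon> f y * cnj (g y) \<partial>lborel)"
    using inverse_fourier_integral_gauss[OF f \<epsilon>] by simp
  also have "\<dots> = 2 * pi * (\<integral>y. gauss_smooth \<epsilon> f y * cnj (g y) \<partial>lborel)"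
    by (simp add: mult.assoc)
  finally show ?thesis .
qed

lemma to_l2_translate:
  assumes "square_integrable f"
  shows "square_integrable (\<lambda>y. f (y + a))" "norm (to_l2 (\<lambda>y. f (y + a))) = norm (to_l2 f)"
proof -
  have [measurable]: "f \<in> borel_measurable borel" using assms by (auto simp: square_integrable_def)
  have *: "(\<integral>\<^sup>+y. ennreal ((cmod (f (y + a)))\<^sup>2) \<partial>lborel) = ennreal ((norm (to_l2 f))\<^sup>2)"
    unfolding nn_norm_to_l2[OF assms, symmetric]
    by (subst (2) nn_integral_real_affine[where c=1 and t=a]) (auto simp: add.commute)
  show s: "square_integrable (\<lambda>y. f (y + a))"
    unfolding square_integrable_iff_nn * by simp
  show "norm (to_l2 (\<lambda>y. f (y + a))) = norm (to_l2 f)"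
    using nn_norm_to_l2[OF s] unfolding * by simp
qed

text \<open>\<open>gauss_smooth\<close> averages translates of \<open>f\<close> over a probability
  density. Every translate has the norm of \<open>f\<close>, so its pairing with \<open>g\<close>
  obeys Cauchy-Schwarz, and averaging preserves the bound whatever \<epsilon> is.\<close>

lemma gauss_smooth_pairing_le:
  assumes f: "square_integrable f" and g: "square_integrable g"
  shows "cmod (\<integral>y. gauss_smooth \<epsilon> f y * cnj (g y) \<partial>lborel) \<le> norm (to_l2 f) * norm (to_l2 g)"
proof -
  have [measurable]: "f \<in> borel_measurable borel" "g \<in> borel_measurable borel"
    using f g by (auto simp: square_integrable_def)
  have "ennreal (cmod (\<integral>y. gauss_smooth \<epsilon> f y * cnj (g y) \<partial>lborel))
      \<le> (\<integral>\<^sup>+y. ennreal (cmod (gauss_smooth \<epsilon> f y * cnj (g y))) \<partial>lborel)"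
    by (rule norm_integral_le_nn_integral)
  also have "\<dots> \<le> (\<integral>\<^sup>+y. (\<integral>\<^sup>+z. ennreal (std_normal_density z) * (ennreal (cmod (f (y - \<epsilon> * z))) * ennreal (cmod (g y))) \<partial>lborel) \<partial>lborel)"
  proof (rule nn_integral_mono)
    fix y
    have "ennreal (cmod (gauss_smooth \<epsilon> f y)) \<le> (\<integral>\<^sup>+z. ennreal (cmod (std_normal_density z *\<^sub>R f (y - \<epsilon> * z))) \<partial>lborel)"
      unfolding gauss_smooth_def by (rule norm_integral_le_nn_integral)
    then have "ennreal (cmod (gauss_smooth \<epsilon> f y)) * ennreal (cmod (g y)) \<le>
      (\<integral>\<^sup>+z. ennreal (cmod (std_normal_density z *\<^sub>R f (y - \<epsilon> * z))) \<partial>lborel) * ennreal (cmod (g y))"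
      by (intro mult_right_mono) auto
    also have "\<dots> = (\<integral>\<^sup>+z. ennreal (cmod (std_normal_density z *\<^sub>R f (y - \<epsilon> * z))) * ennreal (cmod (g y)) \<partial>lborel)"
      by (rule nn_integral_multc[symmetric]) auto
    finally show "ennreal (cmod (gauss_smooth \<epsilon> f y * cnj (g y))) \<le>
      (\<integral>\<^sup>+z. ennreal (std_normal_density z) * (ennreal (cmod (f (y - \<epsilon> * z))) * ennreal (cmod (g y))) \<partial>lborel)"
      by (simp add: norm_mult ennreal_mult mult.assoc normal_density_nonneg)
  qed
  also have "\<dots> = (\<integral>\<^sup>+z. (\<integral>\<^sup>+y. ennreal (std_normal_density z) * (ennreal (cmod (f (y - \<epsilon> * z))) * ennreal (cmod (g y))) \<partial>lborel) \<partial>lborel)"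
    by (rule lborel_pair.Fubini') measurable
  also have "\<dots> \<le> (\<integral>\<^sup>+z. ennreal (std_normal_density z) * ennreal (norm (to_l2 f) * norm (to_l2 g)) \<partial>lborel)"
  proof (rule nn_integral_mono)
    fix z
    have "(\<integral>\<^sup>+y. ennreal (cmod (f (y + (- \<epsilon> * z)))) * ennreal (cmod (g y)) \<partial>lborel) \<le> ennreal (norm (to_l2 f) * norm (to_l2 g))"
      using nn_integral_mult_le_norm[OF to_l2_translate(1)[OF f, of "- \<epsilon> * z"] g]
      unfolding to_l2_translate(2)[OF f] .
    then show "(\<integral>\<^sup>+y. ennreal (std_normal_density z) * (ennreal (cmod (f (y - \<epsilon> * z))) * ennreal (cmod (g y))) \<partial>lborel)
      \<le> ennreal (std_normal_density z) * ennreal (norm (to_l2 f) * norm (to_l2 g))"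
      by (subst nn_integral_cmult) (auto intro!: mult_left_mono)
  qed
  also have "\<dots> = (\<integral>\<^sup>+z. ennreal (std_normal_density z) \<partial>lborel) * ennreal (norm (to_l2 f) * norm (to_l2 g))"
    by (rule nn_integral_multc) auto
  also have "(\<integral>\<^sup>+z. ennreal (std_normal_density z) \<partial>lborel) = 1"
    by (subst nn_integral_eq_integral) (auto simp: normal_density_nonneg)
  finally show ?thesis by simp
qed

text \<open>With \<open>g = f\<close> the regularised identity bounds the Gaussian weighted square
  integral of the transform uniformly in \<epsilon>; Fatou's lemma removes the weight. Only an
  inequality results, which suffices to extend the transform to L^2.\<close>

lemma fourier_integral_norm_le:
  assumes f: "integrable lborel f" "square_integrable f"
  shows "square_integrable (fourier_integral f)"
    "norm (to_l2 (fourier_integral f)) \<le> sqrt (2 * pi) * norm (to_l2 f)"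
proof -
  have [measurable]: "f \<in> borel_measurable borel" using f by auto
  let ?B = "2 * pi * (norm (to_l2 f))\<^sup>2"
  define e where "e n = 1 / real (Suc n)" for n
  have e: "e n > 0" "e \<longlonglongrightarrow> 0" for n
    using LIMSEQ_inverse_real_of_nat by (auto simp: e_def[abs_def] inverse_eq_divide)
  have bd: "(\<integral>\<^sup>+\<xi>. ennreal (gauss (e n) \<xi> * (cmod (fourier_integral f \<xi>))\<^sup>2) \<partial>lborel) \<le> ennreal ?B" for n
  proof -
    have int: "integrable lborel (\<lambda>\<xi>. gauss (e n) \<xi> * (cmod (fourier_integral f \<xi>))\<^sup>2)"
    proof (rule Bochner_Integration.integrable_bound)
      show "integrable lborel (\<lambda>\<xi>. (\<integral>x. cmod (f x) \<partial>lborel)\<^sup>2 * gauss (e n) \<xi>)"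
        using integrable_gauss[OF e(1)] by simp
      show "AE \<xi> in lborel. norm (gauss (e n) \<xi> * (cmod (fourier_integral f \<xi>))\<^sup>2)
          \<le> norm ((\<integral>x. cmod (f x) \<partial>lborel)\<^sup>2 * gauss (e n) \<xi>)"
        by (auto simp: gauss_nonneg norm_mult mult.commute[of "gauss _ _"] intro!: mult_right_mono power_mono fourier_integral_bound)
    qed measurable
    have "complex_of_real (\<integral>\<xi>. gauss (e n) \<xi> * (cmod (fourier_integral f \<xi>))\<^sup>2 \<partial>lborel)
      = (\<integral>\<xi>. complex_of_real (gauss (e n) \<xi> * (cmod (fourier_integral f \<xi>))\<^sup>2) \<partial>lborel)"
      by (rule integral_complex_of_real[symmetric])
    also have "\<dots> = (\<integral>\<xi>. complex_of_real (gauss (e n) \<xi>) * fourier_integral f \<xi> * cnj (fourier_integral f \<xi>) \<partial>lborel)"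
      by (intro Bochner_Integration.integral_cong refl) (simp add: complex_norm_square mult.assoc del: of_real_power)
    also have "\<dots> = 2 * pi * (\<integral>y. gauss_smooth (e n) f y * cnj (f y) \<partial>lborel)"
      by (rule fourier_integral_gauss_pairing[OF f(1) f(1) e(1)])
    finally have eq: "complex_of_real (\<integral>\<xi>. gauss (e n) \<xi> * (cmod (fourier_integral f \<xi>))\<^sup>2 \<partial>lborel)
      = 2 * pi * (\<integral>y. gauss_smooth (e n) f y * cnj (f y) \<partial>lborel)" .
    have "(\<integral>\<xi>. gauss (e n) \<xi> * (cmod (fourier_integral f \<xi>))\<^sup>2 \<partial>lborel)
        \<le> cmod (complex_of_real (\<integral>\<xi>. gauss (e n) \<xi> * (cmod (fourier_integral f \<xi>))\<^sup>2 \<partial>lborel))"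
      by simp
    also have "\<dots> \<le> ?B"
      using gauss_smooth_pairing_le[OF f(2) f(2), of "e n"] unfolding eq
      by (simp add: norm_mult power2_eq_square)
    finally show ?thesis
      by (subst nn_integral_eq_integral[OF int]) (auto simp: gauss_nonneg intro!: ennreal_leI)
  qed
  have "(\<integral>\<^sup>+\<xi>. ennreal ((cmod (fourier_integral f \<xi>))\<^sup>2) \<partial>lborel)
    = (\<integral>\<^sup>+\<xi>. liminf (\<lambda>n. ennreal (gauss (e n) \<xi> * (cmod (fourier_integral f \<xi>))\<^sup>2)) \<partial>lborel)"
  proof (intro nn_integral_cong)
    fix \<xi>
    have "(\<lambda>n. gauss (e n) \<xi> * (cmod (fourier_integral f \<xi>))\<^sup>2) \<longlonglongrightarrow> exp (- (0 * \<xi>)\<^sup>2 / 2) * (cmod (fourier_integral f \<xi>))\<^sup>2"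
      unfolding gauss_def by (intro tendsto_intros e) simp
    then have "(\<lambda>n. ennreal (gauss (e n) \<xi> * (cmod (fourier_integral f \<xi>))\<^sup>2)) \<longlonglongrightarrow> ennreal ((cmod (fourier_integral f \<xi>))\<^sup>2)"
      by (intro tendsto_ennrealI) simp
    from lim_imp_Liminf[OF _ this]
    show "ennreal ((cmod (fourier_integral f \<xi>))\<^sup>2) = liminf (\<lambda>n. ennreal (gauss (e n) \<xi> * (cmod (fourier_integral f \<xi>))\<^sup>2))"
      by simp
  qed
  also have "\<dots> \<le> liminf (\<lambda>n. \<integral>\<^sup>+\<xi>. ennreal (gauss (e n) \<xi> * (cmod (fourier_integral f \<xi>))\<^sup>2) \<partial>lborel)"
    by (rule nn_integral_liminf) measurable
  also have "\<dots> \<le> ennreal ?B"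
    by (rule liminf_le_const) (rule bd)
  also have "?B = (sqrt (2 * pi) * norm (to_l2 f))\<^sup>2"
    by (simp add: power_mult_distrib)
  finally have *: "(\<integral>\<^sup>+\<xi>. ennreal ((cmod (fourier_integral f \<xi>))\<^sup>2) \<partial>lborel) \<le> ennreal ((sqrt (2 * pi) * norm (to_l2 f))\<^sup>2)" .
  show "square_integrable (fourier_integral f)" by (rule norm_to_l2_le_nn(1)[OF _ *]) auto
  show "norm (to_l2 (fourier_integral f)) \<le> sqrt (2 * pi) * norm (to_l2 f)"
    by (rule norm_to_l2_le_nn(2)[OF _ *]) auto
qed

section \<open>Parseval's identity against indicators of intervals\<close>

lemma gauss_smooth_interval:
  assumes "y \<noteq> a" "y \<noteq> b"
  shows "(\<lambda>n. gauss_smooth (1 / real (Suc n)) (\<lambda>x. c * indicator {a..b} x) y) \<longlonglongrightarrow> c * indicator {a..b} y"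
proof -
  have "(\<lambda>n. \<integral>z. std_normal_density z *\<^sub>R (c * indicator {a..b} (y - (1 / real (Suc n)) * z)) \<partial>lborel)
    \<longlonglongrightarrow> (\<integral>z. std_normal_density z *\<^sub>R (c * indicator {a..b} y) \<partial>lborel)"
  proof (rule integral_dominated_convergence[where w="\<lambda>z. cmod c * std_normal_density z"])
    show "AE z in lborel. (\<lambda>n. std_normal_density z *\<^sub>R (c * indicator {a..b} (y - (1 / real (Suc n)) * z)))
      \<longlonglongrightarrow> std_normal_density z *\<^sub>R (c * indicator {a..b} y)"
    proof (rule AE_I2)
      fix z :: real
      have lim: "(\<lambda>n. y - (1 / real (Suc n)) * z) \<longlonglongrightarrow> y - 0 * z"
        using LIMSEQ_inverse_real_of_nat by (intro tendsto_intros) (simp add: inverse_eq_divide)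
      \<comment> \<open>With the end points excluded the indicator is constant near
        \<open>y\<close>, so for each fixed \<open>z\<close> the perturbed argument eventually gives
        the same value.\<close>
      have "\<forall>\<^sub>F n in sequentially. (indicator {a..b} (y - (1 / real (Suc n)) * z) :: complex) = indicator {a..b} y"
      proof (cases "y \<in> {a<..<b}")
        case True
        then have "\<forall>\<^sub>F n in sequentially. y - (1 / real (Suc n)) * z \<in> {a<..<b}"
          by (intro topological_tendstoD[OF lim]) auto
        then show ?thesis by eventually_elim (use True in \<open>auto simp: indicator_def\<close>)
      next
        case False
        then have y: "y \<in> - {a..b}" using assms by auto
        then have "\<forall>\<^sub>F n in sequentially. y - (1 / real (Suc n)) * z \<in> - {a..b}"
          by (intro topological_tendstoD[OF lim]) auto
        then show ?thesis by eventually_elim (use y in \<open>auto simp: indicator_def\<close>)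
      qed
      then have "\<forall>\<^sub>F n in sequentially. std_normal_density z *\<^sub>R (c * indicator {a..b} (y - (1 / real (Suc n)) * z)) =
         std_normal_density z *\<^sub>R (c * indicator {a..b} y)"
        by eventually_elim simp
      then show "(\<lambda>n. std_normal_density z *\<^sub>R (c * indicator {a..b} (y - (1 / real (Suc n)) * z)))
        \<longlonglongrightarrow> std_normal_density z *\<^sub>R (c * indicator {a..b} y)"
        by (rule tendsto_eventually)
    qed
    show "AE z in lborel. norm (std_normal_density z *\<^sub>R (c * indicator {a..b} (y - (1 / real (Suc n)) * z)))
      \<le> cmod c * std_normal_density z" for n
      by (auto simp: indicator_def norm_mult normal_density_nonneg)
    show "(\<lambda>z. std_normal_density z *\<^sub>R (c * indicator {a..b} (y - (1 / real (Suc n)) * z))) \<in> borel_measurable lborel" for n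
      by measurable
  qed auto
  then show ?thesis
    unfolding gauss_smooth_def by (simp add: normal_density_nonneg)
qed

lemma gauss_smooth_interval_le:
  "cmod (gauss_smooth \<epsilon> (\<lambda>x. c * indicator {a..b} x) y) \<le> cmod c"
proof -
  have "cmod (gauss_smooth \<epsilon> (\<lambda>x. c * indicator {a..b} x) y) \<le> (\<integral>z. cmod c * std_normal_density z \<partial>lborel)"
    unfolding gauss_smooth_def
  proof (rule Bochner_Integration.integral_norm_bound_integral)
    show i: "integrable lborel (\<lambda>z. cmod c * std_normal_density z)" by auto
    show b: "norm (std_normal_density z *\<^sub>R (c * indicator {a..b} (y - \<epsilon> * z))) \<le> cmod c * std_normal_density z" for z
      by (auto simp: indicator_def norm_mult normal_density_nonneg)
    have "(\<lambda>z. std_normal_density z *\<^sub>R (c * indicator {a..b} (y - \<epsilon> * z))) \<in> borel_measurable lborel"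
      by measurable
    then show "integrable lborel (\<lambda>z. std_normal_density z *\<^sub>R (c * indicator {a..b} (y - \<epsilon> * z)))"
      by (rule Bochner_Integration.integrable_bound[OF i]) (intro AE_I2 order_trans[OF b], auto simp: normal_density_nonneg)
  qed
  then show ?thesis by simp
qed

lemma square_integrable_interval: "square_integrable (\<lambda>x. c * indicator {a..b::real} x)"
proof -
  have "integrable lborel (\<lambda>x. (cmod c)\<^sup>2 * indicator {a..b} x)"
    by (intro integrable_mult_right integrable_real_indicator) (auto simp: emeasure_lborel_Icc_eq)
  then have "integrable lborel (\<lambda>x. (cmod (c * indicator {a..b} x))\<^sup>2)"
    by (rule Bochner_Integration.integrable_bound) (auto simp: indicator_def norm_mult)
  then show ?thesis by (simp add: square_integrable_def)
qed

lemma integrable_interval: "integrable lborel (\<lambda>x. (c::complex) * indicator {a..b::real} x)"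
proof -
  have "integrable lborel (\<lambda>x. cmod c * indicator {a..b} x)"
    by (intro integrable_mult_right integrable_real_indicator) (auto simp: emeasure_lborel_Icc_eq)
  then show ?thesis
    by (rule Bochner_Integration.integrable_bound) (auto simp: indicator_def norm_mult)
qed

lemma square_integrable_cnj: "square_integrable f \<Longrightarrow> square_integrable (\<lambda>x. cnj (f x))"
  by (auto simp: square_integrable_def)

text \<open>Both sides are limits of the regularised identity. The smoothing is placed on the
  indicator, whose smoothed versions are bounded by \<open>cmod c\<close> and converge almost
  everywhere, so that \<open>cmod c * cmod (f y)\<close> is an integrable majorant.\<close>

lemma fourier_integral_interval_pairing:
  assumes f: "integrable lborel f" "square_integrable f"
  shows "(\<integral>\<xi>. fourier_integral f \<xi> * cnj (fourier_integral (\<lambda>x. c * indicator {a..b} x) \<xi>) \<partial>lborel)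
    = 2 * pi * (\<integral>y. f y * cnj (c * indicator {a..b} y) \<partial>lborel)"
proof -
  let ?h = "\<lambda>x. c * indicator {a..b} x"
  let ?e = "\<lambda>n. 1 / real (Suc n)"
  have [measurable]: "f \<in> borel_measurable borel" using f by auto
  have hm [measurable]: "?h \<in> borel_measurable borel" by measurable
  note h = integrable_interval[of c a b] square_integrable_interval[of c a b]
  have int: "integrable lborel (\<lambda>\<xi>. fourier_integral f \<xi> * cnj (fourier_integral ?h \<xi>))"
    by (intro square_integrable_mult_integrable square_integrable_cnj fourier_integral_norm_le f h)
  have lim1: "(\<lambda>n. \<integral>\<xi>. complex_of_real (gauss (?e n) \<xi>) * fourier_integral f \<xi> * cnj (fourier_integral ?h \<xi>) \<partial>lborel)
    \<longlonglongrightarrow> (\<integral>\<xi>. fourier_integral f \<xi> * cnj (fourier_integral ?h \<xi>) \<partial>lborel)"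
  proof (rule integral_dominated_convergence[where w="\<lambda>\<xi>. cmod (fourier_integral f \<xi> * cnj (fourier_integral ?h \<xi>))"])
    show "AE \<xi> in lborel. (\<lambda>n. complex_of_real (gauss (?e n) \<xi>) * fourier_integral f \<xi> * cnj (fourier_integral ?h \<xi>))
      \<longlonglongrightarrow> fourier_integral f \<xi> * cnj (fourier_integral ?h \<xi>)"
    proof (rule AE_I2)
      fix \<xi>
      have "(\<lambda>n. complex_of_real (gauss (?e n) \<xi>)) \<longlonglongrightarrow> complex_of_real (exp (- (0 * \<xi>)\<^sup>2 / 2))"
        unfolding gauss_def using LIMSEQ_inverse_real_of_nat by (intro tendsto_intros) (auto simp: inverse_eq_divide)
      then have "(\<lambda>n. complex_of_real (gauss (?e n) \<xi>) * (fourier_integral f \<xi> * cnj (fourier_integral ?h \<xi>)))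
        \<longlonglongrightarrow> complex_of_real (exp (- (0 * \<xi>)\<^sup>2 / 2)) * (fourier_integral f \<xi> * cnj (fourier_integral ?h \<xi>))"
        by (intro tendsto_mult tendsto_const)
      then show "(\<lambda>n. complex_of_real (gauss (?e n) \<xi>) * fourier_integral f \<xi> * cnj (fourier_integral ?h \<xi>))
        \<longlonglongrightarrow> fourier_integral f \<xi> * cnj (fourier_integral ?h \<xi>)"
        by (simp add: mult.assoc)
    qed
    show "AE \<xi> in lborel. norm (complex_of_real (gauss (?e n) \<xi>) * fourier_integral f \<xi> * cnj (fourier_integral ?h \<xi>))
       \<le> cmod (fourier_integral f \<xi> * cnj (fourier_integral ?h \<xi>))" for n
      using gauss_le_1 gauss_nonneg
      by (intro AE_I2) (simp add: norm_mult mult.assoc mult_left_le_one_le del: of_nat_Suc)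
  qed (use int in \<open>auto\<close>)
  have lim2: "(\<lambda>n. \<integral>y. cnj (gauss_smooth (?e n) ?h y) * f y \<partial>lborel)
     \<longlonglongrightarrow> (\<integral>y. cnj (?h y) * f y \<partial>lborel)"
  proof (rule integral_dominated_convergence[where w="\<lambda>y. cmod c * cmod (f y)"])
    have "AE y in lborel. y \<noteq> a \<and> y \<noteq> b"
      using AE_lborel_singleton[of a] AE_lborel_singleton[of b] by eventually_elim auto
    then show "AE y in lborel. (\<lambda>n. cnj (gauss_smooth (?e n) ?h y) * f y) \<longlonglongrightarrow> cnj (?h y) * f y"
      by eventually_elim (intro tendsto_intros gauss_smooth_interval, auto)
    show "AE y in lborel. norm (cnj (gauss_smooth (?e n) ?h y) * f y) \<le> cmod c * cmod (f y)" for n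
      by (intro AE_I2) (simp add: norm_mult gauss_smooth_interval_le mult_right_mono del: of_nat_Suc)
  qed (use f in \<open>auto\<close>)
  \<comment> \<open>The regularised identity is taken with the indicator in the first slot and then
    conjugated, which moves the smoothing from \<open>f\<close> to the indicator.\<close>
  have eq: "(\<integral>\<xi>. complex_of_real (gauss (?e n) \<xi>) * fourier_integral f \<xi> * cnj (fourier_integral ?h \<xi>) \<partial>lborel)
     = 2 * pi * (\<integral>y. cnj (gauss_smooth (?e n) ?h y) * f y \<partial>lborel)" for n
  proof -
    have "(\<integral>\<xi>. complex_of_real (gauss (?e n) \<xi>) * fourier_integral f \<xi> * cnj (fourier_integral ?h \<xi>) \<partial>lborel)
      = (\<integral>\<xi>. cnj (complex_of_real (gauss (?e n) \<xi>) * fourier_integral ?h \<xi> * cnj (fourier_integral f \<xi>)) \<partial>lborel)"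
      by (intro Bochner_Integration.integral_cong) (auto simp: mult_ac)
    also have "\<dots> = cnj (2 * pi * (\<integral>y. gauss_smooth (?e n) ?h y * cnj (f y) \<partial>lborel))"
      using fourier_integral_gauss_pairing[OF h(1) f(1), of "?e n"] by (simp only: Bochner_Integration.integral_cnj) simp
    also have "\<dots> = 2 * pi * (\<integral>y. cnj (gauss_smooth (?e n) ?h y) * f y \<partial>lborel)"
      by (simp add: Bochner_Integration.integral_cnj[symmetric])
    finally show ?thesis .
  qed
  from LIMSEQ_unique[OF lim1[unfolded eq] tendsto_mult[OF tendsto_const lim2]]
  show ?thesis by (simp add: mult.commute)
qed

text \<open>On a bounded interval the positive and the negative part of \<open>g\<close> are
  densities of finite measures that agree on all half-lines and hence coincide. Uniqueness of
  densities gives \<open>max 0 (g x) = max 0 (- g x)\<close>, which forces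
  \<open>g x = 0\<close>.\<close>

lemma AE_zero_of_interval_integrals:
  fixes g :: "real \<Rightarrow> real"
  assumes g: "\<And>N. integrable lborel (\<lambda>x. indicator {-N..N} x * g x)" and [measurable]: "g \<in> borel_measurable borel"
    and z: "\<And>a b. (\<integral>x. indicator {a..b} x * g x \<partial>lborel) = 0"
  shows "AE x in lborel. g x = 0"
proof -
  have "AE x in lborel. indicator {- real N..real N} x * g x = 0" for N :: nat
  proof -
    let ?I = "indicator {- real N..real N} :: real \<Rightarrow> real"
    let ?p = "\<lambda>x. ennreal (?I x * max 0 (g x))" and ?m = "\<lambda>x. ennreal (?I x * max 0 (- g x))"
    have fin: "emeasure (density lborel (\<lambda>x. ennreal (?I x * max 0 (s * g x)))) {x<..} < \<infinity>"
      if "s = 1 \<or> s = -1" for s x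
    proof -
      have "emeasure (density lborel (\<lambda>x. ennreal (?I x * max 0 (s * g x)))) {x<..}
        \<le> (\<integral>\<^sup>+x. ennreal (norm (?I x * g x)) \<partial>lborel)"
        using that by (subst emeasure_density) (auto intro!: nn_integral_mono simp: indicator_def)
      also have "\<dots> < \<infinity>" using g[of "real N"] by (simp add: integrable_iff_bounded)
      finally show ?thesis .
    qed
    have "density lborel ?p = density lborel ?m"
    proof (rule measure_eqI_lessThan)
      fix x
      show "emeasure (density lborel ?p) {x<..} < \<infinity>" using fin[of 1] by simp
      define J where "J = {x<..} \<inter> {- real N..real N}"
      have int: "integrable lborel (\<lambda>y. indicator J y * (s * g y))" for s
        by (rule Bochner_Integration.integrable_bound[OF integrable_mult_right[OF g[of "real N"], of s]])
           (auto simp: J_def indicator_def abs_mult)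
      have int': "integrable lborel (\<lambda>y. indicator J y * max 0 (s * g y))" for s
        by (rule Bochner_Integration.integrable_bound[OF int[of s]]) (auto simp: J_def indicator_def)
      have em: "emeasure (density lborel (\<lambda>y. ennreal (?I y * max 0 (s * g y)))) {x<..}
          = ennreal (\<integral>y. indicator J y * max 0 (s * g y) \<partial>lborel)" for s
      proof -
        have "emeasure (density lborel (\<lambda>y. ennreal (?I y * max 0 (s * g y)))) {x<..}
          = (\<integral>\<^sup>+y. ennreal (indicator J y * max 0 (s * g y)) \<partial>lborel)"
          by (subst emeasure_density) (auto intro!: nn_integral_cong simp: J_def indicator_def)
        also have "\<dots> = ennreal (\<integral>y. indicator J y * max 0 (s * g y) \<partial>lborel)"
          by (rule nn_integral_eq_integral[OF int']) (auto simp: indicator_def)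
        finally show ?thesis .
      qed
      have "(\<integral>y. indicator J y * max 0 (1 * g y) \<partial>lborel) - (\<integral>y. indicator J y * max 0 ((-1) * g y) \<partial>lborel)
        = (\<integral>y. indicator J y * max 0 (1 * g y) - indicator J y * max 0 ((-1) * g y) \<partial>lborel)"
        by (rule Bochner_Integration.integral_diff[symmetric, OF int' int'])
      also have "\<dots> = (\<integral>y. indicator {max x (- real N)..real N} y * g y \<partial>lborel)"
      proof (rule integral_cong_AE)
        \<comment> \<open>The open half-line and the closed interval of the hypothesis can differ
          only at the point \<open>x\<close>.\<close>
        show "AE y in lborel. indicator J y * max 0 (1 * g y) - indicator J y * max 0 ((-1) * g y)
          = indicator {max x (- real N)..real N} y * g y"
          using AE_lborel_singleton[of x] by eventually_elim (auto simp: J_def indicator_def)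
      qed (auto simp: J_def)
      also have "\<dots> = 0" by (rule z)
      finally show "emeasure (density lborel ?p) {x<..} = emeasure (density lborel ?m) {x<..}"
        using em[of 1] em[of "-1"] by simp
    qed auto
    then have "AE x in lborel. ?p x = ?m x"
      by (intro sigma_finite_measure.density_unique[OF lborel.sigma_finite_measure_axioms]) auto
    then show ?thesis
      by eventually_elim (auto simp: indicator_def max_def ennreal_eq_0_iff split: if_splits)
  qed
  then have "AE x in lborel. \<forall>N::nat. indicator {- real N..real N} x * g x = 0"
    unfolding AE_all_countable by blast
  then show ?thesis
  proof eventually_elim
    fix x assume *: "\<forall>N::nat. indicator {- real N..real N} x * g x = 0"
    obtain N :: nat where "\<bar>x\<bar> \<le> real N" using real_arch_simple by blast
    then show "g x = 0" using spec[OF *, of N] by (auto simp: indicator_def split: if_splits)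
  qed
qed

text \<open>The inner product of \<open>l2\<close> is only the real part of the Hermitian one; the
  heights \<open>c = 1\<close> and \<open>c = \<i>\<close> pick out the real and the imaginary part
  of \<open>f\<close>.\<close>

lemma l2_zero_of_intervals:
  assumes "\<And>c a b. f \<bullet> to_l2 (\<lambda>x. c * indicator {a..b} x) = 0"
  shows "f = 0"
proof -
  have loc: "integrable lborel (\<lambda>x. indicator {-N..N} x * Re (c * rep_l2 f x))" for N c
  proof -
    have "integrable lborel (\<lambda>x. rep_l2 f x * (c * indicator {-N..N} x))"
      by (intro square_integrable_mult_integrable square_integrable_rep_l2 square_integrable_interval)
    then have "integrable lborel (\<lambda>x. Re (rep_l2 f x * (c * indicator {-N..N} x)))" by (rule integrable_Re)
    then show ?thesis
      by (rule Bochner_Integration.integrable_bound) (auto simp: indicator_def mult.commute)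
  qed
  have "AE x in lborel. Re (cnj c * rep_l2 f x) = 0" for c
  proof (rule AE_zero_of_interval_integrals[OF loc])
    fix a b
    have "f \<bullet> to_l2 (\<lambda>x. c * indicator {a..b} x) = (\<integral>x. rep_l2 f x \<bullet> (c * indicator {a..b} x) \<partial>lborel)"
      using inner_to_l2[OF square_integrable_rep_l2[of f] square_integrable_interval] by simp
    also have "\<dots> = (\<integral>x. indicator {a..b} x * Re (cnj c * rep_l2 f x) \<partial>lborel)"
      by (intro Bochner_Integration.integral_cong) (auto simp: indicator_def inner_complex_def mult.commute)
    finally show "(\<integral>x. indicator {a..b} x * Re (cnj c * rep_l2 f x) \<partial>lborel) = 0"
      using assms by simp
  qed measurable
  from this[of 1] this[of \<i>] have "AE x in lborel. rep_l2 f x = 0"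
    by eventually_elim (auto simp: complex_eq_iff)
  with rep_l2_zero have "AE x in lborel. rep_l2 f x = rep_l2 0 x"
    by eventually_elim simp
  then show ?thesis by (rule l2_eqI)
qed

section \<open>The Fourier transform on L2\<close>

definition cutoff :: "real \<Rightarrow> l2 \<Rightarrow> real \<Rightarrow> complex" where
  "cutoff R f x = indicator {-R..R} x *\<^sub>R rep_l2 f x"

lemma cutoff_measurable [measurable]: "cutoff R f \<in> borel_measurable borel"
  unfolding cutoff_def by measurable

lemma square_integrable_cutoff: "square_integrable (cutoff R f)"
  by (rule square_integrable_bound[OF square_integrable_rep_l2[of f], where K=1]) (auto simp: cutoff_def indicator_def)

lemma integrable_cutoff: "integrable lborel (cutoff R f)"
proof -
  have "integrable lborel (\<lambda>x. rep_l2 f x * (1 * indicator {-R..R} x))"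
    by (intro square_integrable_mult_integrable square_integrable_rep_l2 square_integrable_interval)
  then show ?thesis
    by (rule Bochner_Integration.integrable_bound) (auto simp: cutoff_def indicator_def)
qed

lemma truncated_fourier_eq: "truncated_fourier R f = fourier_integral (cutoff R f)"
  unfolding truncated_fourier_def fourier_integral_def set_lebesgue_integral_def cutoff_def fun_eq_iff
  by (auto intro!: Bochner_Integration.integral_cong)

lemma cutoff_tendsto: "((\<lambda>R. to_l2 (cutoff R f)) \<longlongrightarrow> f) at_top"
proof -
  have sd: "square_integrable (\<lambda>x. cutoff R f x - rep_l2 f x)" for R
    by (intro square_integrable_diff square_integrable_cutoff square_integrable_rep_l2)
  have "((\<lambda>R. \<integral>x. (cmod (cutoff R f x - rep_l2 f x))\<^sup>2 \<partial>lborel) \<longlongrightarrow> (\<integral>x. 0 \<partial>(lborel::real measure))) at_top"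
  proof (rule integral_dominated_convergence_at_top[where w="\<lambda>x. (cmod (rep_l2 f x))\<^sup>2"])
    show "AE x in lborel. ((\<lambda>R. (cmod (cutoff R f x - rep_l2 f x))\<^sup>2) \<longlongrightarrow> 0) at_top"
    proof (rule AE_I2)
      fix x
      have "\<forall>\<^sub>F R in at_top. (cmod (cutoff R f x - rep_l2 f x))\<^sup>2 = 0"
        using eventually_ge_at_top[of "\<bar>x\<bar>"] by eventually_elim (auto simp: cutoff_def indicator_def abs_le_iff)
      then show "((\<lambda>R. (cmod (cutoff R f x - rep_l2 f x))\<^sup>2) \<longlongrightarrow> 0) at_top"
        by (rule tendsto_eventually)
    qed
    show "\<forall>\<^sub>F R in at_top. AE x in lborel. norm ((cmod (cutoff R f x - rep_l2 f x))\<^sup>2) \<le> (cmod (rep_l2 f x))\<^sup>2"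
      by (auto simp: cutoff_def indicator_def)
    show "integrable lborel (\<lambda>x. (cmod (rep_l2 f x))\<^sup>2)"
      using square_integrable_rep_l2[of f] by (simp add: square_integrable_def)
  qed auto
  then have "((\<lambda>R. (norm (to_l2 (cutoff R f) - f))\<^sup>2) \<longlongrightarrow> 0) at_top"
    using norm_to_l2[OF sd] by (simp add: to_l2_diff square_integrable_cutoff square_integrable_rep_l2)
  then have "((\<lambda>R. sqrt ((norm (to_l2 (cutoff R f) - f))\<^sup>2)) \<longlongrightarrow> sqrt 0) at_top"
    by (intro tendsto_intros)
  then show ?thesis by (subst tendsto_dist_iff) (simp add: dist_norm)
qed

lemma fourier_integral_dist_le:
  assumes "integrable lborel f" "square_integrable f" "integrable lborel g" "square_integrable g"
  shows "norm (to_l2 (fourier_integral f) - to_l2 (fourier_integral g)) \<le> sqrt (2 * pi) * norm (to_l2 f - to_l2 g)"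
proof -
  have "fourier_integral (\<lambda>x. f x - g x) = (\<lambda>\<xi>. fourier_integral f \<xi> - fourier_integral g \<xi>)"
    using assms by (simp add: fourier_integral_diff fun_eq_iff)
  then show ?thesis
    using fourier_integral_norm_le(2)[of "\<lambda>x. f x - g x"] assms
    by (simp add: to_l2_diff fourier_integral_norm_le square_integrable_diff)
qed

text \<open>\<open>fourier\<close> is defined through \<open>Lim\<close>, which carries no
  information until the limit exists. The norm bound transfers the Cauchy property from the cutoffs;
  completeness is used along the integers, and the same bound extends the convergence to real
  \<open>R\<close>.\<close>

lemma fourier_cutoff_tendsto: "((\<lambda>R. to_l2 (fourier_integral (cutoff R f))) \<longlongrightarrow> fourier f) at_top"
proof -
  let ?Q = "\<lambda>R. to_l2 (fourier_integral (cutoff R f))" and ?T = "\<lambda>R. to_l2 (cutoff R f)"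
  have Q: "dist (?Q R) (?Q R') \<le> sqrt (2 * pi) * dist (?T R) (?T R')" for R R'
    unfolding dist_norm by (intro fourier_integral_dist_le integrable_cutoff square_integrable_cutoff)
  have T: "(\<lambda>n. ?T (real n)) \<longlonglongrightarrow> f"
    by (rule filterlim_compose[OF cutoff_tendsto filterlim_real_sequentially])
  have "Cauchy (\<lambda>n. ?Q (real n))"
  proof (rule metric_CauchyI)
    fix e :: real assume e: "e > 0"
    from metric_CauchyD[OF LIMSEQ_imp_Cauchy[OF T], of "e / sqrt (2 * pi)"] e
    obtain M where "\<forall>m\<ge>M. \<forall>n\<ge>M. dist (?T (real m)) (?T (real n)) < e / sqrt (2 * pi)" by auto
    then have "dist (?Q (real m)) (?Q (real n)) < e" if "m \<ge> M" "n \<ge> M" for m n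
    proof -
      have "sqrt (2 * pi) * dist (?T (real m)) (?T (real n)) < e"
        using \<open>\<forall>m\<ge>M. \<forall>n\<ge>M. dist (?T (real m)) (?T (real n)) < e / sqrt (2 * pi)\<close> that
        by (simp add: pos_less_divide_eq mult.commute)
      with Q[of "real m" "real n"] show ?thesis by linarith
    qed
    then show "\<exists>M. \<forall>m\<ge>M. \<forall>n\<ge>M. dist (?Q (real m)) (?Q (real n)) < e" by blast
  qed
  then obtain L where L: "(\<lambda>n. ?Q (real n)) \<longlonglongrightarrow> L"
    using Cauchy_convergent convergent_def by blast
  have QL: "dist (?Q R) L \<le> sqrt (2 * pi) * dist (?T R) f" for R
  proof (rule LIMSEQ_le)
    show "(\<lambda>n. dist (?Q R) (?Q (real n))) \<longlonglongrightarrow> dist (?Q R) L" by (intro tendsto_intros L)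
    show "(\<lambda>n. sqrt (2 * pi) * dist (?T R) (?T (real n))) \<longlonglongrightarrow> sqrt (2 * pi) * dist (?T R) f"
      by (intro tendsto_intros T)
    show "\<exists>N. \<forall>n\<ge>N. dist (?Q R) (?Q (real n)) \<le> sqrt (2 * pi) * dist (?T R) (?T (real n))"
      by (intro exI allI impI Q)
  qed
  have "((\<lambda>R. dist (?Q R) L) \<longlongrightarrow> 0) at_top"
  proof (rule tendsto_sandwich[OF _ _ tendsto_const])
    show "((\<lambda>R. sqrt (2 * pi) * dist (?T R) f) \<longlongrightarrow> 0) at_top"
      using tendsto_mult[OF tendsto_const[of "sqrt (2 * pi)"] tendsto_dist_iff[THEN iffD1, OF cutoff_tendsto[of f]]] by simp
    show "\<forall>\<^sub>F R in at_top. dist (?Q R) L \<le> sqrt (2 * pi) * dist (?T R) f"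
      by (intro always_eventually allI QL)
  qed auto
  then have lim: "(?Q \<longlongrightarrow> L) at_top" by (subst tendsto_dist_iff)
  then have "fourier f = L"
    unfolding fourier_def truncated_fourier_eq by (rule tendsto_Lim[OF trivial_limit_at_top_linorder])
  with lim show ?thesis by simp
qed

lemma fourier_to_l2:
  assumes "integrable lborel f" "square_integrable f"
  shows "fourier (to_l2 f) = to_l2 (fourier_integral f)"
proof (rule tendsto_unique[OF trivial_limit_at_top_linorder fourier_cutoff_tendsto])
  let ?Q = "\<lambda>R. to_l2 (fourier_integral (cutoff R (to_l2 f)))"
  show "(?Q \<longlongrightarrow> to_l2 (fourier_integral f)) at_top"
  proof (rule tendsto_dist_iff[THEN iffD2], rule tendsto_sandwich[OF _ _ tendsto_const])
    show "((\<lambda>R. sqrt (2 * pi) * dist (to_l2 (cutoff R (to_l2 f))) (to_l2 f)) \<longlongrightarrow> 0) at_top"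
      using tendsto_mult[OF tendsto_const[of "sqrt (2 * pi)"] tendsto_dist_iff[THEN iffD1, OF cutoff_tendsto[of "to_l2 f"]]] by simp
    show "\<forall>\<^sub>F R in at_top. dist (?Q R) (to_l2 (fourier_integral f)) \<le> sqrt (2 * pi) * dist (to_l2 (cutoff R (to_l2 f))) (to_l2 f)"
      unfolding dist_norm by (intro always_eventually allI fourier_integral_dist_le integrable_cutoff square_integrable_cutoff assms)
  qed auto
qed

text \<open>Density principle: cutoffs approximate every element, so an identity between continuous
  maps has to be checked only on functions that are both integrable and square integrable, where the
  transform is an actual integral.\<close>

lemma fourier_cong_limit:
  assumes "continuous_on UNIV A" "continuous_on UNIV B"
    and "\<And>f. integrable lborel f \<Longrightarrow> square_integrable f \<Longrightarrow> A (to_l2 f) = (B (to_l2 f) :: 'a::t2_space)"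
  shows "A f = B f"
proof (rule tendsto_unique[OF trivial_limit_at_top_linorder])
  show "((\<lambda>R. A (to_l2 (cutoff R f))) \<longlongrightarrow> A f) at_top"
    using assms(1) by (intro continuous_on_tendsto_compose[OF _ cutoff_tendsto]) auto
  have "((\<lambda>R. B (to_l2 (cutoff R f))) \<longlongrightarrow> B f) at_top"
    using assms(2) by (intro continuous_on_tendsto_compose[OF _ cutoff_tendsto]) auto
  then show "((\<lambda>R. A (to_l2 (cutoff R f))) \<longlongrightarrow> B f) at_top"
    by (simp add: assms(3) integrable_cutoff square_integrable_cutoff)
qed

text \<open>Square integrability is invariant under changes on null sets, so if it fails for one
  function it fails for both and \<open>to_l2\<close> gives the default value 0 twice. This permits
  unbounded multipliers.\<close>

lemma to_l2_cong_AE: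
  assumes "f \<in> borel_measurable borel" "g \<in> borel_measurable borel" "AE x in lborel. f x = g x"
  shows "to_l2 f = to_l2 g"
proof (cases "square_integrable f")
  case True
  then show ?thesis using square_integrable_cong_AE[OF True assms(2,3)] to_l2_cong assms(3) by blast
next
  case False
  have "AE x in lborel. g x = f x" using assms(3) by eventually_elim simp
  with False have "\<not> square_integrable g"
    using square_integrable_cong_AE[of g f] assms(1) by blast
  with False show ?thesis by (simp add: to_l2_def)
qed

lemma fourier_add: "fourier (f + g) = fourier f + fourier g"
proof (rule tendsto_unique[OF trivial_limit_at_top_linorder fourier_cutoff_tendsto])
  have "to_l2 (fourier_integral (cutoff R (f + g))) = to_l2 (fourier_integral (cutoff R f)) + to_l2 (fourier_integral (cutoff R g))" for R
  proof -
    have "AE x in lborel. cutoff R (f + g) x = cutoff R f x + cutoff R g x"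
      using rep_l2_add[of f g] by eventually_elim (simp add: cutoff_def scaleR_add_right)
    then have "fourier_integral (cutoff R (f + g)) \<xi> = fourier_integral (\<lambda>x. cutoff R f x + cutoff R g x) \<xi>" for \<xi>
      unfolding fourier_integral_def by (intro integral_cong_AE) auto
    then have "fourier_integral (cutoff R (f + g)) = (\<lambda>\<xi>. fourier_integral (cutoff R f) \<xi> + fourier_integral (cutoff R g) \<xi>)"
      by (simp add: fourier_integral_add integrable_cutoff fun_eq_iff)
    then show ?thesis
      by (simp add: to_l2_add fourier_integral_norm_le integrable_cutoff square_integrable_cutoff)
  qed
  then show "((\<lambda>R. to_l2 (fourier_integral (cutoff R (f + g)))) \<longlongrightarrow> fourier f + fourier g) at_top"
    by (simp add: tendsto_add fourier_cutoff_tendsto)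
qed

lemma fourier_scaleR: "fourier (c *\<^sub>R f) = c *\<^sub>R fourier f"
proof (rule tendsto_unique[OF trivial_limit_at_top_linorder fourier_cutoff_tendsto])
  have "to_l2 (fourier_integral (cutoff R (c *\<^sub>R f))) = c *\<^sub>R to_l2 (fourier_integral (cutoff R f))" for R
  proof -
    have "AE x in lborel. cutoff R (c *\<^sub>R f) x = complex_of_real c * cutoff R f x"
      using rep_l2_scaleR[of c f] by eventually_elim (simp add: cutoff_def scaleR_conv_of_real mult_ac)
    then have "fourier_integral (cutoff R (c *\<^sub>R f)) \<xi> = fourier_integral (\<lambda>x. complex_of_real c * cutoff R f x) \<xi>" for \<xi>
      unfolding fourier_integral_def by (intro integral_cong_AE) auto
    then have "fourier_integral (cutoff R (c *\<^sub>R f)) = (\<lambda>\<xi>. c *\<^sub>R fourier_integral (cutoff R f) \<xi>)"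
      by (simp add: fourier_integral_cmult scaleR_conv_of_real fun_eq_iff)
    then show ?thesis
      by (simp add: to_l2_scaleR fourier_integral_norm_le integrable_cutoff square_integrable_cutoff)
  qed
  then show "((\<lambda>R. to_l2 (fourier_integral (cutoff R (c *\<^sub>R f)))) \<longlongrightarrow> c *\<^sub>R fourier f) at_top"
    by (simp add: tendsto_scaleR fourier_cutoff_tendsto)
qed

lemma norm_fourier_le: "norm (fourier f) \<le> norm f * sqrt (2 * pi)"
proof (rule tendsto_le[OF trivial_limit_at_top_linorder])
  show "((\<lambda>R. norm (to_l2 (fourier_integral (cutoff R f)))) \<longlongrightarrow> norm (fourier f)) at_top"
    by (intro tendsto_intros fourier_cutoff_tendsto)
  show "((\<lambda>R. norm (to_l2 (cutoff R f)) * sqrt (2 * pi)) \<longlongrightarrow> norm f * sqrt (2 * pi)) at_top"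
    by (intro tendsto_intros cutoff_tendsto)
  show "\<forall>\<^sub>F R in at_top. norm (to_l2 (fourier_integral (cutoff R f))) \<le> norm (to_l2 (cutoff R f)) * sqrt (2 * pi)"
    using fourier_integral_norm_le(2)[OF integrable_cutoff square_integrable_cutoff] by (simp add: mult.commute)
qed

lemma bounded_linear_fourier: "bounded_linear fourier"
  using bounded_linear_intro[OF fourier_add fourier_scaleR norm_fourier_le] .

section \<open>Reflection, conjugation and the inversion theorem\<close>

definition reflect :: "l2 \<Rightarrow> l2" where "reflect f = to_l2 (\<lambda>x. rep_l2 f (- x))"

definition conj_l2 :: "l2 \<Rightarrow> l2" where "conj_l2 f = to_l2 (\<lambda>x. cnj (rep_l2 f x))"

lemma AE_reflect:
  fixes P :: "real \<Rightarrow> bool"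
  assumes "AE x in lborel. P x" and P: "Measurable.pred borel P"
  shows "AE x in lborel. P (- x)"
proof -
  have "AE x in distr lborel borel uminus. P x" using assms(1) unfolding lborel_distr_uminus .
  moreover have "{x \<in> space borel. P x} \<in> sets borel" using P by measurable
  ultimately show ?thesis using AE_distr_iff[of uminus lborel borel P] by simp
qed

lemma square_integrable_reflect:
  assumes "square_integrable f" shows "square_integrable (\<lambda>x. f (- x))"
proof -
  have [measurable]: "f \<in> borel_measurable borel" using assms by (auto simp: square_integrable_def)
  show ?thesis using assms lborel_integrable_real_affine[of "\<lambda>x. (cmod (f x))\<^sup>2" "-1" 0]
    by (auto simp: square_integrable_def)
qed

lemma inner_reflect_to_l2:
  assumes "square_integrable f" "square_integrable g"
  shows "to_l2 (\<lambda>x. f (- x)) \<bullet> to_l2 (\<lambda>x. g (- x)) = to_l2 f \<bullet> to_l2 g"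
  using assms lborel_integral_real_affine[of "-1" "\<lambda>x. f x \<bullet> g x" 0]
  by (simp add: inner_to_l2 square_integrable_reflect)

lemma reflect_to_l2:
  assumes "square_integrable f" shows "reflect (to_l2 f) = to_l2 (\<lambda>x. f (- x))"
proof -
  have [measurable]: "f \<in> borel_measurable borel" using assms by (auto simp: square_integrable_def)
  show ?thesis unfolding reflect_def
    by (intro to_l2_cong square_integrable_reflect square_integrable_rep_l2 assms AE_reflect[OF rep_l2_to_l2[OF assms]]) measurable
qed

lemma inner_reflect: "reflect f \<bullet> reflect g = f \<bullet> g"
  using inner_reflect_to_l2[OF square_integrable_rep_l2 square_integrable_rep_l2] by (simp add: reflect_def)

lemma rep_l2_conj: "AE x in lborel. rep_l2 (conj_l2 f) x = cnj (rep_l2 f x)"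
  unfolding conj_l2_def by (rule rep_l2_to_l2[OF square_integrable_cnj[OF square_integrable_rep_l2]])

lemma conj_to_l2:
  assumes "square_integrable f" shows "conj_l2 (to_l2 f) = to_l2 (\<lambda>x. cnj (f x))"
  unfolding conj_l2_def
  by (intro to_l2_cong square_integrable_cnj square_integrable_rep_l2 assms)
     (use rep_l2_to_l2[OF assms] in eventually_elim, simp)

lemma bounded_linear_reflect: "bounded_linear reflect"
proof (rule bounded_linear_intro[where K=1])
  show "reflect (f + g) = reflect f + reflect g" for f g
  proof -
    have "reflect (f + g) = reflect (to_l2 (\<lambda>x. rep_l2 f x + rep_l2 g x))"
      by (simp add: to_l2_add square_integrable_rep_l2)
    also have "\<dots> = reflect f + reflect g"
      by (subst reflect_to_l2) (auto simp: reflect_def to_l2_add square_integrable_add square_integrable_rep_l2 square_integrable_reflect)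
    finally show ?thesis .
  qed
  show "reflect (r *\<^sub>R f) = r *\<^sub>R reflect f" for r f
  proof -
    have "reflect (r *\<^sub>R f) = reflect (to_l2 (\<lambda>x. r *\<^sub>R rep_l2 f x))"
      by (simp add: to_l2_scaleR square_integrable_rep_l2)
    also have "\<dots> = r *\<^sub>R reflect f"
      by (subst reflect_to_l2) (auto simp: reflect_def to_l2_scaleR square_integrable_scaleR square_integrable_rep_l2 square_integrable_reflect)
    finally show ?thesis .
  qed
  show "norm (reflect f) \<le> norm f * 1" for f
    by (simp add: norm_eq_sqrt_inner inner_reflect)
qed

lemma bounded_linear_conj_l2: "bounded_linear conj_l2"
proof (rule bounded_linear_intro[where K=1])
  show "conj_l2 (f + g) = conj_l2 f + conj_l2 g" for f g
  proof -
    have "conj_l2 (f + g) = conj_l2 (to_l2 (\<lambda>x. rep_l2 f x + rep_l2 g x))"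
      by (simp add: to_l2_add square_integrable_rep_l2)
    also have "\<dots> = conj_l2 f + conj_l2 g"
      by (subst conj_to_l2) (auto simp: conj_l2_def to_l2_add square_integrable_add square_integrable_rep_l2 square_integrable_cnj)
    finally show ?thesis .
  qed
  show "conj_l2 (r *\<^sub>R f) = r *\<^sub>R conj_l2 f" for r f
  proof -
    have "conj_l2 (r *\<^sub>R f) = conj_l2 (to_l2 (\<lambda>x. r *\<^sub>R rep_l2 f x))"
      by (simp add: to_l2_scaleR square_integrable_rep_l2)
    also have "\<dots> = r *\<^sub>R conj_l2 f"
      by (subst conj_to_l2) (auto simp: conj_l2_def to_l2_scaleR square_integrable_scaleR square_integrable_rep_l2 square_integrable_cnj)
    finally show ?thesis .
  qed
  show "norm (conj_l2 f) \<le> norm f * 1" for f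
    using norm_to_l2_bound[OF square_integrable_rep_l2[of f] square_integrable_cnj[OF square_integrable_rep_l2[of f]], of 1]
    by (simp add: conj_l2_def)
qed

lemma fourier_reflect: "fourier (reflect f) = reflect (fourier f)"
proof (rule fourier_cong_limit[where f=f and A="\<lambda>f. fourier (reflect f)" and B="\<lambda>f. reflect (fourier f)"])
  show "continuous_on UNIV (\<lambda>f. fourier (reflect f))" "continuous_on UNIV (\<lambda>f. reflect (fourier f))"
    by (intro linear_continuous_on bounded_linear_compose[OF bounded_linear_fourier bounded_linear_reflect]
        bounded_linear_compose[OF bounded_linear_reflect bounded_linear_fourier])+
next
  fix f assume f: "integrable lborel f" "square_integrable f"
  have "integrable lborel (\<lambda>x. f (- x))"
    using lborel_integrable_real_affine[OF f(1), of "-1" 0] by simp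
  moreover have "fourier_integral (\<lambda>x. f (- x)) = (\<lambda>\<xi>. fourier_integral f (- \<xi>))"
    by (simp add: fourier_integral_reflect fun_eq_iff)
  ultimately show "fourier (reflect (to_l2 f)) = reflect (fourier (to_l2 f))"
    using f by (simp add: reflect_to_l2 fourier_to_l2 square_integrable_reflect fourier_integral_norm_le)
qed

lemma fourier_conj: "fourier (conj_l2 f) = conj_l2 (reflect (fourier f))"
proof (rule fourier_cong_limit[where f=f and A="\<lambda>f. fourier (conj_l2 f)" and B="\<lambda>f. conj_l2 (reflect (fourier f))"])
  show "continuous_on UNIV (\<lambda>f. fourier (conj_l2 f))" "continuous_on UNIV (\<lambda>f. conj_l2 (reflect (fourier f)))"
    by (intro linear_continuous_on bounded_linear_compose[OF bounded_linear_fourier bounded_linear_conj_l2]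
        bounded_linear_compose[OF bounded_linear_conj_l2 bounded_linear_compose[OF bounded_linear_reflect bounded_linear_fourier]])+
next
  fix f assume f: "integrable lborel f" "square_integrable f"
  have "fourier_integral (\<lambda>x. cnj (f x)) = (\<lambda>\<xi>. cnj (fourier_integral f (- \<xi>)))"
    by (simp add: fourier_integral_cnj fun_eq_iff)
  then show "fourier (conj_l2 (to_l2 f)) = conj_l2 (reflect (fourier (to_l2 f)))"
    using f by (simp add: reflect_to_l2 conj_to_l2 fourier_to_l2 square_integrable_reflect square_integrable_cnj fourier_integral_norm_le)
qed

text \<open>Fubini moves the exponential from \<open>f\<close> to \<open>g\<close>. Taking it under
  the conjugate changes its sign, which is why the adjoint of the transform is the reflected
  transform.\<close>

lemma inner_fourier_integral:
  assumes f: "integrable lborel f" "square_integrable f" and g: "integrable lborel g" "square_integrable g"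
  shows "to_l2 (fourier_integral f) \<bullet> to_l2 g = to_l2 f \<bullet> to_l2 (\<lambda>x. fourier_integral g (- x))"
proof -
  have [measurable]: "f \<in> borel_measurable borel" "g \<in> borel_measurable borel" using f g by auto
  let ?F = "\<lambda>\<xi> x. exp (- (\<i> * complex_of_real (x * \<xi>))) * f x * cnj (g \<xi>)"
  have int: "integrable lborel (\<lambda>\<xi>. u \<xi> * cnj (v \<xi>))" if "square_integrable u" "square_integrable v" for u v
    using that by (intro square_integrable_mult_integrable square_integrable_cnj)
  have inn: "to_l2 u \<bullet> to_l2 v = Re (\<integral>\<xi>. u \<xi> * cnj (v \<xi>) \<partial>lborel)" if "square_integrable u" "square_integrable v" for u v
    using that by (simp add: inner_to_l2 integral_Re[OF int[OF that], symmetric] inner_complex_def)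
  have "(\<integral>\<xi>. fourier_integral f \<xi> * cnj (g \<xi>) \<partial>lborel) = (\<integral>\<xi>. \<integral>x. ?F \<xi> x \<partial>lborel \<partial>lborel)"
    unfolding fourier_integral_def by simp
  also have "\<dots> = (\<integral>x. \<integral>\<xi>. ?F \<xi> x \<partial>lborel \<partial>lborel)"
  proof (rule lborel_pair.Fubini_integral[symmetric])
    show "integrable (lborel \<Otimes>\<^sub>M lborel) (\<lambda>(\<xi>, x). ?F \<xi> x)"
    proof (rule integrable_pair_bound[OF g(1) f(1)])
      show "(\<lambda>(\<xi>, x). ?F \<xi> x) \<in> borel_measurable (lborel \<Otimes>\<^sub>M lborel)" by measurable
    qed (simp add: norm_mult)
  qed
  also have "\<dots> = (\<integral>x. f x * cnj (fourier_integral g (- x)) \<partial>lborel)"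
  proof (intro Bochner_Integration.integral_cong refl)
    fix x
    have "cnj (fourier_integral g (- x)) = (\<integral>\<xi>. exp (- (\<i> * complex_of_real (x * \<xi>))) * cnj (g \<xi>) \<partial>lborel)"
      using fourier_integral_cnj[of g x] by (simp add: fourier_integral_def mult.commute)
    then have "f x * cnj (fourier_integral g (- x)) = (\<integral>\<xi>. f x * (exp (- (\<i> * complex_of_real (x * \<xi>))) * cnj (g \<xi>)) \<partial>lborel)"
      by simp
    also have "\<dots> = (\<integral>\<xi>. ?F \<xi> x \<partial>lborel)" by (simp only: mult.assoc mult.left_commute)
    finally show "(\<integral>\<xi>. ?F \<xi> x \<partial>lborel) = f x * cnj (fourier_integral g (- x))" by simp
  qed
  finally show ?thesis
    using f g by (simp add: inn fourier_integral_norm_le square_integrable_reflect)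
qed

lemma inner_fourier_left: "fourier f \<bullet> g = f \<bullet> reflect (fourier g)"
proof (rule fourier_cong_limit[where f=f])
  show "continuous_on UNIV (\<lambda>f. fourier f \<bullet> g)"
    by (intro continuous_intros linear_continuous_on bounded_linear_fourier)
  show "continuous_on UNIV (\<lambda>f. f \<bullet> reflect (fourier g))" by (intro continuous_intros)
next
  fix f assume f: "integrable lborel f" "square_integrable f"
  show "fourier (to_l2 f) \<bullet> g = to_l2 f \<bullet> reflect (fourier g)"
  proof (rule fourier_cong_limit[where f=g])
    show "continuous_on UNIV (\<lambda>g. fourier (to_l2 f) \<bullet> g)" by (intro continuous_intros)
    show "continuous_on UNIV (\<lambda>g. to_l2 f \<bullet> reflect (fourier g))"
      by (intro continuous_intros linear_continuous_on bounded_linear_compose[OF bounded_linear_reflect bounded_linear_fourier])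
  next
    fix g assume g: "integrable lborel g" "square_integrable g"
    show "fourier (to_l2 f) \<bullet> to_l2 g = to_l2 f \<bullet> reflect (fourier (to_l2 g))"
      using inner_fourier_integral[OF f g] f g by (simp add: fourier_to_l2 reflect_to_l2 fourier_integral_norm_le)
  qed
qed

text \<open>For an interval indicator h, the adjoint formula turns the pairing of the left side with
  h into the pairing of \<open>fourier f\<close> with \<open>fourier h\<close>, and Parseval for
  intervals makes this 2 pi times the pairing of \<open>f\<close> with h. Such h separate the
  elements of L^2.\<close>

lemma fourier_inversion: "reflect (fourier (fourier f)) = (2 * pi) *\<^sub>R f"
proof -
  have *: "fourier f \<bullet> fourier (to_l2 (\<lambda>x. c * indicator {a..b} x)) = 2 * pi * (f \<bullet> to_l2 (\<lambda>x. c * indicator {a..b} x))" for f c a b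
  proof (rule fourier_cong_limit[where f=f])
    show "continuous_on UNIV (\<lambda>f. fourier f \<bullet> fourier (to_l2 (\<lambda>x. c * indicator {a..b} x)))"
      by (intro continuous_intros linear_continuous_on bounded_linear_fourier)
    show "continuous_on UNIV (\<lambda>f. 2 * pi * (f \<bullet> to_l2 (\<lambda>x. c * indicator {a..b} x)))"
      by (intro continuous_intros)
  next
    fix f assume f: "integrable lborel f" "square_integrable f"
    let ?h = "\<lambda>x. c * indicator {a..b} x"
    note h = integrable_interval[of c a b] square_integrable_interval[of c a b]
    have inn: "to_l2 u \<bullet> to_l2 v = Re (\<integral>\<xi>. u \<xi> * cnj (v \<xi>) \<partial>lborel)" if "square_integrable u" "square_integrable v" for u v
      using that by (simp add: inner_to_l2 integral_Re[OF square_integrable_mult_integrable[OF that(1) square_integrable_cnj[OF that(2)]], symmetric] inner_complex_def)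
    have "fourier (to_l2 f) \<bullet> fourier (to_l2 ?h) = Re (\<integral>\<xi>. fourier_integral f \<xi> * cnj (fourier_integral ?h \<xi>) \<partial>lborel)"
      using f h by (simp only: fourier_to_l2 inn fourier_integral_norm_le)
    also have "\<dots> = Re (complex_of_real (2 * pi) * (\<integral>y. f y * cnj (?h y) \<partial>lborel))"
      unfolding fourier_integral_interval_pairing[OF f] by simp
    also have "\<dots> = 2 * pi * (to_l2 f \<bullet> to_l2 ?h)"
      unfolding inn[OF f(2) h(2)] by (simp add: Re_complex_of_real)
    finally show "fourier (to_l2 f) \<bullet> fourier (to_l2 ?h) = 2 * pi * (to_l2 f \<bullet> to_l2 ?h)" .
  qed
  have "reflect (fourier (fourier f)) - (2 * pi) *\<^sub>R f = 0"
  proof (rule l2_zero_of_intervals)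
    fix c a b
    let ?h = "to_l2 (\<lambda>x. c * indicator {a..b} x)"
    have "reflect (fourier (fourier f)) \<bullet> ?h = ?h \<bullet> reflect (fourier (fourier f))" by (rule inner_commute)
    also have "\<dots> = fourier ?h \<bullet> fourier f" by (rule inner_fourier_left[symmetric])
    also have "\<dots> = fourier f \<bullet> fourier ?h" by (rule inner_commute)
    also have "\<dots> = 2 * pi * (f \<bullet> ?h)" by (rule *)
    finally show "(reflect (fourier (fourier f)) - (2 * pi) *\<^sub>R f) \<bullet> ?h = 0"
      by (simp add: inner_diff_left)
  qed
  then show ?thesis by simp
qed

definition inv_fourier :: "l2 \<Rightarrow> l2" where "inv_fourier f = (1 / (2 * pi)) *\<^sub>R reflect (fourier f)"

lemma inv_fourier_fourier [simp]: "inv_fourier (fourier f) = f"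
  by (simp add: inv_fourier_def fourier_inversion)

lemma fourier_inv_fourier [simp]: "fourier (inv_fourier f) = f"
  by (simp add: inv_fourier_def fourier_scaleR fourier_reflect fourier_inversion)

text \<open>\<open>fourier_multiplier\<close> uses \<open>inv\<close>, a choice of preimages; it is
  pinned down once an explicit two-sided inverse is known.\<close>

lemma inv_fourier_eq: "inv fourier = inv_fourier"
  by (rule inv_equality) auto

lemma inner_fourier: "fourier f \<bullet> fourier g = 2 * pi * (f \<bullet> g)"
  by (simp add: inner_fourier_left fourier_inversion)

lemma bounded_linear_inv_fourier: "bounded_linear inv_fourier"
  unfolding inv_fourier_def
  by (intro bounded_linear_const_scaleR bounded_linear_compose[OF bounded_linear_reflect bounded_linear_fourier])

lemma fourier_multiplier_eq: "fourier (fourier_multiplier m f) = multiply m (fourier f)"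
  by (simp add: fourier_multiplier_def inv_fourier_eq)

section \<open>Multiplication operators\<close>

lemma rep_l2_multiply:
  assumes "square_integrable (\<lambda>x. m x * rep_l2 f x)"
  shows "AE x in lborel. rep_l2 (multiply m f) x = m x * rep_l2 f x"
  unfolding multiply_def by (rule rep_l2_to_l2[OF assms])

lemma square_integrable_mult_bounded:
  assumes "square_integrable f" "m \<in> borel_measurable borel" "\<And>x. cmod (m x) \<le> K"
  shows "square_integrable (\<lambda>x. m x * f x)"
proof (rule square_integrable_bound[OF assms(1)])
  have [measurable]: "f \<in> borel_measurable borel" using assms by (auto simp: square_integrable_def)
  show "(\<lambda>x. m x * f x) \<in> borel_measurable borel" using assms(2) by measurable
  show "cmod (m x * f x) \<le> K * cmod (f x)" for x
    using assms(3) by (auto simp: norm_mult intro!: mult_right_mono)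
qed

text \<open>\<open>m\<close> may be unbounded, as for the symbol of \<open>deriv_x\<close>: if the
  product is not square integrable, both sides are the default value 0.\<close>

lemma multiply_to_l2:
  assumes "square_integrable f" "m \<in> borel_measurable borel"
  shows "multiply m (to_l2 f) = to_l2 (\<lambda>x. m x * f x)"
proof -
  have [measurable]: "f \<in> borel_measurable borel" "m \<in> borel_measurable borel"
    using assms by (auto simp: square_integrable_def)
  show ?thesis unfolding multiply_def
  proof (rule to_l2_cong_AE)
    show "AE x in lborel. m x * rep_l2 (to_l2 f) x = m x * f x"
      using rep_l2_to_l2[OF assms(1)] by eventually_elim simp
  qed measurable
qed

lemma multiply_multiply:
  assumes "square_integrable (\<lambda>x. n x * rep_l2 f x)" "m \<in> borel_measurable borel"
  shows "multiply m (multiply n f) = multiply (\<lambda>x. m x * n x) f"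
proof -
  have "multiply m (multiply n f) = to_l2 (\<lambda>x. m x * (n x * rep_l2 f x))"
    unfolding multiply_def[of n] by (rule multiply_to_l2[OF assms])
  then show ?thesis by (simp add: multiply_def mult.assoc)
qed

lemma bounded_linear_multiply:
  assumes "m \<in> borel_measurable borel" "\<And>x. cmod (m x) \<le> K"
  shows "bounded_linear (multiply m)" "norm (multiply m f) \<le> K * norm f"
proof -
  have K: "0 \<le> K" using assms(2) norm_ge_zero order_trans by blast
  have si: "square_integrable (\<lambda>x. m x * rep_l2 f x)" for f
    by (rule square_integrable_mult_bounded[OF square_integrable_rep_l2 assms])
  show nb: "norm (multiply m f) \<le> K * norm f" for f
  proof -
    have "norm (multiply m f) \<le> K * norm (to_l2 (rep_l2 f))" unfolding multiply_def
      by (rule norm_to_l2_bound[OF square_integrable_rep_l2 si _ K])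
         (use assms(2) in \<open>auto simp: norm_mult intro!: mult_right_mono\<close>)
    then show ?thesis by simp
  qed
  show "bounded_linear (multiply m)"
  proof (rule bounded_linear_intro[where K=K])
    fix f g and r :: real
    have "multiply m (f + g) = multiply m (to_l2 (\<lambda>x. rep_l2 f x + rep_l2 g x))"
      by (simp add: to_l2_add square_integrable_rep_l2)
    also have "\<dots> = to_l2 (\<lambda>x. m x * rep_l2 f x + m x * rep_l2 g x)"
      by (subst multiply_to_l2[OF _ assms(1)]) (auto simp: square_integrable_add square_integrable_rep_l2 distrib_left)
    finally show "multiply m (f + g) = multiply m f + multiply m g"
      by (simp add: to_l2_add si multiply_def)
    have "multiply m (r *\<^sub>R f) = multiply m (to_l2 (\<lambda>x. r *\<^sub>R rep_l2 f x))"
      by (simp add: to_l2_scaleR square_integrable_rep_l2)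
    also have "\<dots> = to_l2 (\<lambda>x. r *\<^sub>R (m x * rep_l2 f x))"
      by (subst multiply_to_l2[OF _ assms(1)]) (auto simp: square_integrable_scaleR square_integrable_rep_l2)
    finally show "multiply m (r *\<^sub>R f) = r *\<^sub>R multiply m f"
      by (simp only: to_l2_scaleR si multiply_def)
  qed (use nb in \<open>simp add: mult.commute\<close>)
qed

lemma inner_multiply_real:
  assumes "m \<in> borel_measurable borel" "\<And>x. \<bar>m x\<bar> \<le> K"
  shows "multiply (\<lambda>x. complex_of_real (m x)) f \<bullet> g = f \<bullet> multiply (\<lambda>x. complex_of_real (m x)) g"
proof -
  have si: "square_integrable (\<lambda>x. complex_of_real (m x) * rep_l2 f x)" for f
    by (rule square_integrable_mult_bounded[OF square_integrable_rep_l2, where K=K]) (use assms in auto)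
  have "multiply (\<lambda>x. complex_of_real (m x)) f \<bullet> to_l2 (rep_l2 g) = (\<integral>x. (m x * rep_l2 f x) \<bullet> rep_l2 g x \<partial>lborel)"
    unfolding multiply_def by (rule inner_to_l2[OF si square_integrable_rep_l2])
  also have "\<dots> = (\<integral>x. rep_l2 f x \<bullet> (m x * rep_l2 g x) \<partial>lborel)"
    by (intro Bochner_Integration.integral_cong) (auto simp: inner_complex_def algebra_simps)
  also have "\<dots> = to_l2 (rep_l2 f) \<bullet> multiply (\<lambda>x. complex_of_real (m x)) g"
    unfolding multiply_def by (rule inner_to_l2[OF square_integrable_rep_l2 si, symmetric])
  finally show ?thesis by simp
qed

section \<open>Bilinear operators with a kernel\<close>

text \<open>The bracket \<open>\<langle>x\<rangle>\<close> of the paper.\<close>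

definition jb :: "real \<Rightarrow> real" where "jb x = sqrt (1 + x\<^sup>2)"

lemma jb_measurable [measurable]: "jb \<in> borel_measurable borel"
  unfolding jb_def by measurable

lemma jb_ge_1: "1 \<le> jb x" by (simp add: jb_def)
lemma jb_pos [simp]: "0 < jb x" using jb_ge_1[of x] by linarith
lemma jb_nonneg [simp]: "0 \<le> jb x" using jb_pos[of x] by linarith
lemma jb_neq_0 [simp]: "jb x \<noteq> 0" using jb_pos[of x] by linarith
lemma jb_sq: "(jb x)\<^sup>2 = 1 + x\<^sup>2" by (simp add: jb_def add_nonneg_nonneg)
lemma jb_uminus [simp]: "jb (- x) = jb x" by (simp add: jb_def)
lemma abs_le_jb: "\<bar>x\<bar> \<le> jb x" unfolding jb_def by (rule real_le_rsqrt) simp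

text \<open>The function 1/(1 + x^2) on the half-line is added to its reflection; the point 0 is
  counted twice, which is harmless in a majorant.\<close>

lemma square_integrable_inverse_jb: "square_integrable (\<lambda>x. complex_of_real (1 / jb x))"
proof -
  have i: "set_integrable lborel {0..} (\<lambda>x::real. 1 / (1 + x\<^sup>2))"
    using integrable_I0i_1_div_plus_square
    by (simp add: interval_lebesgue_integrable_def einterval_def set_integrable_def
      zero_ereal_def[symmetric] ) (rule integrable_cong_AE_imp, assumption, measurable,
       use AE_lborel_singleton[of "0::real"] in eventually_elim, auto simp: indicator_def inverse_eq_divide)
  then have "integrable lborel (\<lambda>x::real. indicator {0..} x * (1 / (1 + x\<^sup>2)))"
    by (simp add: set_integrable_def)
  from Bochner_Integration.integrable_add[OF this lborel_integrable_real_affine[OF this, of "-1" 0]]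
  have "integrable lborel (\<lambda>x::real. indicator {0..} x * (1 / (1 + x\<^sup>2)) + indicator {0..} (- x) * (1 / (1 + x\<^sup>2)))"
    by simp
  then have "integrable lborel (\<lambda>x::real. 1 / (1 + x\<^sup>2))"
    by (rule Bochner_Integration.integrable_bound) (auto simp: indicator_def)
  then show ?thesis
    by (simp add: square_integrable_def power_divide jb_sq norm_divide)
qed

text \<open>Numerically sqrt(pi); what matters is that it is finite and does not involve
  \<sigma>.\<close>

definition jb_const :: real where "jb_const = norm (to_l2 (\<lambda>x. complex_of_real (1 / jb x)))"

lemma jb_const_nonneg: "0 \<le> jb_const" by (simp add: jb_const_def)

lemma nn_integral_jb: "(\<integral>\<^sup>+x. ennreal ((1 / jb x)\<^sup>2) \<partial>lborel) = ennreal (jb_const\<^sup>2)"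
  unfolding jb_const_def nn_norm_to_l2[OF square_integrable_inverse_jb, symmetric]
  by (intro nn_integral_cong) (simp add: norm_divide)

lemma nn_integral_translate_reflect:
  assumes [measurable]: "f \<in> borel_measurable borel"
  shows "(\<integral>\<^sup>+y. f (x - y :: real) \<partial>lborel) = (\<integral>\<^sup>+y. f y \<partial>lborel)"
  using nn_integral_real_affine[OF assms, of "-1" x] by simp

lemma nn_integral_translate:
  assumes [measurable]: "f \<in> borel_measurable borel"
  shows "(\<integral>\<^sup>+x. f (x - y :: real) \<partial>lborel) = (\<integral>\<^sup>+x. f x \<partial>lborel)"
  using nn_integral_real_affine[OF assms, of 1 "-y"] by simp

text \<open>Cauchy-Schwarz in \<open>y\<close> splits off 1/<y>, whose square is integrable. What
  remains is the convolution of |f|^2 and |g|^2, integrated by Tonelli and translation invariance.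
  This plays the role of the algebra property of Sobolev spaces.\<close>

lemma nn_kernel_bound:
  assumes f: "square_integrable f" and g: "square_integrable g"
  shows "(\<integral>\<^sup>+x. (\<integral>\<^sup>+y. ennreal (1 / jb y) * (ennreal (cmod (f y)) * ennreal (cmod (g (x - y)))) \<partial>lborel)\<^sup>2 \<partial>lborel)
    \<le> ennreal ((jb_const * norm (to_l2 f) * norm (to_l2 g))\<^sup>2)"
proof -
  have [measurable]: "f \<in> borel_measurable borel" "g \<in> borel_measurable borel"
    using assms by (auto simp: square_integrable_def)
  have "(\<integral>\<^sup>+x. (\<integral>\<^sup>+y. ennreal (1 / jb y) * (ennreal (cmod (f y)) * ennreal (cmod (g (x - y)))) \<partial>lborel)\<^sup>2 \<partial>lborel)
    \<le> (\<integral>\<^sup>+x. ennreal (jb_const\<^sup>2) * (\<integral>\<^sup>+y. ennreal ((cmod (f y))\<^sup>2) * ennreal ((cmod (g (x - y)))\<^sup>2) \<partial>lborel) \<partial>lborel)"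
  proof (rule nn_integral_mono)
    fix x
    have "(\<integral>\<^sup>+y. ennreal (1 / jb y) * (ennreal (cmod (f y)) * ennreal (cmod (g (x - y)))) \<partial>lborel)\<^sup>2
      \<le> (\<integral>\<^sup>+y. (ennreal (1 / jb y))\<^sup>2 \<partial>lborel) * (\<integral>\<^sup>+y. (ennreal (cmod (f y)) * ennreal (cmod (g (x - y))))\<^sup>2 \<partial>lborel)"
      by (rule Cauchy_Schwarz_nn_integral) auto
    also have "(\<integral>\<^sup>+y. (ennreal (1 / jb y))\<^sup>2 \<partial>lborel) = ennreal (jb_const\<^sup>2)"
      unfolding nn_integral_jb[symmetric] by (intro nn_integral_cong) (simp add: ennreal_power)
    finally show "(\<integral>\<^sup>+y. ennreal (1 / jb y) * (ennreal (cmod (f y)) * ennreal (cmod (g (x - y)))) \<partial>lborel)\<^sup>2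
      \<le> ennreal (jb_const\<^sup>2) * (\<integral>\<^sup>+y. ennreal ((cmod (f y))\<^sup>2) * ennreal ((cmod (g (x - y)))\<^sup>2) \<partial>lborel)"
      by (simp add: power_mult_distrib ennreal_power)
  qed
  also have "\<dots> = ennreal (jb_const\<^sup>2) * (\<integral>\<^sup>+x. \<integral>\<^sup>+y. ennreal ((cmod (f y))\<^sup>2) * ennreal ((cmod (g (x - y)))\<^sup>2) \<partial>lborel \<partial>lborel)"
    by (rule nn_integral_cmult) measurable
  also have "(\<integral>\<^sup>+x. \<integral>\<^sup>+y. ennreal ((cmod (f y))\<^sup>2) * ennreal ((cmod (g (x - y)))\<^sup>2) \<partial>lborel \<partial>lborel)
    = (\<integral>\<^sup>+y. \<integral>\<^sup>+x. ennreal ((cmod (f y))\<^sup>2) * ennreal ((cmod (g (x - y)))\<^sup>2) \<partial>lborel \<partial>lborel)"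
    by (rule lborel_pair.Fubini') measurable
  also have "\<dots> = (\<integral>\<^sup>+y. ennreal ((cmod (f y))\<^sup>2) * ennreal ((norm (to_l2 g))\<^sup>2) \<partial>lborel)"
  proof (intro nn_integral_cong)
    fix y
    have "(\<integral>\<^sup>+x. ennreal ((cmod (f y))\<^sup>2) * ennreal ((cmod (g (x - y)))\<^sup>2) \<partial>lborel)
      = ennreal ((cmod (f y))\<^sup>2) * (\<integral>\<^sup>+x. ennreal ((cmod (g (x - y)))\<^sup>2) \<partial>lborel)"
      by (rule nn_integral_cmult) measurable
    also have "(\<integral>\<^sup>+x. ennreal ((cmod (g (x - y)))\<^sup>2) \<partial>lborel) = ennreal ((norm (to_l2 g))\<^sup>2)"
      using nn_integral_translate[of "\<lambda>x. ennreal ((cmod (g x))\<^sup>2)" y] nn_norm_to_l2[OF g] by simp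
    finally show "(\<integral>\<^sup>+x. ennreal ((cmod (f y))\<^sup>2) * ennreal ((cmod (g (x - y)))\<^sup>2) \<partial>lborel)
      = ennreal ((cmod (f y))\<^sup>2) * ennreal ((norm (to_l2 g))\<^sup>2)" .
  qed
  also have "\<dots> = ennreal ((norm (to_l2 f))\<^sup>2) * ennreal ((norm (to_l2 g))\<^sup>2)"
    using nn_norm_to_l2[OF f] by (subst nn_integral_multc) auto
  finally show ?thesis
    by (simp add: ennreal_mult[symmetric] power_mult_distrib mult.assoc)
qed

text \<open>A bilinear Fourier multiplier seen in frequency: \<open>y\<close> and
  \<open>x - y\<close> are the frequencies of the factors, \<open>x\<close> is that of the
  product.\<close>

definition kernel_int :: "(real \<Rightarrow> real \<Rightarrow> real) \<Rightarrow> (real \<Rightarrow> complex) \<Rightarrow> (real \<Rightarrow> complex) \<Rightarrow> real \<Rightarrow> complex" where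
  "kernel_int k f g x = (\<integral>y. complex_of_real (k x y) * (f y * g (x - y)) \<partial>lborel)"

definition kernel_bound :: "(real \<Rightarrow> real \<Rightarrow> real) \<Rightarrow> real \<Rightarrow> bool" where
  "kernel_bound k K \<longleftrightarrow> 0 \<le> K \<and> (\<lambda>(x, y). k x y) \<in> borel_measurable (borel \<Otimes>\<^sub>M borel) \<and> (\<forall>x y. \<bar>k x y\<bar> \<le> K / jb y)"

lemma kernel_boundD:
  assumes "kernel_bound k K"
  shows "0 \<le> K" "(\<lambda>(x, y). k x y) \<in> borel_measurable (borel \<Otimes>\<^sub>M borel)" "\<bar>k x y\<bar> \<le> K / jb y" "\<bar>k x y\<bar> \<le> K"
    "k x \<in> borel_measurable borel"
proof -
  show K: "0 \<le> K" and [measurable]: "(\<lambda>(x, y). k x y) \<in> borel_measurable (borel \<Otimes>\<^sub>M borel)" and *: "\<bar>k x y\<bar> \<le> K / jb y"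
    using assms by (auto simp: kernel_bound_def)
  have "K / jb y \<le> K / 1" using K jb_ge_1[of y] by (intro divide_left_mono) auto
  with * show "\<bar>k x y\<bar> \<le> K" by simp
  show "k x \<in> borel_measurable borel"
    by (rule measurable_compose_Pair1[of x borel "\<lambda>(x,y). k x y", simplified]) simp_all
qed

lemma square_integrable_translate_reflect:
  assumes "square_integrable g" shows "square_integrable (\<lambda>y. g (x - y))"
proof -
  have [measurable]: "g \<in> borel_measurable borel" using assms by (auto simp: square_integrable_def)
  show ?thesis using assms nn_integral_translate_reflect[of "\<lambda>y. ennreal ((cmod (g y))\<^sup>2)" x]
    by (simp add: square_integrable_iff_nn)
qed

lemma kernel_int_integrable:
  assumes "kernel_bound k K" "square_integrable f" "square_integrable g"
  shows "integrable lborel (\<lambda>y. complex_of_real (k x y) * (f y * g (x - y)))"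
proof -
  note [measurable] = kernel_boundD(5)[OF assms(1)]
  have [measurable]: "f \<in> borel_measurable borel" "g \<in> borel_measurable borel"
    using assms by (auto simp: square_integrable_def)
  have "integrable lborel (\<lambda>y. complex_of_real K * (f y * g (x - y)))"
    by (intro integrable_mult_right square_integrable_mult_integrable square_integrable_translate_reflect assms)
  then show ?thesis
    by (rule Bochner_Integration.integrable_bound)
       (use kernel_boundD(1,4)[OF assms(1)] in \<open>auto simp: norm_mult intro!: mult_right_mono\<close>)
qed

lemma kernel_int_measurable:
  assumes [measurable]: "(\<lambda>(x, y). k x y) \<in> borel_measurable (borel \<Otimes>\<^sub>M borel)" "f \<in> borel_measurable borel" "g \<in> borel_measurable borel"
  shows "kernel_int k f g \<in> borel_measurable borel"
proof -
  have "(\<lambda>x. \<integral>y. (\<lambda>(x, y). complex_of_real ((\<lambda>(x, y). k x y) (x, y)) * (f y * g (x - y))) (x, y) \<partial>lborel) \<in> borel_measurable borel"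
    by measurable
  then show ?thesis by (simp add: kernel_int_def[abs_def])
qed

lemma norm_kernel_int_le:
  assumes k: "kernel_bound k K"
    and [measurable]: "f \<in> borel_measurable borel" "g \<in> borel_measurable borel"
  shows "ennreal (cmod (kernel_int k f g x)) \<le>
    ennreal K * (\<integral>\<^sup>+y. ennreal (1 / jb y) * (ennreal (cmod (f y)) * ennreal (cmod (g (x - y)))) \<partial>lborel)"
proof -
  have "ennreal (cmod (kernel_int k f g x)) \<le> (\<integral>\<^sup>+y. ennreal (cmod (complex_of_real (k x y) * (f y * g (x - y)))) \<partial>lborel)"
    unfolding kernel_int_def by (rule norm_integral_le_nn_integral)
  also have "\<dots> \<le> (\<integral>\<^sup>+y. ennreal K * (ennreal (1 / jb y) * (ennreal (cmod (f y)) * ennreal (cmod (g (x - y))))) \<partial>lborel)"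
  proof (rule nn_integral_mono)
    fix y
    have "\<bar>k x y\<bar> * (cmod (f y) * cmod (g (x - y))) \<le> (K * (1 / jb y)) * (cmod (f y) * cmod (g (x - y)))"
      using kernel_boundD(3)[OF k, of x y] by (intro mult_right_mono) auto
    then show "ennreal (cmod (complex_of_real (k x y) * (f y * g (x - y)))) \<le>
      ennreal K * (ennreal (1 / jb y) * (ennreal (cmod (f y)) * ennreal (cmod (g (x - y)))))"
      using kernel_boundD(1)[OF k] by (simp add: norm_mult ennreal_mult[symmetric] mult.assoc)
  qed
  also have "\<dots> = ennreal K * (\<integral>\<^sup>+y. ennreal (1 / jb y) * (ennreal (cmod (f y)) * ennreal (cmod (g (x - y)))) \<partial>lborel)"
    by (rule nn_integral_cmult) measurable
  finally show ?thesis .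
qed

lemma kernel_int_bound:
  assumes k: "kernel_bound k K" and f: "square_integrable f" and g: "square_integrable g"
  shows "square_integrable (kernel_int k f g)"
    "norm (to_l2 (kernel_int k f g)) \<le> K * jb_const * norm (to_l2 f) * norm (to_l2 g)"
proof -
  have [measurable]: "f \<in> borel_measurable borel" "g \<in> borel_measurable borel"
    using assms by (auto simp: square_integrable_def)
  note K = kernel_boundD(1)[OF k]
  have m: "kernel_int k f g \<in> borel_measurable borel"
    by (intro kernel_int_measurable kernel_boundD(2)[OF k]) measurable
  have "(\<integral>\<^sup>+x. ennreal ((cmod (kernel_int k f g x))\<^sup>2) \<partial>lborel)
    \<le> (\<integral>\<^sup>+x. ennreal (K\<^sup>2) * (\<integral>\<^sup>+y. ennreal (1 / jb y) * (ennreal (cmod (f y)) * ennreal (cmod (g (x - y)))) \<partial>lborel)\<^sup>2 \<partial>lborel)"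
  proof (rule nn_integral_mono)
    fix x
    have "(ennreal (cmod (kernel_int k f g x)))\<^sup>2 \<le>
      (ennreal K * (\<integral>\<^sup>+y. ennreal (1 / jb y) * (ennreal (cmod (f y)) * ennreal (cmod (g (x - y)))) \<partial>lborel))\<^sup>2"
      by (intro power_mono norm_kernel_int_le[OF k]) auto
    then show "ennreal ((cmod (kernel_int k f g x))\<^sup>2) \<le>
      ennreal (K\<^sup>2) * (\<integral>\<^sup>+y. ennreal (1 / jb y) * (ennreal (cmod (f y)) * ennreal (cmod (g (x - y)))) \<partial>lborel)\<^sup>2"
      using K by (simp add: ennreal_power power_mult_distrib)
  qed
  also have "\<dots> = ennreal (K\<^sup>2) * (\<integral>\<^sup>+x. (\<integral>\<^sup>+y. ennreal (1 / jb y) * (ennreal (cmod (f y)) * ennreal (cmod (g (x - y)))) \<partial>lborel)\<^sup>2 \<partial>lborel)"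
    by (rule nn_integral_cmult) measurable
  also have "\<dots> \<le> ennreal (K\<^sup>2) * ennreal ((jb_const * norm (to_l2 f) * norm (to_l2 g))\<^sup>2)"
    by (intro mult_left_mono nn_kernel_bound f g) auto
  also have "\<dots> = ennreal ((K * jb_const * norm (to_l2 f) * norm (to_l2 g))\<^sup>2)"
    by (simp add: ennreal_mult[symmetric] power_mult_distrib mult.assoc)
  finally have *: "(\<integral>\<^sup>+x. ennreal ((cmod (kernel_int k f g x))\<^sup>2) \<partial>lborel) \<le> ennreal ((K * jb_const * norm (to_l2 f) * norm (to_l2 g))\<^sup>2)" .
  show "square_integrable (kernel_int k f g)" by (rule norm_to_l2_le_nn(1)[OF m *]) (simp add: K jb_const_nonneg)
  show "norm (to_l2 (kernel_int k f g)) \<le> K * jb_const * norm (to_l2 f) * norm (to_l2 g)"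
    by (rule norm_to_l2_le_nn(2)[OF m *]) (simp add: K jb_const_nonneg)
qed

lemma AE_translate_reflect:
  fixes P :: "real \<Rightarrow> bool"
  assumes "AE x in lborel. P x" and P: "Measurable.pred borel P"
  shows "AE y in lborel. P (x - y)"
proof -
  have d: "distr lborel borel (\<lambda>y. x - y) = lborel"
    using lborel_real_affine[of "-1" x] by (simp add: density_1 one_ennreal_def[symmetric] cong: distr_cong)
  have "AE x in distr lborel borel (\<lambda>y. x - y). P x" using assms(1) unfolding d .
  moreover have "{x \<in> space borel. P x} \<in> sets borel" using P by measurable
  ultimately show ?thesis using AE_distr_iff[of "\<lambda>y. x - y" lborel borel P] by simp
qed

lemma kernel_int_cong:
  assumes "k x \<in> borel_measurable borel" "f \<in> borel_measurable borel" "f' \<in> borel_measurable borel"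
    "g \<in> borel_measurable borel" "g' \<in> borel_measurable borel"
    "AE y in lborel. f y = f' y" "AE y in lborel. g y = g' y"
  shows "kernel_int k f g x = kernel_int k f' g' x"
proof -
  note [measurable] = assms(1-5)
  have "AE y in lborel. g (x - y) = g' (x - y)"
    by (rule AE_translate_reflect[OF assms(7)]) measurable
  with assms(6) show ?thesis unfolding kernel_int_def
    by (intro integral_cong_AE) (auto elim!: eventually_elim2)
qed

definition kernel_op :: "(real \<Rightarrow> real \<Rightarrow> real) \<Rightarrow> l2 \<Rightarrow> l2 \<Rightarrow> l2" where
  "kernel_op k f g = to_l2 (kernel_int k (rep_l2 f) (rep_l2 g))"

lemma kernel_op_to_l2:
  assumes k: "kernel_bound k K" and f: "square_integrable f" and g: "square_integrable g"
  shows "kernel_op k (to_l2 f) (to_l2 g) = to_l2 (kernel_int k f g)"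
proof -
  have [measurable]: "f \<in> borel_measurable borel" "g \<in> borel_measurable borel"
    using assms by (auto simp: square_integrable_def)
  have "kernel_int k (rep_l2 (to_l2 f)) (rep_l2 (to_l2 g)) = kernel_int k f g"
    by (intro ext kernel_int_cong kernel_boundD(5)[OF k] rep_l2_to_l2 f g) measurable
  then show ?thesis by (simp add: kernel_op_def)
qed

lemma norm_kernel_op:
  assumes "kernel_bound k K"
  shows "norm (kernel_op k f g) \<le> K * jb_const * norm f * norm g"
  using kernel_int_bound(2)[OF assms square_integrable_rep_l2 square_integrable_rep_l2, of f g]
  by (simp add: kernel_op_def)

lemma bounded_bilinear_kernel_op:
  assumes k: "kernel_bound k K"
  shows "bounded_bilinear (kernel_op k)"
proof
  fix f g h :: l2 and r :: real
  note si = square_integrable_rep_l2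
  note i = kernel_int_integrable[OF k si si] and b = kernel_int_bound(1)[OF k si si]
  have "kernel_op k (to_l2 (\<lambda>x. rep_l2 f x + rep_l2 g x)) (to_l2 (rep_l2 h)) = to_l2 (kernel_int k (\<lambda>x. rep_l2 f x + rep_l2 g x) (rep_l2 h))"
    by (intro kernel_op_to_l2[OF k] square_integrable_add si)
  also have "kernel_int k (\<lambda>x. rep_l2 f x + rep_l2 g x) (rep_l2 h) = (\<lambda>x. kernel_int k (rep_l2 f) (rep_l2 h) x + kernel_int k (rep_l2 g) (rep_l2 h) x)"
    unfolding kernel_int_def fun_eq_iff by (simp add: distrib_left distrib_right Bochner_Integration.integral_add[OF i i])
  finally show "kernel_op k (f + g) h = kernel_op k f h + kernel_op k g h"
    by (simp add: to_l2_add si b kernel_op_def)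
  have "kernel_op k (to_l2 (rep_l2 h)) (to_l2 (\<lambda>x. rep_l2 f x + rep_l2 g x)) = to_l2 (kernel_int k (rep_l2 h) (\<lambda>x. rep_l2 f x + rep_l2 g x))"
    by (intro kernel_op_to_l2[OF k] square_integrable_add si)
  also have "kernel_int k (rep_l2 h) (\<lambda>x. rep_l2 f x + rep_l2 g x) = (\<lambda>x. kernel_int k (rep_l2 h) (rep_l2 f) x + kernel_int k (rep_l2 h) (rep_l2 g) x)"
    unfolding kernel_int_def fun_eq_iff by (simp add: distrib_left distrib_right Bochner_Integration.integral_add[OF i i])
  finally show "kernel_op k h (f + g) = kernel_op k h f + kernel_op k h g"
    by (simp add: to_l2_add si b kernel_op_def)
  have s: "kernel_int k (\<lambda>x. r *\<^sub>R rep_l2 f x) (rep_l2 g) = (\<lambda>x. r *\<^sub>R kernel_int k (rep_l2 f) (rep_l2 g) x)"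
    "kernel_int k (rep_l2 f) (\<lambda>x. r *\<^sub>R rep_l2 g x) = (\<lambda>x. r *\<^sub>R kernel_int k (rep_l2 f) (rep_l2 g) x)"
    unfolding kernel_int_def fun_eq_iff by (simp_all flip: integral_scaleR_right)
  have "kernel_op k (to_l2 (\<lambda>x. r *\<^sub>R rep_l2 f x)) (to_l2 (rep_l2 g)) = to_l2 (kernel_int k (\<lambda>x. r *\<^sub>R rep_l2 f x) (rep_l2 g))"
    by (intro kernel_op_to_l2[OF k] square_integrable_scaleR si)
  then show "kernel_op k (r *\<^sub>R f) g = r *\<^sub>R kernel_op k f g"
    unfolding s to_l2_scaleR[OF si] to_l2_scaleR[OF b] to_l2_rep_l2 by (simp add: kernel_op_def)
  have "kernel_op k (to_l2 (rep_l2 f)) (to_l2 (\<lambda>x. r *\<^sub>R rep_l2 g x)) = to_l2 (kernel_int k (rep_l2 f) (\<lambda>x. r *\<^sub>R rep_l2 g x))"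
    by (intro kernel_op_to_l2[OF k] square_integrable_scaleR si)
  then show "kernel_op k f (r *\<^sub>R g) = r *\<^sub>R kernel_op k f g"
    unfolding s to_l2_scaleR[OF si] to_l2_scaleR[OF b] to_l2_rep_l2 by (simp add: kernel_op_def)
  show "\<exists>C. \<forall>f g. norm (kernel_op k f g) \<le> norm f * norm g * C"
    using norm_kernel_op[OF k] by (intro exI[of _ "K * jb_const"]) (simp add: mult_ac)
qed

section \<open>Products and convolutions\<close>

lemma conv_pair_integrable:
  fixes a b :: "real \<Rightarrow> complex"
  assumes a: "integrable lborel a" and b: "integrable lborel b"
  shows "integrable (lborel \<Otimes>\<^sub>M lborel) (\<lambda>(x, y). a y * b (x - y))"
proof -
  have [measurable]: "a \<in> borel_measurable borel" "b \<in> borel_measurable borel" using a b by auto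
  have m: "(\<lambda>(x, y). a y * b (x - y)) \<in> borel_measurable (lborel \<Otimes>\<^sub>M lborel)" by measurable
  have "(\<integral>\<^sup>+p. ennreal (norm ((\<lambda>(x, y). a y * b (x - y)) p)) \<partial>(lborel \<Otimes>\<^sub>M lborel))
    = (\<integral>\<^sup>+x. \<integral>\<^sup>+y. ennreal (cmod (a y)) * ennreal (cmod (b (x - y))) \<partial>lborel \<partial>lborel)"
    by (subst lborel.nn_integral_fst[symmetric]) (auto simp: norm_mult ennreal_mult)
  also have "\<dots> = (\<integral>\<^sup>+y. \<integral>\<^sup>+x. ennreal (cmod (a y)) * ennreal (cmod (b (x - y))) \<partial>lborel \<partial>lborel)"
    by (rule lborel_pair.Fubini') measurable
  also have "\<dots> = (\<integral>\<^sup>+y. ennreal (cmod (a y)) * (\<integral>\<^sup>+x. ennreal (cmod (b x)) \<partial>lborel) \<partial>lborel)"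
  proof (intro nn_integral_cong)
    fix y
    show "(\<integral>\<^sup>+x. ennreal (cmod (a y)) * ennreal (cmod (b (x - y))) \<partial>lborel) = ennreal (cmod (a y)) * (\<integral>\<^sup>+x. ennreal (cmod (b x)) \<partial>lborel)"
      using nn_integral_translate[of "\<lambda>x. ennreal (cmod (b x))" y] by (subst nn_integral_cmult) auto
  qed
  also have "\<dots> = (\<integral>\<^sup>+y. ennreal (cmod (a y)) \<partial>lborel) * (\<integral>\<^sup>+x. ennreal (cmod (b x)) \<partial>lborel)"
    by (rule nn_integral_multc) measurable
  also have "\<dots> < \<infinity>"
    using a b unfolding integrable_iff_bounded by (auto simp: ennreal_mult_less_top)
  finally show ?thesis using m by (simp add: integrable_iff_bounded)
qed

text \<open>The kernel 1 has no decay, so \<open>kernel_bound\<close> does not cover it. Integrable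
  factors are used instead; square integrability is later obtained by moving weights from the
  factors into the kernel.\<close>

abbreviation conv :: "(real \<Rightarrow> complex) \<Rightarrow> (real \<Rightarrow> complex) \<Rightarrow> real \<Rightarrow> complex" where
  "conv \<equiv> kernel_int (\<lambda>_ _. 1)"

lemma integrable_conv:
  assumes "integrable lborel a" "integrable lborel b"
  shows "integrable lborel (conv a b)"
  using lborel_pair.integrable_fst'[OF conv_pair_integrable[OF assms]] by (simp add: kernel_int_def[abs_def])

lemma fourier_integral_conv:
  assumes a: "integrable lborel a" and b: "integrable lborel b"
  shows "fourier_integral (conv a b) \<xi> = fourier_integral a \<xi> * fourier_integral b \<xi>"
proof -
  have [measurable]: "a \<in> borel_measurable borel" "b \<in> borel_measurable borel" using a b by auto
  let ?e = "\<lambda>x. exp (- (\<i> * complex_of_real (x * \<xi>)))"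
  have "fourier_integral (conv a b) \<xi> = (\<integral>x. \<integral>y. ?e x * (a y * b (x - y)) \<partial>lborel \<partial>lborel)"
    unfolding fourier_integral_def kernel_int_def by simp
  also have "\<dots> = (\<integral>y. \<integral>x. ?e x * (a y * b (x - y)) \<partial>lborel \<partial>lborel)"
  proof (rule lborel_pair.Fubini_integral[symmetric])
    have "(\<lambda>(x, y). ?e x * (a y * b (x - y))) \<in> borel_measurable (lborel \<Otimes>\<^sub>M lborel)" by measurable
    then show "integrable (lborel \<Otimes>\<^sub>M lborel) (\<lambda>(x, y). ?e x * (a y * b (x - y)))"
      by (rule Bochner_Integration.integrable_bound[OF conv_pair_integrable[OF a b]]) (auto simp: norm_mult)
  qed
  also have "\<dots> = (\<integral>y. ?e y * a y * fourier_integral b \<xi> \<partial>lborel)"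
  proof (intro Bochner_Integration.integral_cong refl)
    fix y
    have "(\<integral>x. ?e x * (a y * b (x - y)) \<partial>lborel) = \<bar>1\<bar> *\<^sub>R (\<integral>x. ?e (y + 1 * x) * (a y * b (y + 1 * x - y)) \<partial>lborel)"
      by (rule lborel_integral_real_affine) simp
    also have "\<dots> = (\<integral>x. (?e y * a y) * (?e x * b x) \<partial>lborel)"
    proof -
      have "?e (y + 1 * x) = ?e y * ?e x" for x
        unfolding exp_add[symmetric] by (simp add: algebra_simps)
      then have "?e (y + 1 * x) * (a y * b (y + 1 * x - y)) = (?e y * a y) * (?e x * b x)" for x
        by (simp only: mult_ac) (simp add: mult_ac)
      then show ?thesis by (simp only: abs_one scaleR_one)
    qed
    also have "\<dots> = ?e y * a y * fourier_integral b \<xi>"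
      unfolding fourier_integral_def by (rule integral_mult_right_zero)
    finally show "(\<integral>x. ?e x * (a y * b (x - y)) \<partial>lborel) = ?e y * a y * fourier_integral b \<xi>" .
  qed
  also have "\<dots> = fourier_integral a \<xi> * fourier_integral b \<xi>"
    unfolding fourier_integral_def[of a] by (rule integral_mult_left_zero)
  finally show ?thesis .
qed

text \<open>The nonlinearity multiplies representatives, so inversion is needed pointwise almost
  everywhere and not merely as an identity in L^2.\<close>

lemma rep_l2_inv_fourier:
  assumes a: "integrable lborel a" "square_integrable a" and f: "fourier f = to_l2 a"
  shows "AE x in lborel. rep_l2 f x = (1 / (2 * pi)) *\<^sub>R fourier_integral a (- x)"
proof -
  note s = fourier_integral_norm_le(1)[OF a]
  have "f = inv_fourier (to_l2 a)" using f inv_fourier_fourier by metis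
  also have "\<dots> = to_l2 (\<lambda>x. (1 / (2 * pi)) *\<^sub>R fourier_integral a (- x))"
    unfolding inv_fourier_def fourier_to_l2[OF a] reflect_to_l2[OF s]
    by (rule to_l2_scaleR[symmetric]) (rule square_integrable_reflect[OF s])
  finally show ?thesis
    using rep_l2_to_l2[OF square_integrable_scaleR[OF square_integrable_reflect[OF s]]] by simp
qed

text \<open>The convolution is integrable and square integrable, so its inverse transform is given
  pointwise, and up to a factor it is the product of those of \<open>a\<close> and \<open>b\<close>.
  These bring two factors 1/(2 pi), one of which belongs to the inversion of the convolution. The
  first claim ensures that \<open>to_l2\<close> does not take its default value.\<close>

lemma fourier_product:
  assumes a: "integrable lborel a" "square_integrable a" and b: "integrable lborel b" "square_integrable b"
    and f: "fourier f = to_l2 a" and g: "fourier g = to_l2 b" and c: "square_integrable (conv a b)"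
  shows "square_integrable (\<lambda>x. rep_l2 f x * rep_l2 g x)"
    "fourier (to_l2 (\<lambda>x. rep_l2 f x * rep_l2 g x)) = (1 / (2 * pi)) *\<^sub>R to_l2 (conv a b)"
proof -
  note ci = integrable_conv[OF a(1) b(1)]
  define h where "h = (1 / (2 * pi)) *\<^sub>R inv_fourier (to_l2 (conv a b))"
  have "AE x in lborel. rep_l2 (inv_fourier (to_l2 (conv a b))) x = (1 / (2 * pi)) *\<^sub>R fourier_integral (conv a b) (- x)"
    by (rule rep_l2_inv_fourier[OF ci c]) simp
  then have AE: "AE x in lborel. rep_l2 f x * rep_l2 g x = rep_l2 h x"
    using rep_l2_inv_fourier[OF a f] rep_l2_inv_fourier[OF b g]
      rep_l2_scaleR[of "1 / (2 * pi)" "inv_fourier (to_l2 (conv a b))", folded h_def]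
    by eventually_elim (simp add: fourier_integral_conv[OF a(1) b(1)])
  have "square_integrable (rep_l2 h)" by (rule square_integrable_rep_l2)
  moreover have "(\<lambda>x. rep_l2 f x * rep_l2 g x) \<in> borel_measurable borel" by measurable
  moreover have "AE x in lborel. rep_l2 h x = rep_l2 f x * rep_l2 g x" using AE by eventually_elim simp
  ultimately show s: "square_integrable (\<lambda>x. rep_l2 f x * rep_l2 g x)" by (rule square_integrable_cong_AE)
  have "to_l2 (\<lambda>x. rep_l2 f x * rep_l2 g x) = h" by (rule to_l2_eqI[OF s AE])
  then show "fourier (to_l2 (\<lambda>x. rep_l2 f x * rep_l2 g x)) = (1 / (2 * pi)) *\<^sub>R to_l2 (conv a b)"
    by (simp add: h_def fourier_scaleR)
qed

section \<open>Weights and symbols\<close>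

lemma cosh_measurable [measurable]: "(cosh :: real \<Rightarrow> real) \<in> borel_measurable borel"
  by (intro borel_measurable_continuous_onI continuous_intros)

definition wt :: "real \<Rightarrow> real \<Rightarrow> real" where "wt \<sigma> x = cosh (\<sigma> * x) * (jb x)\<^sup>2"

lemma wt_measurable [measurable]: "wt \<sigma> \<in> borel_measurable borel"
  unfolding wt_def by measurable

lemma jb_le_jb_sq: "jb x \<le> (jb x)\<^sup>2"
  using mult_left_mono[OF jb_ge_1[of x] jb_nonneg[of x]] by (simp add: power2_eq_square)

lemma jb_sq_le_wt: "(jb x)\<^sup>2 \<le> wt \<sigma> x"
  using cosh_real_ge_1[of "\<sigma> * x"] mult_right_mono[of 1 "cosh (\<sigma> * x)" "(jb x)\<^sup>2"] by (simp add: wt_def)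

lemma wt_pos [simp]: "0 < wt \<sigma> x" by (simp add: wt_def)
lemma wt_neq_0 [simp]: "wt \<sigma> x \<noteq> 0" using wt_pos[of \<sigma> x] by linarith
lemma wt_nonneg [simp]: "0 \<le> wt \<sigma> x" using wt_pos[of \<sigma> x] by linarith
lemma wt_ge_1: "1 \<le> wt \<sigma> x" using jb_sq_le_wt[of x \<sigma>] jb_le_jb_sq[of x] jb_ge_1[of x] by linarith
lemma wt_uminus [simp]: "wt \<sigma> (- x) = wt \<sigma> x" by (simp add: wt_def)

text \<open>The addition theorem together with |sinh| <= cosh. The 2 is free of \<sigma>, and this
  is where the uniformity in \<sigma> of the kernel bounds for the nonlinearity comes from.\<close>

lemma cosh_split_le: "cosh (\<sigma> * x) \<le> 2 * (cosh (\<sigma> * y) * cosh (\<sigma> * (x - y :: real)))"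
proof -
  have "cosh (\<sigma> * x) = cosh (\<sigma> * y + \<sigma> * (x - y))" by (simp add: algebra_simps)
  also have "\<dots> = cosh (\<sigma> * y) * cosh (\<sigma> * (x - y)) + sinh (\<sigma> * y) * sinh (\<sigma> * (x - y))" by (rule cosh_add)
  also have "sinh (\<sigma> * y) * sinh (\<sigma> * (x - y)) \<le> \<bar>sinh (\<sigma> * y)\<bar> * \<bar>sinh (\<sigma> * (x - y))\<bar>"
    by (metis abs_ge_self abs_mult)
  also have "\<bar>sinh (\<sigma> * y)\<bar> * \<bar>sinh (\<sigma> * (x - y))\<bar> \<le> cosh (\<sigma> * y) * cosh (\<sigma> * (x - y))"
    using sinh_less_cosh_real[of "\<bar>\<sigma> * y\<bar>"] sinh_less_cosh_real[of "\<bar>\<sigma> * (x - y)\<bar>"]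
    by (intro mult_mono) (auto simp: sinh_real_abs cosh_real_abs)
  finally show ?thesis by simp
qed

lemma jb_split_le: "jb x \<le> 2 * (jb y * jb (x - y))"
proof (rule power2_le_imp_le)
  have "1 + x\<^sup>2 \<le> 4 * ((1 + y\<^sup>2) * (1 + (x - y)\<^sup>2))"
  proof -
    have "0 \<le> (y - (x - y))\<^sup>2" by simp
    then have "x\<^sup>2 \<le> 2 * y\<^sup>2 + 2 * (x - y)\<^sup>2" by (simp add: power2_eq_square algebra_simps)
    then have "1 + x\<^sup>2 \<le> 1 + 2 * y\<^sup>2 + 2 * (x - y)\<^sup>2" by simp
    moreover have "0 \<le> y\<^sup>2 * (x - y)\<^sup>2" by simp
    moreover have "4 * ((1 + y\<^sup>2) * (1 + (x - y)\<^sup>2)) = 4 + 4 * y\<^sup>2 + 4 * (x - y)\<^sup>2 + 4 * (y\<^sup>2 * (x - y)\<^sup>2)"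
      by algebra
    moreover have "0 \<le> y\<^sup>2" "0 \<le> (x - y)\<^sup>2" by auto
    ultimately show ?thesis by linarith
  qed
  then show "(jb x)\<^sup>2 \<le> (2 * (jb y * jb (x - y)))\<^sup>2"
    by (simp add: power_mult_distrib jb_sq)
qed simp

lemma kernel_boundI:
  assumes "0 \<le> K" "(\<lambda>(x, y). k x y) \<in> borel_measurable (borel \<Otimes>\<^sub>M borel)"
    "\<And>x y. \<bar>k x y\<bar> \<le> K / (jb y * jb (x - y))"
  shows "kernel_bound k K"
  unfolding kernel_bound_def
proof (intro conjI allI assms)
  fix x y :: real
  have "K / (jb y * jb (x - y)) \<le> K / (jb y * 1)"
    using assms(1) jb_ge_1[of "x - y"] by (intro divide_left_mono mult_left_mono) auto
  with assms(3)[of x y] show "\<bar>k x y\<bar> \<le> K / jb y" by simp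
qed

locale coeffs =
  fixes \<gamma>1 \<gamma>2 \<delta>1 \<delta>2 :: real
  assumes \<gamma>1: "\<gamma>1 > 0" and \<delta>1: "\<delta>1 > 0"
begin

abbreviation "den \<equiv> sym_den \<gamma>1 \<delta>1"
abbreviation "tau \<equiv> sym_tau (7/48) \<gamma>1 \<delta>1"
abbreviation "psi \<equiv> sym_psi \<gamma>1 \<delta>1"
abbreviation "phi \<equiv> sym_phi \<gamma>1 \<gamma>2 \<delta>1 \<delta>2"

text \<open>\<open>kap\<close> and \<open>Lam\<close> are the lower and upper constants comparing
  \<open>den x\<close> with \<open>(jb x) ^ 4\<close>. The division by 2 pays for (1 + x^2)^2 <= 2
  (1 + x^4).\<close>

definition kap :: real where "kap = min 1 \<delta>1 / 2"
definition Lam :: real where "Lam = 1 + \<gamma>1 + \<delta>1"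

lemma kap_pos [simp]: "0 < kap" using \<delta>1 by (simp add: kap_def)
lemma kap_neq_0 [simp]: "kap \<noteq> 0" using kap_pos by linarith
lemma Lam_pos [simp]: "0 < Lam" using \<gamma>1 \<delta>1 by (simp add: Lam_def)

lemma den_ge: "kap * (jb x) ^ 4 \<le> den x"
proof -
  have e: "(jb x) ^ 4 = (1 + x\<^sup>2)\<^sup>2" using jb_sq[of x] by (metis power_even_eq[of "jb x" 2] mult_2 numeral_Bit0)
  have x4: "x ^ 4 = (x\<^sup>2)\<^sup>2" by simp
  have "(1 + x\<^sup>2)\<^sup>2 \<le> 2 * (1 + x ^ 4)"
    using sum_squares_bound[of 1 "x\<^sup>2"] unfolding x4 by (simp add: power2_sum)
  then have "kap * (jb x) ^ 4 \<le> kap * (2 * (1 + x ^ 4))" unfolding e by (intro mult_left_mono) (auto simp: less_imp_le)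
  also have "\<dots> = min 1 \<delta>1 + min 1 \<delta>1 * x ^ 4" by (simp add: kap_def algebra_simps)
  also have "\<dots> \<le> 1 + \<delta>1 * x ^ 4" by (intro add_mono mult_right_mono) auto
  also have "\<dots> \<le> den x" using \<gamma>1 by (simp add: sym_den_def)
  finally show ?thesis .
qed

lemma den_le: "den x \<le> Lam * (jb x) ^ 4"
proof -
  have e: "(jb x) ^ 4 = (1 + x\<^sup>2)\<^sup>2" using jb_sq[of x] by (metis power_even_eq[of "jb x" 2] mult_2 numeral_Bit0)
  have "Lam * (1 + x\<^sup>2)\<^sup>2 - den x = (\<gamma>1 + \<delta>1) + (2 * (1 + \<gamma>1 + \<delta>1) - \<gamma>1) * x\<^sup>2 + (1 + \<gamma>1) * x ^ 4"
    by (simp add: Lam_def sym_den_def algebra_simps power2_sum power_even_eq[of x 2, simplified])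
  also have "\<dots> \<ge> 0" using \<gamma>1 \<delta>1 by (intro add_nonneg_nonneg mult_nonneg_nonneg) auto
  finally show ?thesis unfolding e by simp
qed

lemma den_pos [simp]: "0 < den x"
  using den_ge[of x] mult_pos_pos[OF kap_pos zero_less_power[OF jb_pos[of x], of 4]] by linarith

lemma den_neq_0 [simp]: "den x \<noteq> 0" using den_pos[of x] by linarith

lemma den_nonneg [simp]: "0 \<le> den x" using den_pos[of x] by linarith

lemma kap_nonneg [simp]: "0 \<le> kap" using kap_pos by linarith

lemma den_uminus [simp]: "den (- x) = den x" by (simp add: sym_den_def)
lemma tau_uminus [simp]: "tau (- x) = - tau x" by (simp add: sym_tau_def)
lemma psi_uminus [simp]: "psi (- x) = - psi x" by (simp add: sym_psi_def)
lemma phi_uminus [simp]: "phi (- x) = - phi x" by (simp add: sym_phi_def)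

lemma den_measurable [measurable]: "den \<in> borel_measurable borel"
  unfolding sym_den_def by measurable
lemma tau_measurable [measurable]: "tau \<in> borel_measurable borel"
  unfolding sym_tau_def[abs_def] by measurable
lemma psi_measurable [measurable]: "psi \<in> borel_measurable borel"
  unfolding sym_psi_def[abs_def] by measurable
lemma phi_measurable [measurable]: "phi \<in> borel_measurable borel"
  unfolding sym_phi_def[abs_def] by measurable

text \<open>Degree 1 over a denominator of degree 4 gains three powers of <x>; \<open>tau\<close>,
  of degree 3 over 4, gains only one.\<close>

lemma psi_bound: "\<bar>psi x\<bar> * (jb x) ^ 3 \<le> 1 / kap"
proof -
  have "\<bar>psi x\<bar> * (jb x) ^ 3 = \<bar>x\<bar> * (jb x) ^ 3 / den x"
    by (simp add: sym_psi_def abs_mult abs_of_pos[OF den_pos])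
  also have "\<dots> \<le> (jb x) ^ 4 / den x"
    using mult_right_mono[OF abs_le_jb[of x], of "(jb x) ^ 3"] den_pos[of x]
    by (intro divide_right_mono) (auto simp: power_numeral_reduce less_imp_le)
  also have "\<dots> \<le> 1 / kap" using den_ge[of x] by (simp add: divide_simps mult.commute)
  finally show ?thesis .
qed

lemma tau_bound: "\<bar>tau x\<bar> * jb x \<le> 1 / kap"
proof -
  have "\<bar>3 - 4 * (7/48) * t\<bar> \<le> 4 * (1 + t)" if "0 \<le> t" for t :: real
    using that by (simp add: abs_if)
  then have "\<bar>3 - 4 * (7/48) * x\<^sup>2\<bar> \<le> 4 * (jb x)\<^sup>2"
    unfolding jb_sq by simp
  then have "\<bar>x\<bar> * \<bar>3 - 4 * (7/48) * x\<^sup>2\<bar> * jb x \<le> jb x * (4 * (jb x)\<^sup>2) * jb x"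
    by (intro mult_mono abs_le_jb) auto
  also have "\<dots> = 4 * (jb x) ^ 4" by (simp add: power_numeral_reduce)
  finally have "\<bar>x\<bar> * \<bar>3 - 4 * (7/48) * x\<^sup>2\<bar> * jb x \<le> 4 * (jb x) ^ 4" .
  then have "\<bar>tau x\<bar> * jb x \<le> 4 * (jb x) ^ 4 / (4 * den x)"
  proof -
    have "\<bar>tau x\<bar> * jb x = \<bar>x\<bar> * \<bar>3 - 4 * (7/48) * x\<^sup>2\<bar> * jb x / (4 * den x)"
      by (simp only: sym_tau_def abs_mult abs_divide abs_of_pos[OF den_pos] abs_numeral times_divide_eq_left)
    then show ?thesis using divide_right_mono[OF \<open>\<bar>x\<bar> * \<bar>3 - 4 * (7/48) * x\<^sup>2\<bar> * jb x \<le> 4 * (jb x) ^ 4\<close>, of "4 * den x"] by simp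
  qed
  also have "\<dots> \<le> 1 / kap" using den_ge[of x] by (simp add: divide_simps mult.commute)
  finally show ?thesis .
qed

lemma psi_bound2: "\<bar>psi x\<bar> * (jb x)\<^sup>2 \<le> 1 / kap"
proof -
  have "\<bar>psi x\<bar> * (jb x)\<^sup>2 \<le> \<bar>psi x\<bar> * (jb x) ^ 3" by (intro mult_left_mono power_increasing jb_ge_1) auto
  with psi_bound[of x] show ?thesis by linarith
qed

lemma psi_le: "\<bar>psi x\<bar> \<le> 1 / kap"
proof -
  have "\<bar>psi x\<bar> * 1 \<le> \<bar>psi x\<bar> * (jb x) ^ 3" by (intro mult_left_mono one_le_power jb_ge_1) auto
  with psi_bound[of x] show ?thesis by linarith
qed

lemma tau_le: "\<bar>tau x\<bar> \<le> 1 / kap"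
proof -
  have "\<bar>tau x\<bar> * 1 \<le> \<bar>tau x\<bar> * jb x" by (intro mult_left_mono jb_ge_1) auto
  with tau_bound[of x] show ?thesis by linarith
qed

text \<open>The quadratic part of the nonlinearity with the weights moved into the kernel: the
  output is multiplied by \<open>wt\<close> and each input divided by it. The \<open>psi\<close>
  term appears with a plus sign because two derivatives bring (i y)(i (x - y)) = - y (x -
  y).\<close>

definition kB :: "real \<Rightarrow> real \<Rightarrow> real \<Rightarrow> real" where
  "kB \<sigma> x y = wt \<sigma> x * (tau x + 7/48 * psi x * (y * (x - y))) / (wt \<sigma> y * wt \<sigma> (x - y))"
text \<open>The cubic term is a nesting of two bilinear operators, with \<open>kC\<close> inside
  \<open>kD\<close>. The intermediate square carries one power of <x> instead of two: the inputs of
  \<open>kC\<close> then keep the decay 1/(<y> <x - y>), and the outer step can afford the weaker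
  weight because \<open>psi\<close> absorbs the <x>^2 of the output.\<close>

definition kC :: "real \<Rightarrow> real \<Rightarrow> real \<Rightarrow> real" where
  "kC \<sigma> x y = jb x * cosh (\<sigma> * x) / (wt \<sigma> y * wt \<sigma> (x - y))"
definition kD :: "real \<Rightarrow> real \<Rightarrow> real \<Rightarrow> real" where
  "kD \<sigma> x y = wt \<sigma> x * psi x / (wt \<sigma> y * (jb (x - y) * cosh (\<sigma> * (x - y))))"

text \<open>\<open>tau\<close> absorbs one power of <x> and \<open>psi\<close> two; the power left
  over with \<open>tau\<close> is split between the inputs. Of the two powers in each input weight
  one is spent in this way and the other remains as decay. The 6 is 2 from cosh times 3 from the
  symbol.\<close>

lemma kernel_bound_kB: "kernel_bound (kB \<sigma>) (6 / kap)"
proof (rule kernel_boundI)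
  show "(\<lambda>(x, y). kB \<sigma> x y) \<in> borel_measurable (borel \<Otimes>\<^sub>M borel)" unfolding kB_def by measurable
  fix x y :: real
  let ?z = "x - y"
  have "(jb x)\<^sup>2 * \<bar>tau x + 7/48 * psi x * (y * ?z)\<bar> \<le> (jb x)\<^sup>2 * (\<bar>tau x\<bar> + \<bar>psi x\<bar> * (\<bar>y\<bar> * \<bar>?z\<bar>))"
  proof (intro mult_left_mono)
    have "\<bar>7/48 * psi x * (y * ?z)\<bar> \<le> \<bar>psi x\<bar> * (\<bar>y\<bar> * \<bar>?z\<bar>)"
      by (simp add: abs_mult mult_left_le_one_le)
    then show "\<bar>tau x + 7/48 * psi x * (y * ?z)\<bar> \<le> \<bar>tau x\<bar> + \<bar>psi x\<bar> * (\<bar>y\<bar> * \<bar>?z\<bar>)" by linarith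
  qed auto
  also have "\<dots> = (\<bar>tau x\<bar> * jb x) * jb x + (\<bar>psi x\<bar> * (jb x)\<^sup>2) * (\<bar>y\<bar> * \<bar>?z\<bar>)"
    by (simp add: algebra_simps power2_eq_square)
  also have "\<dots> \<le> (1 / kap) * (2 * (jb y * jb ?z)) + (1 / kap) * (jb y * jb ?z)"
  proof (intro add_mono mult_mono tau_bound jb_split_le abs_le_jb)
    show "\<bar>psi x\<bar> * (jb x)\<^sup>2 \<le> 1 / kap" by (rule psi_bound2)
  qed (auto simp: less_imp_le)
  also have "\<dots> = (3 / kap) * (jb y * jb ?z)" by simp
  finally have *: "(jb x)\<^sup>2 * \<bar>tau x + 7/48 * psi x * (y * ?z)\<bar> \<le> (3 / kap) * (jb y * jb ?z)" .
  have "\<bar>kB \<sigma> x y\<bar> = cosh (\<sigma> * x) * ((jb x)\<^sup>2 * \<bar>tau x + 7/48 * psi x * (y * ?z)\<bar>) / (wt \<sigma> y * wt \<sigma> ?z)"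
    by (simp add: kB_def abs_mult wt_def)
  also have "\<dots> \<le> 2 * (cosh (\<sigma> * y) * cosh (\<sigma> * ?z)) * ((3 / kap) * (jb y * jb ?z)) / (wt \<sigma> y * wt \<sigma> ?z)"
    by (intro divide_right_mono mult_mono[OF cosh_split_le *]) auto
  also have "\<dots> = 6 / kap / (jb y * jb ?z)"
    by (simp add: wt_def power2_eq_square divide_simps)
  finally show "\<bar>kB \<sigma> x y\<bar> \<le> 6 / kap / (jb y * jb ?z)" .
qed (simp add: less_imp_le)

lemma kernel_bound_kC: "kernel_bound (kC \<sigma>) 4"
proof (rule kernel_boundI)
  show "(\<lambda>(x, y). kC \<sigma> x y) \<in> borel_measurable (borel \<Otimes>\<^sub>M borel)" unfolding kC_def by measurable
  fix x y :: real
  let ?z = "x - y"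
  have "\<bar>kC \<sigma> x y\<bar> = jb x * cosh (\<sigma> * x) / (wt \<sigma> y * wt \<sigma> ?z)" by (simp add: kC_def abs_mult abs_of_pos[OF wt_pos])
  also have "\<dots> \<le> (2 * (jb y * jb ?z)) * (2 * (cosh (\<sigma> * y) * cosh (\<sigma> * ?z))) / (wt \<sigma> y * wt \<sigma> ?z)"
    by (intro divide_right_mono mult_mono cosh_split_le jb_split_le) auto
  also have "\<dots> = 4 / (jb y * jb ?z)"
    by (simp add: wt_def power2_eq_square divide_simps)
  finally show "\<bar>kC \<sigma> x y\<bar> \<le> 4 / (jb y * jb ?z)" .
qed simp

lemma kernel_bound_kD: "kernel_bound (kD \<sigma>) (2 / kap)"
proof (rule kernel_boundI)
  show "(\<lambda>(x, y). kD \<sigma> x y) \<in> borel_measurable (borel \<Otimes>\<^sub>M borel)" unfolding kD_def by measurable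
  fix x y :: real
  let ?z = "x - y"
  have p: "(jb x)\<^sup>2 * \<bar>psi x\<bar> \<le> 1 / kap" using psi_bound2[of x] by (simp add: mult.commute)
  have "\<bar>kD \<sigma> x y\<bar> = cosh (\<sigma> * x) * ((jb x)\<^sup>2 * \<bar>psi x\<bar>) / (wt \<sigma> y * (jb ?z * cosh (\<sigma> * ?z)))"
    by (simp add: kD_def abs_mult wt_def)
  also have "\<dots> \<le> 2 * (cosh (\<sigma> * y) * cosh (\<sigma> * ?z)) * (1 / kap) / (wt \<sigma> y * (jb ?z * cosh (\<sigma> * ?z)))"
    by (intro divide_right_mono mult_mono[OF cosh_split_le p]) auto
  also have "\<dots> = 2 / kap / ((jb y)\<^sup>2 * jb ?z)"
    by (simp add: wt_def divide_simps)
  also have "\<dots> \<le> 2 / kap / (jb y * jb ?z)"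
    using jb_le_jb_sq[of y] by (intro divide_left_mono mult_right_mono) (auto simp: less_imp_le)
  finally show "\<bar>kD \<sigma> x y\<bar> \<le> 2 / kap / (jb y * jb ?z)" .
qed (simp add: less_imp_le)

end

lemma square_integrable_cmult: "square_integrable f \<Longrightarrow> square_integrable (\<lambda>x. c * f x)"
  by (rule square_integrable_mult_bounded[where K="cmod c"]) auto

text \<open>The nonlinearity, conjugated by the weight \<open>cosh(\<sigma>\<xi>)\<langle>\<xi>\<rangle>\<^sup>2\<close> and the Fourier transform, becomes a
  polynomial map of \<open>L\<^sup>2\<close> built from bounded bilinear kernel operators.\<close>

definition gevrey_lift :: "real \<Rightarrow> l2 \<Rightarrow> l2" where
  "gevrey_lift \<sigma> u = inv_fourier (multiply (\<lambda>x. complex_of_real (1 / wt \<sigma> x)) u)"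

lemma inverse_wt_le: "cmod (complex_of_real (1 / wt \<sigma> x)) \<le> 1"
  using wt_ge_1[of \<sigma> x] by (simp add: norm_divide)

lemma fourier_gevrey_lift: "fourier (gevrey_lift \<sigma> u) = multiply (\<lambda>x. complex_of_real (1 / wt \<sigma> x)) u"
  by (simp add: gevrey_lift_def)

lemma square_integrable_div_wt:
  assumes "square_integrable u"
  shows "square_integrable (\<lambda>x. complex_of_real (1 / wt \<sigma> x) * u x)"
  by (rule square_integrable_mult_bounded[OF assms _ inverse_wt_le]) measurable

lemma integrable_div_jb:
  assumes "square_integrable u" "f \<in> borel_measurable borel" "\<And>x. cmod (f x) \<le> cmod (u x) / jb x"
  shows "integrable lborel f"
proof -
  have "integrable lborel (\<lambda>x. complex_of_real (1 / jb x) * u x)"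
    by (intro square_integrable_mult_integrable square_integrable_inverse_jb assms)
  then show ?thesis
    using assms(2) by (elim Bochner_Integration.integrable_bound) (use assms(3) in \<open>auto simp: norm_mult norm_divide\<close>)
qed

context coeffs
begin

text \<open>Each product costs 1/(2 pi) in frequency, so the cubic prefactor is 1/8 * 1/(2 pi)^2 =
  1/(32 pi^2).\<close>

definition nonlin :: "real \<Rightarrow> l2 \<Rightarrow> l2" where
  "nonlin \<sigma> u = (1 / (2 * pi)) *\<^sub>R kernel_op (kB \<sigma>) u u
     - (1 / (32 * pi\<^sup>2)) *\<^sub>R kernel_op (kD \<sigma>) u (kernel_op (kC \<sigma>) u u)"

text \<open>Division by the weight leaves two powers of decay on the transform of \<eta> and one on
  that of its derivative. Hence both are integrable, \<open>fourier_product\<close> applies to every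
  product in the nonlinearity, and the weight of the output is absorbed into the kernels.\<close>

lemma fourier_nonlinearity:
  "fourier (nonlinearity (7/48) \<gamma>1 \<delta>1 (gevrey_lift \<sigma> u)) = multiply (\<lambda>x. complex_of_real (1 / wt \<sigma> x)) (nonlin \<sigma> u)"
proof -
  define \<eta> where "\<eta> = gevrey_lift \<sigma> u"
  define w where "w = rep_l2 u"
  have sw: "square_integrable w" by (simp add: w_def square_integrable_rep_l2)
  have [measurable]: "w \<in> borel_measurable borel" by (simp add: w_def)
  define a where "a x = complex_of_real (1 / wt \<sigma> x) * w x" for x
  define b where "b x = (\<i> * complex_of_real x) * a x" for x
  have [measurable]: "a \<in> borel_measurable borel" "b \<in> borel_measurable borel" unfolding a_def b_def by measurable
  have a_le: "cmod (a x) \<le> cmod (w x) / (jb x)\<^sup>2" for x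
    using jb_sq_le_wt[of x \<sigma>] by (simp add: a_def norm_mult norm_divide divide_left_mono)
  have b_le: "cmod (b x) \<le> cmod (w x) / jb x" for x
  proof -
    have "cmod (b x) \<le> jb x * (cmod (w x) / (jb x)\<^sup>2)"
      unfolding b_def norm_mult using a_le abs_le_jb by (intro mult_mono) auto
    then show ?thesis by (simp add: power2_eq_square)
  qed
  have jj: "cmod (w x) / (jb x)\<^sup>2 \<le> cmod (w x) / jb x" "cmod (w x) / jb x \<le> cmod (w x)" for x
    using divide_left_mono[OF jb_le_jb_sq[of x], of "cmod (w x)"] divide_left_mono[OF jb_ge_1[of x], of "cmod (w x)"] by auto
  have a: "integrable lborel a" "square_integrable a"
    using order_trans[OF a_le jj(1)] order_trans[OF order_trans[OF a_le jj(1)] jj(2)]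
    by (auto intro!: integrable_div_jb[OF sw] square_integrable_bound[OF sw, where K=1])
  have b: "integrable lborel b" "square_integrable b"
    using b_le order_trans[OF b_le jj(2)]
    by (auto intro!: integrable_div_jb[OF sw] square_integrable_bound[OF sw, where K=1])
  have f\<eta>: "fourier \<eta> = to_l2 a"
    unfolding \<eta>_def fourier_gevrey_lift multiply_def a_def w_def ..
  have fd: "fourier (deriv_x \<eta>) = to_l2 b"
  proof -
    have "(\<lambda>\<xi>. \<i> * complex_of_real \<xi>) \<in> borel_measurable borel" by measurable
    then show ?thesis
      unfolding deriv_x_def fourier_multiplier_eq f\<eta> b_def by (rule multiply_to_l2[OF a(2)])
  qed
  \<comment> \<open>With the input weights in the kernel, the convolutions become kernel operators
    with decay; this supplies the square integrability that \<open>fourier_product\<close> demands.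
    In \<open>?k2\<close> only the first input is unweighted, the second being the square
    itself.\<close>
  let ?k0 = "\<lambda>x y. 1 / (wt \<sigma> y * wt \<sigma> (x - y))" and ?k1 = "\<lambda>x y. - (y * (x - y)) / (wt \<sigma> y * wt \<sigma> (x - y))"
    and ?k2 = "\<lambda>x y. 1 / wt \<sigma> y"
  have k0: "kernel_bound ?k0 1"
  proof (rule kernel_boundI)
    fix x y :: real
    have "jb y * jb (x - y) \<le> wt \<sigma> y * wt \<sigma> (x - y)"
      by (intro mult_mono order_trans[OF jb_le_jb_sq jb_sq_le_wt]) auto
    then show "\<bar>?k0 x y\<bar> \<le> 1 / (jb y * jb (x - y))"
      by (auto simp: abs_mult intro!: divide_left_mono)
  qed auto
  have k1: "kernel_bound ?k1 1"
  proof (rule kernel_boundI)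
    fix x y :: real
    have e: "\<bar>?k1 x y\<bar> = \<bar>y\<bar> * \<bar>x - y\<bar> / (wt \<sigma> y * wt \<sigma> (x - y))"
      by (simp add: abs_mult)
    have "\<bar>y\<bar> * \<bar>x - y\<bar> / (wt \<sigma> y * wt \<sigma> (x - y)) \<le> jb y * jb (x - y) / ((jb y)\<^sup>2 * (jb (x - y))\<^sup>2)"
      by (intro frac_le mult_mono abs_le_jb jb_sq_le_wt) auto
    then show "\<bar>?k1 x y\<bar> \<le> 1 / (jb y * jb (x - y))" unfolding e
      by (simp add: power2_eq_square)
  qed auto
  have k2: "kernel_bound ?k2 1"
    unfolding kernel_bound_def
  proof (intro conjI allI)
    fix x y :: real
    have "jb y \<le> wt \<sigma> y" using jb_le_jb_sq jb_sq_le_wt order_trans by blast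
    then show "\<bar>?k2 x y\<bar> \<le> 1 / jb y" by (simp add: frac_le)
  qed (simp, measurable)
  have caa: "conv a a = kernel_int ?k0 w w"
    unfolding kernel_int_def a_def fun_eq_iff by (auto intro!: Bochner_Integration.integral_cong)
  have cbb: "conv b b = kernel_int ?k1 w w"
    unfolding kernel_int_def a_def b_def fun_eq_iff
    by (auto intro!: Bochner_Integration.integral_cong simp: divide_simps algebra_simps)
  define c where "c x = complex_of_real (1 / (2 * pi)) * conv a a x" for x
  have saa: "square_integrable (conv a a)" unfolding caa by (rule kernel_int_bound[OF k0 sw sw])
  have sbb: "square_integrable (conv b b)" unfolding cbb by (rule kernel_int_bound[OF k1 sw sw])
  have c: "integrable lborel c" "square_integrable c"
    unfolding c_def by (intro integrable_mult_right integrable_conv a square_integrable_cmult saa)+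
  have cac: "conv a c = kernel_int ?k2 w c"
    unfolding kernel_int_def a_def fun_eq_iff by (auto intro!: Bochner_Integration.integral_cong)
  have sac: "square_integrable (conv a c)" unfolding cac by (rule kernel_int_bound[OF k2 sw c(2)])
  note p2 = fourier_product[OF a a f\<eta> f\<eta> saa]
  note pd = fourier_product[OF b b fd fd sbb]
  have f2: "fourier (to_l2 (\<lambda>x. rep_l2 \<eta> x * rep_l2 \<eta> x)) = to_l2 c"
    using p2(2) to_l2_scaleR[OF saa, of "1 / (2 * pi)"] by (simp add: c_def[abs_def] scaleR_conv_of_real)
  note p3 = fourier_product[OF a c f\<eta> f2 sac]
  have e3: "to_l2 (\<lambda>x. (rep_l2 \<eta> x) ^ 3) = to_l2 (\<lambda>x. rep_l2 \<eta> x * rep_l2 (to_l2 (\<lambda>x. rep_l2 \<eta> x * rep_l2 \<eta> x)) x)"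
  proof (rule to_l2_cong_AE)
    show "AE x in lborel. (rep_l2 \<eta> x) ^ 3 = rep_l2 \<eta> x * rep_l2 (to_l2 (\<lambda>x. rep_l2 \<eta> x * rep_l2 \<eta> x)) x"
      using rep_l2_to_l2[OF p2(1)] by eventually_elim (simp add: power3_eq_cube)
  qed measurable
  have mt: "(\<lambda>\<xi>. complex_of_real (tau \<xi>)) \<in> borel_measurable borel" "(\<lambda>\<xi>. complex_of_real (psi \<xi>)) \<in> borel_measurable borel"
    by measurable
  define A where "A x = complex_of_real (tau x) * c x" for x
  define B where "B x = complex_of_real (psi x) * ((1 / (2 * pi)) *\<^sub>R conv b b x)" for x
  define C where "C x = complex_of_real (psi x) * ((1 / (2 * pi)) *\<^sub>R conv a c x)" for x
  have sA: "square_integrable A" unfolding A_def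
    by (rule square_integrable_mult_bounded[OF c(2) mt(1), where K="1 / kap"]) (simp add: tau_le)
  have sB: "square_integrable B" unfolding B_def
    by (rule square_integrable_mult_bounded[OF square_integrable_scaleR[OF sbb] mt(2), where K="1 / kap"]) (simp add: psi_le)
  have sC: "square_integrable C" unfolding C_def
    by (rule square_integrable_mult_bounded[OF square_integrable_scaleR[OF sac] mt(2), where K="1 / kap"]) (simp add: psi_le)
  have fA: "multiply (\<lambda>\<xi>. complex_of_real (tau \<xi>)) (fourier (to_l2 (\<lambda>x. (rep_l2 \<eta> x)\<^sup>2))) = to_l2 A"
    unfolding power2_eq_square f2 A_def by (rule multiply_to_l2[OF c(2) mt(1)])
  have fB: "multiply (\<lambda>\<xi>. complex_of_real (psi \<xi>)) (fourier (to_l2 (\<lambda>x. (rep_l2 (deriv_x \<eta>) x)\<^sup>2))) = to_l2 B"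
    unfolding power2_eq_square pd(2) B_def to_l2_scaleR[OF sbb, symmetric]
    by (rule multiply_to_l2[OF square_integrable_scaleR[OF sbb] mt(2)])
  have fC: "multiply (\<lambda>\<xi>. complex_of_real (psi \<xi>)) (fourier (to_l2 (\<lambda>x. (rep_l2 \<eta> x) ^ 3))) = to_l2 C"
    unfolding e3 p3(2) C_def to_l2_scaleR[OF sac, symmetric]
    by (rule multiply_to_l2[OF square_integrable_scaleR[OF sac] mt(2)])
  interpret F: bounded_linear fourier by (rule bounded_linear_fourier)
  have "fourier (nonlinearity (7/48) \<gamma>1 \<delta>1 \<eta>) = to_l2 A - (7/48) *\<^sub>R to_l2 B - (1/8) *\<^sub>R to_l2 C"
    unfolding nonlinearity_def F.diff F.scaleR fourier_multiplier_eq fA fB fC ..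
  also have "\<dots> = to_l2 (\<lambda>x. A x - (7/48) *\<^sub>R B x - (1/8) *\<^sub>R C x)"
    using sA sB sC by (simp add: to_l2_diff to_l2_scaleR[symmetric] square_integrable_diff square_integrable_scaleR)
  finally have L: "fourier (nonlinearity (7/48) \<gamma>1 \<delta>1 \<eta>) = to_l2 (\<lambda>x. A x - (7/48) *\<^sub>R B x - (1/8) *\<^sub>R C x)" .

  define Y where "Y = kernel_int (kC \<sigma>) w w"
  have sY: "square_integrable Y" unfolding Y_def by (rule kernel_int_bound[OF kernel_bound_kC sw sw])
  have kop: "kernel_op (kB \<sigma>) u u = to_l2 (kernel_int (kB \<sigma>) w w)"
    "kernel_op (kD \<sigma>) u (kernel_op (kC \<sigma>) u u) = to_l2 (kernel_int (kD \<sigma>) w Y)"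
    using kernel_op_to_l2[OF kernel_bound_kB sw sw, of \<sigma>] kernel_op_to_l2[OF kernel_bound_kC sw sw, of \<sigma>] kernel_op_to_l2[OF kernel_bound_kD sw sY, of \<sigma>]
    by (simp_all add: w_def Y_def)
  have sBB: "square_integrable (kernel_int (kB \<sigma>) w w)" and sDD: "square_integrable (kernel_int (kD \<sigma>) w Y)"
    by (rule kernel_int_bound[OF kernel_bound_kB sw sw], rule kernel_int_bound[OF kernel_bound_kD sw sY])
  define Z where "Z x = (1 / (2 * pi)) *\<^sub>R kernel_int (kB \<sigma>) w w x - (1 / (32 * pi\<^sup>2)) *\<^sub>R kernel_int (kD \<sigma>) w Y x" for x
  have sZ: "square_integrable Z" unfolding Z_def by (intro square_integrable_diff square_integrable_scaleR sBB sDD)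
  have "nonlin \<sigma> u = to_l2 Z" unfolding nonlin_def kop Z_def
    by (simp add: to_l2_diff to_l2_scaleR sBB sDD square_integrable_scaleR)
  moreover have "(\<lambda>x. complex_of_real (1 / wt \<sigma> x)) \<in> borel_measurable borel" by measurable
  ultimately have R: "multiply (\<lambda>x. complex_of_real (1 / wt \<sigma> x)) (nonlin \<sigma> u) = to_l2 (\<lambda>x. complex_of_real (1 / wt \<sigma> x) * Z x)"
    using multiply_to_l2[OF sZ] by simp
  have intaa: "integrable lborel (\<lambda>y. complex_of_real (?k0 x y) * (w y * w (x - y)))"
    and intbb: "integrable lborel (\<lambda>y. complex_of_real (?k1 x y) * (w y * w (x - y)))" for x
    by (rule kernel_int_integrable[OF k0 sw sw], rule kernel_int_integrable[OF k1 sw sw])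
  have kBe: "kernel_int (kB \<sigma>) w w x = complex_of_real (wt \<sigma> x) * (complex_of_real (tau x) * conv a a x - complex_of_real (7/48 * psi x) * conv b b x)" for x
  proof -
    let ?P = "\<lambda>y. complex_of_real (?k0 x y) * (w y * w (x - y))" and ?Q = "\<lambda>y. complex_of_real (?k1 x y) * (w y * w (x - y))"
    have "kernel_int (kB \<sigma>) w w x = (\<integral>y. complex_of_real (wt \<sigma> x * tau x) * ?P y - complex_of_real (wt \<sigma> x * (7/48 * psi x)) * ?Q y \<partial>lborel)"
      unfolding kernel_int_def
    proof (intro Bochner_Integration.integral_cong refl)
      fix y
      have "kB \<sigma> x y = (wt \<sigma> x * tau x) * ?k0 x y - (wt \<sigma> x * (7/48 * psi x)) * ?k1 x y"
      proof -
        have "W * (t + 7/48 * p * m) / D = (W * t) * (1 / D) - (W * (7/48 * p)) * (- m / D)" for W t p m D :: real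
          by (simp add: add_divide_distrib algebra_simps)
        then show ?thesis unfolding kB_def .
      qed
      then have "complex_of_real (kB \<sigma> x y) = complex_of_real (wt \<sigma> x * tau x) * complex_of_real (?k0 x y) - complex_of_real (wt \<sigma> x * (7/48 * psi x)) * complex_of_real (?k1 x y)"
        by (simp only: of_real_mult[symmetric] of_real_diff[symmetric])
      then show "complex_of_real (kB \<sigma> x y) * (w y * w (x - y)) = complex_of_real (wt \<sigma> x * tau x) * ?P y - complex_of_real (wt \<sigma> x * (7/48 * psi x)) * ?Q y"
        by (simp only: left_diff_distrib mult.assoc)
    qed
    also have "\<dots> = complex_of_real (wt \<sigma> x * tau x) * conv a a x - complex_of_real (wt \<sigma> x * (7/48 * psi x)) * conv b b x"
      unfolding caa cbb kernel_int_def
      by (subst Bochner_Integration.integral_diff) (intro integrable_mult_right intaa intbb, intro integrable_mult_right intaa intbb, simp only: integral_mult_right_zero)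
    finally show ?thesis by (simp add: algebra_simps)
  qed
  have Ye: "Y x = complex_of_real (jb x * cosh (\<sigma> * x)) * conv a a x" for x
  proof -
    have "Y x = (\<integral>y. complex_of_real (jb x * cosh (\<sigma> * x)) * (complex_of_real (?k0 x y) * (w y * w (x - y))) \<partial>lborel)"
      unfolding Y_def kernel_int_def kC_def by (intro Bochner_Integration.integral_cong) auto
    then show ?thesis unfolding caa kernel_int_def by (simp only: integral_mult_right_zero)
  qed
  have kDe: "kernel_int (kD \<sigma>) w Y x = complex_of_real (wt \<sigma> x * psi x) * (complex_of_real (2 * pi) * conv a c x)" for x
  proof -
    have "kernel_int (kD \<sigma>) w Y x = (\<integral>y. complex_of_real (wt \<sigma> x * psi x) * (complex_of_real (2 * pi) * (complex_of_real (?k2 x y) * (w y * c (x - y)))) \<partial>lborel)"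
      unfolding kernel_int_def[of "kD \<sigma>"] kD_def Ye c_def by (intro Bochner_Integration.integral_cong) auto
    then show ?thesis unfolding cac kernel_int_def by (simp only: integral_mult_right_zero)
  qed
  have "complex_of_real (1 / wt \<sigma> x) * Z x = A x - (7/48) *\<^sub>R B x - (1/8) *\<^sub>R C x" for x
  proof -
    have "complex_of_real (1 / wt \<sigma> x) * Z x = (complex_of_real (tau x) * conv a a x - complex_of_real (7/48 * psi x) * conv b b x) / (2 * pi) - (complex_of_real (psi x) * (complex_of_real (2 * pi) * conv a c x)) / (32 * pi\<^sup>2)"
      unfolding Z_def kBe kDe by (simp add: scaleR_conv_of_real field_simps)
    also have "\<dots> = A x - (7/48) *\<^sub>R B x - (1/8) *\<^sub>R C x"
      unfolding A_def B_def C_def c_def by (simp add: scaleR_conv_of_real field_simps power2_eq_square)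
    finally show ?thesis .
  qed
  then show ?thesis using L R by (simp add: \<eta>_def)
qed

end

section \<open>Ordinary differential equations in Banach spaces\<close>

text \<open>Contraction on the ball of radius 2 a, with a the norm of \<open>u0\<close>. There the
  Lipschitz constant is at most L = K (4 a + (4 a)^2), and T L <= 1/2 gives both invariance of the
  ball and the contraction factor. \<open>P\<close> encodes a linear symmetry preserved by
  \<open>G\<close>, in the application conjugate symmetry, which the fixed point inherits.\<close>

lemma picard_exists:
  fixes G :: "real \<Rightarrow> 'a::banach \<Rightarrow> 'a"
  assumes T: "0 \<le> T"
    and cont: "\<And>w. continuous_on {0..T} w \<Longrightarrow> continuous_on {0..T} (\<lambda>s. G s (w s))"
    and lip: "\<And>s u v. norm (G s u - G s v) \<le> K * ((norm u + norm v) + (norm u + norm v)\<^sup>2) * norm (u - v)"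
    and G0: "\<And>s. G s 0 = 0"
    and P: "bounded_linear P" "\<And>s u. P u = u \<Longrightarrow> P (G s u) = G s u" "P u0 = u0"
    and K: "0 \<le> K" and small: "T * (K * (4 * norm u0 + (4 * norm u0)\<^sup>2)) \<le> 1 / 2"
  obtains w where "continuous_on {0..T} w" "\<And>t. t \<in> {0..T} \<Longrightarrow> P (w t) = w t"
    "\<And>t. t \<in> {0..T} \<Longrightarrow> norm (w t) \<le> 2 * norm u0"
    "\<And>t. t \<in> {0..T} \<Longrightarrow> w t = u0 + integral {0..t} (\<lambda>s. G s (w s))"
proof -
  define a where "a = norm u0"
  define L where "L = K * (4 * a + (4 * a)\<^sup>2)"
  have a: "0 \<le> a" by (simp add: a_def)
  have L: "0 \<le> L" using K a by (simp add: L_def)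
  have TL: "T * L \<le> 1 / 2" using small by (simp add: L_def a_def)
  have lipL: "norm (G s u - G s v) \<le> L * norm (u - v)" if "norm u \<le> 2 * a" "norm v \<le> 2 * a" for s u v
  proof -
    have "norm u + norm v \<le> 4 * a" using that by simp
    then have "K * ((norm u + norm v) + (norm u + norm v)\<^sup>2) \<le> L"
      unfolding L_def using K by (intro mult_left_mono add_mono power_mono) auto
    then have "K * ((norm u + norm v) + (norm u + norm v)\<^sup>2) * norm (u - v) \<le> L * norm (u - v)"
      by (intro mult_right_mono) auto
    with lip[of s u v] show ?thesis by linarith
  qed
  \<comment> \<open>Clamping time to [0, T] makes the iterates bounded continuous functions on the
    whole line, which form a complete metric space.\<close>
  define cl where "cl t = max 0 (min T t)" for t
  have cl: "cl t \<in> {0..T}" for t using T by (auto simp: cl_def)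
  have cl_id: "cl t = t" if "t \<in> {0..T}" for t using that by (auto simp: cl_def)
  have ccl: "continuous_on UNIV cl" unfolding cl_def by (intro continuous_intros)
  define F where "F w t = u0 + integral {0..cl t} (\<lambda>s. G s (apply_bcontfun w s))" for w :: "real \<Rightarrow>\<^sub>C 'a" and t
  have cw: "continuous_on A (apply_bcontfun w)" for A and w :: "real \<Rightarrow>\<^sub>C 'a"
    using bcontfun_def apply_bcontfun[of w] by (auto intro: continuous_on_subset)
  have cG: "continuous_on {0..T} (\<lambda>s. G s (apply_bcontfun w s))" for w :: "real \<Rightarrow>\<^sub>C 'a"
    by (rule cont[OF cw])
  have iG: "(\<lambda>s. G s (apply_bcontfun w s)) integrable_on {0..cl t}" for w :: "real \<Rightarrow>\<^sub>C 'a" and t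
    by (rule integrable_continuous_interval[OF continuous_on_subset[OF cG]]) (use cl[of t] in auto)
  have FB: "F w \<in> bcontfun" for w
  proof -
    have ci: "continuous_on {0..T} (\<lambda>t. u0 + integral {0..t} (\<lambda>s. G s (apply_bcontfun w s)))"
      by (intro continuous_intros indefinite_integral_continuous_1 integrable_continuous_interval cG)
    have "continuous_on UNIV (F w)" unfolding F_def
      by (rule continuous_on_compose2[OF ci ccl]) (use cl in auto)
    moreover have "bounded (range (F w))"
    proof (rule bounded_subset)
      show "bounded ((\<lambda>t. u0 + integral {0..t} (\<lambda>s. G s (apply_bcontfun w s))) ` {0..T})"
        by (intro compact_imp_bounded compact_continuous_image ci) auto
      show "range (F w) \<subseteq> (\<lambda>t. u0 + integral {0..t} (\<lambda>s. G s (apply_bcontfun w s))) ` {0..T}"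
        unfolding F_def using cl by auto
    qed
    ultimately show ?thesis by (simp add: bcontfun_def)
  qed
  define \<Phi> where "\<Phi> w = Bcontfun (F w)" for w
  have \<Phi>: "apply_bcontfun (\<Phi> w) t = F w t" for w t
    unfolding \<Phi>_def using FB by (simp add: Bcontfun_inverse)
  \<comment> \<open>The ball and the symmetry are imposed together; both are closed conditions, so
    Banach's fixed point theorem applies inside \<open>S\<close>.\<close>
  define S where "S = {w :: real \<Rightarrow>\<^sub>C 'a. \<forall>t. P (apply_bcontfun w t) = apply_bcontfun w t \<and> norm (apply_bcontfun w t) \<le> 2 * a}"
  interpret P: bounded_linear P by (rule P(1))
  have cS: "closed S"
    unfolding closed_sequential_limits
  proof (intro allI impI, elim conjE)
    fix f :: "nat \<Rightarrow> real \<Rightarrow>\<^sub>C 'a" and l assume f: "\<forall>n. f n \<in> S" and lim: "f \<longlonglongrightarrow> l"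
    have lt: "(\<lambda>n. apply_bcontfun (f n) t) \<longlonglongrightarrow> apply_bcontfun l t" for t
    proof (rule metric_LIMSEQ_I)
      fix r :: real assume "0 < r"
      from metric_LIMSEQ_D[OF lim this] obtain N where "\<And>n. n \<ge> N \<Longrightarrow> dist (f n) l < r" by blast
      then show "\<exists>no. \<forall>n\<ge>no. dist (apply_bcontfun (f n) t) (apply_bcontfun l t) < r"
        using dist_bounded le_less_trans by blast
    qed
    show "l \<in> S" unfolding S_def
    proof (intro CollectI allI conjI)
      fix t
      have "(\<lambda>n. P (apply_bcontfun (f n) t)) \<longlonglongrightarrow> P (apply_bcontfun l t)" by (rule P.tendsto[OF lt])
      moreover have "(\<lambda>n. P (apply_bcontfun (f n) t)) = (\<lambda>n. apply_bcontfun (f n) t)"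
        using f by (simp add: S_def)
      ultimately show "P (apply_bcontfun l t) = apply_bcontfun l t" using LIMSEQ_unique lt by metis
      show "norm (apply_bcontfun l t) \<le> 2 * a"
        by (rule LIMSEQ_le_const2[OF tendsto_norm[OF lt]]) (use f in \<open>auto simp: S_def\<close>)
    qed
  qed
  note complete = complete_eq_closed[THEN iffD2, OF cS]
  have const: "const_bcontfun u0 \<in> S"
    using P(3) a by (simp add: S_def a_def)
  have nI: "norm (integral {0..cl t} h) \<le> T * B"
    if h: "h integrable_on {0..cl t}" "\<And>s. s \<in> {0..cl t} \<Longrightarrow> norm (h s) \<le> B" and B: "0 \<le> B" for h :: "real \<Rightarrow> 'a" and t B
  proof -
    have "norm (integral {0..cl t} h) \<le> integral {0..cl t} (\<lambda>_. B)"
      by (rule Henstock_Kurzweil_Integration.integral_norm_bound_integral) (use h in auto)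
    also have "\<dots> = B * cl t" using cl[of t] by simp
    also have "\<dots> \<le> B * T" using cl[of t] B by (intro mult_left_mono) auto
    finally show ?thesis by (simp add: mult.commute)
  qed
  have maps: "\<Phi> w \<in> S" if w: "w \<in> S" for w
    unfolding S_def
  proof (intro CollectI allI conjI)
    fix t
    have "P (integral {0..cl t} (\<lambda>s. G s (apply_bcontfun w s))) = integral {0..cl t} (\<lambda>s. P (G s (apply_bcontfun w s)))"
      using integral_linear[OF iG[where w=w and t=t] P(1)] by (simp add: o_def)
    also have "\<dots> = integral {0..cl t} (\<lambda>s. G s (apply_bcontfun w s))"
      using w P(2) by (simp add: S_def)
    finally show "P (apply_bcontfun (\<Phi> w) t) = apply_bcontfun (\<Phi> w) t"
      by (simp add: \<Phi> F_def P.add P(3))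
    have "norm (integral {0..cl t} (\<lambda>s. G s (apply_bcontfun w s))) \<le> T * (L * (2 * a))"
    proof (rule nI[OF iG])
      fix s
      have "norm (apply_bcontfun w s) \<le> 2 * a" using w by (simp add: S_def)
      then have "norm (G s (apply_bcontfun w s)) \<le> L * norm (apply_bcontfun w s)"
        using lipL[of "apply_bcontfun w s" 0 s] a by (simp add: G0)
      also have "\<dots> \<le> L * (2 * a)" using w L by (intro mult_left_mono) (auto simp: S_def)
      finally show "norm (G s (apply_bcontfun w s)) \<le> L * (2 * a)" .
    qed (use L a in auto)
    also have "T * (L * (2 * a)) = (T * L) * (2 * a)" by simp
    also have "\<dots> \<le> (1 / 2) * (2 * a)" using TL a by (intro mult_right_mono) auto
    finally show "norm (apply_bcontfun (\<Phi> w) t) \<le> 2 * a"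
      unfolding \<Phi> F_def using norm_triangle_ineq[of u0 "integral {0..cl t} (\<lambda>s. G s (apply_bcontfun w s))"] by (simp add: a_def)
  qed
  have contr: "dist (\<Phi> v) (\<Phi> w) \<le> (1 / 2) * dist v w" if v: "v \<in> S" and w: "w \<in> S" for v w
  proof (rule dist_bound)
    fix t
    have "dist (apply_bcontfun (\<Phi> v) t) (apply_bcontfun (\<Phi> w) t)
      = norm (integral {0..cl t} (\<lambda>s. G s (apply_bcontfun v s) - G s (apply_bcontfun w s)))"
      unfolding \<Phi> F_def dist_norm by (simp add: Henstock_Kurzweil_Integration.integral_diff[OF iG iG])
    also have "\<dots> \<le> T * (L * dist v w)"
    proof (rule nI)
      show "(\<lambda>s. G s (apply_bcontfun v s) - G s (apply_bcontfun w s)) integrable_on {0..cl t}"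
        by (intro integrable_diff iG)
      fix s
      have "norm (G s (apply_bcontfun v s) - G s (apply_bcontfun w s)) \<le> L * norm (apply_bcontfun v s - apply_bcontfun w s)"
        using v w by (intro lipL) (auto simp: S_def)
      also have "\<dots> \<le> L * dist v w"
        using dist_bounded[of v s w] L by (intro mult_left_mono) (auto simp: dist_norm)
      finally show "norm (G s (apply_bcontfun v s) - G s (apply_bcontfun w s)) \<le> L * dist v w" .
    qed (use L in auto)
    also have "T * (L * dist v w) = (T * L) * dist v w" by simp
    also have "\<dots> \<le> (1 / 2) * dist v w" using TL by (intro mult_right_mono) auto
    finally show "dist (apply_bcontfun (\<Phi> v) t) (apply_bcontfun (\<Phi> w) t) \<le> (1 / 2) * dist v w" .
  qed
  have "\<exists>!w. w \<in> S \<and> \<Phi> w = w"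
    by (rule Banach_fix[OF complete, of "1/2"]) (use const maps contr in auto)
  then obtain w where w: "w \<in> S" "\<Phi> w = w" by blast
  show ?thesis
  proof (rule that[of "apply_bcontfun w"])
    show "continuous_on {0..T} (apply_bcontfun w)" by (rule cw)
    fix t assume t: "t \<in> {0..T}"
    show "P (apply_bcontfun w t) = apply_bcontfun w t" "norm (apply_bcontfun w t) \<le> 2 * norm u0"
      using w(1) by (auto simp: S_def a_def)
    show "apply_bcontfun w t = u0 + integral {0..t} (\<lambda>s. G s (apply_bcontfun w s))"
      using \<Phi>[of w t] unfolding w(2) F_def cl_id[OF t] .
  qed
qed

lemma integral_equation_derivative:
  fixes w :: "real \<Rightarrow> 'a::banach"
  assumes g: "continuous_on {0..T} g" and w: "\<And>t. t \<in> {0..T} \<Longrightarrow> w t = u0 + integral {0..t} g"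
    and t: "0 < t" "t < T"
  shows "(w has_vector_derivative g t) (at t)"
proof -
  have "((\<lambda>u. integral {0..u} g) has_vector_derivative g t) (at t within {0..T})"
    by (rule integral_has_vector_derivative[OF g]) (use t in auto)
  then have "((\<lambda>u. u0 + integral {0..u} g) has_vector_derivative g t) (at t within {0..T})"
    by (auto intro!: derivative_eq_intros)
  then have "(w has_vector_derivative g t) (at t within {0..T})"
    by (rule has_vector_derivative_transform[rotated 2]) (use t w in auto)
  then show ?thesis using t by (simp add: at_within_Icc_at)
qed

text \<open>Gronwall's argument: the squared distance times exp(-2 L t) does not increase and
  vanishes at 0. Both curves are bounded by compactness of the interval, so L exists and uniqueness
  is not confined to the ball of the contraction.\<close>

lemma picard_unique:
  fixes G :: "real \<Rightarrow> 'a::{banach, real_inner} \<Rightarrow> 'a"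
  assumes cont: "\<And>w. continuous_on {0..T} w \<Longrightarrow> continuous_on {0..T} (\<lambda>s. G s (w s))"
    and lip: "\<And>s u v. norm (G s u - G s v) \<le> K * ((norm u + norm v) + (norm u + norm v)\<^sup>2) * norm (u - v)"
    and K: "0 \<le> K"
    and v: "continuous_on {0..T} v" "\<And>t. t \<in> {0..T} \<Longrightarrow> v t = u0 + integral {0..t} (\<lambda>s. G s (v s))"
    and w: "continuous_on {0..T} w" "\<And>t. t \<in> {0..T} \<Longrightarrow> w t = u0 + integral {0..t} (\<lambda>s. G s (w s))"
    and t: "t \<in> {0..T}"
  shows "v t = w t"
proof -
  have "bounded (v ` {0..T})" "bounded (w ` {0..T})"
    by (intro compact_imp_bounded compact_continuous_image v w; simp)+
  then obtain R1 R2 where "\<And>s. s \<in> {0..T} \<Longrightarrow> norm (v s) \<le> R1" "\<And>s. s \<in> {0..T} \<Longrightarrow> norm (w s) \<le> R2"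
    unfolding bounded_iff by blast
  then obtain R where R: "\<And>s. s \<in> {0..T} \<Longrightarrow> norm (v s) + norm (w s) \<le> R"
    by (meson add_mono)
  define L where "L = K * (R + R\<^sup>2)"
  define f where "f s = (v s - w s) \<bullet> (v s - w s)" for s
  define h where "h s = f s * exp (- (2 * L) * s)" for s
  have vd: "(v has_vector_derivative G s (v s)) (at s)" and wd: "(w has_vector_derivative G s (w s)) (at s)" if "0 < s" "s < T" for s
    using integral_equation_derivative[OF cont[OF v(1)] v(2) that] integral_equation_derivative[OF cont[OF w(1)] w(2) that] by auto
  have "h t \<le> h 0"
  proof (cases "t = 0")
    case False
    then have t0: "0 < t" using t by simp
    show ?thesis
    proof (rule DERIV_nonpos_imp_decreasing_open[OF less_imp_le[OF t0]])
      fix s assume s: "0 < s" "s < t"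
      then have sT: "s < T" "s \<in> {0..T}" using t by auto
      let ?d = "2 * ((v s - w s) \<bullet> (G s (v s) - G s (w s)))"
      have "((\<lambda>s. v s - w s) has_vector_derivative (G s (v s) - G s (w s))) (at s)"
        by (intro derivative_intros vd wd s sT)
      then have "((\<lambda>s. v s - w s) has_derivative (\<lambda>x. x *\<^sub>R (G s (v s) - G s (w s)))) (at s)"
        by (simp add: has_vector_derivative_def)
      from has_derivative_inner[OF this this]
      have "(f has_real_derivative ?d) (at s)"
        unfolding f_def has_field_derivative_def by (rule has_derivative_eq_rhs) (auto simp: fun_eq_iff inner_commute algebra_simps)
      then have hd: "(h has_real_derivative (?d * exp (- (2 * L) * s) + (exp (- (2 * L) * s) * (- (2 * L))) * f s)) (at s)"
        unfolding h_def by (auto intro!: derivative_eq_intros)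
      have "(v s - w s) \<bullet> (G s (v s) - G s (w s)) \<le> norm (v s - w s) * norm (G s (v s) - G s (w s))"
        by (rule norm_cauchy_schwarz)
      also have "\<dots> \<le> norm (v s - w s) * (L * norm (v s - w s))"
      proof (intro mult_left_mono order_trans[OF lip] mult_right_mono)
        have "0 \<le> norm (v s) + norm (w s)" by simp
        then show "K * (norm (v s) + norm (w s) + (norm (v s) + norm (w s))\<^sup>2) \<le> L"
          unfolding L_def using R[OF sT(2)] K by (intro mult_left_mono add_mono power_mono) auto
      qed auto
      also have "\<dots> = L * f s" by (simp add: f_def power2_norm_eq_inner[symmetric] power2_eq_square)
      finally have "(?d - 2 * L * f s) * exp (- (2 * L) * s) \<le> 0"
        by (intro mult_nonpos_nonneg) auto
      then have "?d * exp (- (2 * L) * s) + (exp (- (2 * L) * s) * (- (2 * L))) * f s \<le> 0"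
        by (simp add: algebra_simps)
      with hd show "\<exists>y. (h has_real_derivative y) (at s) \<and> y \<le> 0" by blast
    next
      show "continuous_on {0..t} h" unfolding h_def f_def
        by (intro continuous_intros continuous_on_subset[OF v(1)] continuous_on_subset[OF w(1)]) (use t in auto)
    qed
  qed simp
  moreover have "v 0 = w 0" using v(2)[of 0] w(2)[of 0] t by simp
  ultimately have "f t * exp (- (2 * L) * t) \<le> 0" by (simp add: h_def f_def)
  then have "f t \<le> 0" by (simp add: mult_le_0_iff)
  then have "f t = 0" using inner_ge_zero[of "v t - w t"] unfolding f_def by linarith
  then show ?thesis by (simp add: f_def)
qed

section \<open>Conjugate symmetric functions\<close>

text \<open>Complex conjugation carried to the Fourier side; its fixed points are the transforms of
  real-valued functions.\<close>

definition conj_refl :: "l2 \<Rightarrow> l2" where "conj_refl u = conj_l2 (reflect u)"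

lemma bounded_linear_conj_refl: "bounded_linear conj_refl"
  unfolding conj_refl_def by (rule bounded_linear_compose[OF bounded_linear_conj_l2 bounded_linear_reflect])

lemma conj_refl_to_l2: "square_integrable f \<Longrightarrow> conj_refl (to_l2 f) = to_l2 (\<lambda>x. cnj (f (- x)))"
  by (simp add: conj_refl_def reflect_to_l2 conj_to_l2 square_integrable_reflect)

lemma conj_refl_eq: "conj_refl u = to_l2 (\<lambda>x. cnj (rep_l2 u (- x)))"
  using conj_refl_to_l2[OF square_integrable_rep_l2, of u] by simp

lemma conj_refl_multiply:
  assumes m: "m \<in> borel_measurable borel" "\<And>x. cmod (m x) \<le> K"
  shows "conj_refl (multiply m u) = multiply (\<lambda>x. cnj (m (- x))) (conj_refl u)"
proof -
  note [measurable] = m(1)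
  have "conj_refl (multiply m u) = to_l2 (\<lambda>x. cnj (m (- x) * rep_l2 u (- x)))"
    unfolding multiply_def by (rule conj_refl_to_l2[OF square_integrable_mult_bounded[OF square_integrable_rep_l2 m]])
  also have "\<dots> = multiply (\<lambda>x. cnj (m (- x))) (conj_refl u)"
    unfolding conj_refl_eq
    by (subst multiply_to_l2) (auto intro!: square_integrable_cnj square_integrable_reflect square_integrable_rep_l2)
  finally show ?thesis .
qed

text \<open>The substitution y -> - y; \<open>s\<close> is the parity of the kernel, 1 or -1 in the
  applications.\<close>

lemma conj_refl_kernel_op:
  assumes k: "kernel_bound k K" and s: "\<And>x y. k (- x) (- y) = s * k x y"
  shows "conj_refl (kernel_op k u v) = s *\<^sub>R kernel_op k (conj_refl u) (conj_refl v)"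
proof -
  let ?u = "\<lambda>x. cnj (rep_l2 u (- x))" and ?v = "\<lambda>x. cnj (rep_l2 v (- x))"
  have si: "square_integrable ?u" "square_integrable ?v"
    by (auto intro!: square_integrable_cnj square_integrable_reflect square_integrable_rep_l2)
  have "cnj (kernel_int k (rep_l2 u) (rep_l2 v) (- x)) = s *\<^sub>R kernel_int k ?u ?v x" for x
  proof -
    have "kernel_int k (rep_l2 u) (rep_l2 v) (- x) = \<bar>-1\<bar> *\<^sub>R (\<integral>y. complex_of_real (k (- x) (0 + (-1) * y)) * (rep_l2 u (0 + (-1) * y) * rep_l2 v (- x - (0 + (-1) * y))) \<partial>lborel)"
      unfolding kernel_int_def by (rule lborel_integral_real_affine) simp
    also have "\<dots> = (\<integral>y. complex_of_real s * (complex_of_real (k x y) * (rep_l2 u (- y) * rep_l2 v (- (x - y)))) \<partial>lborel)"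
      by (simp add: s mult.assoc)
    finally have "cnj (kernel_int k (rep_l2 u) (rep_l2 v) (- x)) = cnj (\<integral>y. complex_of_real s * (complex_of_real (k x y) * (rep_l2 u (- y) * rep_l2 v (- (x - y)))) \<partial>lborel)"
      by simp
    also have "\<dots> = (\<integral>y. complex_of_real s * (complex_of_real (k x y) * (?u y * ?v (x - y))) \<partial>lborel)"
      by (subst Bochner_Integration.integral_cnj[symmetric]) simp
    also have "\<dots> = complex_of_real s * kernel_int k ?u ?v x"
      unfolding kernel_int_def by (rule integral_mult_right_zero)
    finally show ?thesis by (simp add: scaleR_conv_of_real)
  qed
  moreover have "conj_refl (kernel_op k u v) = to_l2 (\<lambda>x. cnj (kernel_int k (rep_l2 u) (rep_l2 v) (- x)))"
    unfolding kernel_op_def by (intro conj_refl_to_l2 kernel_int_bound[OF k] square_integrable_rep_l2)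
  ultimately have "conj_refl (kernel_op k u v) = to_l2 (\<lambda>x. s *\<^sub>R kernel_int k ?u ?v x)" by simp
  also have "\<dots> = s *\<^sub>R to_l2 (kernel_int k ?u ?v)"
    by (rule to_l2_scaleR[OF kernel_int_bound(1)[OF k si]])
  also have "to_l2 (kernel_int k ?u ?v) = kernel_op k (conj_refl u) (conj_refl v)"
    unfolding conj_refl_eq by (rule kernel_op_to_l2[OF k si, symmetric])
  finally show ?thesis .
qed

lemma inj_fourier: "fourier f = fourier g \<longleftrightarrow> f = g"
  by (metis inv_fourier_fourier)

lemma real_valued_iff: "real_valued f \<longleftrightarrow> conj_refl (fourier f) = fourier f"
proof -
  have "real_valued f \<longleftrightarrow> conj_l2 f = f"
  proof
    assume "real_valued f"
    then have "AE x in lborel. cnj (rep_l2 f x) = rep_l2 f x"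
      unfolding real_valued_def by eventually_elim (simp add: Reals_cnj_iff)
    then show "conj_l2 f = f" unfolding conj_l2_def
      by (intro to_l2_eqI square_integrable_cnj square_integrable_rep_l2)
  next
    assume "conj_l2 f = f"
    with rep_l2_conj[of f] have "AE x in lborel. rep_l2 f x = cnj (rep_l2 f x)" by simp
    then show "real_valued f" unfolding real_valued_def by eventually_elim (simp add: Reals_cnj_iff)
  qed
  then show ?thesis unfolding conj_refl_def fourier_conj[symmetric] inj_fourier .
qed

section \<open>The Gevrey lift\<close>

definition gevrey_tr :: "real \<Rightarrow> l2 \<Rightarrow> l2" where "gevrey_tr \<sigma> f = to_l2 (gevrey_transform \<sigma> 2 f)"

lemma gevrey_transform_eq: "gevrey_transform \<sigma> 2 f = (\<lambda>\<xi>. complex_of_real (wt \<sigma> \<xi>) * rep_l2 (fourier f) \<xi>)"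
proof
  fix \<xi>
  have "cosh (\<sigma> * \<bar>\<xi>\<bar>) = cosh (\<sigma> * \<xi>)" by (cases "\<xi> \<ge> 0") auto
  moreover have "sqrt (1 + \<xi>\<^sup>2) powr 2 = (jb \<xi>)\<^sup>2"
    using powr_realpow[OF jb_pos[of \<xi>], of 2] by (simp add: jb_def)
  ultimately show "gevrey_transform \<sigma> 2 f \<xi> = complex_of_real (wt \<sigma> \<xi>) * rep_l2 (fourier f) \<xi>"
    by (simp add: gevrey_transform_def wt_def)
qed

lemma gevrey_norm_eq: "gevrey_norm \<sigma> 2 f = norm (gevrey_tr \<sigma> f)"
  by (simp add: gevrey_norm_def gevrey_tr_def)

lemma inverse_wt_measurable: "(\<lambda>x. complex_of_real (1 / wt \<sigma> x)) \<in> borel_measurable borel"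
  by measurable

lemma gevrey_lift_in_space: "gevrey_lift \<sigma> u \<in> gevrey_space \<sigma> 2"
  and gevrey_tr_lift [simp]: "gevrey_tr \<sigma> (gevrey_lift \<sigma> u) = u"
proof -
  have "AE x in lborel. rep_l2 (fourier (gevrey_lift \<sigma> u)) x = complex_of_real (1 / wt \<sigma> x) * rep_l2 u x"
    unfolding fourier_gevrey_lift by (intro rep_l2_multiply square_integrable_div_wt square_integrable_rep_l2)
  then have AE: "AE x in lborel. rep_l2 u x = gevrey_transform \<sigma> 2 (gevrey_lift \<sigma> u) x"
    unfolding gevrey_transform_eq by eventually_elim simp
  have si: "square_integrable (gevrey_transform \<sigma> 2 (gevrey_lift \<sigma> u))"
    by (rule square_integrable_cong_AE[OF square_integrable_rep_l2 _ AE]) (unfold gevrey_transform_eq, measurable)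
  then show "gevrey_lift \<sigma> u \<in> gevrey_space \<sigma> 2" by (simp add: gevrey_space_def)
  show "gevrey_tr \<sigma> (gevrey_lift \<sigma> u) = u" unfolding gevrey_tr_def
    by (rule to_l2_eqI[OF si]) (use AE in eventually_elim, simp)
qed

lemma gevrey_lift_tr:
  assumes "f \<in> gevrey_space \<sigma> 2" shows "gevrey_lift \<sigma> (gevrey_tr \<sigma> f) = f"
proof -
  have si: "square_integrable (\<lambda>\<xi>. complex_of_real (wt \<sigma> \<xi>) * rep_l2 (fourier f) \<xi>)"
    using assms by (simp add: gevrey_space_def gevrey_transform_eq)
  have "fourier (gevrey_lift \<sigma> (gevrey_tr \<sigma> f)) = to_l2 (\<lambda>x. complex_of_real (1 / wt \<sigma> x) * (complex_of_real (wt \<sigma> x) * rep_l2 (fourier f) x))"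
    unfolding fourier_gevrey_lift gevrey_tr_def gevrey_transform_eq
    by (rule multiply_to_l2[OF si inverse_wt_measurable])
  also have "\<dots> = to_l2 (rep_l2 (fourier f))" by (simp add: mult.assoc[symmetric] of_real_mult[symmetric] del: of_real_mult)
  finally show ?thesis by (simp add: inj_fourier)
qed

lemma inj_gevrey_lift: "gevrey_lift \<sigma> u = gevrey_lift \<sigma> v \<longleftrightarrow> u = v"
  by (metis gevrey_tr_lift)

lemma bounded_linear_gevrey_lift: "bounded_linear (gevrey_lift \<sigma>)"
  unfolding gevrey_lift_def
  by (rule bounded_linear_compose[OF bounded_linear_inv_fourier bounded_linear_multiply(1)[OF inverse_wt_measurable inverse_wt_le]])

lemma gevrey_tr_diff:
  assumes "f \<in> gevrey_space \<sigma> 2" "g \<in> gevrey_space \<sigma> 2"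
  shows "gevrey_tr \<sigma> (f - g) = gevrey_tr \<sigma> f - gevrey_tr \<sigma> g"
proof -
  interpret L: bounded_linear "gevrey_lift \<sigma>" by (rule bounded_linear_gevrey_lift)
  have "f - g = gevrey_lift \<sigma> (gevrey_tr \<sigma> f - gevrey_tr \<sigma> g)"
    using assms by (simp add: L.diff gevrey_lift_tr)
  then show ?thesis by (metis gevrey_tr_lift)
qed

text \<open>\<open>gevrey_tr\<close> respects differences and carries the Gevrey norm to the L^2
  norm, so continuity in the Gevrey space is continuity of an L^2 curve.\<close>

lemma gevrey_curve_iff:
  "gevrey_curve \<sigma> 2 T \<eta> \<longleftrightarrow> (\<forall>t\<in>{0..T}. \<eta> t \<in> gevrey_space \<sigma> 2) \<and> continuous_on {0..T} (\<lambda>t. gevrey_tr \<sigma> (\<eta> t))"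
proof -
  have "((\<lambda>t'. gevrey_norm \<sigma> 2 (\<eta> t' - \<eta> t)) \<longlongrightarrow> 0) (at t within {0..T}) \<longleftrightarrow>
      ((\<lambda>t. gevrey_tr \<sigma> (\<eta> t)) \<longlongrightarrow> gevrey_tr \<sigma> (\<eta> t)) (at t within {0..T})"
    if s: "\<forall>t\<in>{0..T}. \<eta> t \<in> gevrey_space \<sigma> 2" and t: "t \<in> {0..T}" for t
  proof -
    have "((\<lambda>t'. gevrey_norm \<sigma> 2 (\<eta> t' - \<eta> t)) \<longlongrightarrow> 0) (at t within {0..T}) \<longleftrightarrow>
      ((\<lambda>t'. dist (gevrey_tr \<sigma> (\<eta> t')) (gevrey_tr \<sigma> (\<eta> t))) \<longlongrightarrow> 0) (at t within {0..T})"
    proof (rule tendsto_cong)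
      show "\<forall>\<^sub>F t' in at t within {0..T}. gevrey_norm \<sigma> 2 (\<eta> t' - \<eta> t) = dist (gevrey_tr \<sigma> (\<eta> t')) (gevrey_tr \<sigma> (\<eta> t))"
        using s t by (auto simp: eventually_at_filter gevrey_norm_eq gevrey_tr_diff dist_norm)
    qed
    then show ?thesis by (rule trans[OF _ tendsto_dist_iff[symmetric]])
  qed
  then show ?thesis unfolding gevrey_curve_def continuous_on_def by blast
qed

lemma real_valued_gevrey_lift: "real_valued (gevrey_lift \<sigma> u) \<longleftrightarrow> conj_refl u = u"
proof -
  let ?m = "\<lambda>x. complex_of_real (1 / wt \<sigma> x)"
  have "conj_refl (multiply ?m u) = multiply ?m (conj_refl u)"
    using conj_refl_multiply[OF inverse_wt_measurable[of \<sigma>] inverse_wt_le[of \<sigma>], of u] by simp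
  then have "real_valued (gevrey_lift \<sigma> u) \<longleftrightarrow> fourier (gevrey_lift \<sigma> (conj_refl u)) = fourier (gevrey_lift \<sigma> u)"
    unfolding real_valued_iff fourier_gevrey_lift by simp
  then show ?thesis by (simp add: inj_fourier inj_gevrey_lift)
qed

section \<open>The free propagator\<close>

text \<open>\<open>l2\<close> is a vector space over the reals only, so linearity of the transform
  does not include this commutation, which Duhamel's formula needs.\<close>

lemma fourier_multiply_i: "fourier (multiply (\<lambda>x. \<i>) f) = multiply (\<lambda>x. \<i>) (fourier f)"
proof (rule fourier_cong_limit[where f=f and A="\<lambda>f. fourier (multiply (\<lambda>x. \<i>) f)" and B="\<lambda>f. multiply (\<lambda>x. \<i>) (fourier f)"])
  have bl: "bounded_linear (multiply (\<lambda>x. \<i>))" by (rule bounded_linear_multiply(1)[where K=1]) auto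
  show "continuous_on UNIV (\<lambda>f. fourier (multiply (\<lambda>x. \<i>) f))" "continuous_on UNIV (\<lambda>f. multiply (\<lambda>x. \<i>) (fourier f))"
    by (intro linear_continuous_on bounded_linear_compose[OF bounded_linear_fourier bl] bounded_linear_compose[OF bl bounded_linear_fourier])+
next
  fix f assume f: "integrable lborel f" "square_integrable f"
  have "fourier_integral (\<lambda>x. \<i> * f x) = (\<lambda>\<xi>. \<i> * fourier_integral f \<xi>)" by (simp add: fourier_integral_cmult fun_eq_iff)
  moreover have "integrable lborel (\<lambda>x. \<i> * f x)" using f by simp
  ultimately show "fourier (multiply (\<lambda>x. \<i>) (to_l2 f)) = multiply (\<lambda>x. \<i>) (fourier (to_l2 f))"
    using f by (simp add: multiply_to_l2 fourier_to_l2 square_integrable_cmult fourier_integral_norm_le)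
qed

context coeffs
begin

definition evol :: "real \<Rightarrow> l2 \<Rightarrow> l2" where
  "evol t = multiply (\<lambda>\<xi>. exp (- (\<i> * complex_of_real (t * phi \<xi>))))"

lemma evol_symbol: "(\<lambda>\<xi>. exp (- (\<i> * complex_of_real (t * phi \<xi>)))) \<in> borel_measurable borel"
  "cmod (exp (- (\<i> * complex_of_real (t * phi \<xi>)))) \<le> 1"
  by measurable

lemma bounded_linear_evol: "bounded_linear (evol t)"
  unfolding evol_def by (rule bounded_linear_multiply(1)[OF evol_symbol])

lemma square_integrable_evol: "square_integrable (\<lambda>\<xi>. exp (- (\<i> * complex_of_real (t * phi \<xi>))) * rep_l2 u \<xi>)"
  by (rule square_integrable_mult_bounded[OF square_integrable_rep_l2 evol_symbol])

lemma evol_evol: "evol s (evol t u) = evol (s + t) u"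
proof -
  have "evol s (evol t u) = multiply (\<lambda>\<xi>. exp (- (\<i> * complex_of_real (s * phi \<xi>))) * exp (- (\<i> * complex_of_real (t * phi \<xi>)))) u"
    unfolding evol_def by (rule multiply_multiply[OF square_integrable_evol evol_symbol(1)])
  also have "(\<lambda>\<xi>. exp (- (\<i> * complex_of_real (s * phi \<xi>))) * exp (- (\<i> * complex_of_real (t * phi \<xi>)))) = (\<lambda>\<xi>. exp (- (\<i> * complex_of_real ((s + t) * phi \<xi>))))"
    unfolding exp_add[symmetric] by (simp add: algebra_simps)
  finally show ?thesis by (simp add: evol_def)
qed

lemma evol_0 [simp]: "evol 0 u = u"
  by (simp add: evol_def multiply_def)

lemma norm_evol [simp]: "norm (evol t u) = norm u"
proof (rule antisym)
  have le: "norm (evol t u) \<le> norm u" for t u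
    unfolding evol_def using bounded_linear_multiply(2)[OF evol_symbol, of t u] by simp
  show "norm (evol t u) \<le> norm u" by (rule le)
  show "norm u \<le> norm (evol t u)" using le[of "-t" "evol t u"] by (simp add: evol_evol)
qed

text \<open>Dominated convergence, pointwise in \<xi>. Since \<open>phi\<close> may be unbounded,
  continuity in time is claimed for each fixed \<open>u\<close> and not in operator norm.\<close>

lemma evol_continuous_at: "isCont (\<lambda>t. evol t u) t"
proof (rule continuous_at_sequentiallyI)
  fix X assume X: "X \<longlonglongrightarrow> t"
  let ?e = "\<lambda>t \<xi>. exp (- (\<i> * complex_of_real (t * phi \<xi>)))"
  have "(\<lambda>n. \<integral>\<xi>. (cmod (?e (X n) \<xi> * rep_l2 u \<xi> - ?e t \<xi> * rep_l2 u \<xi>))\<^sup>2 \<partial>lborel) \<longlonglongrightarrow> (\<integral>\<xi>. 0 \<partial>(lborel :: real measure))"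
  proof (rule integral_dominated_convergence[where w="\<lambda>\<xi>. 4 * (cmod (rep_l2 u \<xi>))\<^sup>2"])
    show "integrable lborel (\<lambda>\<xi>. 4 * (cmod (rep_l2 u \<xi>))\<^sup>2)"
      using square_integrable_rep_l2[of u] by (simp add: square_integrable_def)
    show "AE \<xi> in lborel. (\<lambda>n. (cmod (?e (X n) \<xi> * rep_l2 u \<xi> - ?e t \<xi> * rep_l2 u \<xi>))\<^sup>2) \<longlonglongrightarrow> 0"
    proof (rule AE_I2)
      fix \<xi>
      have "(\<lambda>n. (cmod (?e (X n) \<xi> * rep_l2 u \<xi> - ?e t \<xi> * rep_l2 u \<xi>))\<^sup>2) \<longlonglongrightarrow> (cmod (?e t \<xi> * rep_l2 u \<xi> - ?e t \<xi> * rep_l2 u \<xi>))\<^sup>2"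
        by (intro tendsto_intros X)
      then show "(\<lambda>n. (cmod (?e (X n) \<xi> * rep_l2 u \<xi> - ?e t \<xi> * rep_l2 u \<xi>))\<^sup>2) \<longlonglongrightarrow> 0" by simp
    qed
    show "AE \<xi> in lborel. norm ((cmod (?e (X n) \<xi> * rep_l2 u \<xi> - ?e t \<xi> * rep_l2 u \<xi>))\<^sup>2) \<le> 4 * (cmod (rep_l2 u \<xi>))\<^sup>2" for n
    proof (rule AE_I2)
      fix \<xi>
      have "cmod (?e (X n) \<xi> * rep_l2 u \<xi> - ?e t \<xi> * rep_l2 u \<xi>) \<le> cmod (?e (X n) \<xi> * rep_l2 u \<xi>) + cmod (?e t \<xi> * rep_l2 u \<xi>)"
        by (rule norm_triangle_ineq4)
      also have "\<dots> = 2 * cmod (rep_l2 u \<xi>)" by (simp add: norm_mult)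
      finally have "(cmod (?e (X n) \<xi> * rep_l2 u \<xi> - ?e t \<xi> * rep_l2 u \<xi>))\<^sup>2 \<le> (2 * cmod (rep_l2 u \<xi>))\<^sup>2"
        by (rule power_mono) simp
      then show "norm ((cmod (?e (X n) \<xi> * rep_l2 u \<xi> - ?e t \<xi> * rep_l2 u \<xi>))\<^sup>2) \<le> 4 * (cmod (rep_l2 u \<xi>))\<^sup>2"
        by (simp add: power_mult_distrib)
    qed
  qed measurable
  moreover have "(norm (evol (X n) u - evol t u))\<^sup>2 = (\<integral>\<xi>. (cmod (?e (X n) \<xi> * rep_l2 u \<xi> - ?e t \<xi> * rep_l2 u \<xi>))\<^sup>2 \<partial>lborel)" for n
    unfolding evol_def multiply_def to_l2_diff[OF square_integrable_evol square_integrable_evol, symmetric]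
    by (rule norm_to_l2[OF square_integrable_diff[OF square_integrable_evol square_integrable_evol]])
  ultimately have "(\<lambda>n. (norm (evol (X n) u - evol t u))\<^sup>2) \<longlonglongrightarrow> 0" by simp
  then have "(\<lambda>n. sqrt ((norm (evol (X n) u - evol t u))\<^sup>2)) \<longlonglongrightarrow> sqrt 0" by (intro tendsto_intros)
  then have "(\<lambda>n. dist (evol (X n) u) (evol t u)) \<longlonglongrightarrow> 0" by (simp add: dist_norm)
  then show "(\<lambda>n. evol (X n) u) \<longlonglongrightarrow> evol t u" by (rule tendsto_dist_iff[THEN iffD2])
qed

text \<open>The operators are isometries, so a change of \<open>f\<close> is transmitted uniformly
  in time; strong continuity takes care of the change of \<open>g\<close>.\<close>

lemma continuous_on_evol:
  assumes g: "continuous_on A g" and f: "continuous_on A f"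
  shows "continuous_on A (\<lambda>s. evol (g s) (f s))"
  unfolding continuous_on_def
proof
  fix x assume x: "x \<in> A"
  interpret E: bounded_linear "evol t" for t by (rule bounded_linear_evol)
  have fx: "(f \<longlongrightarrow> f x) (at x within A)" and gx: "(g \<longlongrightarrow> g x) (at x within A)"
    using f g x by (auto simp: continuous_on_def)
  have "((\<lambda>s. evol (g s) (f s - f x)) \<longlongrightarrow> 0) (at x within A)"
  proof (rule tendsto_norm_zero_cancel)
    have "((\<lambda>s. norm (f s - f x)) \<longlongrightarrow> norm (f x - f x)) (at x within A)" by (intro tendsto_intros fx)
    then show "((\<lambda>s. norm (evol (g s) (f s - f x))) \<longlongrightarrow> 0) (at x within A)" by simp
  qed
  moreover have "((\<lambda>s. evol (g s) (f x)) \<longlongrightarrow> evol (g x) (f x)) (at x within A)"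
    by (rule isCont_tendsto_compose[OF evol_continuous_at gx])
  ultimately have "((\<lambda>s. evol (g s) (f s - f x) + evol (g s) (f x)) \<longlongrightarrow> 0 + evol (g x) (f x)) (at x within A)"
    by (rule tendsto_add)
  then show "((\<lambda>s. evol (g s) (f s)) \<longlongrightarrow> evol (g x) (f x)) (at x within A)"
    by (simp add: E.diff)
qed

lemma propagator_gevrey_lift: "propagator \<gamma>1 \<gamma>2 \<delta>1 \<delta>2 t (gevrey_lift \<sigma> u) = gevrey_lift \<sigma> (evol t u)"
proof -
  let ?m = "\<lambda>x. complex_of_real (1 / wt \<sigma> x)"
  have "fourier (propagator \<gamma>1 \<gamma>2 \<delta>1 \<delta>2 t (gevrey_lift \<sigma> u)) = evol t (multiply ?m u)"
    unfolding propagator_def fourier_multiplier_eq fourier_gevrey_lift evol_def ..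
  also have "\<dots> = multiply (\<lambda>\<xi>. exp (- (\<i> * complex_of_real (t * phi \<xi>))) * ?m \<xi>) u"
    unfolding evol_def by (rule multiply_multiply[OF square_integrable_div_wt[OF square_integrable_rep_l2] evol_symbol(1)])
  also have "\<dots> = multiply ?m (evol t u)"
    unfolding evol_def by (subst multiply_multiply[OF square_integrable_evol inverse_wt_measurable]) (simp add: mult.commute)
  finally show ?thesis unfolding fourier_gevrey_lift[symmetric] inj_fourier .
qed

lemma nonlinearity_gevrey_lift: "nonlinearity (7/48) \<gamma>1 \<delta>1 (gevrey_lift \<sigma> u) = gevrey_lift \<sigma> (nonlin \<sigma> u)"
  using fourier_nonlinearity[of \<sigma> u] unfolding fourier_gevrey_lift[symmetric] inj_fourier .

lemma multiply_i_gevrey_lift: "multiply (\<lambda>x. \<i>) (gevrey_lift \<sigma> u) = gevrey_lift \<sigma> (multiply (\<lambda>x. \<i>) u)"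
proof -
  let ?m = "\<lambda>x. complex_of_real (1 / wt \<sigma> x)"
  have "fourier (multiply (\<lambda>x. \<i>) (gevrey_lift \<sigma> u)) = multiply (\<lambda>x. \<i> * ?m x) u"
    unfolding fourier_multiply_i fourier_gevrey_lift
    by (rule multiply_multiply[OF square_integrable_div_wt[OF square_integrable_rep_l2]]) simp
  also have "\<dots> = multiply ?m (multiply (\<lambda>x. \<i>) u)"
    by (subst multiply_multiply[OF square_integrable_cmult[OF square_integrable_rep_l2] inverse_wt_measurable]) (simp add: mult.commute)
  finally show ?thesis unfolding fourier_gevrey_lift[symmetric] inj_fourier .
qed

section \<open>Local Lipschitz continuity and symmetry of the nonlinearity\<close>

definition bil_const :: real where "bil_const = 6 / kap * jb_const"
definition tri_const :: real where "tri_const = (2 / kap * jb_const) * (4 * jb_const)"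

lemma bil_const_nonneg: "0 \<le> bil_const" and tri_const_nonneg: "0 \<le> tri_const"
  by (simp_all add: bil_const_def tri_const_def jb_const_nonneg)

lemma norm_B: "norm (kernel_op (kB \<sigma>) u v) \<le> bil_const * norm u * norm v"
  unfolding bil_const_def by (rule norm_kernel_op[OF kernel_bound_kB])

lemma norm_D: "norm (kernel_op (kD \<sigma>) u (kernel_op (kC \<sigma>) v w)) \<le> tri_const * norm u * norm v * norm w"
proof -
  have "norm (kernel_op (kD \<sigma>) u (kernel_op (kC \<sigma>) v w)) \<le> 2 / kap * jb_const * norm u * norm (kernel_op (kC \<sigma>) v w)"
    by (rule norm_kernel_op[OF kernel_bound_kD])
  also have "\<dots> \<le> 2 / kap * jb_const * norm u * (4 * jb_const * norm v * norm w)"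
    by (intro mult_left_mono norm_kernel_op[OF kernel_bound_kC]) (auto simp: jb_const_nonneg)
  finally show ?thesis by (simp add: tri_const_def mult_ac)
qed

definition lip_const :: real where "lip_const = bil_const + 2 * tri_const"

lemma lip_const_nonneg: "0 \<le> lip_const" by (simp add: lip_const_def bil_const_nonneg tri_const_nonneg)

text \<open>Telescoping of the quadratic and the cubic expression; the prefactors 1/(2 pi) and 1/(32
  pi^2) are at most 1 and are given away.\<close>

lemma nonlin_lipschitz:
  "norm (nonlin \<sigma> u - nonlin \<sigma> v) \<le> lip_const * ((norm u + norm v) + (norm u + norm v)\<^sup>2) * norm (u - v)"
proof -
  interpret B: bounded_bilinear "kernel_op (kB \<sigma>)" by (rule bounded_bilinear_kernel_op[OF kernel_bound_kB])
  interpret C: bounded_bilinear "kernel_op (kC \<sigma>)" by (rule bounded_bilinear_kernel_op[OF kernel_bound_kC])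
  interpret D: bounded_bilinear "kernel_op (kD \<sigma>)" by (rule bounded_bilinear_kernel_op[OF kernel_bound_kD])
  let ?B = "kernel_op (kB \<sigma>)" and ?D = "\<lambda>u v w. kernel_op (kD \<sigma>) u (kernel_op (kC \<sigma>) v w)"
  let ?R = "norm u + norm v"
  have b: "norm (?B u u - ?B v v) \<le> bil_const * ?R * norm (u - v)"
  proof -
    have "?B u u - ?B v v = ?B (u - v) u + ?B v (u - v)" by (simp add: B.diff_left B.diff_right)
    also have "norm \<dots> \<le> bil_const * norm (u - v) * norm u + bil_const * norm v * norm (u - v)"
      by (intro norm_triangle_mono norm_B)
    finally show ?thesis by (simp add: algebra_simps)
  qed
  have d: "norm (?D u u u - ?D v v v) \<le> 2 * tri_const * ?R\<^sup>2 * norm (u - v)"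
  proof -
    have "?D u u u - ?D v v v = ?D (u - v) u u + (?D v (u - v) u + ?D v v (u - v))"
      by (simp add: D.diff_left D.diff_right C.diff_left C.diff_right)
    also have "norm \<dots> \<le> tri_const * norm (u - v) * norm u * norm u + (tri_const * norm v * norm (u - v) * norm u + tri_const * norm v * norm v * norm (u - v))"
      by (intro norm_triangle_mono norm_D)
    also have "\<dots> = tri_const * norm (u - v) * (norm u * norm u + norm v * norm u + norm v * norm v)"
      by (simp add: algebra_simps)
    also have "\<dots> \<le> tri_const * norm (u - v) * (2 * ?R\<^sup>2)"
      using mult_nonneg_nonneg[OF norm_ge_zero[of u] norm_ge_zero[of v]] zero_le_square[of "norm u"] zero_le_square[of "norm v"]
      by (intro mult_left_mono mult_nonneg_nonneg tri_const_nonneg) (auto simp: power2_eq_square algebra_simps)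
    finally show ?thesis by (simp add: mult_ac)
  qed
  have e: "nonlin \<sigma> u - nonlin \<sigma> v = (1 / (2 * pi)) *\<^sub>R (?B u u - ?B v v) - (1 / (32 * pi\<^sup>2)) *\<^sub>R (?D u u u - ?D v v v)"
    by (simp add: nonlin_def scaleR_diff_right)
  have "norm (nonlin \<sigma> u - nonlin \<sigma> v) \<le> norm ((1 / (2 * pi)) *\<^sub>R (?B u u - ?B v v)) + norm ((1 / (32 * pi\<^sup>2)) *\<^sub>R (?D u u u - ?D v v v))"
    unfolding e by (rule norm_triangle_ineq4)
  also have "\<dots> \<le> norm (?B u u - ?B v v) + norm (?D u u u - ?D v v v)"
  proof -
    have p: "1 \<le> pi" using pi_gt3 by simp
    then have "1 \<le> pi\<^sup>2" by (simp add: one_le_power)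
    then have "1 \<le> 32 * pi\<^sup>2" by linarith
    with p show ?thesis unfolding norm_scaleR by (intro add_mono mult_left_le_one_le) auto
  qed
  also have "\<dots> \<le> bil_const * ?R * norm (u - v) + 2 * tri_const * ?R\<^sup>2 * norm (u - v)" by (intro add_mono b d)
  also have "\<dots> = (bil_const * ?R + 2 * tri_const * ?R\<^sup>2) * norm (u - v)" by (simp add: algebra_simps)
  also have "\<dots> \<le> (lip_const * (?R + ?R\<^sup>2)) * norm (u - v)"
    unfolding lip_const_def distrib_left using bil_const_nonneg tri_const_nonneg
    by (intro mult_right_mono add_mono) auto
  finally show ?thesis .
qed

lemma nonlin_0: "nonlin \<sigma> 0 = 0"
proof -
  interpret B: bounded_bilinear "kernel_op (kB \<sigma>)" by (rule bounded_bilinear_kernel_op[OF kernel_bound_kB])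
  interpret D: bounded_bilinear "kernel_op (kD \<sigma>)" by (rule bounded_bilinear_kernel_op[OF kernel_bound_kD])
  show ?thesis by (simp add: nonlin_def B.zero_left D.zero_left)
qed

lemma continuous_on_nonlin:
  assumes "continuous_on A f" shows "continuous_on A (\<lambda>s. nonlin \<sigma> (f s))"
  unfolding nonlin_def
  by (intro continuous_intros bounded_bilinear.continuous_on[OF bounded_bilinear_kernel_op[OF kernel_bound_kB]]
      bounded_bilinear.continuous_on[OF bounded_bilinear_kernel_op[OF kernel_bound_kC]]
      bounded_bilinear.continuous_on[OF bounded_bilinear_kernel_op[OF kernel_bound_kD]] assms)

text \<open>\<open>tau\<close> and \<open>psi\<close> are odd, so \<open>kB\<close> and
  \<open>kD\<close> change sign when both frequencies are reflected, while \<open>kC\<close> is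
  even. The resulting minus sign is undone by the factor -i in \<open>rhs\<close>.\<close>

lemma conj_refl_nonlin: "conj_refl (nonlin \<sigma> u) = - nonlin \<sigma> (conj_refl u)"
proof -
  interpret R: bounded_linear conj_refl by (rule bounded_linear_conj_refl)
  have d: "- x - - y = - (x - y)" for x y :: real by simp
  have B: "kB \<sigma> (- x) (- y) = (-1) * kB \<sigma> x y" for x y
  proof -
    have "W * (- t + 7/48 * - p * m) / D = (-1) * (W * (t + 7/48 * p * m) / D)" for W t p m D :: real
      by (simp add: algebra_simps add_divide_distrib diff_divide_distrib)
    then show ?thesis unfolding kB_def d wt_uminus tau_uminus psi_uminus minus_mult_minus .
  qed
  have C: "kC \<sigma> (- x) (- y) = 1 * kC \<sigma> x y" for x y
    unfolding kC_def d wt_uminus by simp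
  have D: "kD \<sigma> (- x) (- y) = (-1) * kD \<sigma> x y" for x y
    unfolding kD_def d wt_uminus psi_uminus jb_uminus mult_minus_right cosh_minus by simp
  show ?thesis unfolding nonlin_def R.diff R.scaleR
    conj_refl_kernel_op[OF kernel_bound_kB B] conj_refl_kernel_op[OF kernel_bound_kD D] conj_refl_kernel_op[OF kernel_bound_kC C]
    by simp
qed

lemma conj_refl_evol: "conj_refl (evol t u) = evol t (conj_refl u)"
  unfolding evol_def by (subst conj_refl_multiply[OF evol_symbol]) (simp add: exp_cnj)

text \<open>The right-hand side of the equation in the interaction picture \<open>w(t) = e\<^sup>i\<^sup>t\<^sup>\<phi> u(t)\<close>.\<close>

definition rhs :: "real \<Rightarrow> real \<Rightarrow> l2 \<Rightarrow> l2" where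
  "rhs \<sigma> s u = evol (- s) (multiply (\<lambda>x. - \<i>) (nonlin \<sigma> (evol s u)))"

lemma bl_minus_i: "bounded_linear (multiply (\<lambda>x. - \<i>))" "norm (multiply (\<lambda>x. - \<i>) u) \<le> norm u"
  using bounded_linear_multiply[of "\<lambda>x. - \<i>" 1] by auto

lemma rhs_lipschitz:
  "norm (rhs \<sigma> s u - rhs \<sigma> s v) \<le> lip_const * ((norm u + norm v) + (norm u + norm v)\<^sup>2) * norm (u - v)"
proof -
  interpret E: bounded_linear "evol t" for t by (rule bounded_linear_evol)
  interpret I: bounded_linear "multiply (\<lambda>x. - \<i>)" by (rule bl_minus_i)
  have "norm (rhs \<sigma> s u - rhs \<sigma> s v) = norm (multiply (\<lambda>x. - \<i>) (nonlin \<sigma> (evol s u) - nonlin \<sigma> (evol s v)))"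
    unfolding rhs_def E.diff[symmetric] I.diff[symmetric] by simp
  also have "\<dots> \<le> norm (nonlin \<sigma> (evol s u) - nonlin \<sigma> (evol s v))" by (rule bl_minus_i)
  also have "\<dots> \<le> lip_const * ((norm u + norm v) + (norm u + norm v)\<^sup>2) * norm (u - v)"
    using nonlin_lipschitz[of \<sigma> "evol s u" "evol s v"] by (simp add: E.diff[symmetric])
  finally show ?thesis .
qed

lemma rhs_0: "rhs \<sigma> s 0 = 0"
proof -
  interpret E: bounded_linear "evol t" for t by (rule bounded_linear_evol)
  interpret I: bounded_linear "multiply (\<lambda>x. - \<i>)" by (rule bl_minus_i)
  show ?thesis by (simp add: rhs_def E.zero I.zero nonlin_0)
qed

lemma continuous_on_rhs:
  assumes "continuous_on A w" shows "continuous_on A (\<lambda>s. rhs \<sigma> s (w s))"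
  unfolding rhs_def
  by (intro continuous_on_evol continuous_on_nonlin bounded_linear.continuous_on[OF bl_minus_i(1)] assms continuous_intros)

lemma conj_refl_rhs:
  assumes "conj_refl u = u" shows "conj_refl (rhs \<sigma> s u) = rhs \<sigma> s u"
proof -
  interpret I: bounded_linear "multiply (\<lambda>x. - \<i>)" by (rule bl_minus_i)
  have s: "square_integrable (\<lambda>x. c * rep_l2 u x)" for c u by (rule square_integrable_cmult[OF square_integrable_rep_l2])
  have "multiply (\<lambda>x. \<i>) (- f) = multiply (\<lambda>x. - \<i>) f" for f
  proof -
    interpret J: bounded_linear "multiply (\<lambda>x. \<i>)" by (rule bounded_linear_multiply(1)[where K=1]) auto
    show ?thesis unfolding J.neg using to_l2_scaleR[OF s[of \<i> f], of "-1"] by (simp add: multiply_def)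
  qed
  moreover have "conj_refl (multiply (\<lambda>x. - \<i>) f) = multiply (\<lambda>x. \<i>) (conj_refl f)" for f
    by (subst conj_refl_multiply[where K=1]) auto
  ultimately show ?thesis
    by (simp add: rhs_def conj_refl_evol conj_refl_nonlin assms)
qed

end

section \<open>Solutions in the interaction picture\<close>

context coeffs
begin

lemma evol_commute_minus_i: "evol t (multiply (\<lambda>x. - \<i>) u) = multiply (\<lambda>x. - \<i>) (evol t u)"
proof -
  have "evol t (multiply (\<lambda>x. - \<i>) u) = multiply (\<lambda>\<xi>. exp (- (\<i> * complex_of_real (t * phi \<xi>))) * (- \<i>)) u"
    unfolding evol_def by (rule multiply_multiply[OF square_integrable_cmult[OF square_integrable_rep_l2] evol_symbol(1)])
  also have "\<dots> = multiply (\<lambda>x. - \<i>) (evol t u)"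
    unfolding evol_def by (subst multiply_multiply[OF square_integrable_evol]) (simp_all add: mult.commute)
  finally show ?thesis .
qed

lemma minus_i_eq: "multiply (\<lambda>x. - \<i>) f = - multiply (\<lambda>x. \<i>) f"
  using to_l2_scaleR[OF square_integrable_cmult[OF square_integrable_rep_l2], of "-1" \<i> f] by (simp add: multiply_def)

text \<open>Lift, propagator and multiplication by \<i> are bounded linear maps that commute as
  required, so they pass through the integral; applying \<open>evol (- t)\<close> yields the
  integral equation of the interaction picture. The integral in \<open>duhamel\<close> is
  existentially quantified but unique.\<close>

lemma duhamel_iff:
  assumes u: "continuous_on {0..T} u" and t: "t \<in> {0..T}"
    and \<eta>: "\<And>s. s \<in> {0..T} \<Longrightarrow> \<eta> s = gevrey_lift \<sigma> (u s)"
  shows "duhamel (7/48) \<gamma>1 \<gamma>2 \<delta>1 \<delta>2 (gevrey_lift \<sigma> u0) \<eta> t \<longleftrightarrow>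
    evol (- t) (u t) = u0 + integral {0..t} (\<lambda>s. rhs \<sigma> s (evol (- s) (u s)))"
proof -
  interpret L: bounded_linear "gevrey_lift \<sigma>" by (rule bounded_linear_gevrey_lift)
  interpret E: bounded_linear "evol s" for s by (rule bounded_linear_evol)
  interpret I: bounded_linear "multiply (\<lambda>x. - \<i>)" by (rule bl_minus_i)
  have sub: "{0..t} \<subseteq> {0..T}" using t by auto
  define K where "K = integral {0..t} (\<lambda>s. evol (t - s) (nonlin \<sigma> (u s)))"
  have "(\<lambda>s. evol (t - s) (nonlin \<sigma> (u s))) integrable_on {0..t}"
    by (intro integrable_continuous_interval continuous_on_evol continuous_on_nonlin continuous_on_subset[OF u sub] continuous_intros)
  then have hK: "((\<lambda>s. evol (t - s) (nonlin \<sigma> (u s))) has_integral K) {0..t}"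
    unfolding K_def by (rule integrable_integral)
  have hL: "((\<lambda>s. propagator \<gamma>1 \<gamma>2 \<delta>1 \<delta>2 (t - s) (nonlinearity (7/48) \<gamma>1 \<delta>1 (\<eta> s))) has_integral gevrey_lift \<sigma> K) {0..t}"
  proof (rule has_integral_eq[OF _ has_integral_linear[OF hK bounded_linear_gevrey_lift, of \<sigma>]])
    fix s assume "s \<in> {0..t}"
    then show "(gevrey_lift \<sigma> \<circ> (\<lambda>s. evol (t - s) (nonlin \<sigma> (u s)))) s = propagator \<gamma>1 \<gamma>2 \<delta>1 \<delta>2 (t - s) (nonlinearity (7/48) \<gamma>1 \<delta>1 (\<eta> s))"
      using sub \<eta> by (auto simp: nonlinearity_gevrey_lift propagator_gevrey_lift)
  qed
  have "duhamel (7/48) \<gamma>1 \<gamma>2 \<delta>1 \<delta>2 (gevrey_lift \<sigma> u0) \<eta> t \<longleftrightarrow>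
    \<eta> t = propagator \<gamma>1 \<gamma>2 \<delta>1 \<delta>2 t (gevrey_lift \<sigma> u0) - multiply (\<lambda>x. \<i>) (gevrey_lift \<sigma> K)"
    unfolding duhamel_def using hL has_integral_unique by blast
  also have "\<dots> \<longleftrightarrow> gevrey_lift \<sigma> (u t) = gevrey_lift \<sigma> (evol t u0 + multiply (\<lambda>x. - \<i>) K)"
    unfolding \<eta>[OF t] propagator_gevrey_lift multiply_i_gevrey_lift minus_i_eq by (simp add: L.diff)
  also have "\<dots> \<longleftrightarrow> u t = evol t u0 + multiply (\<lambda>x. - \<i>) K" by (rule inj_gevrey_lift)
  also have "\<dots> \<longleftrightarrow> evol (- t) (u t) = evol (- t) (evol t u0 + multiply (\<lambda>x. - \<i>) K)"
    by (metis evol_evol evol_0 add.right_inverse)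
  also have "evol (- t) (evol t u0 + multiply (\<lambda>x. - \<i>) K) = u0 + evol (- t) (multiply (\<lambda>x. - \<i>) K)"
    by (simp add: E.add evol_evol)
  also have "evol (- t) (multiply (\<lambda>x. - \<i>) K) = integral {0..t} (\<lambda>s. rhs \<sigma> s (evol (- s) (u s)))"
  proof (rule integral_unique[symmetric])
    have "((\<lambda>s. evol (- t) (multiply (\<lambda>x. - \<i>) (evol (t - s) (nonlin \<sigma> (u s))))) has_integral evol (- t) (multiply (\<lambda>x. - \<i>) K)) {0..t}"
      using has_integral_linear[OF has_integral_linear[OF hK bl_minus_i(1)] bounded_linear_evol[of "-t"]] by (simp add: o_def)
    moreover have "evol (- t) (multiply (\<lambda>x. - \<i>) (evol (t - s) (nonlin \<sigma> (u s)))) = rhs \<sigma> s (evol (- s) (u s))" for s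
      by (simp add: rhs_def evol_evol evol_commute_minus_i[symmetric])
    ultimately show "((\<lambda>s. rhs \<sigma> s (evol (- s) (u s))) has_integral evol (- t) (multiply (\<lambda>x. - \<i>) K)) {0..t}"
      by simp
  qed
  finally show ?thesis .
qed

text \<open>Reduces solutions of the Cauchy problem to continuous conjugate symmetric curves with an
  integral equation in L^2, the setting of the abstract existence and uniqueness results.\<close>

lemma solution_iff:
  assumes \<eta>0: "\<eta>0 \<in> gevrey_space \<sigma> 2"
  shows "solution (7/48) \<gamma>1 \<gamma>2 \<delta>1 \<delta>2 \<sigma> T \<eta>0 \<eta> \<longleftrightarrow>
    (\<exists>w. continuous_on {0..T} w \<and> (\<forall>t\<in>{0..T}. \<eta> t = gevrey_lift \<sigma> (evol t (w t)) \<and> conj_refl (w t) = w t \<and>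
       w t = gevrey_tr \<sigma> \<eta>0 + integral {0..t} (\<lambda>s. rhs \<sigma> s (w s))))" (is "_ \<longleftrightarrow> ?R")
proof
  assume "solution (7/48) \<gamma>1 \<gamma>2 \<delta>1 \<delta>2 \<sigma> T \<eta>0 \<eta>"
  then have gc: "\<forall>t\<in>{0..T}. \<eta> t \<in> gevrey_space \<sigma> 2" "continuous_on {0..T} (\<lambda>t. gevrey_tr \<sigma> (\<eta> t))"
    and rv: "\<forall>t\<in>{0..T}. real_valued (\<eta> t)" and du: "\<forall>t\<in>{0..T}. duhamel (7/48) \<gamma>1 \<gamma>2 \<delta>1 \<delta>2 \<eta>0 \<eta> t"
    unfolding solution_def gevrey_curve_iff by auto
  define w where "w t = evol (- t) (gevrey_tr \<sigma> (\<eta> t))" for t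
  have e: "\<eta> t = gevrey_lift \<sigma> (gevrey_tr \<sigma> (\<eta> t))" if "t \<in> {0..T}" for t
    using gc(1) that by (simp add: gevrey_lift_tr)
  show ?R
  proof (intro exI[of _ w] conjI ballI)
    show "continuous_on {0..T} w" unfolding w_def by (intro continuous_on_evol gc continuous_intros)
    fix t assume t: "t \<in> {0..T}"
    show "\<eta> t = gevrey_lift \<sigma> (evol t (w t))" using e[OF t] by (simp add: w_def evol_evol)
    have "conj_refl (gevrey_tr \<sigma> (\<eta> t)) = gevrey_tr \<sigma> (\<eta> t)"
      using rv t e[OF t] real_valued_gevrey_lift by metis
    then show "conj_refl (w t) = w t" by (simp add: w_def conj_refl_evol)
    have "duhamel (7/48) \<gamma>1 \<gamma>2 \<delta>1 \<delta>2 (gevrey_lift \<sigma> (gevrey_tr \<sigma> \<eta>0)) \<eta> t"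
      using du t \<eta>0 by (simp add: gevrey_lift_tr)
    from duhamel_iff[THEN iffD1, OF gc(2) t e this]
    show "w t = gevrey_tr \<sigma> \<eta>0 + integral {0..t} (\<lambda>s. rhs \<sigma> s (w s))" by (simp add: w_def)
  qed
next
  assume ?R
  then obtain w where w: "continuous_on {0..T} w" and e: "\<And>t. t \<in> {0..T} \<Longrightarrow> \<eta> t = gevrey_lift \<sigma> (evol t (w t))"
    and c: "\<And>t. t \<in> {0..T} \<Longrightarrow> conj_refl (w t) = w t"
    and i: "\<And>t. t \<in> {0..T} \<Longrightarrow> w t = gevrey_tr \<sigma> \<eta>0 + integral {0..t} (\<lambda>s. rhs \<sigma> s (w s))" by blast
  have cu: "continuous_on {0..T} (\<lambda>t. evol t (w t))" by (intro continuous_on_evol w continuous_intros)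
  show "solution (7/48) \<gamma>1 \<gamma>2 \<delta>1 \<delta>2 \<sigma> T \<eta>0 \<eta>"
    unfolding solution_def gevrey_curve_iff
  proof (intro conjI ballI)
    show "continuous_on {0..T} (\<lambda>t. gevrey_tr \<sigma> (\<eta> t))"
      using cu by (subst continuous_on_cong[OF refl, where g="\<lambda>t. evol t (w t)"]) (auto simp: e)
    fix t assume t: "t \<in> {0..T}"
    show "\<eta> t \<in> gevrey_space \<sigma> 2" by (simp add: e[OF t] gevrey_lift_in_space)
    show "real_valued (\<eta> t)" by (simp add: e[OF t] real_valued_gevrey_lift conj_refl_evol c[OF t])
    have "duhamel (7/48) \<gamma>1 \<gamma>2 \<delta>1 \<delta>2 (gevrey_lift \<sigma> (gevrey_tr \<sigma> \<eta>0)) \<eta> t"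
      by (rule duhamel_iff[THEN iffD2, OF cu t e]) (use i[OF t] in \<open>auto simp: evol_evol\<close>)
    then show "duhamel (7/48) \<gamma>1 \<gamma>2 \<delta>1 \<delta>2 \<eta>0 \<eta> t" using \<eta>0 by (simp add: gevrey_lift_tr)
  qed
qed

text \<open>With a the norm of the data, 4 a + (4 a)^2 <= 16 (1 + a)^2 cancels the denominator of
  \<open>local_time\<close>, and 16/32 = 1/2 is the contraction condition. The + 1 keeps the
  quotient positive.\<close>

definition time_const :: real where "time_const = 1 / (32 * (lip_const + 1))"

lemma time_const_pos: "0 < time_const"
  using lip_const_nonneg by (simp add: time_const_def)

lemma local_time_small:
  assumes "0 < c" "c \<le> time_const"
  shows "local_time c \<sigma> \<eta>0 * (lip_const * (4 * norm (gevrey_tr \<sigma> \<eta>0) + (4 * norm (gevrey_tr \<sigma> \<eta>0))\<^sup>2)) \<le> 1 / 2"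
    "0 < local_time c \<sigma> \<eta>0"
proof -
  define a where "a = norm (gevrey_tr \<sigma> \<eta>0)"
  have a: "0 \<le> a" by (simp add: a_def)
  then have p: "0 < (1 + a)\<^sup>2" by simp
  have lt: "local_time c \<sigma> \<eta>0 = c / (1 + a)\<^sup>2" by (simp add: local_time_def gevrey_norm_eq a_def)
  show "0 < local_time c \<sigma> \<eta>0" unfolding lt using assms p by simp
  have q: "4 * a + (4 * a)\<^sup>2 \<le> 16 * (1 + a)\<^sup>2" using a by (simp add: power2_eq_square algebra_simps)
  have "c * lip_const \<le> time_const * (lip_const + 1)" using assms lip_const_nonneg by (intro mult_mono) auto
  also have "\<dots> = 1 / 32" using lip_const_nonneg by (simp add: time_const_def)
  finally have ck: "c * lip_const \<le> 1 / 32" .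
  have "c / (1 + a)\<^sup>2 * (lip_const * (4 * a + (4 * a)\<^sup>2)) \<le> c / (1 + a)\<^sup>2 * (lip_const * (16 * (1 + a)\<^sup>2))"
    using assms lip_const_nonneg p by (intro mult_left_mono q) auto
  also have "\<dots> = 16 * (c * lip_const)" using p by simp
  also have "\<dots> \<le> 1 / 2" using ck by simp
  finally show "local_time c \<sigma> \<eta>0 * (lip_const * (4 * norm (gevrey_tr \<sigma> \<eta>0) + (4 * norm (gevrey_tr \<sigma> \<eta>0))\<^sup>2)) \<le> 1 / 2"
    unfolding lt a_def .
qed

lemma local_solution:
  assumes c: "0 < c" "c \<le> time_const" and \<eta>0: "\<eta>0 \<in> gevrey_space \<sigma> 2" "real_valued \<eta>0"
    and T: "T = local_time c \<sigma> \<eta>0"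
  shows "\<exists>w. continuous_on {0..T} w \<and> (\<forall>t\<in>{0..T}. conj_refl (w t) = w t \<and>
    norm (w t) \<le> 2 * norm (gevrey_tr \<sigma> \<eta>0) \<and>
    w t = gevrey_tr \<sigma> \<eta>0 + integral {0..t} (\<lambda>s. rhs \<sigma> s (w s)))"
proof -
  have "conj_refl (gevrey_tr \<sigma> \<eta>0) = gevrey_tr \<sigma> \<eta>0"
    using \<eta>0 gevrey_lift_tr real_valued_gevrey_lift by metis
  note cr = this
  have small: "T * (lip_const * (4 * norm (gevrey_tr \<sigma> \<eta>0) + (4 * norm (gevrey_tr \<sigma> \<eta>0))\<^sup>2)) \<le> 1 / 2" and "0 < T"
    unfolding T by (intro local_time_small[OF c])+
  then have T0: "0 \<le> T" by simp
  show ?thesis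
  proof (rule picard_exists[where G="rhs \<sigma>" and P=conj_refl, OF T0 continuous_on_rhs rhs_lipschitz rhs_0 bounded_linear_conj_refl conj_refl_rhs cr lip_const_nonneg small])
    fix w assume w: "continuous_on {0..T} w" "\<And>t. t \<in> {0..T} \<Longrightarrow> conj_refl (w t) = w t"
      "\<And>t. t \<in> {0..T} \<Longrightarrow> norm (w t) \<le> 2 * norm (gevrey_tr \<sigma> \<eta>0)"
      "\<And>t. t \<in> {0..T} \<Longrightarrow> w t = gevrey_tr \<sigma> \<eta>0 + integral {0..t} (\<lambda>s. rhs \<sigma> s (w s))"
    show ?thesis using w by (intro exI[of _ w] conjI ballI) auto
  qed
qed

lemma solution_unique:
  assumes "continuous_on {0..T} v" "\<And>t. t \<in> {0..T} \<Longrightarrow> v t = u0 + integral {0..t} (\<lambda>s. rhs \<sigma> s (v s))"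
    "continuous_on {0..T} w" "\<And>t. t \<in> {0..T} \<Longrightarrow> w t = u0 + integral {0..t} (\<lambda>s. rhs \<sigma> s (w s))" "t \<in> {0..T}"
  shows "v t = w t"
  by (rule picard_unique[OF continuous_on_rhs rhs_lipschitz lip_const_nonneg assms])

lemma well_posed:
  assumes c: "0 < c" "c \<le> time_const" and \<eta>0: "\<eta>0 \<in> gevrey_space \<sigma> 2" "real_valued \<eta>0"
  shows "uniquely_solvable (7/48) \<gamma>1 \<gamma>2 \<delta>1 \<delta>2 \<sigma> (local_time c \<sigma> \<eta>0) \<eta>0"
proof -
  let ?T = "local_time c \<sigma> \<eta>0"
  obtain w where w: "continuous_on {0..?T} w" "\<And>t. t \<in> {0..?T} \<Longrightarrow> conj_refl (w t) = w t"
    and "\<And>t. t \<in> {0..?T} \<Longrightarrow> norm (w t) \<le> 2 * norm (gevrey_tr \<sigma> \<eta>0)"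
    and wi: "\<And>t. t \<in> {0..?T} \<Longrightarrow> w t = gevrey_tr \<sigma> \<eta>0 + integral {0..t} (\<lambda>s. rhs \<sigma> s (w s))"
    using local_solution[OF c \<eta>0 refl] by blast
  show ?thesis unfolding uniquely_solvable_def
  proof (intro exI[of _ "\<lambda>t. gevrey_lift \<sigma> (evol t (w t))"] conjI allI impI ballI)
    show "solution (7/48) \<gamma>1 \<gamma>2 \<delta>1 \<delta>2 \<sigma> ?T \<eta>0 (\<lambda>t. gevrey_lift \<sigma> (evol t (w t)))"
      unfolding solution_iff[OF \<eta>0(1)] using w wi by blast
    fix \<eta>' t assume "solution (7/48) \<gamma>1 \<gamma>2 \<delta>1 \<delta>2 \<sigma> ?T \<eta>0 \<eta>'" and t: "t \<in> {0..?T}"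
    then obtain v where v: "continuous_on {0..?T} v" "\<And>t. t \<in> {0..?T} \<Longrightarrow> \<eta>' t = gevrey_lift \<sigma> (evol t (v t))"
      "\<And>t. t \<in> {0..?T} \<Longrightarrow> v t = gevrey_tr \<sigma> \<eta>0 + integral {0..t} (\<lambda>s. rhs \<sigma> s (v s))"
      unfolding solution_iff[OF \<eta>0(1)] by blast
    show "\<eta>' t = gevrey_lift \<sigma> (evol t (w t))"
      using solution_unique[OF v(1,3) w(1) wi t] v(2)[OF t] by simp
  qed
qed

text \<open>The bound by twice the data is known for the Picard solution; uniqueness transfers it to
  the given one.\<close>

lemma solution_bound:
  assumes c: "0 < c" "c \<le> time_const" and \<eta>0: "\<eta>0 \<in> gevrey_space \<sigma> 2" "real_valued \<eta>0"
    and T: "T = local_time c \<sigma> \<eta>0" and sol: "solution (7/48) \<gamma>1 \<gamma>2 \<delta>1 \<delta>2 \<sigma> T \<eta>0 \<eta>"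
  obtains w where "continuous_on {0..T} w" "\<And>t. t \<in> {0..T} \<Longrightarrow> \<eta> t = gevrey_lift \<sigma> (evol t (w t))"
    "\<And>t. t \<in> {0..T} \<Longrightarrow> conj_refl (w t) = w t"
    "\<And>t. t \<in> {0..T} \<Longrightarrow> norm (w t) \<le> 2 * norm (gevrey_tr \<sigma> \<eta>0)"
    "\<And>t. t \<in> {0..T} \<Longrightarrow> w t = gevrey_tr \<sigma> \<eta>0 + integral {0..t} (\<lambda>s. rhs \<sigma> s (w s))"
proof -
  obtain w where w: "continuous_on {0..T} w" and "\<And>t. t \<in> {0..T} \<Longrightarrow> conj_refl (w t) = w t"
    and wn: "\<And>t. t \<in> {0..T} \<Longrightarrow> norm (w t) \<le> 2 * norm (gevrey_tr \<sigma> \<eta>0)"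
    and wi: "\<And>t. t \<in> {0..T} \<Longrightarrow> w t = gevrey_tr \<sigma> \<eta>0 + integral {0..t} (\<lambda>s. rhs \<sigma> s (w s))"
    using local_solution[OF c \<eta>0 T] by blast
  obtain v where v: "continuous_on {0..T} v" "\<And>t. t \<in> {0..T} \<Longrightarrow> \<eta> t = gevrey_lift \<sigma> (evol t (v t))"
      "\<And>t. t \<in> {0..T} \<Longrightarrow> conj_refl (v t) = v t"
      "\<And>t. t \<in> {0..T} \<Longrightarrow> v t = gevrey_tr \<sigma> \<eta>0 + integral {0..t} (\<lambda>s. rhs \<sigma> s (v s))"
    using sol unfolding solution_iff[OF \<eta>0(1)] by blast
  have vn: "norm (v t) \<le> 2 * norm (gevrey_tr \<sigma> \<eta>0)" if "t \<in> {0..T}" for t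
    using solution_unique[OF v(1,4) w wi that] wn[OF that] by simp
  show ?thesis by (rule that[OF v(1) v(2) v(3) vn v(4)])
qed

end

section \<open>Trilinear integrals over the plane\<close>

lemma distr_pairI:
  fixes T :: "real \<times> real \<Rightarrow> real \<times> real"
  assumes T [measurable]: "T \<in> lborel \<Otimes>\<^sub>M lborel \<rightarrow>\<^sub>M lborel \<Otimes>\<^sub>M lborel"
    and eq: "\<And>f :: real \<times> real \<Rightarrow> ennreal. f \<in> borel_measurable (lborel \<Otimes>\<^sub>M lborel) \<Longrightarrow>
      (\<integral>\<^sup>+x. \<integral>\<^sup>+y. f (T (x, y)) \<partial>lborel \<partial>lborel) = (\<integral>\<^sup>+x. \<integral>\<^sup>+y. f (x, y) \<partial>lborel \<partial>lborel)"
  shows "distr (lborel \<Otimes>\<^sub>M lborel) (lborel \<Otimes>\<^sub>M lborel) T = lborel \<Otimes>\<^sub>M lborel"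
proof (rule measure_eqI)
  fix A assume A: "A \<in> sets (distr (lborel \<Otimes>\<^sub>M lborel) (lborel \<Otimes>\<^sub>M lborel) T)"
  then have A' [measurable]: "A \<in> sets (lborel \<Otimes>\<^sub>M lborel)" by simp
  have "emeasure (distr (lborel \<Otimes>\<^sub>M lborel) (lborel \<Otimes>\<^sub>M lborel) T) A
    = (\<integral>\<^sup>+p. indicator A p \<partial>distr (lborel \<Otimes>\<^sub>M lborel) (lborel \<Otimes>\<^sub>M lborel) T)"
    using A by simp
  also have "\<dots> = (\<integral>\<^sup>+p. indicator A (T p) \<partial>(lborel \<Otimes>\<^sub>M lborel))"
    by (rule nn_integral_distr) measurable
  also have "\<dots> = (\<integral>\<^sup>+x. \<integral>\<^sup>+y. indicator A (T (x, y)) \<partial>lborel \<partial>lborel)"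
    by (rule lborel.nn_integral_fst[symmetric]) measurable
  also have "\<dots> = (\<integral>\<^sup>+x. \<integral>\<^sup>+y. indicator A (x, y) \<partial>lborel \<partial>lborel)"
    by (rule eq) measurable
  also have "\<dots> = (\<integral>\<^sup>+p. indicator A p \<partial>(lborel \<Otimes>\<^sub>M lborel))"
    by (rule lborel.nn_integral_fst) measurable
  also have "\<dots> = emeasure (lborel \<Otimes>\<^sub>M lborel) A" by (rule nn_integral_indicator[OF A'])
  finally show "emeasure (distr (lborel \<Otimes>\<^sub>M lborel) (lborel \<Otimes>\<^sub>M lborel) T) A = emeasure (lborel \<Otimes>\<^sub>M lborel) A" .
qed simp

text \<open>Let p = x, q = - y, r = y - x be the three frequencies of sum 0. Then
  \<open>shear\<close> exchanges q and r, \<open>flip\<close> exchanges p and q, and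
  \<open>rot\<close> is the cyclic shift of (p, q, r) to (q, r, p).\<close>

definition shear :: "real \<times> real \<Rightarrow> real \<times> real" where "shear = (\<lambda>(x, y). (x, x - y))"
definition flip :: "real \<times> real \<Rightarrow> real \<times> real" where "flip = (\<lambda>(x, y). (- y, - x))"
definition rot :: "real \<times> real \<Rightarrow> real \<times> real" where "rot = (\<lambda>(x, y). (- y, x - y))"

lemma shear_measurable [measurable]: "shear \<in> lborel \<Otimes>\<^sub>M lborel \<rightarrow>\<^sub>M lborel \<Otimes>\<^sub>M lborel"
  and flip_measurable [measurable]: "flip \<in> lborel \<Otimes>\<^sub>M lborel \<rightarrow>\<^sub>M lborel \<Otimes>\<^sub>M lborel"
  and rot_measurable [measurable]: "rot \<in> lborel \<Otimes>\<^sub>M lborel \<rightarrow>\<^sub>M lborel \<Otimes>\<^sub>M lborel"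
  unfolding shear_def flip_def rot_def by measurable

lemma distr_shear: "distr (lborel \<Otimes>\<^sub>M lborel) (lborel \<Otimes>\<^sub>M lborel) shear = lborel \<Otimes>\<^sub>M lborel"
proof (rule distr_pairI[OF shear_measurable])
  fix f :: "real \<times> real \<Rightarrow> ennreal" assume [measurable]: "f \<in> borel_measurable (lborel \<Otimes>\<^sub>M lborel)"
  have "(\<lambda>y. f (x, y)) \<in> borel_measurable borel" for x by measurable
  from nn_integral_translate_reflect[OF this]
  show "(\<integral>\<^sup>+x. \<integral>\<^sup>+y. f (shear (x, y)) \<partial>lborel \<partial>lborel) = (\<integral>\<^sup>+x. \<integral>\<^sup>+y. f (x, y) \<partial>lborel \<partial>lborel)"
    by (simp add: shear_def)
qed

lemma distr_flip: "distr (lborel \<Otimes>\<^sub>M lborel) (lborel \<Otimes>\<^sub>M lborel) flip = lborel \<Otimes>\<^sub>M lborel"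
proof (rule distr_pairI[OF flip_measurable])
  fix f :: "real \<times> real \<Rightarrow> ennreal" assume [measurable]: "f \<in> borel_measurable (lborel \<Otimes>\<^sub>M lborel)"
  have m1: "(\<lambda>x. f (- y, x)) \<in> borel_measurable borel" for y by measurable
  have m2: "(\<lambda>y. \<integral>\<^sup>+x. f (y, x) \<partial>lborel) \<in> borel_measurable borel" by measurable
  have "(\<integral>\<^sup>+x. \<integral>\<^sup>+y. f (flip (x, y)) \<partial>lborel \<partial>lborel) = (\<integral>\<^sup>+x. \<integral>\<^sup>+y. f (- y, - x) \<partial>lborel \<partial>lborel)"
    by (simp add: flip_def)
  also have "\<dots> = (\<integral>\<^sup>+y. \<integral>\<^sup>+x. f (- y, - x) \<partial>lborel \<partial>lborel)"
    by (rule lborel_pair.Fubini') measurable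
  also have "\<dots> = (\<integral>\<^sup>+y. \<integral>\<^sup>+x. f (- y, x) \<partial>lborel \<partial>lborel)"
  proof -
    have "(\<integral>\<^sup>+x. f (- y, - x) \<partial>lborel) = (\<integral>\<^sup>+x. f (- y, x) \<partial>lborel)" for y
      using nn_integral_translate_reflect[OF m1[of y], of 0] by simp
    then show ?thesis by simp
  qed
  also have "\<dots> = (\<integral>\<^sup>+y. \<integral>\<^sup>+x. f (y, x) \<partial>lborel \<partial>lborel)"
    using nn_integral_translate_reflect[OF m2, of 0] by simp
  finally show "(\<integral>\<^sup>+x. \<integral>\<^sup>+y. f (flip (x, y)) \<partial>lborel \<partial>lborel) = (\<integral>\<^sup>+x. \<integral>\<^sup>+y. f (x, y) \<partial>lborel \<partial>lborel)" .
qed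

lemma distr_rot: "distr (lborel \<Otimes>\<^sub>M lborel) (lborel \<Otimes>\<^sub>M lborel) rot = lborel \<Otimes>\<^sub>M lborel"
proof -
  have "rot = shear \<circ> flip" by (auto simp: rot_def shear_def flip_def fun_eq_iff)
  then show ?thesis using distr_distr[OF shear_measurable flip_measurable] by (simp add: distr_shear distr_flip)
qed

lemma integral_preserved:
  fixes F :: "real \<times> real \<Rightarrow> complex"
  assumes "T \<in> lborel \<Otimes>\<^sub>M lborel \<rightarrow>\<^sub>M lborel \<Otimes>\<^sub>M lborel" "distr (lborel \<Otimes>\<^sub>M lborel) (lborel \<Otimes>\<^sub>M lborel) T = lborel \<Otimes>\<^sub>M lborel"
    and F: "integrable (lborel \<Otimes>\<^sub>M lborel) F"
  shows "integrable (lborel \<Otimes>\<^sub>M lborel) (\<lambda>p. F (T p))"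
    "(\<integral>p. F (T p) \<partial>(lborel \<Otimes>\<^sub>M lborel)) = (\<integral>p. F p \<partial>(lborel \<Otimes>\<^sub>M lborel))"
  using integrable_distr_eq[OF assms(1), of F] integral_distr[OF assms(1), of F] F unfolding assms(2)
  by auto

text \<open>Cauchy-Schwarz in \<open>x\<close> against the bilinear estimate
  \<open>nn_kernel_bound\<close>.\<close>

lemma nn_tri_bound_aux:
  assumes f: "square_integrable f" and g: "square_integrable g" and h: "square_integrable h"
  shows "(\<integral>\<^sup>+x. \<integral>\<^sup>+y. ennreal (1 / jb y) * ennreal (cmod (f x) * cmod (g y) * cmod (h (x - y))) \<partial>lborel \<partial>lborel)
    \<le> ennreal (jb_const * norm (to_l2 f) * norm (to_l2 g) * norm (to_l2 h))"
proof -
  have [measurable]: "f \<in> borel_measurable borel" "g \<in> borel_measurable borel" "h \<in> borel_measurable borel"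
    using assms by (auto simp: square_integrable_def)
  let ?\<Psi> = "\<lambda>x. \<integral>\<^sup>+y. ennreal (1 / jb y) * (ennreal (cmod (g y)) * ennreal (cmod (h (x - y)))) \<partial>lborel"
  have "(\<integral>\<^sup>+x. \<integral>\<^sup>+y. ennreal (1 / jb y) * ennreal (cmod (f x) * cmod (g y) * cmod (h (x - y))) \<partial>lborel \<partial>lborel)
    = (\<integral>\<^sup>+x. ennreal (cmod (f x)) * ?\<Psi> x \<partial>lborel)"
  proof (intro nn_integral_cong)
    fix x
    have "(\<integral>\<^sup>+y. ennreal (1 / jb y) * ennreal (cmod (f x) * cmod (g y) * cmod (h (x - y))) \<partial>lborel)
      = (\<integral>\<^sup>+y. ennreal (cmod (f x)) * (ennreal (1 / jb y) * (ennreal (cmod (g y)) * ennreal (cmod (h (x - y))))) \<partial>lborel)"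
      by (intro nn_integral_cong) (simp add: ennreal_mult mult_ac)
    also have "\<dots> = ennreal (cmod (f x)) * ?\<Psi> x"
      by (rule nn_integral_cmult) measurable
    finally show "(\<integral>\<^sup>+y. ennreal (1 / jb y) * ennreal (cmod (f x) * cmod (g y) * cmod (h (x - y))) \<partial>lborel) = ennreal (cmod (f x)) * ?\<Psi> x" .
  qed
  moreover have "(\<integral>\<^sup>+x. ennreal (cmod (f x)) * ?\<Psi> x \<partial>lborel)\<^sup>2 \<le> (ennreal (jb_const * norm (to_l2 f) * norm (to_l2 g) * norm (to_l2 h)))\<^sup>2"
  proof -
    have "(\<integral>\<^sup>+x. ennreal (cmod (f x)) * ?\<Psi> x \<partial>lborel)\<^sup>2 \<le> (\<integral>\<^sup>+x. (ennreal (cmod (f x)))\<^sup>2 \<partial>lborel) * (\<integral>\<^sup>+x. (?\<Psi> x)\<^sup>2 \<partial>lborel)"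
      by (rule Cauchy_Schwarz_nn_integral) measurable
    also have "\<dots> \<le> ennreal ((norm (to_l2 f))\<^sup>2) * ennreal ((jb_const * norm (to_l2 g) * norm (to_l2 h))\<^sup>2)"
      using nn_norm_to_l2[OF f] by (intro mult_mono nn_kernel_bound g h) (auto simp: ennreal_power)
    also have "\<dots> = (ennreal (jb_const * norm (to_l2 f) * norm (to_l2 g) * norm (to_l2 h)))\<^sup>2"
      using jb_const_nonneg by (simp add: ennreal_power ennreal_mult[symmetric] power_mult_distrib mult_ac)
    finally show ?thesis .
  qed
  ultimately show ?thesis by (simp add: ennreal_power2_le_imp_le)
qed

text \<open>Decay in any one of the three frequencies is enough: Fubini and a reflection of
  \<open>h\<close> handle 1/<x>, the substitution y -> x - y handles 1/<x - y>.\<close>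

lemma nn_tri_bound:
  assumes f: "square_integrable f" and g: "square_integrable g" and h: "square_integrable h"
  shows "(\<integral>\<^sup>+x. \<integral>\<^sup>+y. ennreal (1 / jb x + 1 / jb y + 1 / jb (x - y)) * ennreal (cmod (f x) * cmod (g y) * cmod (h (x - y))) \<partial>lborel \<partial>lborel)
    \<le> ennreal (3 * (jb_const * norm (to_l2 f) * norm (to_l2 g) * norm (to_l2 h)))"
proof -
  have [measurable]: "f \<in> borel_measurable borel" "g \<in> borel_measurable borel" "h \<in> borel_measurable borel"
    using assms by (auto simp: square_integrable_def)
  let ?P = "\<lambda>x y. ennreal (cmod (f x) * cmod (g y) * cmod (h (x - y)))"
  let ?C = "ennreal (jb_const * norm (to_l2 f) * norm (to_l2 g) * norm (to_l2 h))"
  note h' = square_integrable_reflect[OF h]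
  have nh': "norm (to_l2 (\<lambda>x. h (- x))) = norm (to_l2 h)"
    using inner_reflect_to_l2[OF h h] by (simp add: norm_eq_sqrt_inner)
  have 1: "(\<integral>\<^sup>+x. \<integral>\<^sup>+y. ennreal (1 / jb x) * ?P x y \<partial>lborel \<partial>lborel) \<le> ?C"
  proof -
    have "(\<integral>\<^sup>+x. \<integral>\<^sup>+y. ennreal (1 / jb x) * ?P x y \<partial>lborel \<partial>lborel) = (\<integral>\<^sup>+y. \<integral>\<^sup>+x. ennreal (1 / jb x) * ?P x y \<partial>lborel \<partial>lborel)"
      by (rule lborel_pair.Fubini') measurable
    also have "\<dots> = (\<integral>\<^sup>+y. \<integral>\<^sup>+x. ennreal (1 / jb x) * ennreal (cmod (g y) * cmod (f x) * cmod (h (- (y - x)))) \<partial>lborel \<partial>lborel)"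
      by (simp add: mult_ac)
    also have "\<dots> \<le> ennreal (jb_const * norm (to_l2 g) * norm (to_l2 f) * norm (to_l2 (\<lambda>x. h (- x))))"
      by (rule nn_tri_bound_aux[OF g f h'])
    finally show ?thesis by (simp add: nh' mult_ac)
  qed
  have 2: "(\<integral>\<^sup>+x. \<integral>\<^sup>+y. ennreal (1 / jb y) * ?P x y \<partial>lborel \<partial>lborel) \<le> ?C"
    by (rule nn_tri_bound_aux[OF f g h])
  have 3: "(\<integral>\<^sup>+x. \<integral>\<^sup>+y. ennreal (1 / jb (x - y)) * ?P x y \<partial>lborel \<partial>lborel) \<le> ?C"
  proof -
    have m: "(\<lambda>y. ennreal (1 / jb y) * ennreal (cmod (f x) * cmod (h y) * cmod (g (x - y)))) \<in> borel_measurable borel" for x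
      by measurable
    have "(\<integral>\<^sup>+x. \<integral>\<^sup>+y. ennreal (1 / jb (x - y)) * ?P x y \<partial>lborel \<partial>lborel) = (\<integral>\<^sup>+x. \<integral>\<^sup>+y. ennreal (1 / jb (x - y)) * ennreal (cmod (f x) * cmod (h (x - y)) * cmod (g (x - (x - y)))) \<partial>lborel \<partial>lborel)"
      by (simp add: mult_ac)
    also have "\<dots> = (\<integral>\<^sup>+x. \<integral>\<^sup>+y. ennreal (1 / jb y) * ennreal (cmod (f x) * cmod (h y) * cmod (g (x - y))) \<partial>lborel \<partial>lborel)"
      by (intro nn_integral_cong nn_integral_translate_reflect[OF m])
    also have "\<dots> \<le> ennreal (jb_const * norm (to_l2 f) * norm (to_l2 h) * norm (to_l2 g))"
      by (rule nn_tri_bound_aux[OF f h g])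
    finally show ?thesis by (simp add: mult_ac)
  qed
  have "(\<integral>\<^sup>+x. \<integral>\<^sup>+y. ennreal (1 / jb x + 1 / jb y + 1 / jb (x - y)) * ?P x y \<partial>lborel \<partial>lborel)
    = (\<integral>\<^sup>+x. ((\<integral>\<^sup>+y. ennreal (1 / jb x) * ?P x y \<partial>lborel) + (\<integral>\<^sup>+y. ennreal (1 / jb y) * ?P x y \<partial>lborel)) + (\<integral>\<^sup>+y. ennreal (1 / jb (x - y)) * ?P x y \<partial>lborel) \<partial>lborel)"
    by (simp add: ennreal_plus[symmetric] distrib_right nn_integral_add[symmetric] del: ennreal_plus)
       (simp add: ennreal_plus distrib_right)
  also have "\<dots> = ((\<integral>\<^sup>+x. \<integral>\<^sup>+y. ennreal (1 / jb x) * ?P x y \<partial>lborel \<partial>lborel) + (\<integral>\<^sup>+x. \<integral>\<^sup>+y. ennreal (1 / jb y) * ?P x y \<partial>lborel \<partial>lborel))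
    + (\<integral>\<^sup>+x. \<integral>\<^sup>+y. ennreal (1 / jb (x - y)) * ?P x y \<partial>lborel \<partial>lborel)"
    by (simp add: nn_integral_add)
  also have "\<dots> \<le> (?C + ?C) + ?C" by (intro add_mono 1 2 3)
  also have "\<dots> = ennreal (3 * (jb_const * norm (to_l2 f) * norm (to_l2 g) * norm (to_l2 h)))"
    using jb_const_nonneg by (simp add: ennreal_plus[symmetric] del: ennreal_plus)
  finally show ?thesis .
qed

lemma tri_bound:
  fixes F :: "real \<times> real \<Rightarrow> complex"
  assumes f: "square_integrable f" and g: "square_integrable g" and h: "square_integrable h"
    and F: "F \<in> borel_measurable (lborel \<Otimes>\<^sub>M lborel)" and K: "0 \<le> K"
    and le: "\<And>x y. cmod (F (x, y)) \<le> K * (1 / jb x + 1 / jb y + 1 / jb (x - y)) * (cmod (f x) * cmod (g y) * cmod (h (x - y)))"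
  shows "integrable (lborel \<Otimes>\<^sub>M lborel) F"
    "cmod (\<integral>p. F p \<partial>(lborel \<Otimes>\<^sub>M lborel)) \<le> 3 * K * jb_const * norm (to_l2 f) * norm (to_l2 g) * norm (to_l2 h)"
proof -
  have [measurable]: "f \<in> borel_measurable borel" "g \<in> borel_measurable borel" "h \<in> borel_measurable borel"
    using assms by (auto simp: square_integrable_def)
  let ?B = "3 * K * jb_const * norm (to_l2 f) * norm (to_l2 g) * norm (to_l2 h)"
  have B: "0 \<le> ?B" using K jb_const_nonneg by simp
  have "(\<integral>\<^sup>+p. ennreal (cmod (F p)) \<partial>(lborel \<Otimes>\<^sub>M lborel)) = (\<integral>\<^sup>+x. \<integral>\<^sup>+y. ennreal (cmod (F (x, y))) \<partial>lborel \<partial>lborel)"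
    using F by (subst lborel.nn_integral_fst[symmetric]) auto
  also have "\<dots> \<le> (\<integral>\<^sup>+x. \<integral>\<^sup>+y. ennreal K * (ennreal (1 / jb x + 1 / jb y + 1 / jb (x - y)) * ennreal (cmod (f x) * cmod (g y) * cmod (h (x - y)))) \<partial>lborel \<partial>lborel)"
  proof (intro nn_integral_mono)
    fix x y
    have "ennreal (K * W * P) = ennreal K * (ennreal W * ennreal P)" if "0 \<le> W" "0 \<le> P" for W P
      using K that by (simp add: ennreal_mult mult.assoc)
    from this[of "1 / jb x + 1 / jb y + 1 / jb (x - y)" "cmod (f x) * cmod (g y) * cmod (h (x - y))"] ennreal_leI[OF le[of x y]]
    show "ennreal (cmod (F (x, y))) \<le> ennreal K * (ennreal (1 / jb x + 1 / jb y + 1 / jb (x - y)) * ennreal (cmod (f x) * cmod (g y) * cmod (h (x - y))))"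
      by (simp only: add_nonneg_nonneg divide_nonneg_nonneg zero_le_one jb_nonneg mult_nonneg_nonneg norm_ge_zero)
  qed
  also have "\<dots> = (\<integral>\<^sup>+x. ennreal K * (\<integral>\<^sup>+y. ennreal (1 / jb x + 1 / jb y + 1 / jb (x - y)) * ennreal (cmod (f x) * cmod (g y) * cmod (h (x - y))) \<partial>lborel) \<partial>lborel)"
    by (intro nn_integral_cong nn_integral_cmult) measurable
  also have "\<dots> = ennreal K * (\<integral>\<^sup>+x. \<integral>\<^sup>+y. ennreal (1 / jb x + 1 / jb y + 1 / jb (x - y)) * ennreal (cmod (f x) * cmod (g y) * cmod (h (x - y))) \<partial>lborel \<partial>lborel)"
    by (rule nn_integral_cmult) measurable
  also have "\<dots> \<le> ennreal K * ennreal (3 * (jb_const * norm (to_l2 f) * norm (to_l2 g) * norm (to_l2 h)))"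
    by (intro mult_left_mono nn_tri_bound f g h) auto
  also have "\<dots> = ennreal ?B" using K jb_const_nonneg by (simp add: ennreal_mult[symmetric] mult_ac)
  finally have *: "(\<integral>\<^sup>+p. ennreal (cmod (F p)) \<partial>(lborel \<Otimes>\<^sub>M lborel)) \<le> ennreal ?B" .
  show "integrable (lborel \<Otimes>\<^sub>M lborel) F"
    using F * by (auto simp: integrable_iff_bounded intro: le_less_trans)
  show "cmod (\<integral>p. F p \<partial>(lborel \<Otimes>\<^sub>M lborel)) \<le> ?B"
    using order_trans[OF norm_integral_le_nn_integral *] B by simp
qed

text \<open>The real inner product with -i K is minus the imaginary part of the Hermitian pairing
  with K, and Fubini makes it an integral over the plane. For conjugate symmetric functions the
  three arguments become x, - y and y - x, which exposes the permutation symmetry.\<close>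

lemma kernel_pairing:
  assumes k: "kernel_bound k K" and m: "m \<in> borel_measurable borel" "\<And>x. \<bar>m x\<bar> \<le> M"
    and f: "square_integrable f" and g: "square_integrable g" and h: "square_integrable h"
  defines "F \<equiv> \<lambda>(x, y). complex_of_real (m x * k x y) * (f x * cnj (g y) * cnj (h (x - y)))"
  shows "integrable (lborel \<Otimes>\<^sub>M lborel) F"
    "multiply (\<lambda>x. complex_of_real (m x)) (to_l2 f) \<bullet> multiply (\<lambda>x. - \<i>) (kernel_op k (to_l2 g) (to_l2 h))
      = - Im (\<integral>p. F p \<partial>(lborel \<Otimes>\<^sub>M lborel))"
proof -
  note [measurable] = m(1) kernel_boundD(2)[OF k]
  have [measurable]: "f \<in> borel_measurable borel" "g \<in> borel_measurable borel" "h \<in> borel_measurable borel"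
    using f g h by (auto simp: square_integrable_def)
  have M: "0 \<le> M" using m(2)[of 0] by linarith
  note K = kernel_boundD(1)[OF k]
  have km: "(\<lambda>p. k (fst p) (snd p)) \<in> borel_measurable (borel \<Otimes>\<^sub>M borel)"
    using kernel_boundD(2)[OF k] by (simp add: split_beta')
  have Fm: "F \<in> borel_measurable (lborel \<Otimes>\<^sub>M lborel)"
    unfolding F_def split_beta' using km by measurable
  show Fi: "integrable (lborel \<Otimes>\<^sub>M lborel) F"
  proof (rule tri_bound(1)[OF f g h Fm])
    show "0 \<le> M * K" using M K by simp
    fix x y
    have "\<bar>m x\<bar> * \<bar>k x y\<bar> \<le> M * (K / jb y)" using M by (intro mult_mono m kernel_boundD(3)[OF k]) auto
    also have "\<dots> \<le> M * K * (1 / jb x + 1 / jb y + 1 / jb (x - y))"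
      using M K by (simp add: distrib_left)
    finally show "cmod (F (x, y)) \<le> M * K * (1 / jb x + 1 / jb y + 1 / jb (x - y)) * (cmod (f x) * cmod (g y) * cmod (h (x - y)))"
      unfolding F_def by (simp add: norm_mult abs_mult mult_right_mono)
  qed
  have sm: "square_integrable (\<lambda>x. complex_of_real (m x) * f x)"
    by (rule square_integrable_mult_bounded[OF f, where K=M]) (use m in auto)
  note sk = kernel_int_bound(1)[OF k g h]
  have ip: "integrable lborel (\<lambda>x. complex_of_real (m x) * f x * cnj (kernel_int k g h x))"
    by (intro square_integrable_mult_integrable sm square_integrable_cnj sk)
  have "multiply (\<lambda>x. complex_of_real (m x)) (to_l2 f) \<bullet> multiply (\<lambda>x. - \<i>) (kernel_op k (to_l2 g) (to_l2 h))
    = to_l2 (\<lambda>x. complex_of_real (m x) * f x) \<bullet> to_l2 (\<lambda>x. - \<i> * kernel_int k g h x)"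
    unfolding kernel_op_to_l2[OF k g h] by (simp add: multiply_to_l2 f sk)
  also have "\<dots> = (\<integral>x. (complex_of_real (m x) * f x) \<bullet> (- \<i> * kernel_int k g h x) \<partial>lborel)"
    by (rule inner_to_l2[OF sm square_integrable_cmult[OF sk]])
  also have "\<dots> = (\<integral>x. - Im (complex_of_real (m x) * f x * cnj (kernel_int k g h x)) \<partial>lborel)"
    by (intro Bochner_Integration.integral_cong refl) (simp add: inner_complex_def algebra_simps)
  also have "\<dots> = - Im (\<integral>x. complex_of_real (m x) * f x * cnj (kernel_int k g h x) \<partial>lborel)"
    unfolding Bochner_Integration.integral_minus integral_Im[OF ip] ..
  also have "(\<integral>x. complex_of_real (m x) * f x * cnj (kernel_int k g h x) \<partial>lborel) = (\<integral>x. \<integral>y. F (x, y) \<partial>lborel \<partial>lborel)"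
  proof (intro Bochner_Integration.integral_cong refl)
    fix x
    have "complex_of_real (m x) * f x * cnj (kernel_int k g h x) = complex_of_real (m x) * f x * (\<integral>y. cnj (complex_of_real (k x y) * (g y * h (x - y))) \<partial>lborel)"
      by (simp only: kernel_int_def Bochner_Integration.integral_cnj)
    also have "\<dots> = (\<integral>y. complex_of_real (m x) * f x * cnj (complex_of_real (k x y) * (g y * h (x - y))) \<partial>lborel)"
      by (rule integral_mult_right_zero[symmetric])
    also have "\<dots> = (\<integral>y. F (x, y) \<partial>lborel)"
      unfolding F_def by (intro Bochner_Integration.integral_cong refl) (simp add: mult_ac)
    finally show "complex_of_real (m x) * f x * cnj (kernel_int k g h x) = (\<integral>y. F (x, y) \<partial>lborel)" .
  qed
  also have "\<dots> = (\<integral>p. F p \<partial>(lborel \<Otimes>\<^sub>M lborel))"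
    by (rule lborel_pair.integral_fst'[OF Fi])
  finally show "multiply (\<lambda>x. complex_of_real (m x)) (to_l2 f) \<bullet> multiply (\<lambda>x. - \<i>) (kernel_op k (to_l2 g) (to_l2 h))
      = - Im (\<integral>p. F p \<partial>(lborel \<Otimes>\<^sub>M lborel))" .
qed

section \<open>The almost conservation law\<close>

lemma sinh_measurable [measurable]: "(sinh :: real \<Rightarrow> real) \<in> borel_measurable borel"
  by (intro borel_measurable_continuous_onI continuous_intros)

lemma tanh_measurable [measurable]: "(tanh :: real \<Rightarrow> real) \<in> borel_measurable borel"
  unfolding tanh_def[abs_def] by measurable

text \<open>The derivative of t cosh t - sinh t is t sinh t, nonnegative for t >= 0; oddness of sinh
  covers negative arguments.\<close>

lemma abs_sinh_le: "\<bar>sinh a\<bar> \<le> \<bar>a\<bar> * cosh (a :: real)"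
proof -
  have pos: "sinh x \<le> x * cosh x" if "0 \<le> x" for x :: real
  proof -
    have "0 * cosh 0 - sinh 0 \<le> x * cosh x - sinh (x :: real)"
    proof (rule DERIV_nonneg_imp_nondecreasing[OF that])
      fix t :: real assume "0 \<le> t" "t \<le> x"
      have "((\<lambda>t. t * cosh t - sinh t) has_real_derivative t * sinh t) (at t)"
        by (auto intro!: derivative_eq_intros)
      moreover have "0 \<le> t * sinh t" using \<open>0 \<le> t\<close> by simp
      ultimately show "\<exists>y. ((\<lambda>t. t * cosh t - sinh t) has_real_derivative y) (at t) \<and> 0 \<le> y" by blast
    qed
    then show ?thesis by simp
  qed
  show ?thesis using pos[of a] pos[of "- a"] by (cases "0 \<le> a") auto
qed

lemma jb_triangle: "jb x \<le> jb y + jb (x - y)"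
proof (rule power2_le_imp_le)
  have "y * (x - y) \<le> jb y * jb (x - y)"
    using abs_le_jb[of y] abs_le_jb[of "x - y"] mult_mono[of "\<bar>y\<bar>" "jb y" "\<bar>x - y\<bar>" "jb (x - y)"] abs_ge_self[of "y * (x - y)"]
    by (simp add: abs_mult)
  moreover have "(jb y + jb (x - y))\<^sup>2 = (1 + y\<^sup>2) + (1 + (x - y)\<^sup>2) + 2 * (jb y * jb (x - y))"
    by (simp add: power2_sum jb_sq)
  moreover have "x\<^sup>2 = y\<^sup>2 + (x - y)\<^sup>2 + 2 * (y * (x - y))" by (simp add: power2_eq_square algebra_simps)
  ultimately show "(jb x)\<^sup>2 \<le> (jb y + jb (x - y))\<^sup>2" unfolding jb_sq by linarith
qed simp

text \<open>The fixed point equation gives symmetry only almost everywhere. Averaging a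
  representative with its reflected conjugate makes it hold at every point, as the pointwise
  rearrangements of the integrands require.\<close>

lemma conj_refl_representative:
  assumes "conj_refl u = u"
  obtains w where "square_integrable w" "to_l2 w = u" "\<And>x. w (- x) = cnj (w x)"
proof -
  define w where "w x = (1/2) *\<^sub>R (rep_l2 u x + cnj (rep_l2 u (- x)))" for x
  have si: "square_integrable (\<lambda>x. cnj (rep_l2 u (- x)))"
    by (intro square_integrable_cnj square_integrable_reflect square_integrable_rep_l2)
  have "to_l2 w = (1/2) *\<^sub>R (u + conj_refl u)"
    unfolding w_def conj_refl_eq
    by (simp only: to_l2_scaleR to_l2_add square_integrable_add si square_integrable_rep_l2 to_l2_rep_l2)
  also have "\<dots> = u" using assms by (simp add: scaleR_2[symmetric])
  finally have 2: "to_l2 w = u" .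
  have 1: "square_integrable w" unfolding w_def
    by (intro square_integrable_scaleR square_integrable_add si square_integrable_rep_l2)
  have 3: "w (- x) = cnj (w x)" for x by (simp add: w_def add.commute)
  show ?thesis by (rule that[OF 1 2 3])
qed

context coeffs
begin

text \<open>The energy density in the weighted variable: for \<open>gevrey_lift \<sigma> u\<close>
  the energy is the integral of \<open>ew\<close> |u|^2 divided by 4 pi.\<close>

definition ew :: "real \<Rightarrow> real" where "ew x = den x / (jb x) ^ 4"

lemma ew_measurable [measurable]: "ew \<in> borel_measurable borel"
  unfolding ew_def by measurable

lemma ew_bounds: "kap \<le> ew x" "ew x \<le> Lam"
  using den_ge[of x] den_le[of x] by (simp_all add: ew_def divide_simps)

lemma abs_ew_le: "\<bar>ew x\<bar> \<le> Lam"
  using ew_bounds[of x] kap_pos by linarith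

text \<open>The energy weight cancels the denominators of \<open>tau\<close> and \<open>psi\<close>;
  this polynomial of degree three is what remains of the quadratic nonlinearity.\<close>

definition cubic_symbol :: "real \<Rightarrow> real \<Rightarrow> real" where
  "cubic_symbol x y = x * (3 - 4 * (7/48) * x\<^sup>2) / 4 + 7/48 * (x * (y * (x - y)))"

lemma den_symbol: "den x * (tau x + 7/48 * psi x * m) = x * (3 - 4 * (7/48) * x\<^sup>2) / 4 + 7/48 * (x * m)"
proof -
  have "den x * tau x = x * (3 - 4 * (7/48) * x\<^sup>2) / 4" "den x * psi x = x"
    by (simp_all add: sym_tau_def sym_psi_def)
  moreover have "den x * (tau x + 7/48 * psi x * m) = den x * tau x + 7/48 * (den x * psi x) * m"
    by (simp add: algebra_simps)
  ultimately show ?thesis by simp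
qed

lemma cosh_split: "cosh (\<sigma> * x) = cosh (\<sigma> * y) * cosh (\<sigma> * (x - y)) + sinh (\<sigma> * y) * sinh (\<sigma> * (x - y :: real))"
  unfolding cosh_add[symmetric] by (simp add: algebra_simps)

text \<open>The addition theorem for cosh(\<sigma> x) separates a product that does not involve
  \<sigma>, the part in V alone, from one with two sinh factors.\<close>

lemma ew_kB:
  "ew x * kB \<sigma> x y = cubic_symbol x y * ((1 / (jb x)\<^sup>2) * ((1 / (jb y)\<^sup>2) * (1 / (jb (x - y))\<^sup>2)
     + (sinh (\<sigma> * y) / wt \<sigma> y) * (sinh (\<sigma> * (x - y)) / wt \<sigma> (x - y))))"
proof -
  have c: "cosh (\<sigma> * t) / wt \<sigma> t = 1 / (jb t)\<^sup>2" for t by (simp add: wt_def)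
  have "ew x * kB \<sigma> x y = (den x * (tau x + 7/48 * psi x * (y * (x - y)))) * (1 / (jb x)\<^sup>2) * (cosh (\<sigma> * x) / (wt \<sigma> y * wt \<sigma> (x - y)))"
    unfolding ew_def kB_def wt_def[of \<sigma> x] by (simp add: power_numeral_reduce divide_simps)
  also have "cosh (\<sigma> * x) / (wt \<sigma> y * wt \<sigma> (x - y)) = (cosh (\<sigma> * y) / wt \<sigma> y) * (cosh (\<sigma> * (x - y)) / wt \<sigma> (x - y))
     + (sinh (\<sigma> * y) / wt \<sigma> y) * (sinh (\<sigma> * (x - y)) / wt \<sigma> (x - y))"
    unfolding cosh_split[of \<sigma> x y] by (simp add: add_divide_distrib)
  finally show ?thesis unfolding c den_symbol cubic_symbol_def by (simp add: mult.assoc)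
qed

lemma cubic_symbol_le: "\<bar>cubic_symbol x y\<bar> \<le> (jb x) ^ 3 + jb x * (\<bar>y\<bar> * \<bar>x - y\<bar>)"
proof -
  have "\<bar>3 - 4 * (7/48) * t\<bar> \<le> 4 * (1 + t)" if "0 \<le> t" for t :: real
    using that by (simp add: abs_if)
  then have "\<bar>3 - 4 * (7/48) * x\<^sup>2\<bar> \<le> 4 * (jb x)\<^sup>2" unfolding jb_sq by simp
  then have "\<bar>x\<bar> * \<bar>3 - 4 * (7/48) * x\<^sup>2\<bar> \<le> jb x * (4 * (jb x)\<^sup>2)"
    by (intro mult_mono abs_le_jb) auto
  then have 1: "\<bar>x * (3 - 4 * (7/48) * x\<^sup>2) / 4\<bar> \<le> (jb x) ^ 3"
    unfolding abs_mult abs_divide by (simp add: power_numeral_reduce)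
  have "7/48 * (\<bar>x\<bar> * (\<bar>y\<bar> * \<bar>x - y\<bar>)) \<le> 1 * (jb x * (\<bar>y\<bar> * \<bar>x - y\<bar>))"
    by (intro mult_mono abs_le_jb order_refl) auto
  then have 2: "\<bar>7/48 * (x * (y * (x - y)))\<bar> \<le> jb x * (\<bar>y\<bar> * \<bar>x - y\<bar>)"
    by (simp add: abs_mult)
  show ?thesis unfolding cubic_symbol_def using abs_triangle_ineq[of "x * (3 - 4 * (7/48) * x\<^sup>2) / 4" "7/48 * (x * (y * (x - y)))"] 1 2 by linarith
qed

lemma sinh_wt_le:
  assumes "0 < \<sigma>" shows "\<bar>sinh (\<sigma> * y) / wt \<sigma> y\<bar> \<le> \<sigma> * (\<bar>y\<bar> / (jb y)\<^sup>2)" "\<bar>sinh (\<sigma> * y) / wt \<sigma> y\<bar> \<le> \<sigma> * (1 / jb y)"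
proof -
  have "\<bar>sinh (\<sigma> * y)\<bar> / wt \<sigma> y \<le> \<sigma> * \<bar>y\<bar> * cosh (\<sigma> * y) / wt \<sigma> y"
    using abs_sinh_le[of "\<sigma> * y"] assms by (intro divide_right_mono) (auto simp: abs_mult)
  also have "\<dots> = \<sigma> * (\<bar>y\<bar> / (jb y)\<^sup>2)" by (simp add: wt_def)
  finally show 1: "\<bar>sinh (\<sigma> * y) / wt \<sigma> y\<bar> \<le> \<sigma> * (\<bar>y\<bar> / (jb y)\<^sup>2)" by simp
  have "\<bar>y\<bar> / (jb y)\<^sup>2 \<le> jb y / (jb y)\<^sup>2" by (intro divide_right_mono abs_le_jb) auto
  also have "\<dots> = 1 / jb y" by (simp add: power2_eq_square)
  finally have "\<sigma> * (\<bar>y\<bar> / (jb y)\<^sup>2) \<le> \<sigma> * (1 / jb y)" using assms by (intro mult_left_mono) auto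
  with 1 show "\<bar>sinh (\<sigma> * y) / wt \<sigma> y\<bar> \<le> \<sigma> * (1 / jb y)" by linarith
qed

text \<open>After division by <x>^2 the cubic symbol is at most <x> + |y| |x - y| / <x>. In the
  first term <x> <= <y> + <x - y>, and the sinh factors contribute \<sigma>^2 / (<y> <x - y>); in
  the second they compensate |y| and |x - y| exactly, so that 1/<x> survives.\<close>

lemma remainder_symbol_le:
  assumes "0 < \<sigma>"
  shows "\<bar>cubic_symbol x y * ((1 / (jb x)\<^sup>2) * ((sinh (\<sigma> * y) / wt \<sigma> y) * (sinh (\<sigma> * (x - y)) / wt \<sigma> (x - y))))\<bar>
    \<le> \<sigma>\<^sup>2 * (1 / jb x + 1 / jb y + 1 / jb (x - y))"
proof -
  let ?z = "x - y"
  have e: "(jb x ^ 3 + jb x * (\<bar>y\<bar> * \<bar>?z\<bar>)) * (1 / (jb x)\<^sup>2) = jb x + (\<bar>y\<bar> * \<bar>?z\<bar>) / jb x"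
    by (simp add: power_numeral_reduce divide_simps distrib_left distrib_right)
  have "\<bar>cubic_symbol x y * ((1 / (jb x)\<^sup>2) * ((sinh (\<sigma> * y) / wt \<sigma> y) * (sinh (\<sigma> * ?z) / wt \<sigma> ?z)))\<bar>
    = (\<bar>cubic_symbol x y\<bar> * (1 / (jb x)\<^sup>2)) * (\<bar>sinh (\<sigma> * y) / wt \<sigma> y\<bar> * \<bar>sinh (\<sigma> * ?z) / wt \<sigma> ?z\<bar>)"
    by (simp add: abs_mult mult_ac)
  also have "\<dots> \<le> ((jb x ^ 3 + jb x * (\<bar>y\<bar> * \<bar>?z\<bar>)) * (1 / (jb x)\<^sup>2)) * ((\<sigma> * (\<bar>y\<bar> / (jb y)\<^sup>2)) * (\<sigma> * (\<bar>?z\<bar> / (jb ?z)\<^sup>2)))"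
    using assms by (intro mult_mono cubic_symbol_le sinh_wt_le mult_nonneg_nonneg) auto
  also have "\<dots> = \<sigma>\<^sup>2 * ((jb x + (\<bar>y\<bar> * \<bar>?z\<bar>) / jb x) * ((\<bar>y\<bar> / (jb y)\<^sup>2) * (\<bar>?z\<bar> / (jb ?z)\<^sup>2)))"
    unfolding e by (simp add: power2_eq_square)
  also have "\<dots> \<le> \<sigma>\<^sup>2 * (1 / jb x + 1 / jb y + 1 / jb ?z)"
  proof (rule mult_left_mono)
    have m: "\<bar>t\<bar> / (jb t)\<^sup>2 \<le> 1 / jb t" for t
    proof -
      have "\<bar>t\<bar> / (jb t)\<^sup>2 \<le> jb t / (jb t)\<^sup>2" by (intro divide_right_mono abs_le_jb) auto
      then show ?thesis by (simp add: power2_eq_square)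
    qed
    have m2: "\<bar>t\<bar> * (\<bar>t\<bar> / (jb t)\<^sup>2) \<le> 1" for t
    proof -
      have "\<bar>t\<bar> * (\<bar>t\<bar> / (jb t)\<^sup>2) \<le> jb t * (1 / jb t)" by (intro mult_mono m abs_le_jb) auto
      then show ?thesis by simp
    qed
    have "jb x * ((\<bar>y\<bar> / (jb y)\<^sup>2) * (\<bar>?z\<bar> / (jb ?z)\<^sup>2)) \<le> (jb y + jb ?z) * ((1 / jb y) * (1 / jb ?z))"
      by (intro mult_mono m jb_triangle) auto
    also have "\<dots> = 1 / jb y + 1 / jb ?z" by (simp add: field_simps)
    finally have 1: "jb x * ((\<bar>y\<bar> / (jb y)\<^sup>2) * (\<bar>?z\<bar> / (jb ?z)\<^sup>2)) \<le> 1 / jb y + 1 / jb ?z" .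
    have "(\<bar>y\<bar> * \<bar>?z\<bar>) / jb x * ((\<bar>y\<bar> / (jb y)\<^sup>2) * (\<bar>?z\<bar> / (jb ?z)\<^sup>2))
      = (1 / jb x) * ((\<bar>y\<bar> * (\<bar>y\<bar> / (jb y)\<^sup>2)) * (\<bar>?z\<bar> * (\<bar>?z\<bar> / (jb ?z)\<^sup>2)))"
    proof -
      have "(a * b) / j * ((a / p) * (b / q)) = (1 / j) * ((a * (a / p)) * (b * (b / q)))" for a b j p q :: real
        by simp
      then show ?thesis .
    qed
    also have "\<dots> \<le> (1 / jb x) * (1 * 1)" by (intro mult_left_mono mult_mono m2) auto
    finally have 2: "(\<bar>y\<bar> * \<bar>?z\<bar>) / jb x * ((\<bar>y\<bar> / (jb y)\<^sup>2) * (\<bar>?z\<bar> / (jb ?z)\<^sup>2)) \<le> 1 / jb x" by simp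
    from 1 2 show "(jb x + (\<bar>y\<bar> * \<bar>?z\<bar>) / jb x) * ((\<bar>y\<bar> / (jb y)\<^sup>2) * (\<bar>?z\<bar> / (jb ?z)\<^sup>2)) \<le> 1 / jb x + 1 / jb y + 1 / jb ?z"
      by (simp only: distrib_right)
  qed simp
  finally show ?thesis .
qed

text \<open>The symbol identity behind the conservation law: it needs the coefficient of \<open>\<partial>\<^sub>x\<^sup>3(\<eta>\<^sup>2)\<close> to be
  \<open>7/48\<close>, since \<open>\<xi>\<^sub>1\<^sup>3 + \<xi>\<^sub>2\<^sup>3 + \<xi>\<^sub>3\<^sup>3 = 3 \<xi>\<^sub>1\<xi>\<^sub>2\<xi>\<^sub>3\<close> when \<open>\<xi>\<^sub>1 + \<xi>\<^sub>2 + \<xi>\<^sub>3 = 0\<close>.\<close>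

lemma cubic_symbol_cyclic: "cubic_symbol x y + cubic_symbol (- y) (x - y) + cubic_symbol (y - x) (- x) = 0"
  unfolding cubic_symbol_def by (simp add: power2_eq_square field_simps)

lemma cubic_pairing:
  assumes \<sigma>: "0 < \<sigma>" and w: "square_integrable w" and sym: "\<And>x. w (- x) = cnj (w x)"
  shows "\<bar>multiply (\<lambda>x. complex_of_real (ew x)) (to_l2 w) \<bullet> multiply (\<lambda>x. - \<i>) (kernel_op (kB \<sigma>) (to_l2 w) (to_l2 w))\<bar>
    \<le> 3 * \<sigma>\<^sup>2 * jb_const * norm (to_l2 w) * norm (to_l2 w) * norm (to_l2 w)"
proof -
  have [measurable]: "w \<in> borel_measurable borel" using w by (simp add: square_integrable_def)
  define F where "F = (\<lambda>(x, y). complex_of_real (ew x * kB \<sigma> x y) * (w x * cnj (w y) * cnj (w (x - y))))"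
  define V where "V x = complex_of_real (1 / (jb x)\<^sup>2) * w x" for x
  define G where "G = (\<lambda>(x, y). complex_of_real (cubic_symbol x y) * (V x * (V (- y) * V (y - x))))"
  define H where "H = (\<lambda>(x, y). complex_of_real (cubic_symbol x y * ((1 / (jb x)\<^sup>2) * ((sinh (\<sigma> * y) / wt \<sigma> y) * (sinh (\<sigma> * (x - y)) / wt \<sigma> (x - y))))) * (w x * cnj (w y) * cnj (w (x - y))))"
  note kp = kernel_pairing[OF kernel_bound_kB ew_measurable abs_ew_le w w w, of \<sigma>, folded F_def]
  have Hm: "H \<in> borel_measurable (lborel \<Otimes>\<^sub>M lborel)" unfolding H_def cubic_symbol_def by measurable
  have Hle: "cmod (H (x, y)) \<le> \<sigma>\<^sup>2 * (1 / jb x + 1 / jb y + 1 / jb (x - y)) * (cmod (w x) * cmod (w y) * cmod (w (x - y)))" for x y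
    using mult_right_mono[OF remainder_symbol_le[OF \<sigma>, of x y], of "cmod (w x) * cmod (w y) * cmod (w (x - y))"]
    unfolding H_def by (simp only: prod.case norm_mult norm_of_real complex_mod_cnj) simp
  note Ht = tri_bound[OF w w w Hm zero_le_power2 Hle]
  have FGH: "F p = G p + H p" for p
  proof -
    obtain x y where p: "p = (x, y)" by (cases p)
    have s: "w (- y) = cnj (w y)" "w (y - x) = cnj (w (x - y))" using sym[of y] sym[of "x - y"] by auto
    have j: "jb (y - x) = jb (x - y)" using jb_uminus[of "x - y"] by simp
    have "F p = complex_of_real (cubic_symbol x y * ((1 / (jb x)\<^sup>2) * ((1 / (jb y)\<^sup>2) * (1 / (jb (x - y))\<^sup>2)))) * (w x * cnj (w y) * cnj (w (x - y))) + H p"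
      unfolding F_def H_def p prod.case ew_kB by (simp only: distrib_left distrib_right of_real_add of_real_mult)
    also have "complex_of_real (cubic_symbol x y * ((1 / (jb x)\<^sup>2) * ((1 / (jb y)\<^sup>2) * (1 / (jb (x - y))\<^sup>2)))) * (w x * cnj (w y) * cnj (w (x - y))) = G p"
      unfolding G_def V_def p prod.case s j jb_uminus by (simp only: of_real_mult mult_ac)
    finally show ?thesis .
  qed
  \<comment> \<open>\<open>G\<close> is not estimated directly; it inherits integrability as the
    difference of \<open>F\<close> and \<open>H\<close>.\<close>
  have Gi: "integrable (lborel \<Otimes>\<^sub>M lborel) G"
    using Bochner_Integration.integrable_diff[OF kp(1) Ht(1)] by (simp add: FGH)
  have G0: "(\<integral>p. G p \<partial>(lborel \<Otimes>\<^sub>M lborel)) = 0"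
  proof -
    \<comment> \<open>The rotation preserves measure, so three times the integral of
      \<open>G\<close> is the integral of its cyclic sum. The product of the three V factors is
      invariant under the rotation, and the symbols add up to 0.\<close>
    note r1 = integral_preserved[OF rot_measurable distr_rot Gi]
    note r2 = integral_preserved[OF rot_measurable distr_rot r1(1)]
    have "G p + G (rot p) + G (rot (rot p)) = 0" for p
    proof -
      obtain x y where p: "p = (x, y)" by (cases p)
      have "G p + G (rot p) + G (rot (rot p)) = complex_of_real (cubic_symbol x y + cubic_symbol (- y) (x - y) + cubic_symbol (y - x) (- x)) * (V x * V (- y) * V (y - x))"
        unfolding p G_def rot_def by (simp add: algebra_simps)
      then show ?thesis unfolding cubic_symbol_cyclic by simp
    qed
    then have "0 = (\<integral>p. G p + G (rot p) + G (rot (rot p)) \<partial>(lborel \<Otimes>\<^sub>M lborel))" by simp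
    also have "\<dots> = (\<integral>p. G p \<partial>(lborel \<Otimes>\<^sub>M lborel)) + (\<integral>p. G (rot p) \<partial>(lborel \<Otimes>\<^sub>M lborel)) + (\<integral>p. G (rot (rot p)) \<partial>(lborel \<Otimes>\<^sub>M lborel))"
      using Gi r1(1) r2(1) by (simp add: Bochner_Integration.integral_add Bochner_Integration.integrable_add)
    finally show ?thesis unfolding r1(2) r2(2) by simp
  qed
  have "(\<integral>p. F p \<partial>(lborel \<Otimes>\<^sub>M lborel)) = (\<integral>p. H p \<partial>(lborel \<Otimes>\<^sub>M lborel))"
    unfolding FGH using Bochner_Integration.integral_add[OF Gi Ht(1)] G0 by simp
  then have "\<bar>- Im (\<integral>p. F p \<partial>(lborel \<Otimes>\<^sub>M lborel))\<bar> \<le> cmod (\<integral>p. H p \<partial>(lborel \<Otimes>\<^sub>M lborel))"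
    using abs_Im_le_cmod by simp
  with Ht(2) show ?thesis unfolding kp(2) by linarith
qed

text \<open>The inner product carries its own cosh(\<sigma> (x - y)), by which the kernel divides.
  The addition theorem therefore leaves 1 in the main term and tanh in the remainder, and |tanh a|
  <= |a| will supply the second factor \<sigma>.\<close>

lemma ew_kD:
  "ew x * kD \<sigma> x y = (x / (jb x)\<^sup>2) * ((1 / (jb y)\<^sup>2) * (1 / jb (x - y))
     + (sinh (\<sigma> * y) / wt \<sigma> y) * (tanh (\<sigma> * (x - y)) / jb (x - y)))"
proof -
  have c: "cosh (\<sigma> * t) / wt \<sigma> t = 1 / (jb t)\<^sup>2" for t by (simp add: wt_def)
  have dp: "den x * psi x = x" by (simp add: sym_psi_def)
  have "ew x * kD \<sigma> x y = (den x * psi x) * (1 / (jb x)\<^sup>2) * (cosh (\<sigma> * x) / (wt \<sigma> y * (jb (x - y) * cosh (\<sigma> * (x - y)))))"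
    unfolding ew_def kD_def wt_def[of \<sigma> x] by (simp add: power_numeral_reduce divide_simps)
  also have "cosh (\<sigma> * x) / (wt \<sigma> y * (jb (x - y) * cosh (\<sigma> * (x - y)))) = (cosh (\<sigma> * y) / wt \<sigma> y) * (1 / jb (x - y))
     + (sinh (\<sigma> * y) / wt \<sigma> y) * (tanh (\<sigma> * (x - y)) / jb (x - y))"
    unfolding cosh_split[of \<sigma> x y] tanh_def by (simp add: add_divide_distrib)
  finally show ?thesis unfolding c dp by (simp add: mult.assoc)
qed

text \<open>\<open>kV\<close> and \<open>kL\<close> are the cosh-cosh and the sinh-sinh part of
  \<open>kC\<close> without its factor <x>; the smallness \<sigma>^2 sits in
  \<open>kL\<close>.\<close>

definition kV :: "real \<Rightarrow> real \<Rightarrow> real" where "kV x y = (1 / (jb y)\<^sup>2) * (1 / (jb (x - y))\<^sup>2)"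
definition kL :: "real \<Rightarrow> real \<Rightarrow> real \<Rightarrow> real" where
  "kL \<sigma> x y = (sinh (\<sigma> * y) / wt \<sigma> y) * (sinh (\<sigma> * (x - y)) / wt \<sigma> (x - y))"

lemma kC_split: "kC \<sigma> x y = jb x * (kV x y + kL \<sigma> x y)"
proof -
  have c: "cosh (\<sigma> * t) / wt \<sigma> t = 1 / (jb t)\<^sup>2" for t by (simp add: wt_def)
  have "kC \<sigma> x y = jb x * ((cosh (\<sigma> * y) / wt \<sigma> y) * (cosh (\<sigma> * (x - y)) / wt \<sigma> (x - y)) + kL \<sigma> x y)"
    unfolding kC_def kL_def cosh_split[of \<sigma> x y] by (simp add: add_divide_distrib distrib_left)
  then show ?thesis unfolding c kV_def .
qed

lemma kernel_bound_kV: "kernel_bound kV 1"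
proof (rule kernel_boundI)
  show "(\<lambda>(x, y). kV x y) \<in> borel_measurable (borel \<Otimes>\<^sub>M borel)" unfolding kV_def by measurable
  fix x y :: real
  have "1 / (jb t)\<^sup>2 \<le> 1 / jb t" for t using jb_le_jb_sq[of t] by (intro divide_left_mono) auto
  then have "(1 / (jb y)\<^sup>2) * (1 / (jb (x - y))\<^sup>2) \<le> (1 / jb y) * (1 / jb (x - y))" by (intro mult_mono) auto
  then show "\<bar>kV x y\<bar> \<le> 1 / (jb y * jb (x - y))" by (simp add: kV_def)
qed simp

lemma kernel_bound_kL:
  assumes "0 < \<sigma>" shows "kernel_bound (kL \<sigma>) (\<sigma>\<^sup>2)"
proof (rule kernel_boundI)
  show "(\<lambda>(x, y). kL \<sigma> x y) \<in> borel_measurable (borel \<Otimes>\<^sub>M borel)" unfolding kL_def by measurable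
  fix x y :: real
  have "\<bar>kL \<sigma> x y\<bar> \<le> (\<sigma> * (1 / jb y)) * (\<sigma> * (1 / jb (x - y)))"
    unfolding kL_def abs_mult using assms by (intro mult_mono sinh_wt_le) auto
  then show "\<bar>kL \<sigma> x y\<bar> \<le> \<sigma>\<^sup>2 / (jb y * jb (x - y))" by (simp add: power2_eq_square)
qed simp

text \<open>Both the outer and the inner product are split by the addition theorem. In the part
  \<open>A\<close> in V alone, exchanging the first two frequencies symmetrises the symbol x into x
  - y, minus the third frequency; what is left is the integral of an odd function. \<open>B\<close>
  has \<sigma>^2 from the inner split, \<open>C\<close> from the outer one.\<close>

lemma quartic_pairing:
  assumes \<sigma>: "0 < \<sigma>" and w: "square_integrable w" and sym: "\<And>x. w (- x) = cnj (w x)"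
  shows "\<bar>multiply (\<lambda>x. complex_of_real (ew x)) (to_l2 w) \<bullet>
      multiply (\<lambda>x. - \<i>) (kernel_op (kD \<sigma>) (to_l2 w) (kernel_op (kC \<sigma>) (to_l2 w) (to_l2 w)))\<bar>
    \<le> 15 * \<sigma>\<^sup>2 * jb_const\<^sup>2 * (norm (to_l2 w)) ^ 4"
proof -
  have [measurable]: "w \<in> borel_measurable borel" using w by (simp add: square_integrable_def)
  define Y where "Y = kernel_int (kC \<sigma>) w w"
  define Kn where "Kn = kernel_int kV w w"
  define Ln where "Ln = kernel_int (kL \<sigma>) w w"
  note Ys = kernel_int_bound[OF kernel_bound_kC w w, of \<sigma>, folded Y_def]
  note Ks = kernel_int_bound[OF kernel_bound_kV w w, folded Kn_def]
  note Ls = kernel_int_bound[OF kernel_bound_kL[OF \<sigma>] w w, folded Ln_def]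
  have [measurable]: "Y \<in> borel_measurable borel" "Kn \<in> borel_measurable borel" "Ln \<in> borel_measurable borel"
    using Ys(1) Ks(1) Ls(1) by (auto simp: square_integrable_def)
  have YKL: "Y z = complex_of_real (jb z) * (Kn z + Ln z)" for z
  proof -
    have "Y z = (\<integral>y. complex_of_real (jb z) * (complex_of_real (kV z y) * (w y * w (z - y)) + complex_of_real (kL \<sigma> z y) * (w y * w (z - y))) \<partial>lborel)"
      unfolding Y_def kernel_int_def kC_split by (simp add: algebra_simps)
    also have "\<dots> = complex_of_real (jb z) * (\<integral>y. complex_of_real (kV z y) * (w y * w (z - y)) + complex_of_real (kL \<sigma> z y) * (w y * w (z - y)) \<partial>lborel)"
      by (rule integral_mult_right_zero)
    also have "(\<integral>y. complex_of_real (kV z y) * (w y * w (z - y)) + complex_of_real (kL \<sigma> z y) * (w y * w (z - y)) \<partial>lborel) = Kn z + Ln z"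
      unfolding Kn_def Ln_def kernel_int_def
      by (rule Bochner_Integration.integral_add[OF kernel_int_integrable[OF kernel_bound_kV w w] kernel_int_integrable[OF kernel_bound_kL[OF \<sigma>] w w]])
    finally show ?thesis .
  qed
  define V where "V x = complex_of_real (1 / (jb x)\<^sup>2) * w x" for x
  have KnV: "Kn z = (\<integral>y. V y * V (z - y) \<partial>lborel)" for z
    unfolding Kn_def kernel_int_def V_def kV_def of_real_mult
    by (intro Bochner_Integration.integral_cong refl) (simp only: mult_ac)
  have Vsym: "V (- x) = cnj (V x)" for x by (simp add: V_def sym)
  have Ksym: "Kn (- z) = cnj (Kn z)" for z
  proof -
    have "Kn (- z) = \<bar>-1\<bar> *\<^sub>R (\<integral>y. V (0 + (-1) * y) * V (- z - (0 + (-1) * y)) \<partial>lborel)"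
      unfolding KnV by (rule lborel_integral_real_affine) simp
    also have "\<dots> = (\<integral>y. V (- y) * V (- (z - y)) \<partial>lborel)" by simp
    also have "\<dots> = (\<integral>y. cnj (V y * V (z - y)) \<partial>lborel)" by (simp only: Vsym complex_cnj_mult)
    also have "\<dots> = cnj (Kn z)" unfolding KnV by (rule Bochner_Integration.integral_cnj)
    finally show ?thesis .
  qed
  define F where "F = (\<lambda>(x, y). complex_of_real (ew x * kD \<sigma> x y) * (w x * cnj (w y) * cnj (Y (x - y))))"
  define A where "A = (\<lambda>(x, y). complex_of_real ((x / (jb x)\<^sup>2) * (1 / (jb y)\<^sup>2)) * (w x * cnj (w y) * cnj (Kn (x - y))))"
  define B where "B = (\<lambda>(x, y). complex_of_real ((x / (jb x)\<^sup>2) * (1 / (jb y)\<^sup>2)) * (w x * cnj (w y) * cnj (Ln (x - y))))"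
  define C where "C = (\<lambda>(x, y). complex_of_real ((x / (jb x)\<^sup>2) * ((sinh (\<sigma> * y) / wt \<sigma> y) * (tanh (\<sigma> * (x - y)) / jb (x - y)))) * (w x * cnj (w y) * cnj (Y (x - y))))"
  have m: "A \<in> borel_measurable (lborel \<Otimes>\<^sub>M lborel)" "B \<in> borel_measurable (lborel \<Otimes>\<^sub>M lborel)" "C \<in> borel_measurable (lborel \<Otimes>\<^sub>M lborel)"
    unfolding A_def B_def C_def by measurable
  note kp = kernel_pairing[OF kernel_bound_kD ew_measurable abs_ew_le w w Ys(1), of \<sigma>, folded F_def]
  have xj: "\<bar>x / (jb x)\<^sup>2\<bar> \<le> 1 / jb x" for x
  proof -
    have "\<bar>x\<bar> / (jb x)\<^sup>2 \<le> jb x / (jb x)\<^sup>2" by (intro divide_right_mono abs_le_jb) auto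
    then show ?thesis by (simp add: power2_eq_square)
  qed
  have j1: "1 / jb x \<le> 1" for x using jb_ge_1[of x] by simp
  have wle: "1 / jb x \<le> 1 / jb x + 1 / jb y + 1 / jb (x - y)" for x y by simp
  have s1: "\<bar>(x / (jb x)\<^sup>2) * (1 / (jb y)\<^sup>2)\<bar> \<le> 1 * (1 / jb x + 1 / jb y + 1 / jb (x - y))" for x y
  proof -
    have "\<bar>1 / (jb y)\<^sup>2\<bar> \<le> 1" using jb_le_jb_sq[of y] jb_ge_1[of y] by simp
    then have "\<bar>x / (jb x)\<^sup>2\<bar> * \<bar>1 / (jb y)\<^sup>2\<bar> \<le> (1 / jb x) * 1" by (intro mult_mono xj) auto
    then have "\<bar>x / (jb x)\<^sup>2\<bar> * \<bar>1 / (jb y)\<^sup>2\<bar> \<le> 1 / jb x" by (simp only: mult_1_right)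
    from order_trans[OF this wle[of x y]] show ?thesis unfolding abs_mult mult_1 .
  qed
  have s2: "\<bar>(x / (jb x)\<^sup>2) * ((sinh (\<sigma> * y) / wt \<sigma> y) * (tanh (\<sigma> * (x - y)) / jb (x - y)))\<bar> \<le> \<sigma>\<^sup>2 * (1 / jb x + 1 / jb y + 1 / jb (x - y))" for x y
  proof -
    have t: "\<bar>tanh (\<sigma> * z) / jb z\<bar> \<le> \<sigma> * 1" for z
    proof -
      have "\<bar>tanh (\<sigma> * z)\<bar> \<le> \<sigma> * \<bar>z\<bar>"
        using abs_sinh_le[of "\<sigma> * z"] \<sigma> by (simp add: tanh_def abs_mult divide_le_eq)
      also have "\<dots> \<le> \<sigma> * jb z" using \<sigma> by (intro mult_left_mono abs_le_jb) auto
      finally show ?thesis by (simp add: divide_le_eq)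
    qed
    have u: "\<bar>sinh (\<sigma> * y) / wt \<sigma> y\<bar> \<le> \<sigma> * 1"
      using sinh_wt_le(2)[OF \<sigma>, of y] mult_left_mono[OF j1[of y], of \<sigma>] \<sigma> by linarith
    have "\<bar>x / (jb x)\<^sup>2\<bar> * (\<bar>sinh (\<sigma> * y) / wt \<sigma> y\<bar> * \<bar>tanh (\<sigma> * (x - y)) / jb (x - y)\<bar>) \<le> (1 / jb x) * ((\<sigma> * 1) * (\<sigma> * 1))"
      using \<sigma> by (intro mult_mono xj t u mult_nonneg_nonneg) auto
    also have "\<dots> = \<sigma>\<^sup>2 * (1 / jb x)" by (simp add: power2_eq_square)
    also have "\<dots> \<le> \<sigma>\<^sup>2 * (1 / jb x + 1 / jb y + 1 / jb (x - y))" by (intro mult_left_mono wle) auto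
    finally show ?thesis unfolding abs_mult .
  qed
  have leA: "cmod (A (x, y)) \<le> 1 * (1 / jb x + 1 / jb y + 1 / jb (x - y)) * (cmod (w x) * cmod (w y) * cmod (Kn (x - y)))" for x y
    using mult_right_mono[OF s1[of x y], of "cmod (w x) * cmod (w y) * cmod (Kn (x - y))"]
    unfolding A_def by (simp only: prod.case norm_mult norm_of_real complex_mod_cnj) simp
  have leB: "cmod (B (x, y)) \<le> 1 * (1 / jb x + 1 / jb y + 1 / jb (x - y)) * (cmod (w x) * cmod (w y) * cmod (Ln (x - y)))" for x y
    using mult_right_mono[OF s1[of x y], of "cmod (w x) * cmod (w y) * cmod (Ln (x - y))"]
    unfolding B_def by (simp only: prod.case norm_mult norm_of_real complex_mod_cnj) simp
  have leC: "cmod (C (x, y)) \<le> \<sigma>\<^sup>2 * (1 / jb x + 1 / jb y + 1 / jb (x - y)) * (cmod (w x) * cmod (w y) * cmod (Y (x - y)))" for x y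
    using mult_right_mono[OF s2[of x y], of "cmod (w x) * cmod (w y) * cmod (Y (x - y))"]
    unfolding C_def by (simp only: prod.case norm_mult norm_of_real complex_mod_cnj) simp
  note At = tri_bound[OF w w Ks(1) m(1) zero_le_one leA]
  note Bt = tri_bound[OF w w Ls(1) m(2) zero_le_one leB]
  note Ct = tri_bound[OF w w Ys(1) m(3) zero_le_power2 leC]
  have FABC: "F p = A p + (B p + C p)" for p
  proof -
    obtain x y where p: "p = (x, y)" by (cases p)
    have "F p = complex_of_real ((x / (jb x)\<^sup>2) * ((1 / (jb y)\<^sup>2) * (1 / jb (x - y)))) * (w x * cnj (w y) * cnj (Y (x - y))) + C p"
      unfolding F_def C_def p prod.case ew_kD by (simp only: distrib_left distrib_right of_real_add of_real_mult)
    also have "complex_of_real ((x / (jb x)\<^sup>2) * ((1 / (jb y)\<^sup>2) * (1 / jb (x - y)))) * (w x * cnj (w y) * cnj (Y (x - y))) = A p + B p"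
      unfolding A_def B_def p prod.case YKL by (simp add: distrib_left mult.assoc)
    finally show ?thesis by (simp add: add.assoc)
  qed
  have A0: "(\<integral>p. A p \<partial>(lborel \<Otimes>\<^sub>M lborel)) = 0"
  proof -
    define D where "D p = A p + A (flip p)" for p
    note r = integral_preserved[OF flip_measurable distr_flip At(1)]
    have Di: "integrable (lborel \<Otimes>\<^sub>M lborel) D" unfolding D_def
      by (rule Bochner_Integration.integrable_add[OF At(1) r(1)])
    have D2: "(\<integral>p. D p \<partial>(lborel \<Otimes>\<^sub>M lborel)) = 2 * (\<integral>p. A p \<partial>(lborel \<Otimes>\<^sub>M lborel))"
      unfolding D_def using Bochner_Integration.integral_add[OF At(1) r(1)] r(2) by simp
    note sh = integral_preserved[OF shear_measurable distr_shear Di]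
    have Axy: "A (x, y) = complex_of_real x * (V x * V (- y) * Kn (y - x))" for x y
    proof -
      have "Kn (y - x) = cnj (Kn (x - y))" using Ksym[of "x - y"] by simp
      then show ?thesis unfolding A_def V_def by (simp add: sym)
    qed
    \<comment> \<open>After the shear the two outer frequencies are x and y - x, of sum y, so the
      integral over \<open>x\<close> is a convolution that reproduces \<open>Kn y\<close>.\<close>
    have Ds: "D (shear (x, y)) = complex_of_real y * Kn (- y) * (V x * V (y - x))" for x y
      unfolding D_def shear_def flip_def by (simp add: Axy algebra_simps)
    have "(\<integral>p. D (shear p) \<partial>(lborel \<Otimes>\<^sub>M lborel)) = (\<integral>y. \<integral>x. D (shear (x, y)) \<partial>lborel \<partial>lborel)"
      using lborel_pair.integral_snd[of "\<lambda>x y. D (shear (x, y))"] sh(1) by (simp add: split_beta')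
    also have "\<dots> = (\<integral>y. complex_of_real y * Kn (- y) * Kn y \<partial>lborel)"
      unfolding Ds KnV integral_mult_right_zero ..
    finally have e: "(\<integral>p. D (shear p) \<partial>(lborel \<Otimes>\<^sub>M lborel)) = (\<integral>y. complex_of_real y * Kn (- y) * Kn y \<partial>lborel)" .
    have "(\<integral>y. complex_of_real y * Kn (- y) * Kn y \<partial>lborel) = \<bar>-1\<bar> *\<^sub>R (\<integral>y. complex_of_real (0 + (-1) * y) * Kn (- (0 + (-1) * y)) * Kn (0 + (-1) * y) \<partial>lborel)"
      by (rule lborel_integral_real_affine) simp
    also have "\<dots> = (\<integral>y. - (complex_of_real y * Kn (- y) * Kn y) \<partial>lborel)" by (simp add: mult_ac)
    also have "\<dots> = - (\<integral>y. complex_of_real y * Kn (- y) * Kn y \<partial>lborel)" by (rule Bochner_Integration.integral_minus)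
    finally have "(\<integral>y. complex_of_real y * Kn (- y) * Kn y \<partial>lborel) = 0" by simp
    with e sh(2) D2 show ?thesis by simp
  qed
  let ?n = "norm (to_l2 w)"
  have "(\<integral>p. F p \<partial>(lborel \<Otimes>\<^sub>M lborel)) = (\<integral>p. B p \<partial>(lborel \<Otimes>\<^sub>M lborel)) + (\<integral>p. C p \<partial>(lborel \<Otimes>\<^sub>M lborel))"
    unfolding FABC using Bochner_Integration.integral_add[OF At(1) Bochner_Integration.integrable_add[OF Bt(1) Ct(1)]] A0
      Bochner_Integration.integral_add[OF Bt(1) Ct(1)] by simp
  then have "\<bar>- Im (\<integral>p. F p \<partial>(lborel \<Otimes>\<^sub>M lborel))\<bar> \<le> cmod (\<integral>p. B p \<partial>(lborel \<Otimes>\<^sub>M lborel)) + cmod (\<integral>p. C p \<partial>(lborel \<Otimes>\<^sub>M lborel))"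
    using abs_Im_le_cmod[of "\<integral>p. F p \<partial>(lborel \<Otimes>\<^sub>M lborel)"] norm_triangle_ineq[of "\<integral>p. B p \<partial>(lborel \<Otimes>\<^sub>M lborel)" "\<integral>p. C p \<partial>(lborel \<Otimes>\<^sub>M lborel)"] by simp
  \<comment> \<open>The final 15 is 3 + 12: 3 from \<open>B\<close>, whose factor \<open>Ln\<close>
    is already of size \<sigma>^2, and 3 * 4 from \<open>C\<close>, the 4 being the bound of
    \<open>kC\<close>.\<close>
  also have "\<dots> \<le> 3 * 1 * jb_const * ?n * ?n * (\<sigma>\<^sup>2 * jb_const * ?n * ?n) + 3 * \<sigma>\<^sup>2 * jb_const * ?n * ?n * (4 * jb_const * ?n * ?n)"
    using jb_const_nonneg
    by (intro add_mono order_trans[OF Bt(2)] order_trans[OF Ct(2)] mult_left_mono Ls(2) Ys(2)) auto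
  also have "\<dots> = 15 * \<sigma>\<^sup>2 * jb_const\<^sup>2 * ?n ^ 4"
    by (simp add: power_numeral_reduce algebra_simps)
  finally show ?thesis
    unfolding kernel_op_to_l2[OF kernel_bound_kC w w] Y_def[symmetric] kp(2) .
qed

lemma nonlin_pairing:
  assumes \<sigma>: "0 < \<sigma>" and u: "conj_refl u = u"
  shows "\<bar>multiply (\<lambda>x. complex_of_real (ew x)) u \<bullet> multiply (\<lambda>x. - \<i>) (nonlin \<sigma> u)\<bar>
    \<le> 3 * \<sigma>\<^sup>2 * jb_const * (norm u) ^ 3 + 15 * \<sigma>\<^sup>2 * jb_const\<^sup>2 * (norm u) ^ 4"
proof -
  obtain w where w: "square_integrable w" "to_l2 w = u" "\<And>x. w (- x) = cnj (w x)"
    using conj_refl_representative[OF u] by blast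
  interpret I: bounded_linear "multiply (\<lambda>x. - \<i>)" by (rule bl_minus_i)
  let ?b = "multiply (\<lambda>x. complex_of_real (ew x)) u \<bullet> multiply (\<lambda>x. - \<i>) (kernel_op (kB \<sigma>) u u)"
  let ?d = "multiply (\<lambda>x. complex_of_real (ew x)) u \<bullet> multiply (\<lambda>x. - \<i>) (kernel_op (kD \<sigma>) u (kernel_op (kC \<sigma>) u u))"
  have e: "multiply (\<lambda>x. complex_of_real (ew x)) u \<bullet> multiply (\<lambda>x. - \<i>) (nonlin \<sigma> u) = (1 / (2 * pi)) * ?b - (1 / (32 * pi\<^sup>2)) * ?d"
    by (simp add: nonlin_def I.diff I.scaleR inner_diff_right)
  have b: "\<bar>?b\<bar> \<le> 3 * \<sigma>\<^sup>2 * jb_const * norm u ^ 3"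
    using cubic_pairing[OF \<sigma> w(1,3)] unfolding w(2) by (simp add: power3_eq_cube mult.assoc)
  have d: "\<bar>?d\<bar> \<le> 15 * \<sigma>\<^sup>2 * jb_const\<^sup>2 * norm u ^ 4"
    using quartic_pairing[OF \<sigma> w(1,3)] unfolding w(2) .
  have p: "1 \<le> pi" using pi_gt3 by linarith
  then have p2: "1 \<le> pi\<^sup>2" by (simp add: one_le_power)
  have "\<bar>(1 / (2 * pi)) * ?b\<bar> \<le> \<bar>?b\<bar>" unfolding abs_mult using p by (intro mult_left_le_one_le) auto
  moreover have "1 \<le> 32 * pi\<^sup>2" using p2 by linarith
  then have "\<bar>(1 / (32 * pi\<^sup>2)) * ?d\<bar> \<le> \<bar>?d\<bar>" unfolding abs_mult by (intro mult_left_le_one_le) auto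
  ultimately show ?thesis unfolding e using b d by linarith
qed

section \<open>The energy in the weighted variable and its drift\<close>

abbreviation "ewop \<equiv> multiply (\<lambda>x. complex_of_real (ew x))"

lemma ew_symbol: "(\<lambda>x. complex_of_real (ew x)) \<in> borel_measurable borel" "cmod (complex_of_real (ew x)) \<le> Lam"
  by (measurable, use abs_ew_le in simp)

lemma ewop_inner: "ewop u \<bullet> u = (\<integral>x. ew x * (cmod (rep_l2 u x))\<^sup>2 \<partial>lborel)"
proof -
  have "ewop u \<bullet> to_l2 (rep_l2 u) = (\<integral>x. (complex_of_real (ew x) * rep_l2 u x) \<bullet> rep_l2 u x \<partial>lborel)"
    unfolding multiply_def
    by (rule inner_to_l2[OF square_integrable_mult_bounded[OF square_integrable_rep_l2 ew_symbol] square_integrable_rep_l2])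
  also have "\<dots> = (\<integral>x. ew x * (cmod (rep_l2 u x))\<^sup>2 \<partial>lborel)"
    by (intro Bochner_Integration.integral_cong refl) (simp add: inner_complex_def cmod_power2, simp add: power2_eq_square algebra_simps)
  finally show ?thesis by simp
qed

lemma ew_integrable: "integrable lborel (\<lambda>x. ew x * (cmod (rep_l2 u x))\<^sup>2)"
proof (rule Bochner_Integration.integrable_bound)
  show "integrable lborel (\<lambda>x. Lam * (cmod (rep_l2 u x))\<^sup>2)"
    using square_integrable_rep_l2[of u] by (simp add: square_integrable_def)
  show "AE x in lborel. norm (ew x * (cmod (rep_l2 u x))\<^sup>2) \<le> norm (Lam * (cmod (rep_l2 u x))\<^sup>2)"
    using order_trans[OF abs_ew_le abs_ge_self] by (intro AE_I2) (auto simp: abs_mult intro!: mult_right_mono)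
qed measurable

lemma ewop_inner_ge: "kap * (norm u)\<^sup>2 \<le> ewop u \<bullet> u"
proof -
  have i: "integrable lborel (\<lambda>x. (cmod (rep_l2 u x))\<^sup>2)"
    using square_integrable_rep_l2[of u] by (simp add: square_integrable_def)
  have "kap * (norm u)\<^sup>2 = (\<integral>x. kap * (cmod (rep_l2 u x))\<^sup>2 \<partial>lborel)"
    by (simp add: norm_l2_sq)
  also have "\<dots> \<le> (\<integral>x. ew x * (cmod (rep_l2 u x))\<^sup>2 \<partial>lborel)"
    using i by (intro integral_mono ew_integrable mult_right_mono ew_bounds) auto
  finally show ?thesis by (simp add: ewop_inner)
qed

lemma norm_fourier_sq: "(norm (fourier f))\<^sup>2 = 2 * pi * (norm f)\<^sup>2"
  using inner_fourier[of f f] by (simp add: power2_norm_eq_inner)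

text \<open>The factor cosh cancels against the weight, so v has the transform u / <x>^2, and the
  three squares add up to \<open>den\<close> over <x>^4. The 4 pi combines the 2 pi of Plancherel
  with the 1/2 of the energy.\<close>

lemma energy_gevrey_lift: "energy \<gamma>1 \<delta>1 \<sigma> (gevrey_lift \<sigma> u) = (ewop u \<bullet> u) / (4 * pi)"
proof -
  define w where "w = rep_l2 u"
  have sw: "square_integrable w" by (simp add: w_def square_integrable_rep_l2)
  have [measurable]: "w \<in> borel_measurable borel" by (simp add: w_def)
  define v where "v = cosh_D \<sigma> (gevrey_lift \<sigma> u)"
  let ?i = "\<lambda>x. \<i> * complex_of_real x"
  have coshm [measurable]: "(\<lambda>\<xi>. complex_of_real (cosh (\<sigma> * \<bar>\<xi>\<bar>))) \<in> borel_measurable borel" by measurable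
  define g0 where "g0 x = complex_of_real (1 / (jb x)\<^sup>2) * w x" for x
  define g1 where "g1 x = ?i x * g0 x" for x
  define g2 where "g2 x = ?i x * g1 x" for x
  have [measurable]: "g0 \<in> borel_measurable borel" "g1 \<in> borel_measurable borel" "g2 \<in> borel_measurable borel"
    unfolding g0_def g1_def g2_def by measurable
  have n: "cmod (g0 x) = cmod (w x) / (jb x)\<^sup>2" "cmod (g1 x) = \<bar>x\<bar> * (cmod (w x) / (jb x)\<^sup>2)" "cmod (g2 x) = \<bar>x\<bar> * (\<bar>x\<bar> * (cmod (w x) / (jb x)\<^sup>2))" for x
    unfolding g2_def g1_def g0_def by (simp_all add: norm_mult norm_divide norm_power)
  have le: "cmod (g0 x) \<le> 1 * cmod (w x)" "cmod (g1 x) \<le> 1 * cmod (w x)" "cmod (g2 x) \<le> 1 * cmod (w x)" for x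
  proof -
    have 1: "1 / (jb x)\<^sup>2 \<le> 1" using jb_le_jb_sq[of x] jb_ge_1[of x] by simp
    have "\<bar>x\<bar> * \<bar>x\<bar> \<le> (jb x)\<^sup>2" unfolding power2_eq_square by (intro mult_mono abs_le_jb) auto
    then have 3: "\<bar>x\<bar> * \<bar>x\<bar> / (jb x)\<^sup>2 \<le> 1" by simp
    have "\<bar>x\<bar> \<le> (jb x)\<^sup>2" using abs_le_jb[of x] jb_le_jb_sq[of x] by linarith
    then have 2: "\<bar>x\<bar> / (jb x)\<^sup>2 \<le> 1" by simp
    show "cmod (g0 x) \<le> 1 * cmod (w x)" "cmod (g1 x) \<le> 1 * cmod (w x)" "cmod (g2 x) \<le> 1 * cmod (w x)"
      unfolding n using mult_right_mono[OF 1, of "cmod (w x)"] mult_right_mono[OF 2, of "cmod (w x)"] mult_right_mono[OF 3, of "cmod (w x)"]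
      by (simp_all add: mult.assoc)
  qed
  have s: "square_integrable g0" "square_integrable g1" "square_integrable g2"
    by (rule square_integrable_bound[OF sw _ le(1)], measurable, rule square_integrable_bound[OF sw _ le(2)], measurable,
        rule square_integrable_bound[OF sw _ le(3)], measurable)
  have im: "?i \<in> borel_measurable borel" by measurable
  have f0: "fourier v = to_l2 g0"
  proof -
    have "fourier v = to_l2 (\<lambda>x. complex_of_real (cosh (\<sigma> * \<bar>x\<bar>)) * (complex_of_real (1 / wt \<sigma> x) * w x))"
      unfolding v_def cosh_D_def fourier_multiplier_eq fourier_gevrey_lift unfolding multiply_def[of "\<lambda>x. complex_of_real (1 / wt \<sigma> x)"] w_def
      by (rule multiply_to_l2[OF square_integrable_div_wt[OF square_integrable_rep_l2] coshm])
    also have "(\<lambda>x. complex_of_real (cosh (\<sigma> * \<bar>x\<bar>)) * (complex_of_real (1 / wt \<sigma> x) * w x)) = g0"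
    proof
      fix x
      have *: "cosh (\<sigma> * \<bar>x\<bar>) = cosh (\<sigma> * x)" by (cases "x \<ge> 0") auto
      show "complex_of_real (cosh (\<sigma> * \<bar>x\<bar>)) * (complex_of_real (1 / wt \<sigma> x) * w x) = g0 x"
        unfolding * by (simp add: g0_def wt_def)
    qed
    finally show ?thesis .
  qed
  have fd: "fourier (deriv_x f) = multiply ?i (fourier f)" for f
    unfolding deriv_x_def fourier_multiplier_eq ..
  have f1: "fourier (deriv_x v) = to_l2 g1"
    unfolding fd f0 g1_def by (rule multiply_to_l2[OF s(1) im])
  have f2: "fourier (deriv_x (deriv_x v)) = to_l2 g2"
    unfolding fd[of "deriv_x v"] f1 g2_def by (rule multiply_to_l2[OF s(2) im])
  have N: "(\<integral>x. (cmod (rep_l2 f x))\<^sup>2 \<partial>lborel) = (\<integral>x. (cmod (g x))\<^sup>2 \<partial>lborel) / (2 * pi)" if "fourier f = to_l2 g" "square_integrable g" for f g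
  proof -
    have "(\<integral>x. (cmod (g x))\<^sup>2 \<partial>lborel) = 2 * pi * (norm f)\<^sup>2"
      unfolding norm_to_l2[OF that(2), symmetric] that(1)[symmetric] by (rule norm_fourier_sq)
    then show ?thesis unfolding norm_l2_sq[symmetric] by simp
  qed
  have ri: "integrable lborel (\<lambda>x. (cmod (rep_l2 f x))\<^sup>2)" for f
    using square_integrable_rep_l2[of f] by (simp add: square_integrable_def)
  have gi: "integrable lborel (\<lambda>x. (cmod (g0 x))\<^sup>2)" "integrable lborel (\<lambda>x. (cmod (g1 x))\<^sup>2)" "integrable lborel (\<lambda>x. (cmod (g2 x))\<^sup>2)"
    using s by (auto simp: square_integrable_def)
  have "energy \<gamma>1 \<delta>1 \<sigma> (gevrey_lift \<sigma> u) = 1/2 * ((\<integral>x. (cmod (rep_l2 v x))\<^sup>2 \<partial>lborel) + \<gamma>1 * (\<integral>x. (cmod (rep_l2 (deriv_x v) x))\<^sup>2 \<partial>lborel) + \<delta>1 * (\<integral>x. (cmod (rep_l2 (deriv_x (deriv_x v)) x))\<^sup>2 \<partial>lborel))"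
    unfolding energy_def v_def[symmetric] Let_def by (simp add: ri)
  also have "\<dots> = ((\<integral>x. (cmod (g0 x))\<^sup>2 \<partial>lborel) + \<gamma>1 * (\<integral>x. (cmod (g1 x))\<^sup>2 \<partial>lborel) + \<delta>1 * (\<integral>x. (cmod (g2 x))\<^sup>2 \<partial>lborel)) / (4 * pi)"
    unfolding N[OF f0 s(1)] N[OF f1 s(2)] N[OF f2 s(3)] by (simp add: field_simps)
  also have "(\<integral>x. (cmod (g0 x))\<^sup>2 \<partial>lborel) + \<gamma>1 * (\<integral>x. (cmod (g1 x))\<^sup>2 \<partial>lborel) + \<delta>1 * (\<integral>x. (cmod (g2 x))\<^sup>2 \<partial>lborel)
    = (\<integral>x. (cmod (g0 x))\<^sup>2 + \<gamma>1 * (cmod (g1 x))\<^sup>2 + \<delta>1 * (cmod (g2 x))\<^sup>2 \<partial>lborel)"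
    using gi by simp
  also have "\<dots> = (\<integral>x. ew x * (cmod (w x))\<^sup>2 \<partial>lborel)"
  proof (intro Bochner_Integration.integral_cong refl)
    fix x
    have gen: "(a / J)\<^sup>2 + \<gamma>1 * (\<bar>x\<bar> * (a / J))\<^sup>2 + \<delta>1 * (\<bar>x\<bar> * (\<bar>x\<bar> * (a / J)))\<^sup>2 = (1 + \<gamma>1 * x\<^sup>2 + \<delta>1 * x ^ 4) / J\<^sup>2 * a\<^sup>2" for a J :: real
    proof -
      have p4: "x ^ 4 = x\<^sup>2 * x\<^sup>2" by (simp add: power_numeral_reduce)
      show ?thesis unfolding p4
        by (simp only: power_mult_distrib power2_abs power_divide add_divide_distrib distrib_right mult_1_left times_divide_eq_left times_divide_eq_right mult.assoc)
    qed
    have "((jb x)\<^sup>2)\<^sup>2 = (jb x) ^ 4" by simp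
    then show "(cmod (g0 x))\<^sup>2 + \<gamma>1 * (cmod (g1 x))\<^sup>2 + \<delta>1 * (cmod (g2 x))\<^sup>2 = ew x * (cmod (w x))\<^sup>2"
      unfolding n gen ew_def sym_den_def by simp
  qed
  finally show ?thesis by (simp add: ewop_inner w_def)
qed

lemma inner_evol: "evol t f \<bullet> evol t g = f \<bullet> g"
proof -
  interpret E: bounded_linear "evol t" by (rule bounded_linear_evol)
  show ?thesis unfolding dot_norm E.add[symmetric] norm_evol ..
qed

lemma ewop_evol: "ewop (evol t u) = evol t (ewop u)"
proof -
  have "ewop (evol t u) = multiply (\<lambda>\<xi>. complex_of_real (ew \<xi>) * exp (- (\<i> * complex_of_real (t * phi \<xi>)))) u"
    unfolding evol_def by (rule multiply_multiply[OF square_integrable_evol ew_symbol(1)])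
  also have "\<dots> = evol t (ewop u)"
    unfolding evol_def
    by (subst multiply_multiply[OF square_integrable_mult_bounded[OF square_integrable_rep_l2 ew_symbol] evol_symbol(1)])
       (simp add: mult.commute)
  finally show ?thesis .
qed

text \<open>\<open>ewop\<close> is self-adjoint, so the derivative of the quadratic form is twice
  the pairing of \<open>ewop (w s)\<close> with \<open>rhs\<close>. The propagator preserves inner
  products and commutes with \<open>ewop\<close>; it drops out, and \<open>nonlin_pairing\<close>
  bounds the derivative at each interior time. The mean value theorem does the rest.\<close>

lemma energy_drift:
  assumes \<sigma>: "0 < \<sigma>" and w: "continuous_on {0..T} w" and sym: "\<And>t. t \<in> {0..T} \<Longrightarrow> conj_refl (w t) = w t"
    and b: "\<And>t. t \<in> {0..T} \<Longrightarrow> norm (w t) \<le> R" and R: "0 \<le> R"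
    and i: "\<And>t. t \<in> {0..T} \<Longrightarrow> w t = u0 + integral {0..t} (\<lambda>s. rhs \<sigma> s (w s))"
    and t: "t \<in> {0..T}"
  shows "\<bar>ewop (w t) \<bullet> w t - ewop (w 0) \<bullet> w 0\<bar> \<le> 2 * (3 * \<sigma>\<^sup>2 * jb_const * R ^ 3 + 15 * \<sigma>\<^sup>2 * jb_const\<^sup>2 * R ^ 4) * T"
proof (cases "t = 0")
  case True
  then show ?thesis using R jb_const_nonneg t by auto
next
  case False
  then have t0: "0 < t" "t \<le> T" using t by auto
  let ?M = "3 * \<sigma>\<^sup>2 * jb_const * R ^ 3 + 15 * \<sigma>\<^sup>2 * jb_const\<^sup>2 * R ^ 4"
  define f where "f s = ewop (w s) \<bullet> w s" for s
  have bl: "bounded_linear ewop" by (rule bounded_linear_multiply(1)[OF ew_symbol])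
  have der: "(f has_real_derivative 2 * (ewop (w s) \<bullet> rhs \<sigma> s (w s))) (at s)" if s: "0 < s" "s < t" for s
  proof -
    have wd: "(w has_vector_derivative rhs \<sigma> s (w s)) (at s)"
      using integral_equation_derivative[OF continuous_on_rhs[OF w] i, of s] s t0 by auto
    then have wd': "(w has_derivative (\<lambda>x. x *\<^sub>R rhs \<sigma> s (w s))) (at s)"
      by (simp add: has_vector_derivative_def)
    have "((\<lambda>s. ewop (w s)) has_derivative (\<lambda>x. ewop (x *\<^sub>R rhs \<sigma> s (w s)))) (at s)"
      by (rule bounded_linear.has_derivative[OF bl wd'])
    from has_derivative_inner[OF this wd']
    have "(f has_derivative (\<lambda>h. ewop (w s) \<bullet> (h *\<^sub>R rhs \<sigma> s (w s)) + ewop (h *\<^sub>R rhs \<sigma> s (w s)) \<bullet> w s)) (at s)"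
      unfolding f_def .
    moreover have "ewop (h *\<^sub>R rhs \<sigma> s (w s)) \<bullet> w s = ewop (w s) \<bullet> (h *\<^sub>R rhs \<sigma> s (w s))" for h
      using inner_multiply_real[OF ew_measurable abs_ew_le, of "h *\<^sub>R rhs \<sigma> s (w s)" "w s"] by (simp add: inner_commute)
    ultimately show ?thesis unfolding has_field_derivative_def
      by (elim has_derivative_eq_rhs) (auto simp: fun_eq_iff)
  qed
  have dle: "\<bar>2 * (ewop (w s) \<bullet> rhs \<sigma> s (w s))\<bar> \<le> 2 * ?M" if s: "0 < s" "s < t" for s
  proof -
    have sT: "s \<in> {0..T}" using s t0 by auto
    let ?u = "evol s (w s)"
    have "ewop (w s) \<bullet> rhs \<sigma> s (w s) = evol s (ewop (w s)) \<bullet> evol s (rhs \<sigma> s (w s))" by (simp add: inner_evol)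
    also have "\<dots> = ewop ?u \<bullet> multiply (\<lambda>x. - \<i>) (nonlin \<sigma> ?u)"
      by (simp add: ewop_evol rhs_def evol_evol)
    finally have e: "ewop (w s) \<bullet> rhs \<sigma> s (w s) = ewop ?u \<bullet> multiply (\<lambda>x. - \<i>) (nonlin \<sigma> ?u)" .
    have "conj_refl ?u = ?u" using sym[OF sT] by (simp add: conj_refl_evol)
    from nonlin_pairing[OF \<sigma> this]
    have "\<bar>ewop (w s) \<bullet> rhs \<sigma> s (w s)\<bar> \<le> 3 * \<sigma>\<^sup>2 * jb_const * (norm (w s)) ^ 3 + 15 * \<sigma>\<^sup>2 * jb_const\<^sup>2 * (norm (w s)) ^ 4"
      unfolding e norm_evol .
    also have "\<dots> \<le> ?M"
      using b[OF sT] jb_const_nonneg by (intro add_mono mult_left_mono power_mono) auto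
    finally show ?thesis by (simp add: abs_mult)
  qed
  have "continuous_on {0..t} f" unfolding f_def
    using t0 by (intro continuous_intros bounded_linear.continuous_on[OF bl] continuous_on_subset[OF w]) auto
  moreover have "f differentiable (at s)" if "0 < s" "s < t" for s
    using der[OF that] real_differentiable_def by blast
  ultimately obtain l z where z: "0 < z" "z < t" "DERIV f z :> l" "f t - f 0 = (t - 0) * l"
    using MVT[OF t0(1)] by blast
  have "l = 2 * (ewop (w z) \<bullet> rhs \<sigma> z (w z))" using DERIV_unique[OF z(3) der[OF z(1,2)]] .
  with dle[OF z(1,2)] have "\<bar>l\<bar> \<le> 2 * ?M" by simp
  then have "\<bar>f t - f 0\<bar> \<le> T * (2 * ?M)"
    unfolding z(4) abs_mult using t0 by (intro mult_mono) auto
  then show ?thesis by (simp add: f_def mult.commute)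
qed

lemma powr_three_halves: "0 \<le> x \<Longrightarrow> x powr (3/2) = (sqrt x) ^ 3"
proof (cases "x = 0")
  case False
  assume "0 \<le> x"
  then have "(sqrt x) ^ 3 = (x powr (1/2)) powr 3" using False by (simp add: powr_half_sqrt powr_numeral)
  also have "\<dots> = x powr (3/2)" by (simp add: powr_powr)
  finally show ?thesis by simp
qed simp

text \<open>48 = 2 * 3 * 2^3 and 480 = 2 * 15 * 2^4: twice the pairing constants, with powers of the
  2 from the bound by twice the data. The root converts the norm of the data into E(0)^(1/2), and
  the + 1 ensures positivity.\<close>

definition drift_const :: real where
  "drift_const = 48 * jb_const * (sqrt (4 * pi / kap)) ^ 3 + 480 * jb_const\<^sup>2 * (sqrt (4 * pi / kap)) ^ 4 + 1"

lemma drift_const_pos: "0 < drift_const"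
  using jb_const_nonneg kap_pos by (simp add: drift_const_def add_nonneg_pos)

lemma energy_estimate:
  assumes c: "0 < c" "c \<le> time_const" and \<sigma>: "0 < \<sigma>" and \<eta>0: "\<eta>0 \<in> gevrey_space \<sigma> 2" "real_valued \<eta>0"
    and T: "T = local_time c \<sigma> \<eta>0" and sol: "solution (7/48) \<gamma>1 \<gamma>2 \<delta>1 \<delta>2 \<sigma> T \<eta>0 \<eta>"
  shows "\<bar>(SUP t\<in>{0..T}. energy \<gamma>1 \<delta>1 \<sigma> (\<eta> t)) - energy \<gamma>1 \<delta>1 \<sigma> (\<eta> 0)\<bar>
    \<le> drift_const * \<sigma>\<^sup>2 * T * (1 + sqrt (energy \<gamma>1 \<delta>1 \<sigma> (\<eta> 0))) * energy \<gamma>1 \<delta>1 \<sigma> (\<eta> 0) powr (3/2)"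
proof (rule solution_bound[OF c \<eta>0 T sol])
  fix w assume w: "continuous_on {0..T} w" and \<eta>: "\<And>t. t \<in> {0..T} \<Longrightarrow> \<eta> t = gevrey_lift \<sigma> (evol t (w t))"
    and sym: "\<And>t. t \<in> {0..T} \<Longrightarrow> conj_refl (w t) = w t"
    and b: "\<And>t. t \<in> {0..T} \<Longrightarrow> norm (w t) \<le> 2 * norm (gevrey_tr \<sigma> \<eta>0)"
    and i: "\<And>t. t \<in> {0..T} \<Longrightarrow> w t = gevrey_tr \<sigma> \<eta>0 + integral {0..t} (\<lambda>s. rhs \<sigma> s (w s))"
  have T0: "0 < T" unfolding T by (rule local_time_small(2)[OF c])
  then have z: "0 \<in> {0..T}" by simp
  define a where "a = norm (gevrey_tr \<sigma> \<eta>0)"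
  have w0: "w 0 = gevrey_tr \<sigma> \<eta>0" using i[OF z] by simp
  define E where "E t = energy \<gamma>1 \<delta>1 \<sigma> (\<eta> t)" for t
  have E: "E t = (ewop (w t) \<bullet> w t) / (4 * pi)" if "t \<in> {0..T}" for t
    unfolding E_def \<eta>[OF that] energy_gevrey_lift ewop_evol inner_evol ..
  define e where "e = sqrt (E 0)"
  define s where "s = sqrt (4 * pi / kap)"
  have E0: "kap * a\<^sup>2 \<le> 4 * pi * E 0" using ewop_inner_ge[of "w 0"] unfolding E[OF z] w0 a_def by simp
  have E0n: "0 \<le> E 0"
  proof -
    have "0 \<le> kap * a\<^sup>2" by simp
    with E0 have "0 \<le> 4 * pi * E 0" by linarith
    then show ?thesis using pi_gt_zero by (auto simp: zero_le_mult_iff)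
  qed
  have e: "0 \<le> e" using E0n by (simp add: e_def)
  have s: "0 \<le> s" by (simp add: s_def)
  have a: "0 \<le> a" "a \<le> s * e"
  proof -
    show "0 \<le> a" by (simp add: a_def)
    have "a\<^sup>2 \<le> 4 * pi / kap * E 0" using E0 kap_pos by (simp add: field_simps)
    then have "a \<le> sqrt (4 * pi / kap * E 0)" by (rule real_le_rsqrt)
    then show "a \<le> s * e" unfolding s_def e_def real_sqrt_mult[symmetric] .
  qed
  define B where "B = drift_const * \<sigma>\<^sup>2 * T * (1 + e) * e ^ 3"
  have drift: "\<bar>E t - E 0\<bar> \<le> B" if t: "t \<in> {0..T}" for t
  proof -
    let ?M = "2 * (3 * \<sigma>\<^sup>2 * jb_const * (2 * a) ^ 3 + 15 * \<sigma>\<^sup>2 * jb_const\<^sup>2 * (2 * a) ^ 4) * T"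
    have d: "\<bar>ewop (w t) \<bullet> w t - ewop (w 0) \<bullet> w 0\<bar> \<le> ?M"
      using energy_drift[OF \<sigma> w sym b _ i t] by (simp add: a_def)
    have "\<bar>E t - E 0\<bar> = \<bar>ewop (w t) \<bullet> w t - ewop (w 0) \<bullet> w 0\<bar> / (4 * pi)"
      unfolding E[OF t] E[OF z] diff_divide_distrib[symmetric] by simp
    \<comment> \<open>The factor 1/(4 pi), which is less than 1, is given away.\<close>
    also have "\<dots> \<le> \<bar>ewop (w t) \<bullet> w t - ewop (w 0) \<bullet> w 0\<bar> / 1"
      using pi_gt3 by (intro divide_left_mono) auto
    also have "\<dots> \<le> ?M" using d by simp
    also have "?M = (\<sigma>\<^sup>2 * T) * (48 * jb_const * a ^ 3 + 480 * jb_const\<^sup>2 * a ^ 4)"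
      by (simp add: power_mult_distrib algebra_simps)
    also have "\<dots> \<le> (\<sigma>\<^sup>2 * T) * (48 * jb_const * (s * e) ^ 3 + 480 * jb_const\<^sup>2 * (s * e) ^ 4)"
      using T0 a jb_const_nonneg by (intro mult_left_mono add_mono power_mono) auto
    also have "\<dots> \<le> (\<sigma>\<^sup>2 * T) * (drift_const * ((1 + e) * e ^ 3))"
    proof (rule mult_left_mono)
      \<comment> \<open>The cubic and the quartic contribution both fit under the single expression
        of the claim.\<close>
      have e34: "e ^ 3 \<le> (1 + e) * e ^ 3" "e ^ 4 \<le> (1 + e) * e ^ 3"
        using e by (simp_all add: power_numeral_reduce algebra_simps)
      have "48 * jb_const * (s * e) ^ 3 + 480 * jb_const\<^sup>2 * (s * e) ^ 4 = (48 * jb_const * s ^ 3) * e ^ 3 + (480 * jb_const\<^sup>2 * s ^ 4) * e ^ 4"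
        by (simp add: power_mult_distrib)
      also have "\<dots> \<le> (48 * jb_const * s ^ 3) * ((1 + e) * e ^ 3) + (480 * jb_const\<^sup>2 * s ^ 4) * ((1 + e) * e ^ 3)"
        using s jb_const_nonneg by (intro add_mono mult_left_mono e34) auto
      also have "\<dots> \<le> (48 * jb_const * s ^ 3) * ((1 + e) * e ^ 3) + (480 * jb_const\<^sup>2 * s ^ 4) * ((1 + e) * e ^ 3) + 1 * ((1 + e) * e ^ 3)"
        using e by simp
      also have "\<dots> = drift_const * ((1 + e) * e ^ 3)"
        unfolding drift_const_def s_def distrib_right ..
      finally show "48 * jb_const * (s * e) ^ 3 + 480 * jb_const\<^sup>2 * (s * e) ^ 4 \<le> drift_const * ((1 + e) * e ^ 3)" .
    qed (use T0 in simp)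
    also have "\<dots> = B" by (simp add: B_def mult_ac)
    finally show ?thesis .
  qed
  \<comment> \<open>A real \<open>SUP\<close> has its expected meaning only over a nonempty set that
    is bounded above; the drift bound provides this.\<close>
  have bdd: "bdd_above (E ` {0..T})"
  proof (rule bdd_aboveI2)
    show "E t \<le> E 0 + B" if "t \<in> {0..T}" for t using drift[OF that] by linarith
  qed
  have "E 0 \<le> (SUP t\<in>{0..T}. E t)" by (rule cSUP_upper[OF z bdd])
  moreover have "(SUP t\<in>{0..T}. E t) \<le> E 0 + B"
  proof (rule cSUP_least)
    show "{0..T} \<noteq> {}" using T0 by simp
    show "E t \<le> E 0 + B" if "t \<in> {0..T}" for t using drift[OF that] by linarith
  qed
  ultimately have "\<bar>(SUP t\<in>{0..T}. E t) - E 0\<bar> \<le> B" by linarith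
  then show ?thesis
    using powr_three_halves[OF E0n] unfolding B_def e_def E_def by simp
qed

end

theorem theorem3:
  fixes \<gamma> \<gamma>1 \<gamma>2 \<delta>1 \<delta>2 :: real
  assumes "\<gamma>1 > 0" and "\<delta>1 > 0" and "\<gamma> = 7/48"
  shows "\<exists>c0>0. \<forall>c. 0 < c \<and> c \<le> c0 \<longrightarrow>
    (\<forall>\<sigma>>0. \<forall>\<eta>0\<in>gevrey_space \<sigma> 2. real_valued \<eta>0 \<longrightarrow>
       uniquely_solvable \<gamma> \<gamma>1 \<gamma>2 \<delta>1 \<delta>2 \<sigma> (local_time c \<sigma> \<eta>0) \<eta>0) \<and>
    (\<exists>C>0. \<forall>\<sigma>>0. \<forall>\<eta>0\<in>gevrey_space \<sigma> 2. \<forall>T \<eta>. real_valued \<eta>0 \<longrightarrow> T = local_time c \<sigma> \<eta>0 \<longrightarrow>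
       solution \<gamma> \<gamma>1 \<gamma>2 \<delta>1 \<delta>2 \<sigma> T \<eta>0 \<eta> \<longrightarrow>
       \<bar>(SUP t\<in>{0..T}. energy \<gamma>1 \<delta>1 \<sigma> (\<eta> t)) - energy \<gamma>1 \<delta>1 \<sigma> (\<eta> 0)\<bar>
         \<le> C * \<sigma>\<^sup>2 * T * (1 + sqrt (energy \<gamma>1 \<delta>1 \<sigma> (\<eta> 0))) * energy \<gamma>1 \<delta>1 \<sigma> (\<eta> 0) powr (3/2))"
proof -
  interpret coeffs \<gamma>1 \<gamma>2 \<delta>1 \<delta>2 using assms by unfold_locales
  show ?thesis unfolding assms(3)
  proof (rule exI[of _ time_const], rule conjI[OF time_const_pos], rule allI, rule impI, rule conjI)
    fix c assume c: "0 < c \<and> c \<le> time_const"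
    show "\<forall>\<sigma>>0. \<forall>\<eta>0\<in>gevrey_space \<sigma> 2. real_valued \<eta>0 \<longrightarrow>
       uniquely_solvable (7/48) \<gamma>1 \<gamma>2 \<delta>1 \<delta>2 \<sigma> (local_time c \<sigma> \<eta>0) \<eta>0"
      using c well_posed by blast
    show "\<exists>C>0. \<forall>\<sigma>>0. \<forall>\<eta>0\<in>gevrey_space \<sigma> 2. \<forall>T \<eta>. real_valued \<eta>0 \<longrightarrow> T = local_time c \<sigma> \<eta>0 \<longrightarrow>
       solution (7/48) \<gamma>1 \<gamma>2 \<delta>1 \<delta>2 \<sigma> T \<eta>0 \<eta> \<longrightarrow>
       \<bar>(SUP t\<in>{0..T}. energy \<gamma>1 \<delta>1 \<sigma> (\<eta> t)) - energy \<gamma>1 \<delta>1 \<sigma> (\<eta> 0)\<bar>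
         \<le> C * \<sigma>\<^sup>2 * T * (1 + sqrt (energy \<gamma>1 \<delta>1 \<sigma> (\<eta> 0))) * energy \<gamma>1 \<delta>1 \<sigma> (\<eta> 0) powr (3/2)"
      using c drift_const_pos energy_estimate
      by (intro exI[of _ drift_const] conjI allI ballI impI) auto
  qed
qed

end
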